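(* Let $\mathbf{M}$ be either (1) the Fraïssé limit of a free, transitive and nontrivial amalgamation class, or (2) the bounded rational Urysohn space. Let $\mathbf{M}^*$ be an order expansion or a tournament expansion of $\mathbf{M}$, let $G=\mathrm{Aut}(\mathbf{M}^* )$ and let $\mathrm{id}\neq h\in G$. Then there is some $g\in\langle h\rangle^G$ that moves maximally and is compatible.
   Context: All languages are relational. A countable structure is homogeneous if every isomorphism between finite substructures extends to an automorphism. For finite tuples $a,a'$ and finite $A$, $\mathrm{tp}(a/A)=\mathrm{tp}(a'/A)$ (and $a'$ realizes $\mathrm{tp}(a/A)$) iff some automorphism fixes $A$ pointwise and maps $a$ to $a'$. All types are types (of finite tuples) over finite sets; a type is non-algebraic if it has infinitely many realizations. A set of types is consistent if it is realized by a common tuple. An amalgamation class (Fraïssé class) is free if for all $A\subseteq B,C$ in it with $B\cap C=A$, the free amalgam (the structure on $B\cup C$ whose relations are exactly those of $B$ and those of $C$) belongs to it; transitive if the automorphism group of its limit is transitive on the limit; nontrivial if its limit is not an indiscernible set (i.e. the automorphism group of the limit is not the full symmetric group). The bounded rational Urysohn space is the Fraïssé limit of finite metric spaces with distances in $\mathbb{Q}\cap[0,1]$, with a binary relation for each distance. Let $\mathbf{M}$ be a countable homogeneous $L_1$-structure on $M$. An order expansion of $\mathbf{M}$ is an $L_1\cup\{<\}$-structure on $M$ with $L_1$-reduct $\mathbf{M}$, where $<$ is a total order on $M$ without endpoints (so $(M,<)\cong(\mathbb{Q},<)$), such that every non-algebraic $1$-type of $\mathbf{M}$ over a finite set has a realization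 in every interval $(a,b)$, $a<b$ in $M$. A tournament expansion of $\mathbf{M}$ is an $L_1\cup\{\to\}$-structure on $M$ with $L_1$-reduct $\mathbf{M}$, where $(M,\to)$ is the random tournament, such that for every non-algebraic $1$-type $p$ of $\mathbf{M}$ over a finite set and any disjoint finite $A,B\subseteq M$ there is a realization $x$ of $p$ with $x\to a$ for all $a\in A$ and $b\to x$ for all $b\in B$. Put $L_2=\{<\}$, respectively $L_2=\{\to\}$; $\mathrm{tp}$ denotes types in $\mathbf{M}^*$ and $\mathrm{tp}_{L_2}$ types in the reduct $(M,<)$, respectively $(M,\to)$. Independence relation $\perp$ on $\mathbf{M}$ (between finite subsets of $M$; for tuples use underlying sets). In case (1): $A\perp_B C$ iff $A\cap C\subseteq B$ and no relation of $L_1$ holds of a tuple from $A\cup B\cup C$ having some entry in $A\setminus B$ and some entry in $C\setminus B$. In case (2): $A\perp_C B$ iff for all $a\in A$, $b\in B$ either $d(a,b)=1$ or there is $c\in C$ with $d(a,b)=d(a,c)+d(c,b)$. Write $AB=A\cup B$ and $A\perp_{C;D}B$ for the conjunction of $AC\perp_D B$ and $A\perp_C BD$. Notation. $g^a=a^{-1}ga$ for $a,g\in G$; $\langle h\rangle^G$ is the normal subgroup of $G$ generated by $h$; $\mathrm{Fix}(A)$ is the pointwise stabilizer of $A$ in $G$; $g(\mathrm{tp}(x/X))=\mathrm{tp}(g(x)/g(X))$; $x^i$ are the components of a tuple $x$. Moving maximally. $g\in G$ is $L_2$-homogeneous if $\mathrm{tp}_{L_2}(x\,g(x))=\mathrm{tp}_{L_2}(y\,g(y))$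 for all $x,y\in M$. $g$ moves maximally if it is $L_2$-homogeneous and every non-algebraic type (in $\mathbf{M}^*$) over a finite set $X$ has a realization $x$ with $x\perp_{X;g(X)}g(x)$. Compatible. Let $g\in G$ move maximally. A finite set $X$, with $Y=g(X)$, is full for $g$ if for all tuples $x,y$ with $g(\mathrm{tp}(x/X))=\mathrm{tp}(y/Y)$, $\mathrm{tp}_{L_2}(y^i/x^i)=\mathrm{tp}_{L_2}(g(x^i)/x^i)$ for all $i$, and $x\perp_{X;Y}y$, there is $a\in\mathrm{Fix}(XY)$ with $g^a(x)=y$. The element $g$ is compatible if every finite set $X_0$ has a finite extension $X$, depending only on $X_0$ and $g$, such that with $Y=g(X)$: (1) $X$ is full for $g$; (2) whenever $b\in G$, $Z$ is a finite set with $g^b(Z)=Y$, and $x,z$ are tuples with $g^b(\mathrm{tp}(z/Z))=g(\mathrm{tp}(x/X))$, $z\perp_Z YX$ and $x\perp_X YZ$, there are $b'\in\mathrm{Fix}(YZ)$ and a finite extension $Z^+$ of $Z$ which is full for $g^b$ such that, with $Y^+=g^b(Z^+)$, one has $\mathrm{tp}(g^{bb'}(z)/Y)=\mathrm{tp}(g^b(z)/Y)$, $g^{bb'}(z)\perp_Y (b')^{-1}(Y^+)$, $b'(z)\perp_{Z^+}Y^+$, and the $L_2$-type $\mathrm{tp}_{L_2}(g^{bb'}(z)/b'^{-1}(Y^+))\cup\bigcup_i\mathrm{tp}_{L_2}(g(x^i)/x^i)\cup\bigcup_i\mathrm{tp}_{L_2}(g^{bb'}(z^i)/z^i)$ is consistent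 (the $i$-th members of the two unions being imposed on the $i$-th variable). *)

theory Defs
  imports
    "HOL-Library.Countable_Set"
    "HOL-Algebra.Coset"
    "HOL-Analysis.Abstract_Metric_Spaces"
begin

section \<open>Relational structures\<close>

text \<open>The type \<open>'r\<close> is the set of relation symbols; their arities are given by a
  function \<open>ar :: 'r \<Rightarrow> nat\<close>. Tuples are lists.\<close>

record ('r, 'a) struct =
  univ :: "'a set"
  rel :: "'r \<Rightarrow> 'a list \<Rightarrow> bool"

definition wf_struct :: "('r \<Rightarrow> nat) \<Rightarrow> ('r, 'a) struct \<Rightarrow> bool" where
  "wf_struct ar S \<longleftrightarrow> (\<forall>r xs. rel S r xs \<longrightarrow> length xs = ar r \<and> set xs \<subseteq> univ S)"

definition substr :: "('r, 'a) struct \<Rightarrow> 'a set \<Rightarrow> ('r, 'a) struct" where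
  "substr S A = \<lparr>univ = A, rel = (\<lambda>r xs. rel S r xs \<and> set xs \<subseteq> A)\<rparr>"

definition isom :: "('a \<Rightarrow> 'b) \<Rightarrow> ('r, 'a) struct \<Rightarrow> ('r, 'b) struct \<Rightarrow> bool" where
  "isom f S T \<longleftrightarrow> bij_betw f (univ S) (univ T) \<and>
     (\<forall>r xs. set xs \<subseteq> univ S \<longrightarrow> (rel T r (map f xs) \<longleftrightarrow> rel S r xs))"

definition embedding :: "('a \<Rightarrow> 'b) \<Rightarrow> ('r, 'a) struct \<Rightarrow> ('r, 'b) struct \<Rightarrow> bool" where
  "embedding f S T \<longleftrightarrow> f ` univ S \<subseteq> univ T \<and> isom f S (substr T (f ` univ S))"

text \<open>Automorphisms are only taken of structures with \<open>univ S = UNIV\<close>, so that they are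
  genuine permutations of the type \<open>'a\<close> and composition is \<open>(\<circ>)\<close>.\<close>

definition Aut :: "('r, 'a) struct \<Rightarrow> ('a \<Rightarrow> 'a) set" where
  "Aut S = {f. isom f S S}"

definition homogeneous :: "('r, 'a) struct \<Rightarrow> bool" where
  "homogeneous S \<longleftrightarrow>
     (\<forall>A B f. finite A \<and> finite B \<and> A \<subseteq> univ S \<and> B \<subseteq> univ S \<and>
        isom f (substr S A) (substr S B) \<longrightarrow> (\<exists>g\<in>Aut S. \<forall>a\<in>A. g a = f a))"


section \<open>Amalgamation classes and their limits\<close>

text \<open>A class of finite structures is given by its members with universe a finite set of
  natural numbers. The empty structure is allowed.\<close>

definition fraisse_class :: "('r \<Rightarrow> nat) \<Rightarrow> ('r, nat) struct set \<Rightarrow> bool" where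
  "fraisse_class ar K \<longleftrightarrow>
     K \<noteq> {} \<and>
     (\<forall>B\<in>K. wf_struct ar B \<and> finite (univ B)) \<and>
     (\<forall>B\<in>K. \<forall>C f. wf_struct ar C \<and> isom f B C \<longrightarrow> C \<in> K) \<and>
     (\<exists>K0\<subseteq>K. countable K0 \<and> (\<forall>B\<in>K. \<exists>C\<in>K0. \<exists>f. isom f B C)) \<and>
     (\<forall>B\<in>K. \<forall>A\<subseteq>univ B. substr B A \<in> K) \<and>
     (\<forall>B\<in>K. \<forall>C\<in>K. \<exists>D\<in>K. \<exists>f g. embedding f B D \<and> embedding g C D) \<and>
     (\<forall>A\<in>K. \<forall>B\<in>K. \<forall>C\<in>K. \<forall>i j. embedding i A B \<and> embedding j A C \<longrightarrow>
        (\<exists>D\<in>K. \<exists>f g. embedding f B D \<and> embedding g C D \<and> (\<forall>a\<in>univ A. f (i a) = g (j a))))"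

definition free_amalgam :: "('r, 'a) struct \<Rightarrow> ('r, 'a) struct \<Rightarrow> ('r, 'a) struct" where
  "free_amalgam B C = \<lparr>univ = univ B \<union> univ C, rel = (\<lambda>r xs. rel B r xs \<or> rel C r xs)\<rparr>"

definition free_amalgamation_class :: "('r \<Rightarrow> nat) \<Rightarrow> ('r, nat) struct set \<Rightarrow> bool" where
  "free_amalgamation_class ar K \<longleftrightarrow> fraisse_class ar K \<and>
     (\<forall>A\<in>K. \<forall>B\<in>K. \<forall>C\<in>K.
        univ B \<inter> univ C = univ A \<and> substr B (univ A) = A \<and> substr C (univ A) = A \<longrightarrow>
        free_amalgam B C \<in> K)"

definition age :: "('r \<Rightarrow> nat) \<Rightarrow> ('r, 'a) struct \<Rightarrow> ('r, nat) struct set" where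
  "age ar S = {B. wf_struct ar B \<and> finite (univ B) \<and> (\<exists>f. embedding f B S)}"

definition fraisse_limit :: "('r \<Rightarrow> nat) \<Rightarrow> ('r, nat) struct set \<Rightarrow> ('r, 'a) struct \<Rightarrow> bool" where
  "fraisse_limit ar K M \<longleftrightarrow>
     wf_struct ar M \<and> univ M = UNIV \<and> countable (univ M) \<and> homogeneous M \<and> age ar M = K"

definition transitive :: "('r, 'a) struct \<Rightarrow> bool" where
  "transitive M \<longleftrightarrow> (\<forall>a b. \<exists>f\<in>Aut M. f a = b)"

definition nontrivial :: "('r, 'a) struct \<Rightarrow> bool" where
  "nontrivial M \<longleftrightarrow> Aut M \<noteq> {f. bij f}"


section \<open>The bounded rational Urysohn space\<close>

text \<open>The bijection \<open>\<rho>\<close> assigns to a binary relation symbol the distance it stands for.\<close>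

definition metric_class :: "('r \<Rightarrow> nat) \<Rightarrow> ('r \<Rightarrow> real) \<Rightarrow> ('r, nat) struct set" where
  "metric_class ar \<rho> = {B. wf_struct ar B \<and> finite (univ B) \<and>
     (\<exists>d. Metric_space (univ B) d \<and>
        (\<forall>a\<in>univ B. \<forall>b\<in>univ B. d a b \<in> \<rat> \<inter> {0..1} \<and>
           (\<forall>r. rel B r [a, b] \<longleftrightarrow> d a b = \<rho> r)))}"

definition bounded_rational_urysohn ::
    "('r \<Rightarrow> nat) \<Rightarrow> ('r \<Rightarrow> real) \<Rightarrow> ('r, 'a) struct \<Rightarrow> bool" where
  "bounded_rational_urysohn ar \<rho> M \<longleftrightarrow>
     (\<forall>r. ar r = 2) \<and> bij_betw \<rho> UNIV (\<rat> \<inter> {0..1}) \<and> fraisse_limit ar (metric_class ar \<rho>) M"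

definition urysohn_dist :: "('r \<Rightarrow> real) \<Rightarrow> ('r, 'a) struct \<Rightarrow> 'a \<Rightarrow> 'a \<Rightarrow> real" where
  "urysohn_dist \<rho> M a b = \<rho> (THE r. rel M r [a, b])"


section \<open>Independence\<close>

text \<open>In a ternary relation \<open>ind A C B\<close> the middle argument is the base:
  \<open>A\<close> is independent from \<open>B\<close> over \<open>C\<close>.\<close>

definition free_ind :: "('r, 'a) struct \<Rightarrow> 'a set \<Rightarrow> 'a set \<Rightarrow> 'a set \<Rightarrow> bool" where
  "free_ind M A B C \<longleftrightarrow> A \<inter> C \<subseteq> B \<and>
     \<not> (\<exists>r xs. rel M r xs \<and> set xs \<subseteq> A \<union> B \<union> C \<and>
              set xs \<inter> (A - B) \<noteq> {} \<and> set xs \<inter> (C - B) \<noteq> {})"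

definition urysohn_ind ::
    "('r \<Rightarrow> real) \<Rightarrow> ('r, 'a) struct \<Rightarrow> 'a set \<Rightarrow> 'a set \<Rightarrow> 'a set \<Rightarrow> bool" where
  "urysohn_ind \<rho> M A C B \<longleftrightarrow>
     (\<forall>a\<in>A. \<forall>b\<in>B. urysohn_dist \<rho> M a b = 1 \<or>
        (\<exists>c\<in>C. urysohn_dist \<rho> M a b = urysohn_dist \<rho> M a c + urysohn_dist \<rho> M c b))"

text \<open>\<open>ind2 ind A C D B\<close> is independence of \<open>A\<close> from \<open>B\<close> over the pair \<open>C;D\<close>.\<close>

definition ind2 ::
    "('a set \<Rightarrow> 'a set \<Rightarrow> 'a set \<Rightarrow> bool) \<Rightarrow> 'a set \<Rightarrow> 'a set \<Rightarrow> 'a set \<Rightarrow> 'a set \<Rightarrow> bool" where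
  "ind2 ind A C D B \<longleftrightarrow> ind (A \<union> C) D B \<and> ind A C (B \<union> D)"


section \<open>Types\<close>

definition Fix :: "('r, 'a) struct \<Rightarrow> 'a set \<Rightarrow> ('a \<Rightarrow> 'a) set" where
  "Fix S A = {f \<in> Aut S. \<forall>a\<in>A. f a = a}"

text \<open>A type over a finite set is identified with its set of realizations, that is, with an
  orbit of the pointwise stabilizer of that set: realizing is membership, and a type is
  non-algebraic iff it is infinite as a set. Types over different parameter sets are never
  compared.\<close>

definition tp :: "('r, 'a) struct \<Rightarrow> 'a set \<Rightarrow> 'a list \<Rightarrow> 'a list set" where
  "tp S A x = (\<lambda>f. map f x) ` Fix S A"


section \<open>Order and tournament expansions\<close>

definition bin_struct :: "('a \<Rightarrow> 'a \<Rightarrow> bool) \<Rightarrow> (unit, 'a) struct" where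
  "bin_struct E = \<lparr>univ = UNIV, rel = (\<lambda>_ xs. \<exists>a b. xs = [a, b] \<and> E a b)\<rparr>"

definition expand :: "('r, 'a) struct \<Rightarrow> ('a \<Rightarrow> 'a \<Rightarrow> bool) \<Rightarrow> ('r + unit, 'a) struct" where
  "expand M E = \<lparr>univ = univ M, rel = case_sum (rel M) (rel (bin_struct E))\<rparr>"

definition order_expansion :: "('r, 'a) struct \<Rightarrow> ('a \<Rightarrow> 'a \<Rightarrow> bool) \<Rightarrow> bool" where
  "order_expansion M E \<longleftrightarrow>
     irreflp E \<and> transp E \<and> totalp E \<and> (\<forall>a. \<exists>b. E b a) \<and> (\<forall>a. \<exists>b. E a b) \<and>
     (\<forall>X c. finite X \<and> infinite (tp M X [c]) \<longrightarrow>
        (\<forall>a b. E a b \<longrightarrow> (\<exists>x. [x] \<in> tp M X [c] \<and> E a x \<and> E x b)))"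

definition tournament_class :: "(unit, nat) struct set" where
  "tournament_class = {B. wf_struct (\<lambda>_. 2) B \<and> finite (univ B) \<and>
     (\<forall>a\<in>univ B. \<not> rel B () [a, a]) \<and>
     (\<forall>a\<in>univ B. \<forall>b\<in>univ B. a \<noteq> b \<longrightarrow> (rel B () [a, b] \<longleftrightarrow> \<not> rel B () [b, a]))}"

definition tournament_expansion :: "('r, 'a) struct \<Rightarrow> ('a \<Rightarrow> 'a \<Rightarrow> bool) \<Rightarrow> bool" where
  "tournament_expansion M E \<longleftrightarrow>
     fraisse_limit (\<lambda>_. 2) tournament_class (bin_struct E) \<and>
     (\<forall>X c. finite X \<and> infinite (tp M X [c]) \<longrightarrow>
        (\<forall>A B. finite A \<and> finite B \<and> A \<inter> B = {} \<longrightarrow>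
           (\<exists>x. [x] \<in> tp M X [c] \<and> (\<forall>a\<in>A. E x a) \<and> (\<forall>b\<in>B. E b x))))"


section \<open>The automorphism group\<close>

definition aut_group :: "('r, 'a) struct \<Rightarrow> ('a \<Rightarrow> 'a) monoid" where
  "aut_group S = \<lparr>carrier = Aut S, monoid.mult = (\<circ>), one = id\<rparr>"

definition normal_closure :: "('g, 'b) monoid_scheme \<Rightarrow> 'g \<Rightarrow> 'g set" where
  "normal_closure G h = \<Inter>{N. N \<lhd> G \<and> h \<in> N}"

definition conjug :: "('a \<Rightarrow> 'a) \<Rightarrow> ('a \<Rightarrow> 'a) \<Rightarrow> ('a \<Rightarrow> 'a)" where
  "conjug g a = inv_into UNIV a \<circ> g \<circ> a"


section \<open>Moving maximally and compatibility\<close>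

text \<open>In what follows \<open>M\<close> is the structure, \<open>E\<close> the additional order or tournament relation
  and \<open>ind\<close> the independence relation on \<open>M\<close>. The image of \<open>tp (expand M E) X x\<close> under
  an automorphism \<open>g\<close> is \<open>tp (expand M E) (g ` X) (map g x)\<close>.\<close>

definition L2_homogeneous :: "('a \<Rightarrow> 'a \<Rightarrow> bool) \<Rightarrow> ('a \<Rightarrow> 'a) \<Rightarrow> bool" where
  "L2_homogeneous E g \<longleftrightarrow>
     (\<forall>x y. tp (bin_struct E) {} [x, g x] = tp (bin_struct E) {} [y, g y])"

definition moves_maximally ::
    "('r, 'a) struct \<Rightarrow> ('a \<Rightarrow> 'a \<Rightarrow> bool) \<Rightarrow> ('a set \<Rightarrow> 'a set \<Rightarrow> 'a set \<Rightarrow> bool) \<Rightarrow>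
     ('a \<Rightarrow> 'a) \<Rightarrow> bool" where
  "moves_maximally M E ind g \<longleftrightarrow> L2_homogeneous E g \<and>
     (\<forall>X c. finite X \<and> infinite (tp (expand M E) X c) \<longrightarrow>
        (\<exists>x \<in> tp (expand M E) X c. ind2 ind (set x) X (g ` X) (g ` set x)))"

definition full_for ::
    "('r, 'a) struct \<Rightarrow> ('a \<Rightarrow> 'a \<Rightarrow> bool) \<Rightarrow> ('a set \<Rightarrow> 'a set \<Rightarrow> 'a set \<Rightarrow> bool) \<Rightarrow>
     ('a \<Rightarrow> 'a) \<Rightarrow> 'a set \<Rightarrow> bool" where
  "full_for M E ind g X \<longleftrightarrow>
     (\<forall>x y. tp (expand M E) (g ` X) (map g x) = tp (expand M E) (g ` X) y \<and>
        (\<forall>i<length x. tp (bin_struct E) {x ! i} [y ! i] = tp (bin_struct E) {x ! i} [g (x ! i)]) \<and>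
        ind2 ind (set x) X (g ` X) (set y) \<longrightarrow>
        (\<exists>a \<in> Fix (expand M E) (X \<union> g ` X). map (conjug g a) x = y))"

text \<open>The last existential quantifier over \<open>w\<close> states that the union of \<open>L\<^sub>2\<close>-types is
  consistent. The tuples \<open>x\<close> and \<open>z\<close> have the same length since their images have the
  same type.\<close>

definition compatible ::
    "('r, 'a) struct \<Rightarrow> ('a \<Rightarrow> 'a \<Rightarrow> bool) \<Rightarrow> ('a set \<Rightarrow> 'a set \<Rightarrow> 'a set \<Rightarrow> bool) \<Rightarrow>
     ('a \<Rightarrow> 'a) \<Rightarrow> bool" where
  "compatible M E ind g \<longleftrightarrow>
     (\<forall>X0. finite X0 \<longrightarrow>
       (\<exists>X Y. finite X \<and> X0 \<subseteq> X \<and> Y = g ` X \<and>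
          full_for M E ind g X \<and>
          (\<forall>b Z x z. b \<in> Aut (expand M E) \<and> finite Z \<and> conjug g b ` Z = Y \<and>
             tp (expand M E) Y (map (conjug g b) z) = tp (expand M E) Y (map g x) \<and>
             ind (set z) Z (Y \<union> X) \<and> ind (set x) X (Y \<union> Z) \<longrightarrow>
             (\<exists>b' \<in> Fix (expand M E) (Y \<union> Z). \<exists>Z' Y'.
                finite Z' \<and> Z \<subseteq> Z' \<and> Y' = conjug g b ` Z' \<and>
                full_for M E ind (conjug g b) Z' \<and>
                tp (expand M E) Y (map (conjug g (b \<circ> b')) z)
                  = tp (expand M E) Y (map (conjug g b) z) \<and>
                ind (conjug g (b \<circ> b') ` set z) Y (inv_into UNIV b' ` Y') \<and>
                ind (b' ` set z) Z' Y' \<and>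
                (\<exists>w. w \<in> tp (bin_struct E) (inv_into UNIV b' ` Y') (map (conjug g (b \<circ> b')) z) \<and>
                   (\<forall>i<length x. [w ! i] \<in> tp (bin_struct E) {x ! i} [g (x ! i)]) \<and>
                   (\<forall>i<length z. [w ! i] \<in>
                      tp (bin_struct E) {z ! i} [conjug g (b \<circ> b') (z ! i)]))))))"


section \<open>Basic facts\<close>

lemma Aut_id: "id \<in> Aut S"
  by (simp add: Aut_def isom_def)

lemma Aut_comp: "f \<circ> g \<in> Aut S" if "f \<in> Aut S" "g \<in> Aut S"
proof -
  have *: "rel S r (map f (map g xs)) \<longleftrightarrow> rel S r xs" if "set xs \<subseteq> univ S" for r xs
  proof -
    have "set (map g xs) \<subseteq> univ S"
      using that \<open>g \<in> Aut S\<close> by (auto simp: Aut_def isom_def bij_betw_def)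
    then show ?thesis
      using that \<open>f \<in> Aut S\<close> \<open>g \<in> Aut S\<close> unfolding Aut_def isom_def by blast
  qed
  show ?thesis
    using that * by (auto simp: Aut_def isom_def intro: bij_betw_trans)
qed

lemma Aut_inv: "inv_into UNIV f \<in> Aut S" if "f \<in> Aut S" "univ S = UNIV"
proof -
  have b: "bij f" using that by (simp add: Aut_def isom_def)
  have f_rel: "rel S r (map f ys) \<longleftrightarrow> rel S r ys" for r ys
    using that by (simp add: Aut_def isom_def)
  have "rel S r (map (inv_into UNIV f) xs) \<longleftrightarrow> rel S r xs" for r xs
  proof -
    have "map f (map (inv_into UNIV f) xs) = xs"
      using b by (simp add: bij_is_surj surj_f_inv_f map_idI)
    then show ?thesis
      using f_rel[of r "map (inv_into UNIV f) xs"] by simp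
  qed
  then show ?thesis using b that by (simp add: Aut_def isom_def bij_imp_bij_inv)
qed

lemma group_aut_group: "group (aut_group S)" if "univ S = UNIV"
proof (rule groupI)
  fix f assume "f \<in> carrier (aut_group S)"
  then have f: "f \<in> Aut S" by (simp add: aut_group_def)
  then have "inv_into UNIV f \<circ> f = id"
    using that by (simp add: Aut_def isom_def bij_is_inj)
  then show "\<exists>g\<in>carrier (aut_group S). g \<otimes>\<^bsub>aut_group S\<^esub> f = \<one>\<^bsub>aut_group S\<^esub>"
    using Aut_inv[OF f that] by (auto simp: aut_group_def)
qed (auto simp: aut_group_def Aut_id Aut_comp comp_assoc)

lemma tp_eq_iff: "tp S A x = tp S A y \<longleftrightarrow> (\<exists>f\<in>Fix S A. map f x = y)" if "univ S = UNIV"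
proof
  assume "tp S A x = tp S A y"
  moreover have "y \<in> tp S A y"
    unfolding tp_def Fix_def by (rule image_eqI[of _ _ id]) (auto simp: Aut_id)
  ultimately have "y \<in> tp S A x" by simp
  then show "\<exists>f\<in>Fix S A. map f x = y" by (auto simp: tp_def)
next
  assume "\<exists>f\<in>Fix S A. map f x = y"
  then obtain f where f: "f \<in> Fix S A" and y: "y = map f x" by blast
  then have fA: "f \<in> Aut S" and fix_f: "\<And>a. a \<in> A \<Longrightarrow> f a = a" by (auto simp: Fix_def)
  have inj: "inj f" using fA that by (simp add: Aut_def isom_def bij_is_inj)
  let ?i = "inv_into UNIV f"
  have i: "?i \<in> Fix S A"
    using Aut_inv[OF fA that] inv_into_f_eq[OF inj UNIV_I fix_f] by (simp add: Fix_def)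
  have x: "x = map ?i y" using inj y by (simp add: map_idI)
  have comp: "g \<circ> k \<in> Fix S A" if "g \<in> Fix S A" "k \<in> Fix S A" for g k
    using that by (auto simp: Fix_def Aut_comp)
  have "map g x \<in> tp S A y" if "g \<in> Fix S A" for g
    unfolding tp_def by (rule image_eqI[of _ _ "g \<circ> ?i"]) (use comp[OF that i] x in auto)
  moreover have "map g y \<in> tp S A x" if "g \<in> Fix S A" for g
    unfolding tp_def by (rule image_eqI[of _ _ "g \<circ> f"]) (use comp[OF that f] y in auto)
  ultimately show "tp S A x = tp S A y" by (auto simp: tp_def[of S A x] tp_def[of S A y])
qed

end

theory Submission
  imports Defs
begin

text \<open>The automorphism group of the expansion is handled through a few properties of the independence relation, namely
invariance, transitivity, and existence and stationarity for 1-types, and through the genericity of \<open>E\<close>. Both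
examples have them, so most of the argument takes place in a common abstract setting.

\<^bold>\<open>A sufficient condition.\<close> Call \<open>g\<close> a maximal mover if \<open>E x (g x)\<close> for all \<open>x\<close>, every non-algebraic 1-type over a
finite set \<open>X\<close> is realized by some \<open>x\<close> with \<open>x\<close> independent from \<open>g x\<close> over the pair \<open>X; g X\<close>, and, in an order,
all orbits are cofinal. Independence over a pair can be accumulated entry by entry, so maximal movers move tuples
maximally. To see that a finite set \<open>X\<close> is full, a point \<open>x\<close> with prescribed types of \<open>x\<close> and \<open>g x\<close> over \<open>X \<union> g X\<close> is
needed: in the structure itself a maximally displaced point has the right type by stationarity, and the
positions of \<open>x\<close> and \<open>g x\<close> amount to a cut for \<open>x\<close>, which is consistent if \<open>X\<close> is closed under certain parts of
\<open>g\<close>-orbits (\<open>gap_free\<close>, \<open>orbit_closed\<close>). Every finite set lies in a finite set of this kind; in an order this is where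
cofinal orbits are used. Since conjugates of maximal movers are maximal movers, the second half of compatibility
only asks for a generic position of \<open>z\<close> over a full extension of \<open>Z\<close>, and for room to push the images up.

\<^bold>\<open>Adding up displacements.\<close> If \<open>h\<close> moves a realization of every type far, then \<open>h h\<^sup>k\<close> moves realizations of
every type twice as far for a generic \<open>k\<close>. Such a \<open>k\<close> is built from finite pieces. For each type it is arranged that a
realization \<open>x\<close> is moved far to \<open>h\<inverse> x\<close>, that \<open>y = k x\<close> is moved far by \<open>h\<close>, and that the preimage of \<open>h y\<close> under \<open>k\<close> is
independent from \<open>h\<inverse> x\<close> over \<open>x\<close> and everything decided before (\<open>displace_extend\<close>, \<open>displacement_step\<close>). The notion
of distance is a parameter, and \<open>composes P Q\<close> says that two displacements of size \<open>P\<close> combine to one of size \<open>Q\<close>.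

\<^bold>\<open>The start.\<close> In the free case every nontrivial \<open>h\<close> moves some realization of every non-algebraic type: otherwise
a relation that holds of a moved point and fixed realizations of the type would, applying \<open>h\<close>, contradict
independence. One step of adding up displacements then gives maximal displacement. In the Urysohn space some
realization of every type at distance 1 from the parameters is moved by a fixed \<open>\<epsilon>\<close>, and doubling leads to distance 1. From this
one obtains for arbitrary types a displacement that is at least one half or as large as that along a path
through \<open>X\<close> and \<open>g X\<close>, and one more doubling makes it maximal.

\<^bold>\<open>The relation \<open>E\<close>.\<close> In an order \<open>h\<close> is first replaced by a product of conjugates of \<open>h\<close> and its inverse
that is increasing with cofinal orbits, a property that the later steps preserve. In a tournament
maximal displacement is first obtained without regard to arrows and then with both directions of them; a last
generic \<open>k\<close> has the additional property that \<open>h x \<rightarrow> h\<^sup>k x\<close> for all \<open>x\<close>.\<close>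

section \<open>Automorphisms and pointwise stabilizers\<close>

abbreviation iv :: "('a \<Rightarrow> 'a) \<Rightarrow> 'a \<Rightarrow> 'a" where "iv \<equiv> inv_into UNIV"

lemma Aut_bij: "univ M = UNIV \<Longrightarrow> f \<in> Aut M \<Longrightarrow> bij f"
  by (simp add: Aut_def isom_def)

lemma Aut_iff:
  "univ M = UNIV \<Longrightarrow> f \<in> Aut M \<longleftrightarrow> bij f \<and> (\<forall>r xs. rel M r (map f xs) \<longleftrightarrow> rel M r xs)"
  by (simp add: Aut_def isom_def)

lemma Fix_comp: "f \<in> Fix M A \<Longrightarrow> g \<in> Fix M A \<Longrightarrow> f \<circ> g \<in> Fix M A"
  by (auto simp: Fix_def Aut_comp)

lemma Fix_mono: "A \<subseteq> B \<Longrightarrow> Fix M B \<subseteq> Fix M A"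
  by (auto simp: Fix_def)

lemma Fix_subset_Aut: "f \<in> Fix M A \<Longrightarrow> f \<in> Aut M"
  by (simp add: Fix_def)

section \<open>The calculus of independence\<close>

text \<open>The properties of the two independence relations that the argument uses. Existence and
  stationarity are only required of single points; for finite sets they are obtained by adding
  the points one at a time.\<close>

locale independence =
  fixes M :: "('r, 'a) struct" and ind :: "'a set \<Rightarrow> 'a set \<Rightarrow> 'a set \<Rightarrow> bool"
  assumes univ_M: "univ M = UNIV"
    and ind_aut: "\<And>\<sigma> A B C. \<sigma> \<in> Aut M \<Longrightarrow> ind A B C \<Longrightarrow> ind (\<sigma> ` A) (\<sigma> ` B) (\<sigma> ` C)"
    and ind_sym: "\<And>A B C. ind A B C \<Longrightarrow> ind C B A"
    and ind_base: "\<And>A B C. A \<subseteq> B \<Longrightarrow> ind A B C"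
    and ind_trans: "\<And>A B C D. ind A B (C \<union> D) \<longleftrightarrow> ind A B C \<and> ind A (B \<union> C) D"
    and ind_disjoint: "\<And>A B C. ind A B C \<Longrightarrow> A \<inter> C \<subseteq> B"
    and stationary: "\<And>X A \<sigma> x. finite X \<Longrightarrow> finite A \<Longrightarrow> \<sigma> \<in> Fix M X \<Longrightarrow> ind {x} X A \<Longrightarrow>
      ind {\<sigma> x} X A \<Longrightarrow> \<exists>\<tau>\<in>Fix M (X \<union> A). \<tau> x = \<sigma> x"
    and ind_exists: "\<And>X A c. finite X \<Longrightarrow> finite A \<Longrightarrow> c \<notin> X \<Longrightarrow> \<exists>\<sigma>\<in>Fix M X. ind {\<sigma> c} X A"
    and point_transitive: "\<And>x y. \<exists>\<sigma>\<in>Aut M. \<sigma> x = y"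
begin

lemma ind_base_right: "C \<subseteq> B \<Longrightarrow> ind A B C"
  by (simp add: ind_base ind_sym)

lemma ind_mono_right: "ind A B C \<Longrightarrow> C' \<subseteq> C \<Longrightarrow> ind A B C'"
  using ind_trans[of A B C' C] by (simp add: Un_absorb1)

lemma ind_mono_left: "ind A B C \<Longrightarrow> A' \<subseteq> A \<Longrightarrow> ind A' B C"
  by (meson ind_sym ind_mono_right)

lemma ind_mono: "ind A B C \<Longrightarrow> A' \<subseteq> A \<Longrightarrow> C' \<subseteq> C \<Longrightarrow> ind A' B C'"
  by (meson ind_mono_left ind_mono_right)

lemma ind_absorb_right: "ind A B (B \<union> C) \<longleftrightarrow> ind A B C"
  using ind_trans[of A B B C] ind_base_right[of B B A] by simp

lemma ind_base_mono: "ind A B C \<Longrightarrow> D \<subseteq> B \<union> C \<Longrightarrow> ind A (B \<union> D) C"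
  using ind_absorb_right[of A B C] ind_trans[of A B D "B \<union> C"]
  by (metis Un_upper2 ind_mono_right sup.absorb_iff2)

lemma ind_trans_right: "ind A B C \<Longrightarrow> ind A (B \<union> C) D \<Longrightarrow> ind A B (C \<union> D)"
  using ind_trans by blast

lemma ind_trans_left: "ind A B C \<Longrightarrow> ind A' (B \<union> A) C \<Longrightarrow> ind (A \<union> A') B C"
  using ind_trans by (meson ind_sym)

lemma ind_shrink_left: "ind (A \<union> A') B C \<Longrightarrow> ind A' (B \<union> A) C"
  using ind_trans by (meson ind_sym)

lemma ind_aut_iff:
  assumes "\<sigma> \<in> Aut M" shows "ind (\<sigma> ` A) (\<sigma> ` B) (\<sigma> ` C) \<longleftrightarrow> ind A B C"
proof
  assume "ind (\<sigma> ` A) (\<sigma> ` B) (\<sigma> ` C)"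
  from ind_aut[OF Aut_inv[OF assms univ_M] this] show "ind A B C"
    using Aut_bij[OF univ_M assms] by (simp add: image_comp bij_is_inj)
qed (simp add: ind_aut assms)

text \<open>Displacement over a base enlarged by a set from which \<open>A\<close> is independent is displacement over the base, because
the image of the additional set is independent from the image of \<open>A\<close>.\<close>

lemma ind2_base:
  assumes x: "ind A X C" and i: "ind2 ind A (X \<union> C) (g ` (X \<union> C)) (g ` A)" and g: "g \<in> Aut M"
  shows "ind2 ind A X (g ` X) (g ` A)"
proof -
  have i1: "ind (A \<union> (X \<union> C)) (g ` X \<union> g ` C) (g ` A)"
    and i2: "ind A (X \<union> C) (g ` A \<union> (g ` X \<union> g ` C))"
    using i by (auto simp: ind2_def image_Un)
  have "ind A X (C \<union> (g ` A \<union> (g ` X \<union> g ` C)))" by (rule ind_trans_right[OF x i2])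
  then have 2: "ind A X (g ` A \<union> g ` X)" by (rule ind_mono_right) auto
  have gx: "ind (g ` C) (g ` X) (g ` A)" using ind_aut[OF g x] by (rule ind_sym)
  have "ind (g ` C \<union> (A \<union> (X \<union> C))) (g ` X) (g ` A)" by (rule ind_trans_left[OF gx i1])
  then have "ind (A \<union> X) (g ` X) (g ` A)" by (rule ind_mono_left) auto
  with 2 show ?thesis by (simp add: ind2_def)
qed

text \<open>Independence over a pair is transitive in the way that lets a tuple be moved maximally one
  entry after the other.\<close>

lemma ind2_insert:
  assumes A: "ind2 ind A X Y A'" and s: "ind2 ind S (X \<union> A) (Y \<union> A') S'"
  shows "ind2 ind (A \<union> S) X Y (A' \<union> S')"
proof -
  have s1: "ind (S \<union> (X \<union> A)) (Y \<union> A') S'" and s2: "ind S (X \<union> A) (S' \<union> (Y \<union> A'))"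
    and a1: "ind (A \<union> X) Y A'" and a2: "ind A X (A' \<union> Y)"
    using A s by (auto simp: ind2_def)
  have "ind S (X \<union> A \<union> Y) A'"
  proof -
    have "ind S (X \<union> A \<union> Y) (S' \<union> (Y \<union> A'))" by (rule ind_base_mono[OF s2]) auto
    then show ?thesis by (rule ind_mono_right) auto
  qed
  then have "ind S (Y \<union> (A \<union> X)) A'" by (simp add: Un_ac)
  then have *: "ind (A \<union> X \<union> S) Y A'" by (rule ind_trans_left[OF a1])
  have "ind (A \<union> X \<union> S) (Y \<union> A') S'" using s1 by (simp add: Un_ac)
  then have 1: "ind (A \<union> X \<union> S) Y (A' \<union> S')" by (rule ind_trans_right[OF *])
  have "ind A (Y \<union> A' \<union> X) S'"
  proof -
    have "ind (X \<union> (S \<union> A)) (Y \<union> A') S'" using s1 by (simp add: Un_ac)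
    then have "ind (S \<union> A) (Y \<union> A' \<union> X) S'" by (rule ind_shrink_left)
    then show ?thesis by (rule ind_mono_left) auto
  qed
  then have "ind A (X \<union> (A' \<union> Y)) S'" by (simp add: Un_ac)
  then have "ind A X (A' \<union> Y \<union> S')" by (rule ind_trans_right[OF a2])
  moreover have "ind S (X \<union> A) (A' \<union> Y \<union> S')" using s2 by (simp add: Un_ac)
  ultimately have "ind (A \<union> S) X (A' \<union> Y \<union> S')" by (rule ind_trans_left)
  with 1 show ?thesis by (simp add: ind2_def Un_ac)
qed

lemma ind2_absorb: "S \<subseteq> X \<union> A \<Longrightarrow> ind2 ind A X Y A' \<Longrightarrow> S' \<subseteq> Y \<union> A' \<Longrightarrow> ind2 ind (A \<union> S) X Y (A' \<union> S')"
  by (rule ind2_insert) (auto simp: ind2_def intro: ind_base ind_base_right)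

end

text \<open>In an order only a cut can be realized; in the random tournament any two disjoint sets can be
  separated. The flag tells the two cases apart.\<close>

definition cut :: "('a \<Rightarrow> 'a \<Rightarrow> bool) \<Rightarrow> bool \<Rightarrow> 'a set \<Rightarrow> 'a set \<Rightarrow> bool" where
  "cut E ord L U \<longleftrightarrow> (\<forall>l\<in>L. \<forall>u\<in>U. l \<noteq> u \<and> (ord \<longrightarrow> E l u))"

locale expansion = independence +
  fixes E :: "'a \<Rightarrow> 'a \<Rightarrow> bool" and ord :: bool
  assumes countable_M: "countable (UNIV :: 'a set)"
    and E_irrefl: "\<And>a. \<not> E a a"
    and E_total: "\<And>a b. a \<noteq> b \<Longrightarrow> E a b \<or> E b a"
    and E_asym: "\<And>a b. E a b \<Longrightarrow> \<not> E b a"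
    and E_trans: "\<And>a b c. ord \<Longrightarrow> E a b \<Longrightarrow> E b c \<Longrightarrow> E a c"
    and realize: "\<And>L U X c. finite L \<Longrightarrow> finite U \<Longrightarrow> cut E ord L U \<Longrightarrow> finite X \<Longrightarrow> c \<notin> X \<Longrightarrow>
      \<exists>\<sigma>\<in>Fix M X. (\<forall>l\<in>L. E l (\<sigma> c)) \<and> (\<forall>u\<in>U. E (\<sigma> c) u)"
begin

text \<open>The converse of the relation gives the same expansion up to notation; this halves the
  back-and-forth arguments.\<close>

lemma expansion_converse: "expansion M ind (\<lambda>a b. E b a) ord"
proof unfold_locales
  show "countable (UNIV :: 'a set)" by (rule countable_M)
next
  fix L U X :: "'a set" and c assume "finite L" "finite U" "cut (\<lambda>a b. E b a) ord L U" "finite X" "c \<notin> X"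
  then show "\<exists>\<sigma>\<in>Fix M X. (\<forall>l\<in>L. E (\<sigma> c) l) \<and> (\<forall>u\<in>U. E u (\<sigma> c))"
    using realize[of U L X c] by (fastforce simp: cut_def)
qed (use E_irrefl E_total E_asym E_trans in blast)+

lemma cut_realized: "(\<And>l. l \<in> L \<Longrightarrow> E l s) \<Longrightarrow> (\<And>u. u \<in> U \<Longrightarrow> E s u) \<Longrightarrow> cut E ord L U"
  unfolding cut_def using E_asym E_trans by blast

text \<open>Both kinds of genericity at once. The point is first made independent from \<open>A\<close>; realizing the cut over
\<open>X \<union> A\<close> then keeps it so.\<close>

lemma extend:
  assumes "finite L" "finite U" "cut E ord L U" "finite X" "finite A" "c \<notin> X"
  shows "\<exists>\<sigma>\<in>Fix M X. ind {\<sigma> c} X A \<and> (\<forall>l\<in>L. E l (\<sigma> c)) \<and> (\<forall>u\<in>U. E (\<sigma> c) u)"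
proof -
  obtain \<sigma> where s: "\<sigma> \<in> Fix M X" "ind {\<sigma> c} X A" using ind_exists assms by blast
  have "\<sigma> c \<notin> X"
  proof
    assume "\<sigma> c \<in> X"
    then have "\<sigma> (\<sigma> c) = \<sigma> c" using s by (auto simp: Fix_def)
    then have "\<sigma> c = c" using s Aut_bij[OF univ_M] by (auto simp: Fix_def dest!: bij_is_inj injD)
    then show False using \<open>\<sigma> c \<in> X\<close> assms by simp
  qed
  then have "\<sigma> c \<notin> X \<union> A" using ind_disjoint[OF s(2)] by auto
  then obtain \<tau> where t: "\<tau> \<in> Fix M (X \<union> A)" "\<forall>l\<in>L. E l (\<tau> (\<sigma> c))" "\<forall>u\<in>U. E (\<tau> (\<sigma> c)) u"
    using realize[of L U "X \<union> A" "\<sigma> c"] assms by auto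
  have "ind {\<tau> (\<sigma> c)} X A"
  proof -
    have "\<tau> ` X = X" "\<tau> ` A = A" using t(1) by (auto simp: Fix_def image_iff)
    then show ?thesis using ind_aut[OF Fix_subset_Aut[OF t(1)] s(2)] by simp
  qed
  moreover have "\<tau> \<circ> \<sigma> \<in> Fix M X" using t(1) s(1) by (auto simp: Fix_def Aut_comp)
  ultimately show ?thesis using t by (intro bexI[of _ "\<tau> \<circ> \<sigma>"]) auto
qed

end

section \<open>Back and forth\<close>

lemma dependent_chain:
  fixes I :: "'s \<Rightarrow> bool" and S :: "nat \<Rightarrow> 's \<Rightarrow> 's \<Rightarrow> bool"
  assumes "I s0" and "\<And>n s. I s \<Longrightarrow> \<exists>s'. I s' \<and> S n s s'"
  obtains f where "f 0 = s0" "\<And>n. I (f n)" "\<And>n. S n (f n) (f (Suc n))"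
proof -
  have "\<exists>f. f 0 = s0 \<and> (\<forall>n. I (f n) \<and> S n (f n) (f (Suc n)))"
  proof -
    define nx where "nx n s = (SOME s'. I s' \<and> S n s s')" for n s
    define f where "f = rec_nat s0 nx"
    have nx: "I (nx n s) \<and> S n s (nx n s)" if "I s" for n s
      unfolding nx_def using someI_ex[OF assms(2)[OF that]] .
    have fI: "I (f n)" for n
      by (induction n) (auto simp: f_def assms(1) nx)
    then have "S n (f n) (f (Suc n))" for n using nx by (simp add: f_def)
    with fI show ?thesis by (intro exI[of _ f]) (simp add: f_def)
  qed
  then show ?thesis using that by blast
qed

text \<open>The limit of a back-and-forth construction.\<close>

lemma chain_limit:
  fixes R :: "nat \<Rightarrow> ('a \<times> 'a) set"
  assumes mono: "\<And>n. R n \<subseteq> R (Suc n)"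
    and inj: "\<And>n a b c d. (a, b) \<in> R n \<Longrightarrow> (c, d) \<in> R n \<Longrightarrow> a = c \<longleftrightarrow> b = d"
    and dom: "\<And>a. \<exists>n b. (a, b) \<in> R n" and ran: "\<And>b. \<exists>n a. (a, b) \<in> R n"
  obtains k where "bij k" "\<And>n a b. (a, b) \<in> R n \<Longrightarrow> k a = b"
    "\<And>F. finite F \<Longrightarrow> \<exists>n. \<forall>a\<in>F. (a, k a) \<in> R n"
proof -
  have le: "m \<le> n \<Longrightarrow> R m \<subseteq> R n" for m n by (rule lift_Suc_mono_le[of R]) (use mono in auto)
  have two: "\<exists>n. p \<in> R n \<and> q \<in> R n" if "p \<in> R i" "q \<in> R j" for p q i j
    using le[of i "max i j"] le[of j "max i j"] that by auto
  obtain k where k: "\<And>a. \<exists>n. (a, k a) \<in> R n" using dom by metis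
  have k_eq: "k a = b" if "(a, b) \<in> R n" for a b n
  proof -
    obtain i where "(a, k a) \<in> R i" using k by blast
    with two that obtain m where "(a, k a) \<in> R m" "(a, b) \<in> R m" by blast
    then show ?thesis using inj by blast
  qed
  have "inj k"
  proof (rule injI)
    fix a c assume e: "k a = k c"
    obtain i j where "(a, k a) \<in> R i" "(c, k c) \<in> R j" using k by blast
    with two obtain m where "(a, k a) \<in> R m" "(c, k c) \<in> R m" by blast
    with e inj show "a = c" by metis
  qed
  moreover have "surj k"
  proof -
    have "\<exists>x. k x = y" for y using ran k_eq by blast
    then show ?thesis unfolding surj_def by metis
  qed
  moreover have "\<exists>n. \<forall>a\<in>F. (a, k a) \<in> R n" if "finite F" for F
    using that
  proof induction
    case (insert x F)
    then obtain n where n: "\<forall>a\<in>F. (a, k a) \<in> R n" by blast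
    obtain i where "(x, k x) \<in> R i" using k by blast
    then have "\<forall>a\<in>insert x F. (a, k a) \<in> R (max i n)"
      using n le[of i "max i n"] le[of n "max i n"] by auto
    then show ?case by blast
  qed auto
  ultimately show ?thesis using that k_eq by (auto simp: bij_def)
qed

context expansion
begin

definition from_M :: "nat \<Rightarrow> 'a" where "from_M = from_nat_into UNIV"

lemma from_M_surj: "\<exists>n. from_M n = a"
  using from_nat_into_surj[OF countable_M, of a] by (auto simp: from_M_def)

definition partial_E_iso :: "('a \<times> 'a) set \<Rightarrow> bool" where
  "partial_E_iso r \<longleftrightarrow>
    (\<forall>a b c d. (a, b) \<in> r \<longrightarrow> (c, d) \<in> r \<longrightarrow> (a = c \<longleftrightarrow> b = d) \<and> (E a c \<longleftrightarrow> E b d))"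

lemmas partial_E_isoI = partial_E_iso_def[THEN iffD2, rule_format]

lemmas partial_E_isoD = partial_E_iso_def[THEN iffD1, rule_format]

text \<open>One back-and-forth serves both the expansion and its reduct to the binary relation: the
  condition \<open>J\<close> says what is required of the partial maps besides preserving \<open>E\<close>.\<close>

lemma partial_E_iso_extend:
  assumes r: "finite r" "partial_E_iso r" "J r"
    and J: "\<And>r a L U. finite r \<Longrightarrow> J r \<Longrightarrow> partial_E_iso r \<Longrightarrow> a \<notin> Domain r \<Longrightarrow> finite L \<Longrightarrow> finite U \<Longrightarrow>
      cut E ord L U \<Longrightarrow> \<exists>b. J (insert (a, b) r) \<and> (\<forall>l\<in>L. E l b) \<and> (\<forall>u\<in>U. E b u)"
  shows "\<exists>b. J (insert (a, b) r) \<and> partial_E_iso (insert (a, b) r)"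
proof (cases "a \<in> Domain r")
  case True
  then obtain b where "(a, b) \<in> r" by blast
  then show ?thesis using r by (intro exI[of _ b]) (simp add: insert_absorb)
next
  case False
  define L where "L = {d. \<exists>c. (c, d) \<in> r \<and> E c a}"
  define U where "U = {d. \<exists>c. (c, d) \<in> r \<and> E a c}"
  have fin: "finite L" "finite U"
    by (rule finite_subset[of _ "snd ` r"]; force simp: L_def U_def r)+
  have "cut E ord L U"
    unfolding cut_def L_def U_def
  proof (clarify, intro conjI impI)
    fix l c u d assume lu: "(c, l) \<in> r" "E c a" "(d, u) \<in> r" "E a d"
    then have "c \<noteq> d" using E_asym by blast
    with partial_E_isoD[OF r(2) lu(1,3)] show "l \<noteq> u" by blast
    show "E l u" if ord using E_trans[OF that lu(2,4)] partial_E_isoD[OF r(2) lu(1,3)] by blast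
  qed
  then obtain b where b: "J (insert (a, b) r)" "\<forall>l\<in>L. E l b" "\<forall>u\<in>U. E b u"
    using J[OF r(1,3,2) False fin] by blast
  have *: "a \<noteq> c \<and> b \<noteq> d \<and> (E a c \<longleftrightarrow> E b d) \<and> (E c a \<longleftrightarrow> E d b)" if cd: "(c, d) \<in> r" for c d
  proof -
    have ac: "a \<noteq> c" using cd False by blast
    then consider "E a c" | "E c a" using E_total by blast
    then show ?thesis
    proof cases
      case 1
      then have "E b d" using b(3) cd by (auto simp: U_def)
      then show ?thesis using 1 ac E_asym E_irrefl by metis
    next
      case 2
      then have "E d b" using b(2) cd by (auto simp: L_def)
      then show ?thesis using 2 ac E_asym E_irrefl by metis
    qed
  qed
  have "partial_E_iso (insert (a, b) r)"
  proof (rule partial_E_isoI)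
    fix x y z w assume "(x, y) \<in> insert (a, b) r" "(z, w) \<in> insert (a, b) r"
    then show "(x = z \<longleftrightarrow> y = w) \<and> (E x z \<longleftrightarrow> E y w)"
      using *[of x y] *[of z w] partial_E_isoD[OF r(2), of x y z w] E_irrefl by auto
  qed
  then show ?thesis using b(1) by blast
qed

lemma partial_E_iso_converse: "partial_E_iso (r\<inverse>) \<longleftrightarrow> partial_E_iso r"
proof -
  have "partial_E_iso (r\<inverse>)" if "partial_E_iso r" for r
    by (rule partial_E_isoI) (use partial_E_isoD[OF that] in fast)
  from this[of r] this[of "r\<inverse>"] show ?thesis by auto
qed

text \<open>The extension step applied to the relation and to its converse in turn exhausts domain and range.\<close>

lemma back_and_forth:
  assumes r: "finite r" "partial_E_iso r" "J r"
    and J: "\<And>r a L U. finite r \<Longrightarrow> J r \<Longrightarrow> partial_E_iso r \<Longrightarrow> a \<notin> Domain r \<Longrightarrow> finite L \<Longrightarrow> finite U \<Longrightarrow>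
      cut E ord L U \<Longrightarrow> \<exists>b. J (insert (a, b) r) \<and> (\<forall>l\<in>L. E l b) \<and> (\<forall>u\<in>U. E b u)"
    and Jc: "\<And>r. J r \<Longrightarrow> J (r\<inverse>)"
  obtains k where "bij k" "\<And>a b. (a, b) \<in> r \<Longrightarrow> k a = b" "\<And>a b. E (k a) (k b) \<longleftrightarrow> E a b"
    "\<And>F. finite F \<Longrightarrow> \<exists>r'. J r' \<and> (\<forall>a\<in>F. (a, k a) \<in> r')"
proof -
  define I where "I r \<longleftrightarrow> finite r \<and> partial_E_iso r \<and> J r" for r
  have forth: "\<exists>b. I (insert (a, b) r)" if "I r" for r a
    using partial_E_iso_extend[of r J a] J that by (auto simp: I_def)
  have Ic: "I (r\<inverse>) \<longleftrightarrow> I r" for r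
    using Jc[of r] Jc[of "r\<inverse>"] by (auto simp: I_def partial_E_iso_converse)
  have retract: "\<exists>a. I (insert (a, b) r)" if I: "I r" for r b
  proof -
    obtain a where "I (insert (b, a) (r\<inverse>))" using forth[of "r\<inverse>" b] Ic I by blast
    moreover have "insert (b, a) (r\<inverse>) = (insert (a, b) r)\<inverse>" by auto
    ultimately show ?thesis using Ic by metis
  qed
  have step: "\<exists>r'. I r' \<and> (r \<subseteq> r' \<and> from_M n \<in> Domain r' \<and> from_M n \<in> Range r')" if I: "I r" for n r
  proof -
    obtain b where b: "I (insert (from_M n, b) r)" using forth I by blast
    from retract[OF b] obtain a where "I (insert (a, from_M n) (insert (from_M n, b) r))" by blast
    then show ?thesis by blast
  qed
  obtain R where R: "R 0 = r" "\<And>n. I (R n)"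
    "\<And>n. R n \<subseteq> R (Suc n) \<and> from_M n \<in> Domain (R (Suc n)) \<and> from_M n \<in> Range (R (Suc n))"
    by (rule dependent_chain[of I r "\<lambda>n r r'. r \<subseteq> r' \<and> from_M n \<in> Domain r' \<and> from_M n \<in> Range r'"])
      (use step r in \<open>auto simp: I_def\<close>)
  have iso: "partial_E_iso (R n)" for n using R(2) by (simp add: I_def)
  obtain k where k: "bij k" "\<And>n a b. (a, b) \<in> R n \<Longrightarrow> k a = b"
    "\<And>F. finite F \<Longrightarrow> \<exists>n. \<forall>a\<in>F. (a, k a) \<in> R n"
  proof (rule chain_limit[of R])
    fix a show "\<exists>n b. (a, b) \<in> R n" "\<exists>n b. (b, a) \<in> R n" using from_M_surj[of a] R(3) by blast+
  next
    fix n a b c d assume "(a, b) \<in> R n" "(c, d) \<in> R n"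
    then show "a = c \<longleftrightarrow> b = d" using partial_E_isoD[OF iso[of n]] by blast
  qed (use R(3) that in auto)
  show ?thesis
  proof
    show "k a = b" if "(a, b) \<in> r" for a b using k(2) R(1) that by blast
    show "E (k a) (k b) \<longleftrightarrow> E a b" for a b
    proof -
      obtain n where "(a, k a) \<in> R n" "(b, k b) \<in> R n" using k(3)[of "{a, b}"] by auto
      then show ?thesis using partial_E_isoD[OF iso[of n]] by blast
    qed
    show "\<exists>r'. J r' \<and> (\<forall>a\<in>F. (a, k a) \<in> r')" if "finite F" for F
      using k(3)[OF that] R(2) by (auto simp: I_def)
  qed (rule k(1))
qed

text \<open>The reduct to \<open>E\<close> is homogeneous: an order of this kind is dense without endpoints, and a
  tournament of this kind has the extension property.\<close>

lemma E_homogeneous: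
  assumes "finite r" "partial_E_iso r"
  obtains k where "bij k" "\<And>a b. (a, b) \<in> r \<Longrightarrow> k a = b" "\<And>a b. E (k a) (k b) \<longleftrightarrow> E a b"
proof (rule back_and_forth[of r "\<lambda>_. True"])
  fix L U :: "'a set" and r and a :: 'a assume "finite L" "finite U" "cut E ord L U"
  then show "\<exists>b. True \<and> (\<forall>l\<in>L. E l b) \<and> (\<forall>u\<in>U. E b u)"
    using realize[of L U "{}" a] by blast
qed (use assms that in blast)+

definition G :: "('a \<Rightarrow> 'a) set" where "G = {f \<in> Aut M. \<forall>a b. E (f a) (f b) \<longleftrightarrow> E a b}"

definition GF :: "'a set \<Rightarrow> ('a \<Rightarrow> 'a) set" where "GF X = {f \<in> G. \<forall>a\<in>X. f a = a}"

lemma G_Aut: "f \<in> G \<Longrightarrow> f \<in> Aut M" by (simp add: G_def)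

lemma G_E: "f \<in> G \<Longrightarrow> E (f a) (f b) \<longleftrightarrow> E a b" by (simp add: G_def)

lemma G_bij: "f \<in> G \<Longrightarrow> bij f" using Aut_bij[OF univ_M] G_Aut by blast

lemma G_inj: "f \<in> G \<Longrightarrow> f a = f b \<longleftrightarrow> a = b" using G_bij by (auto simp: bij_def dest: injD)

lemma G_iv1 [simp]: "f \<in> G \<Longrightarrow> iv f (f a) = a" using G_bij by (simp add: bij_is_inj)

lemma G_iv2 [simp]: "f \<in> G \<Longrightarrow> f (iv f a) = a" using G_bij by (simp add: bij_is_surj surj_f_inv_f)

lemma G_iv_img1 [simp]: "f \<in> G \<Longrightarrow> iv f ` f ` A = A" by (simp add: image_image)

lemma G_iv_img2 [simp]: "f \<in> G \<Longrightarrow> f ` iv f ` A = A" by (simp add: image_image)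

lemma G_id [simp]: "id \<in> G" by (simp add: G_def Aut_id)

lemma G_comp: "f \<in> G \<Longrightarrow> g \<in> G \<Longrightarrow> f \<circ> g \<in> G" by (simp add: G_def Aut_comp)

lemma G_iv: "f \<in> G \<Longrightarrow> iv f \<in> G"
  using G_E[of f "iv f _" "iv f _"] by (auto simp: G_def Aut_inv univ_M)

lemma G_iv_iv [simp]: "f \<in> G \<Longrightarrow> iv (iv f) = f" by (simp add: G_bij inv_inv_eq)

lemma G_iv_eq: "f \<in> G \<Longrightarrow> iv f a = b \<longleftrightarrow> a = f b" by auto

lemma G_in_img: "f \<in> G \<Longrightarrow> f a \<in> f ` A \<longleftrightarrow> a \<in> A" by (auto simp: G_inj)

lemma G_in_img': "f \<in> G \<Longrightarrow> a \<in> f ` A \<longleftrightarrow> iv f a \<in> A" using G_in_img[of f "iv f a" A] by simp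

lemma iv_comp: "f \<in> G \<Longrightarrow> g \<in> G \<Longrightarrow> iv (f \<circ> g) = iv g \<circ> iv f"
  by (simp add: G_bij o_inv_distrib)

lemma GF_G: "f \<in> GF X \<Longrightarrow> f \<in> G" by (simp add: GF_def)

lemma GF_fix: "f \<in> GF X \<Longrightarrow> a \<in> X \<Longrightarrow> f a = a" by (simp add: GF_def)

lemma GF_img: "f \<in> GF X \<Longrightarrow> Y \<subseteq> X \<Longrightarrow> f ` Y = Y" by (force simp: GF_def)

lemma GF_comp: "f \<in> GF X \<Longrightarrow> g \<in> GF X \<Longrightarrow> f \<circ> g \<in> GF X" by (simp add: GF_def G_comp)

lemma GF_iv: "f \<in> GF X \<Longrightarrow> iv f \<in> GF X" by (simp add: GF_def G_iv G_iv_eq)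

lemma GF_mono: "f \<in> GF X \<Longrightarrow> Y \<subseteq> X \<Longrightarrow> f \<in> GF Y" by (auto simp: GF_def)

lemma GF_id [simp]: "id \<in> GF X" by (simp add: GF_def)

lemma ind_G: "f \<in> G \<Longrightarrow> ind (f ` A) (f ` B) (f ` C) \<longleftrightarrow> ind A B C"
  by (rule ind_aut_iff) (rule G_Aut)

lemma ind2_G: "f \<in> G \<Longrightarrow> ind2 ind (f ` A) (f ` B) (f ` C) (f ` D) \<longleftrightarrow> ind2 ind A B C D"
  by (simp add: ind2_def ind_G flip: image_Un)

text \<open>Homogeneity of the expansion, by back and forth with partial maps that are restrictions of automorphisms of the
structure and preserve \<open>E\<close>.\<close>

lemma Aut_to_G:
  assumes "finite W" "\<sigma> \<in> Aut M" "\<And>a b. a \<in> W \<Longrightarrow> b \<in> W \<Longrightarrow> E (\<sigma> a) (\<sigma> b) \<longleftrightarrow> E a b"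
  obtains k where "k \<in> G" "\<And>a. a \<in> W \<Longrightarrow> k a = \<sigma> a"
proof -
  define J where "J r \<longleftrightarrow> (\<exists>\<sigma>\<in>Aut M. \<forall>a b. (a, b) \<in> r \<longrightarrow> \<sigma> a = b)" for r :: "('a \<times> 'a) set"
  define r where "r = (\<lambda>a. (a, \<sigma> a)) ` W"
  have inj: "f a = f b \<longleftrightarrow> a = b" if "f \<in> Aut M" for f a b
    using Aut_bij[OF univ_M that] by (auto simp: bij_def dest: injD)
  have Jc: "J (r\<inverse>)" if r: "J r" for r
  proof -
    obtain \<sigma> where s: "\<sigma> \<in> Aut M" "\<forall>a b. (a, b) \<in> r \<longrightarrow> \<sigma> a = b" using r by (auto simp: J_def)
    have "iv \<sigma> b = a" if "(a, b) \<in> r" for a b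
      using s(2) that Aut_bij[OF univ_M s(1)] by (metis bij_is_inj inv_f_f)
    then show ?thesis using Aut_inv[OF s(1) univ_M] by (auto simp: J_def)
  qed
  have J_step: "\<exists>b. J (insert (a, b) r) \<and> (\<forall>l\<in>L. E l b) \<and> (\<forall>u\<in>U. E b u)"
    if r: "finite r" "J r" and a: "a \<notin> Domain r" and LU: "finite L" "finite U" "cut E ord L U" for r a L U
  proof -
    obtain \<sigma> where s: "\<sigma> \<in> Aut M" "\<forall>a b. (a, b) \<in> r \<longrightarrow> \<sigma> a = b" using r by (auto simp: J_def)
    have "\<sigma> a \<notin> Range r"
    proof
      assume "\<sigma> a \<in> Range r"
      then obtain c where c: "(c, \<sigma> a) \<in> r" by blast
      then have "\<sigma> c = \<sigma> a" using s(2) by blast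
      then show False using a c inj[OF s(1)] by auto
    qed
    moreover have "finite (Range r)" using r by (simp add: finite_Range)
    ultimately obtain \<tau> where t: "\<tau> \<in> Fix M (Range r)" "\<forall>l\<in>L. E l (\<tau> (\<sigma> a))" "\<forall>u\<in>U. E (\<tau> (\<sigma> a)) u"
      using realize[OF LU] by blast
    have "J (insert (a, \<tau> (\<sigma> a)) r)"
      unfolding J_def
    proof (intro bexI[of _ "\<tau> \<circ> \<sigma>"] allI impI)
      show "\<tau> \<circ> \<sigma> \<in> Aut M" using s(1) t(1) by (simp add: Fix_def Aut_comp)
      fix c d assume "(c, d) \<in> insert (a, \<tau> (\<sigma> a)) r"
      then show "(\<tau> \<circ> \<sigma>) c = d"
        using s(2) t(1) by (auto simp: Fix_def Range_iff)
    qed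
    with t show ?thesis by blast
  qed
  have r: "finite r" "partial_E_iso r" "J r"
    using assms inj[OF assms(2)] by (auto simp: partial_E_iso_def r_def J_def)
  obtain k where k: "bij k" "\<And>a b. (a, b) \<in> r \<Longrightarrow> k a = b" "\<And>a b. E (k a) (k b) \<longleftrightarrow> E a b"
    "\<And>F. finite F \<Longrightarrow> \<exists>r'. J r' \<and> (\<forall>a\<in>F. (a, k a) \<in> r')"
    by (rule back_and_forth[of r J, OF r J_step Jc]) (assumption | blast)+
  have "k \<in> Aut M"
  proof -
    have "rel M r (map k xs) \<longleftrightarrow> rel M r xs" for r xs
    proof -
      obtain r' where r': "J r'" "\<forall>a\<in>set xs. (a, k a) \<in> r'" using k(4)[of "set xs"] by auto
      then obtain \<sigma> where "\<sigma> \<in> Aut M" "\<forall>a b. (a, b) \<in> r' \<longrightarrow> \<sigma> a = b" unfolding J_def by blast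
      with r' have "\<sigma> \<in> Aut M" "\<forall>a\<in>set xs. \<sigma> a = k a" by blast+
      then have "map k xs = map \<sigma> xs" "rel M r (map \<sigma> xs) \<longleftrightarrow> rel M r xs"
        by (auto simp: Aut_iff[OF univ_M])
      then show ?thesis by (simp only:)
    qed
    then show ?thesis using k(1) by (simp add: Aut_iff[OF univ_M])
  qed
  moreover have "k a = \<sigma> a" if "a \<in> W" for a using k(2) that by (auto simp: r_def)
  ultimately show ?thesis using k(3) by (intro that[of k]) (simp_all add: G_def)
qed

text \<open>As the parameters are fixed, only the type in the structure and the position relative to the parameters have
to be preserved.\<close>

lemma type_over:
  assumes "finite W" "\<sigma> \<in> Fix M W" "\<And>u. u \<in> W \<Longrightarrow> E u (\<sigma> x) \<longleftrightarrow> E u x"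
  obtains k where "k \<in> GF W" "k x = \<sigma> x"
proof -
  have inj: "\<sigma> a = \<sigma> b \<longleftrightarrow> a = b" for a b
    using Aut_bij[OF univ_M Fix_subset_Aut[OF assms(2)]] by (auto simp: bij_def dest: injD)
  have s: "\<sigma> u = u" if "u \<in> W" for u using assms(2) that by (simp add: Fix_def)
  have ux: "u = \<sigma> x \<longleftrightarrow> u = x" if "u \<in> W" for u using inj[of u x] s[OF that] by simp
  have xu: "E (\<sigma> x) u \<longleftrightarrow> E x u" if "u \<in> W" for u
    using assms(3)[OF that] ux[OF that] E_total[of u x] E_total[of u "\<sigma> x"] E_asym E_irrefl by metis
  obtain k where k: "k \<in> G" "\<And>a. a \<in> insert x W \<Longrightarrow> k a = \<sigma> a"
  proof (rule Aut_to_G[of "insert x W" \<sigma>])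
    show "E (\<sigma> a) (\<sigma> b) \<longleftrightarrow> E a b" if "a \<in> insert x W" "b \<in> insert x W" for a b
      using that s xu assms(3) E_irrefl by auto
  qed (use assms that in \<open>auto simp: Fix_def\<close>)
  show ?thesis by (rule that[of k]) (use k s in \<open>auto simp: GF_def\<close>)
qed

text \<open>The combined extension property, in terms of the expansion: a point can be moved over \<open>X\<close> to one
  independent from \<open>A\<close>, and its position relative to points outside \<open>X\<close> may be prescribed.\<close>

lemma move_point:
  assumes "finite X" "finite A" "c \<notin> X" "finite L" "finite U"
    and "cut E ord (L \<union> {u \<in> X. E u c}) (U \<union> {u \<in> X. E c u})"
  obtains a where "a \<in> GF X" "ind {a c} X A" "\<And>l. l \<in> L \<Longrightarrow> E l (a c)" "\<And>u. u \<in> U \<Longrightarrow> E (a c) u"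
proof -
  obtain \<sigma> where s: "\<sigma> \<in> Fix M X" "ind {\<sigma> c} X A" "\<forall>l\<in>L \<union> {u \<in> X. E u c}. E l (\<sigma> c)"
    "\<forall>u\<in>U \<union> {u \<in> X. E c u}. E (\<sigma> c) u"
    using extend[OF _ _ assms(6,1,2,3)] assms by auto
  have "E u (\<sigma> c) \<longleftrightarrow> E u c" if "u \<in> X" for u
    using s(3,4) that E_total[of u c] E_asym assms(3) by blast
  then obtain k where "k \<in> GF X" "k c = \<sigma> c" using type_over[OF assms(1) s(1)] by metis
  then show ?thesis using that s by auto
qed

lemma move_point_generic:
  assumes "finite X" "finite A" "c \<notin> X"
  obtains a where "a \<in> GF X" "ind {a c} X A"
proof (rule move_point[OF assms, of "{}" "{}"])
  show "cut E ord ({} \<union> {u \<in> X. E u c}) ({} \<union> {u \<in> X. E c u})" by (rule cut_realized[of _ c]) auto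
qed (use that in auto)

text \<open>The same for finite sets, adding their points one at a time.\<close>

lemma move_generic:
  assumes "finite S" "finite W" "finite C"
  obtains b where "b \<in> GF W" "ind (b ` S) W C"
proof -
  from assms(1) have "\<exists>b\<in>GF W. ind (b ` S) W C"
  proof induction
    case empty
    show ?case by (intro bexI[of _ id]) (auto intro: ind_base)
  next
    case (insert s S)
    then obtain b where b: "b \<in> GF W" "ind (b ` S) W C" by blast
    show ?case
    proof (cases "b s \<in> W \<union> b ` S")
      case True
      then have "ind {b s} (W \<union> b ` S) C" by (intro ind_base) auto
      then have "ind (b ` S \<union> {b s}) W C" by (rule ind_trans_left[OF b(2)])
      then show ?thesis using b(1) by (intro bexI[of _ b]) auto
    next
      case False
      obtain a where a: "a \<in> GF (W \<union> b ` S)" "ind {a (b s)} (W \<union> b ` S) C"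
        by (rule move_point_generic[of "W \<union> b ` S" C "b s"]) (use assms insert False in auto)
      have "ind (b ` S \<union> {a (b s)}) W C" by (rule ind_trans_left[OF b(2) a(2)])
      moreover have "(a \<circ> b) ` insert s S = b ` S \<union> {a (b s)}"
        using GF_img[OF a(1), of "b ` S"] by (auto simp: image_comp[symmetric])
      moreover have "a \<circ> b \<in> GF W" using GF_comp[OF GF_mono[OF a(1)] b(1)] by auto
      ultimately show ?thesis by (intro bexI[of _ "a \<circ> b"]) auto
    qed
  qed
  then show ?thesis using that by blast
qed

text \<open>Generic automorphisms. A state is an automorphism \<open>\<tau>\<close> of which only the restriction to the
  finite set \<open>A\<close> is decided; the limit of a chain of states meets countably many dense requirements.\<close>

lemma generic_automorphism:
  fixes D :: "nat \<Rightarrow> ('a \<Rightarrow> 'a) \<Rightarrow> 'a set \<Rightarrow> bool"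
  assumes init: "\<tau>0 \<in> G" "finite A0" "I \<tau>0 A0"
    and step: "\<And>\<tau> A n. \<tau> \<in> G \<Longrightarrow> finite A \<Longrightarrow> I \<tau> A \<Longrightarrow> \<exists>\<tau>' A'. \<tau>' \<in> G \<and> finite A' \<and> A \<subseteq> A' \<and>
        (\<forall>a\<in>A. \<tau>' a = \<tau> a) \<and> I \<tau>' A' \<and> D n \<tau>' A'"
    and dom: "\<And>\<tau> A x. \<tau> \<in> G \<Longrightarrow> finite A \<Longrightarrow> I \<tau> A \<Longrightarrow> \<exists>\<tau>' A'. \<tau>' \<in> G \<and> finite A' \<and> A \<subseteq> A' \<and>
        (\<forall>a\<in>A. \<tau>' a = \<tau> a) \<and> I \<tau>' A' \<and> x \<in> A'"
    and ran: "\<And>\<tau> A y. \<tau> \<in> G \<Longrightarrow> finite A \<Longrightarrow> I \<tau> A \<Longrightarrow> \<exists>\<tau>' A'. \<tau>' \<in> G \<and> finite A' \<and> A \<subseteq> A' \<and>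
        (\<forall>a\<in>A. \<tau>' a = \<tau> a) \<and> I \<tau>' A' \<and> y \<in> \<tau>' ` A'"
  obtains k where "k \<in> G" "\<And>a. a \<in> A0 \<Longrightarrow> k a = \<tau>0 a"
    "\<And>F. finite F \<Longrightarrow> \<exists>\<tau> A. \<tau> \<in> G \<and> finite A \<and> I \<tau> A \<and> (\<forall>a\<in>A. k a = \<tau> a) \<and> F \<subseteq> A"
    "\<And>n. \<exists>\<tau> A. \<tau> \<in> G \<and> finite A \<and> I \<tau> A \<and> (\<forall>a\<in>A. k a = \<tau> a) \<and> D n \<tau> A"
proof -
  define st where "st = (\<lambda>(\<tau>, A). \<tau> \<in> G \<and> finite A \<and> I \<tau> A)"
  define le where "le = (\<lambda>(\<tau>, A) (\<tau>' :: 'a \<Rightarrow> 'a, A'). A \<subseteq> A' \<and> (\<forall>a\<in>A. \<tau>' a = (\<tau> a :: 'a)))"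
  define S where "S n s s' \<longleftrightarrow> le s s' \<and> (case s' of (\<tau>, A) \<Rightarrow> D n \<tau> A \<and> from_M n \<in> A \<and> from_M n \<in> \<tau> ` A)"
    for n s s'
  have ex: "\<exists>s'. st s' \<and> S n s s'" if sts: "st s" for n s
  proof -
    obtain \<tau> A where sA: "s = (\<tau>, A)" by (cases s)
    have s: "s = (\<tau>, A)" "\<tau> \<in> G" "finite A" "I \<tau> A" using sts by (simp_all add: sA st_def)
    obtain \<tau>1 A1 where 1: "\<tau>1 \<in> G" "finite A1" "A \<subseteq> A1" "\<forall>a\<in>A. \<tau>1 a = \<tau> a" "I \<tau>1 A1" "from_M n \<in> A1"
      using dom[OF s(2-4), of "from_M n"] by (elim exE conjE) (rule that, assumption+)
    obtain \<tau>2 A2 where 2: "\<tau>2 \<in> G" "finite A2" "A1 \<subseteq> A2" "\<forall>a\<in>A1. \<tau>2 a = \<tau>1 a" "I \<tau>2 A2" "from_M n \<in> \<tau>2 ` A2"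
      using ran[OF 1(1,2,5), of "from_M n"] by (elim exE conjE) (rule that, assumption+)
    obtain \<tau>3 A3 where 3: "\<tau>3 \<in> G" "finite A3" "A2 \<subseteq> A3" "\<forall>a\<in>A2. \<tau>3 a = \<tau>2 a" "I \<tau>3 A3" "D n \<tau>3 A3"
      using step[OF 2(1,2,5), of n] by (elim exE conjE) (rule that, assumption+)
    have t: "\<forall>a\<in>A. \<tau>3 a = \<tau> a"
    proof
      fix a assume a: "a \<in> A"
      then have a1: "a \<in> A1" using 1(3) by (rule set_mp[rotated])
      then have "a \<in> A2" using 2(3) by (rule set_mp[rotated])
      with a a1 show "\<tau>3 a = \<tau> a" using 1(4) 2(4) 3(4) by simp
    qed
    obtain b where b: "b \<in> A2" "from_M n = \<tau>2 b" using 2(6) by auto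
    then have im: "from_M n \<in> \<tau>3 ` A3" using 3(3,4) by (intro image_eqI[of _ _ b]) auto
    have "A \<subseteq> A3" "from_M n \<in> A3" using 1(3,6) 2(3) 3(3) by auto
    with t im 3 have "st (\<tau>3, A3) \<and> S n s (\<tau>3, A3)"
      by (simp add: st_def S_def le_def s(1))
    then show ?thesis by blast
  qed
  obtain f where f: "f 0 = (\<tau>0, A0)" "\<And>n. st (f n)" "\<And>n. S n (f n) (f (Suc n))"
    by (rule dependent_chain[of st "(\<tau>0, A0)" S]) (use ex init in \<open>auto simp: st_def\<close>)
  define T where "T n = fst (f n)" for n
  define B where "B n = snd (f n)" for n
  have TB: "T n \<in> G" "finite (B n)" "I (T n) (B n)" for n
    using f(2)[of n] by (auto simp: st_def T_def B_def split: prod.splits)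
  have S: "B n \<subseteq> B (Suc n)" "\<And>a. a \<in> B n \<Longrightarrow> T (Suc n) a = T n a" "D n (T (Suc n)) (B (Suc n))"
    "from_M n \<in> B (Suc n)" "from_M n \<in> T (Suc n) ` B (Suc n)" for n
    using f(3)[of n] by (auto simp: S_def le_def T_def B_def split: prod.splits)
  define R where "R n = (\<lambda>a. (a, T n a)) ` B n" for n
  obtain k where k: "bij k" "\<And>n a b. (a, b) \<in> R n \<Longrightarrow> k a = b"
    "\<And>F. finite F \<Longrightarrow> \<exists>n. \<forall>a\<in>F. (a, k a) \<in> R n"
  proof (rule chain_limit[of R])
    show "R n \<subseteq> R (Suc n)" for n using S(1)[of n] S(2)[of _ n] by (force simp: R_def)
    show "a = c \<longleftrightarrow> b = d" if "(a, b) \<in> R n" "(c, d) \<in> R n" for n a b c d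
      using that G_inj[OF TB(1)[of n]] by (auto simp: R_def)
    fix a obtain n where n: "from_M n = a" using from_M_surj by blast
    show "\<exists>n b. (a, b) \<in> R n" using S(4)[of n] n by (auto simp: R_def)
    show "\<exists>n b. (b, a) \<in> R n" using S(5)[of n] n by (fastforce simp: R_def)
  qed (use that in auto)
  have kT: "k a = T n a" if "a \<in> B n" for n a using k(2)[of a "T n a" n] that by (auto simp: R_def)
  have fin: "\<exists>n. F \<subseteq> B n" if "finite F" for F using k(3)[OF that] by (fastforce simp: R_def)
  have "k \<in> Aut M"
  proof -
    have "rel M r (map k xs) \<longleftrightarrow> rel M r xs" for r xs
    proof -
      obtain n where "set xs \<subseteq> B n" using fin[of "set xs"] by auto
      then have "map k xs = map (T n) xs" using kT by auto
      moreover have "rel M r (map (T n) xs) \<longleftrightarrow> rel M r xs"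
        using G_Aut[OF TB(1)[of n]] by (simp add: Aut_iff[OF univ_M])
      ultimately show ?thesis by (simp only:)
    qed
    then show ?thesis using k(1) by (simp add: Aut_iff[OF univ_M])
  qed
  moreover have "E (k a) (k b) \<longleftrightarrow> E a b" for a b
  proof -
    obtain n where "{a, b} \<subseteq> B n" using fin[of "{a, b}"] by auto
    then have "k a = T n a" "k b = T n b" using kT[of _ n] by auto
    then show ?thesis by (simp only: G_E[OF TB(1)])
  qed
  ultimately have "k \<in> G" by (simp add: G_def)
  then show ?thesis
  proof (rule that)
    show "k a = \<tau>0 a" if "a \<in> A0" for a using kT[of a 0] that f(1) by (simp add: T_def B_def)
    have st: "T n \<in> G \<and> finite (B n) \<and> I (T n) (B n) \<and> (\<forall>a\<in>B n. k a = T n a)" for n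
      using TB[of n] kT[of _ n] by simp
    show "\<exists>\<tau> A. \<tau> \<in> G \<and> finite A \<and> I \<tau> A \<and> (\<forall>a\<in>A. k a = \<tau> a) \<and> F \<subseteq> A" if "finite F" for F
    proof -
      obtain n where "F \<subseteq> B n" using fin[OF \<open>finite F\<close>] ..
      with st[of n] show ?thesis by (intro exI[of _ "T n"] exI[of _ "B n"]) simp
    qed
    show "\<exists>\<tau> A. \<tau> \<in> G \<and> finite A \<and> I \<tau> A \<and> (\<forall>a\<in>A. k a = \<tau> a) \<and> D n \<tau> A" for n
      using st[of "Suc n"] S(3)[of n] by (intro exI[of _ "T (Suc n)"] exI[of _ "B (Suc n)"]) simp
  qed
qed

end

section \<open>Displacement\<close>

context expansion
begin

lemma GF_notin: "a \<in> GF X \<Longrightarrow> c \<notin> X \<Longrightarrow> a c \<notin> X"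
  by (metis GF_G GF_fix G_inj)

text \<open>A relation \<open>P X x Y y\<close> is read as a lower bound for how far \<open>x\<close> is from \<open>y\<close>, where \<open>x\<close> is given over
  \<open>X\<close> and \<open>y\<close> over \<open>Y\<close>. It may be checked over a larger set from which \<open>x\<close> is independent.\<close>

definition displacement :: "('a set \<Rightarrow> 'a \<Rightarrow> 'a set \<Rightarrow> 'a \<Rightarrow> bool) \<Rightarrow> bool" where
  "displacement P \<longleftrightarrow>
     (\<forall>f\<in>G. \<forall>X x Y y. P X x Y y \<longrightarrow> P (f ` X) (f x) (f ` Y) (f y)) \<and>
     (\<forall>g\<in>G. \<forall>X x C. finite X \<longrightarrow> finite C \<longrightarrow> ind {x} X C \<longrightarrow>
        P (X \<union> C) x (g ` (X \<union> C)) (g x) \<longrightarrow> P X x (g ` X) (g x))"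

definition symmetric_displacement :: "('a set \<Rightarrow> 'a \<Rightarrow> 'a set \<Rightarrow> 'a \<Rightarrow> bool) \<Rightarrow> bool" where
  "symmetric_displacement P \<longleftrightarrow> (\<forall>g\<in>G. \<forall>X x. P X x (g ` X) (g x) \<longrightarrow> P (g ` X) (g x) X x)"

lemma displacement_G: "displacement P \<Longrightarrow> f \<in> G \<Longrightarrow> P X x Y y \<Longrightarrow> P (f ` X) (f x) (f ` Y) (f y)"
  by (simp add: displacement_def)

lemma displacement_base:
  "displacement P \<Longrightarrow> g \<in> G \<Longrightarrow> finite X \<Longrightarrow> finite C \<Longrightarrow> ind {x} X C \<Longrightarrow>
    P (X \<union> C) x (g ` (X \<union> C)) (g x) \<Longrightarrow> P X x (g ` X) (g x)"
  unfolding displacement_def by metis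

lemma displacement_sym: "symmetric_displacement P \<Longrightarrow> g \<in> G \<Longrightarrow> P X x (g ` X) (g x) \<Longrightarrow> P (g ` X) (g x) X x"
  by (simp add: symmetric_displacement_def)

text \<open>Every non-algebraic 1-type of the expansion has a realization moved by \<open>g\<close> as far as \<open>P\<close> says.\<close>

definition displaces :: "('a set \<Rightarrow> 'a \<Rightarrow> 'a set \<Rightarrow> 'a \<Rightarrow> bool) \<Rightarrow> ('a \<Rightarrow> 'a) \<Rightarrow> bool" where
  "displaces P g \<longleftrightarrow> (\<forall>X c. finite X \<longrightarrow> c \<notin> X \<longrightarrow> (\<exists>a\<in>GF X. P X (a c) (g ` X) (g (a c))))"

lemma displacesD:
  assumes "displaces P g" "finite X" "c \<notin> X"
  obtains a where "a \<in> GF X" "P X (a c) (g ` X) (g (a c))"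
  using assms unfolding displaces_def by metis

text \<open>Moving the realization generically first and then realizing the displacement over \<open>X \<union> C\<close> gives both, since
the displacement survives when \<open>C\<close> is dropped from the base.\<close>

lemma displaces_generic:
  assumes P: "displacement P" and g: "g \<in> G" "displaces P g" and X: "finite X" "finite C" "c \<notin> X"
  obtains a where "a \<in> GF X" "ind {a c} X C" "P X (a c) (g ` X) (g (a c))"
proof -
  obtain a where a: "a \<in> GF X" "ind {a c} X C" using move_point_generic[OF X] by metis
  have ac: "a c \<notin> X \<union> C" using GF_notin[OF a(1) X(3)] ind_disjoint[OF a(2)] by auto
  obtain b where b: "b \<in> GF (X \<union> C)" "P (X \<union> C) (b (a c)) (g ` (X \<union> C)) (g (b (a c)))"
    using displacesD[OF g(2) _ ac] X by auto
  have i: "ind {b (a c)} X C"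
    using ind_G[OF GF_G[OF b(1)], of "{a c}" X C] a(2) GF_img[OF b(1), of X] GF_img[OF b(1), of C] by simp
  show ?thesis
  proof (rule that[of "b \<circ> a"])
    show "b \<circ> a \<in> GF X" using GF_comp[OF GF_mono[OF b(1)] a(1)] by simp
    show "ind {(b \<circ> a) c} X C" using i by simp
    show "P X ((b \<circ> a) c) (g ` X) (g ((b \<circ> a) c))"
      using displacement_base[OF P, OF g(1) X(1,2) i b(2)] by simp
  qed
qed

lemma displaces_mono:
  assumes "displaces P g" "g \<in> G"
    and "\<And>X x. finite X \<Longrightarrow> x \<notin> X \<Longrightarrow> P X x (g ` X) (g x) \<Longrightarrow> Q X x (g ` X) (g x)"
  shows "displaces Q g"
  unfolding displaces_def
proof (intro allI impI)
  fix X c assume X: "finite X" "c \<notin> (X :: 'a set)"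
  obtain a where a: "a \<in> GF X" "P X (a c) (g ` X) (g (a c))" using displacesD[OF assms(1) X] .
  then show "\<exists>a\<in>GF X. Q X (a c) (g ` X) (g (a c))"
    using assms(3)[OF X(1) GF_notin[OF a(1) X(2)]] by blast
qed

lemma displaces_iv:
  assumes P: "symmetric_displacement P" and g: "g \<in> G" "displaces P g"
  shows "displaces P (iv g)"
  unfolding displaces_def
proof (intro allI impI)
  fix X c assume X: "finite X" "c \<notin> (X :: 'a set)"
  have "finite (iv g ` X)" "iv g c \<notin> iv g ` X" using X G_in_img[OF G_iv[OF g(1)]] by auto
  then obtain a where a: "a \<in> GF (iv g ` X)"
    "P (iv g ` X) (a (iv g c)) (g ` iv g ` X) (g (a (iv g c)))" using displacesD[OF g(2)] by metis
  define b where "b = g \<circ> a \<circ> iv g"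
  have "b \<in> G" using GF_G[OF a(1)] g(1) by (simp add: b_def G_comp G_iv)
  moreover have "b u = u" if "u \<in> X" for u
    using GF_fix[OF a(1) imageI[OF that]] g(1) by (simp add: b_def)
  ultimately have b: "b \<in> GF X" by (simp add: GF_def)
  have "P (g ` iv g ` X) (g (a (iv g c))) (iv g ` X) (a (iv g c))"
    by (rule displacement_sym[OF P, OF g(1), OF a(2)])
  then have "P X (g (a (iv g c))) (iv g ` X) (a (iv g c))"
    unfolding G_iv_img2[OF g(1)] .
  then have "P X (b c) (iv g ` X) (iv g (b c))" by (simp only: b_def o_apply G_iv1[OF g(1)])
  with b show "\<exists>a\<in>GF X. P X (a c) (iv g ` X) (iv g (a c))" by (intro bexI[of _ b])
qed

lemma displacement_ind2: "displacement (\<lambda>X x Y y. ind2 ind {x} X Y {y})"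
  unfolding displacement_def
proof (intro conjI ballI allI impI)
  fix f X x Y y assume "f \<in> G" "ind2 ind {x} X Y {y}"
  then show "ind2 ind {f x} (f ` X) (f ` Y) {f y}" using ind2_G[of f "{x}" X Y "{y}"] by simp
next
  fix g X x C assume "g \<in> G" "ind {x} X C" "ind2 ind {x} (X \<union> C) (g ` (X \<union> C)) {g x}"
  then show "ind2 ind {x} X (g ` X) {g x}" using ind2_base[of "{x}" X C g] G_Aut by simp
qed

lemma symmetric_displacement_ind2: "symmetric_displacement (\<lambda>X x Y y. ind2 ind {x} X Y {y})"
  by (auto simp: symmetric_displacement_def ind2_def intro: ind_sym)

text \<open>Displacements add up along \<open>p x\<close>, \<open>x\<close>, \<open>q x\<close> when \<open>q x\<close> is independent from \<open>p x\<close> over everything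
  in between: the bound \<open>P\<close> for both steps gives the bound \<open>Q\<close> for the composition.\<close>

definition composes :: "('a set \<Rightarrow> 'a \<Rightarrow> 'a set \<Rightarrow> 'a \<Rightarrow> bool) \<Rightarrow> ('a set \<Rightarrow> 'a \<Rightarrow> 'a set \<Rightarrow> 'a \<Rightarrow> bool) \<Rightarrow> bool" where
  "composes P Q \<longleftrightarrow>
     (\<forall>A X x p q. finite A \<longrightarrow> p \<in> G \<longrightarrow> q \<in> G \<longrightarrow> X \<subseteq> A \<longrightarrow> p ` X \<subseteq> A \<longrightarrow> q ` X \<subseteq> A \<longrightarrow> x \<notin> A \<longrightarrow>
        ind {x} X A \<longrightarrow> ind {p x} (p ` X) A \<longrightarrow> ind {q x} (q ` X) A \<longrightarrow> ind {q x} (insert x A) {p x} \<longrightarrow>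
        P X x (p ` X) (p x) \<longrightarrow> P X x (q ` X) (q x) \<longrightarrow> Q (p ` X) (p x) (q ` X) (q x))"

lemma composesD:
  assumes "composes P Q" "finite A" "p \<in> G" "q \<in> G" "X \<subseteq> A" "p ` X \<subseteq> A" "q ` X \<subseteq> A" "x \<notin> A"
    "ind {x} X A" "ind {p x} (p ` X) A" "ind {q x} (q ` X) A" "ind {q x} (insert x A) {p x}"
    "P X x (p ` X) (p x)" "P X x (q ` X) (q x)"
  shows "Q (p ` X) (p x) (q ` X) (q x)"
  using assms unfolding composes_def by (elim allE impE) assumption+

fun oriented :: "bool option \<Rightarrow> 'a \<Rightarrow> 'a \<Rightarrow> bool" where
  "oriented None x y = True"
| "oriented (Some True) x y = E x y"
| "oriented (Some False) x y = E y x"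

lemma oriented_G: "f \<in> G \<Longrightarrow> oriented r (f x) (f y) \<longleftrightarrow> oriented r x y"
  by (cases "(r, x, y)" rule: oriented.cases) (simp_all add: G_E)

text \<open>Prescribing a direction needs two distinct points, and in an order it would conflict with the parameters.\<close>

definition orientable :: "('a set \<Rightarrow> 'a \<Rightarrow> 'a set \<Rightarrow> 'a \<Rightarrow> bool) \<Rightarrow> bool option \<Rightarrow> bool" where
  "orientable P r \<longleftrightarrow> r = None \<or> \<not> ord \<and> (\<forall>X x Y y. x \<notin> X \<longrightarrow> P X x Y y \<longrightarrow> x \<noteq> y)"

lemma move_point_oriented:
  assumes X: "finite X" "finite A" "c \<notin> X" and v: "v \<notin> X" and r: "r = None \<or> \<not> ord"
  obtains a where "a \<in> GF X" "ind {a c} X A" "oriented r v (a c)"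
proof (cases "(r, v, c)" rule: oriented.cases)
  case (1 x y)
  then show ?thesis using move_point_generic[OF X] that by (metis oriented.simps(1) prod.inject)
next
  case (2 x y)
  have "cut E ord ({v} \<union> {u \<in> X. E u c}) ({} \<union> {u \<in> X. E c u})"
    using r 2 v E_asym by (auto simp: cut_def)
  then obtain a where "a \<in> GF X" "ind {a c} X A" "\<And>l. l \<in> {v} \<Longrightarrow> E l (a c)"
    using move_point[OF X, of "{v}" "{}"] by auto
  then show ?thesis using that[of a] 2 by simp
next
  case (3 x y)
  have "cut E ord ({} \<union> {u \<in> X. E u c}) ({v} \<union> {u \<in> X. E c u})"
    using r 3 v E_asym by (auto simp: cut_def)
  then obtain a where "a \<in> GF X" "ind {a c} X A" "\<And>l. l \<in> {v} \<Longrightarrow> E (a c) l"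
    using move_point[OF X, of "{}" "{v}"] by auto
  then show ?thesis using that[of a] 3 by simp
qed

text \<open>The heart of the construction of \<open>k\<close> with \<open>f\<inverse> h\<^sup>k\<close> moving far. A finite part \<open>\<tau> | A\<close> of \<open>k\<close> is
  extended to a realization \<open>x\<close> of the given type, with \<open>y = \<tau>' x\<close> a realization of the image type, both moved
  far, and then to the preimage \<open>z\<close> of \<open>h y\<close>, chosen independent from \<open>f x\<close>. So \<open>f x\<close> and \<open>z = h\<^sup>k x\<close> are
  related only through \<open>x\<close> and \<open>A\<close>. The sets \<open>N1\<close>, \<open>N2\<close>, \<open>C\<close> are to be avoided by the new points.\<close>

lemma displace_extend:
  assumes fh: "f \<in> G" "h \<in> G" "\<tau> \<in> G" and A: "finite A" "X \<subseteq> A" "f ` X \<subseteq> A" "(iv \<tau> \<circ> h \<circ> \<tau>) ` X \<subseteq> A"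
    and c: "c \<notin> X" and P: "displacement P" "displaces P f" "displaces P h" and PQ: "composes P Q"
    and fin: "finite N1" "finite N2" "\<And>x. finite (C x)" and r: "orientable P r"
  obtains \<tau>' a where "\<tau>' \<in> G" "\<And>u. u \<in> A \<Longrightarrow> \<tau>' u = \<tau> u" "a \<in> GF X"
    "a c \<notin> A \<union> N1" "f (a c) \<notin> A" "\<tau>' (a c) \<notin> N2" "P X (a c) (f ` X) (f (a c))"
    "P (\<tau> ` X) (\<tau>' (a c)) (h ` \<tau> ` X) (h (\<tau>' (a c)))" "h (\<tau>' (a c)) \<notin> \<tau> ` A"
    "iv \<tau>' (h (\<tau>' (a c))) \<noteq> a c \<Longrightarrow> iv \<tau>' (h (\<tau>' (a c))) \<notin> A \<union> insert (a c) (C (a c))"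
    "Q (f ` X) (f (a c)) ((iv \<tau> \<circ> h \<circ> \<tau>) ` X) (iv \<tau>' (h (\<tau>' (a c))))"
    "oriented r (f (a c)) (iv \<tau>' (h (\<tau>' (a c))))"
proof -
  let ?B = "\<tau> ` A" and ?Y = "\<tau> ` X" and ?W = "(iv \<tau> \<circ> h \<circ> \<tau>) ` X"
  have finX: "finite X" using A finite_subset by blast
  note [simp] = fh G_iv
  have hY: "h ` ?Y \<subseteq> ?B"
  proof -
    have "\<tau> ` ?W \<subseteq> ?B" using A(4) by (rule image_mono)
    moreover have "\<tau> ` ?W = h ` ?Y" by (simp add: image_image)
    ultimately show ?thesis by simp
  qed
  \<comment> \<open>the point \<open>x\<close>\<close>
  obtain a where a: "a \<in> GF X" "ind {a c} X (A \<union> iv f ` A \<union> N1)" "P X (a c) (f ` X) (f (a c))"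
    using displaces_generic[OF P(1) fh(1) P(2) finX _ c, of "A \<union> iv f ` A \<union> N1"] A(1) fin(1) by auto
  define x where "x = a c"
  have xX: "x \<notin> X" using GF_notin[OF a(1) c] by (simp add: x_def)
  then have x: "x \<notin> A" "x \<notin> iv f ` A" "x \<notin> N1" using ind_disjoint[OF a(2)] by (auto simp: x_def)
  have fx: "f x \<notin> A"
  proof
    assume "f x \<in> A"
    then have "iv f (f x) \<in> iv f ` A" by (rule imageI)
    then show False using x by simp
  qed
  have ixA: "ind {x} X A" by (rule ind_mono_right[OF a(2)[folded x_def]]) auto
  have ifx: "ind {f x} (f ` X) A"
  proof -
    have "ind {x} X (iv f ` A)" by (rule ind_mono_right[OF a(2)[folded x_def]]) auto
    then have "ind (f ` {x}) (f ` X) (f ` iv f ` A)" by (simp only: ind_G fh)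
    then show ?thesis by simp
  qed
  \<comment> \<open>its image \<open>y\<close>\<close>
  have txB: "\<tau> x \<notin> ?B" using x by (simp add: G_in_img)
  obtain b where b: "b \<in> GF ?B" "ind {b (\<tau> x)} ?B (iv h ` ?B \<union> N2)"
    "P ?B (b (\<tau> x)) (h ` ?B) (h (b (\<tau> x)))"
    using displaces_generic[OF P(1) fh(2) P(3) _ _ txB, of "iv h ` ?B \<union> N2"] A(1) fin(2) by auto
  define y where "y = b (\<tau> x)"
  have bG: "b \<in> G" using GF_G[OF b(1)] .
  have iyB: "ind {y} ?Y ?B"
  proof -
    have "ind (\<tau> ` {x}) (\<tau> ` X) (\<tau> ` A)" using ixA by (simp only: ind_G fh)
    then have "ind (b ` \<tau> ` {x}) (b ` \<tau> ` X) (b ` \<tau> ` A)" by (simp only: ind_G bG)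
    then show ?thesis using GF_img[OF b(1), of "\<tau> ` X"] GF_img[OF b(1), of ?B] A(2)
      by (simp add: y_def image_mono)
  qed
  have yB: "y \<notin> ?B" using GF_notin[OF b(1) txB] by (simp add: y_def)
  then have y: "y \<notin> iv h ` ?B" "y \<notin> N2" using ind_disjoint[OF b(2)] by (auto simp: y_def)
  have YB: "?Y \<union> ?B = ?B" using A(2) by auto
  have iy: "ind {y} ?Y (iv h ` ?B)"
  proof -
    have "ind {y} (?Y \<union> ?B) (iv h ` ?B \<union> N2)" using b(2) YB by (simp add: y_def)
    then have "ind {y} ?Y (?B \<union> (iv h ` ?B \<union> N2))" by (rule ind_trans_right[OF iyB])
    then show ?thesis by (rule ind_mono_right) auto
  qed
  have Py: "P ?Y y (h ` ?Y) (h y)"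
    by (rule displacement_base[OF P(1) fh(2) _ _ iyB]) (use finX A(1) YB b(3) in \<open>simp_all add: y_def\<close>)
  define \<tau>1 where "\<tau>1 = b \<circ> \<tau>"
  have t1: "\<tau>1 \<in> G" "\<tau>1 x = y" by (simp_all add: \<tau>1_def G_comp bG y_def)
  have t1A: "\<tau>1 u = \<tau> u" if "u \<in> A" for u using GF_fix[OF b(1)] that by (simp add: \<tau>1_def)
  \<comment> \<open>the preimage \<open>z\<close> of \<open>v = h y\<close>\<close>
  define v where "v = h y"
  have iv: "ind {v} (h ` ?Y) ?B"
  proof -
    have "ind (h ` {y}) (h ` ?Y) (h ` iv h ` ?B)" using iy by (simp only: ind_G fh)
    then show ?thesis by (simp add: v_def)
  qed
  have vB: "v \<notin> ?B"
  proof
    assume "v \<in> ?B"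
    then have "iv h v \<in> iv h ` ?B" by (rule imageI)
    then show False using y by (simp add: v_def)
  qed
  obtain d where d: "d \<in> GF (insert x A)" "ind {d (iv \<tau>1 v)} (insert x A) {f x}"
    "oriented r (f x) (d (iv \<tau>1 v))" "d (iv \<tau>1 v) \<noteq> x \<Longrightarrow> d (iv \<tau>1 v) \<notin> insert x A \<union> C x"
  proof (cases "v = y")
    case True
    then have e: "iv \<tau>1 v = x" using t1 by (simp add: G_iv_eq)
    have "r = None"
    proof (rule ccontr)
      assume "r \<noteq> None"
      then have "\<forall>X x Y y. x \<notin> X \<longrightarrow> P X x Y y \<longrightarrow> x \<noteq> y" using r by (auto simp: orientable_def)
      moreover have "y \<notin> ?Y" using yB YB by blast
      ultimately show False using Py True by (auto simp: v_def)
    qed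
    then show ?thesis using that[of id] e by (simp add: ind_base)
  next
    case False
    have z1: "iv \<tau>1 v \<notin> insert x A"
    proof
      assume "iv \<tau>1 v \<in> insert x A"
      then have "\<tau>1 (iv \<tau>1 v) = y \<or> \<tau>1 (iv \<tau>1 v) \<in> ?B" using t1(2) t1A by force
      then show False using t1(1) vB False by simp
    qed
    have finI: "finite (insert x A)" "finite (insert (f x) (C x))" using A(1) fin(3) by auto
    have ex: "\<exists>d\<in>GF (insert x A). ind {d (iv \<tau>1 v)} (insert x A) (insert (f x) (C x)) \<and>
        oriented r (f x) (d (iv \<tau>1 v))"
    proof (cases "r = None")
      case True
      then show ?thesis using move_point_generic[OF finI z1] by (metis oriented.simps(1))
    next
      case False
      then have "\<not> ord" "\<forall>X x Y y. x \<notin> X \<longrightarrow> P X x Y y \<longrightarrow> x \<noteq> y" using r by (auto simp: orientable_def)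
      moreover from this(2) have "f x \<noteq> x" using a(3) xX by (metis x_def)
      ultimately have no: "\<not> ord" "f x \<notin> insert x A" using fx by auto
      obtain d where "d \<in> GF (insert x A)" "ind {d (iv \<tau>1 v)} (insert x A) (insert (f x) (C x))"
        "oriented r (f x) (d (iv \<tau>1 v))"
        by (rule move_point_oriented[OF finI z1 no(2), of r]) (use no in auto)
      then show ?thesis by (intro bexI[of _ d]) auto
    qed
    then obtain d where d: "d \<in> GF (insert x A)" "ind {d (iv \<tau>1 v)} (insert x A) (insert (f x) (C x))"
      "oriented r (f x) (d (iv \<tau>1 v))" by blast
    have "d (iv \<tau>1 v) \<notin> insert x A" by (rule GF_notin[OF d(1) z1])
    then have "d (iv \<tau>1 v) \<notin> insert x A \<union> C x" using ind_disjoint[OF d(2)] by auto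
    moreover have "ind {d (iv \<tau>1 v)} (insert x A) {f x}" by (rule ind_mono_right[OF d(2)]) auto
    ultimately show ?thesis using that d by blast
  qed
  define z where "z = d (iv \<tau>1 v)"
  define \<tau>' where "\<tau>' = \<tau>1 \<circ> iv d"
  have dG: "d \<in> G" using GF_G[OF d(1)] .
  have idx: "iv d u = u" if "u \<in> insert x A" for u using GF_fix[OF d(1) that] dG by (simp add: G_iv_eq)
  have t': "\<tau>' \<in> G" using t1(1) dG by (simp add: \<tau>'_def G_comp G_iv)
  have t'x: "\<tau>' x = y" using idx[of x] t1(2) by (simp add: \<tau>'_def)
  have t'A: "\<tau>' u = \<tau> u" if "u \<in> A" for u using idx[of u] t1A that by (simp add: \<tau>'_def)
  have t'z: "\<tau>' z = v" using dG t1(1) by (simp add: \<tau>'_def z_def)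
  have zz: "iv \<tau>' (h (\<tau>' x)) = z" using t' t'x t'z by (simp add: G_iv_eq v_def)
  have zz': "iv \<tau>' (h y) = z" using zz t'x by simp
  define q where "q = iv \<tau>' \<circ> h \<circ> \<tau>'"
  have q: "q \<in> G" using t' by (simp add: q_def G_comp)
  have qx: "q x = z" using zz by (simp add: q_def)
  have t'W: "\<tau>' ` ?W = h ` ?Y"
  proof -
    have "\<tau>' ` ?W = \<tau> ` ?W" using t'A A(4) by (intro image_cong) auto
    also have "\<dots> = h ` ?Y" by (simp add: image_image)
    finally show ?thesis .
  qed
  have t'X: "\<tau>' ` X = ?Y" using t'A A(2) by (intro image_cong) auto
  have qX: "q ` X = ?W"
  proof -
    have "\<tau>' ` (q ` X) = h ` \<tau>' ` X" using t' by (simp add: q_def image_image)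
    also have "\<dots> = \<tau>' ` ?W" by (simp only: t'X t'W)
    finally have "\<tau>' ` (q ` X) = \<tau>' ` ?W" .
    then have "iv \<tau>' ` \<tau>' ` (q ` X) = iv \<tau>' ` \<tau>' ` ?W" by simp
    then show ?thesis using t' by simp
  qed
  have "Q (f ` X) (f x) (q ` X) (q x)"
  proof (rule composesD[OF PQ A(1) fh(1) q A(2,3) _ x(1) ixA ifx])
    show "q ` X \<subseteq> A" using qX A(4) by simp
    show "ind {q x} (q ` X) A"
    proof -
      have "\<tau>' ` A = ?B" using t'A by (intro image_cong) auto
      then have "ind (\<tau>' ` {z}) (\<tau>' ` ?W) (\<tau>' ` A)" using iv t'W t'z by simp
      then show ?thesis using qX qx by (simp only: ind_G t')
    qed
    show "ind {q x} (insert x A) {f x}" using d(2) by (simp add: qx z_def)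
    show "P X x (f ` X) (f x)" using a(3) by (simp add: x_def)
    have "P (iv \<tau>' ` ?Y) (iv \<tau>' y) (iv \<tau>' ` h ` ?Y) (iv \<tau>' (h y))"
      by (rule displacement_G[OF P(1), OF _ Py]) (simp add: t')
    moreover have "iv \<tau>' ` ?Y = X" using t'X t' by (metis G_iv_img1)
    moreover have "iv \<tau>' y = x" using t'x t' by (simp add: G_iv_eq)
    moreover have "iv \<tau>' ` h ` ?Y = q ` X" using t'W t' qX by (metis G_iv_img1)
    moreover have "iv \<tau>' (h y) = q x" using zz qx t'x by simp
    ultimately show "P X x (q ` X) (q x)" by simp
  qed
  then have Q: "Q (f ` X) (f x) ?W z" using qX qx by simp
  show ?thesis
  proof (rule that[of \<tau>' a])
    show "\<tau>' u = \<tau> u" if "u \<in> A" for u by (rule t'A[OF that])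
  qed (use t' a x fx y vB[unfolded v_def] Py Q d(3,4)[folded z_def] t'x zz' in
      \<open>simp_all add: x_def[symmetric]\<close>)
qed

end

context expansion
begin

text \<open>The requirements on a generic automorphism are indexed by types and directions; there are countably many.\<close>

lemma enumerate_types:
  obtains e :: "nat \<Rightarrow> 'a set \<times> 'a \<times> bool option"
  where "\<And>X c r. finite X \<Longrightarrow> \<exists>n. e n = (X, c, r)"
proof -
  let ?S = "{X :: 'a set. finite X} \<times> (UNIV :: 'a set) \<times> (UNIV :: bool option set)"
  have "countable {X :: 'a set. finite X}"
    using countable_Collect_finite_subset[OF countable_M] by simp
  then have c: "countable ?S" by (intro countable_SIGMA countable_M) (auto intro: countable_finite)
  have "\<exists>n. from_nat_into ?S n = (X, c, r)" if "finite X" for X c r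
    by (rule from_nat_into_surj[OF c]) (use that in simp)
  then show ?thesis using that by blast
qed

text \<open>What is required of the finite part \<open>\<tau> | A\<close> of \<open>k\<close> in order that every \<open>k\<close> extending it satisfies
  the displacement condition for the given type.\<close>

definition displaced_in ::
    "('a set \<Rightarrow> 'a \<Rightarrow> 'a set \<Rightarrow> 'a \<Rightarrow> bool) \<Rightarrow> ('a \<Rightarrow> 'a) \<Rightarrow> ('a \<Rightarrow> 'a) \<Rightarrow> 'a set \<Rightarrow> 'a \<Rightarrow> bool option \<Rightarrow>
      ('a \<Rightarrow> 'a) \<Rightarrow> 'a set \<Rightarrow> bool" where
  "displaced_in Q f h X c r \<tau> A \<longleftrightarrow>
     (\<exists>a\<in>GF X. \<exists>z\<in>A. \<exists>X'. X' \<subseteq> A \<and> X \<subseteq> A \<and> a c \<in> A \<and> \<tau> z = h (\<tau> (a c)) \<and> \<tau> ` X' = h ` \<tau> ` X \<and>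
        Q (f ` X) (f (a c)) X' z \<and> oriented r (f (a c)) z)"

lemma displaced_in_limit:
  assumes fhk: "f \<in> G" "h \<in> G" "k \<in> G" and Q: "displacement Q"
    and d: "displaced_in Q f h X c r \<tau> A" and agree: "\<And>u. u \<in> A \<Longrightarrow> k u = \<tau> u"
  defines "g \<equiv> iv f \<circ> iv k \<circ> h \<circ> k"
  shows "\<exists>a\<in>GF X. Q X (a c) (g ` X) (g (a c)) \<and> oriented r (a c) (g (a c))"
proof -
  obtain a z X' where a: "a \<in> GF X" "z \<in> A" "X' \<subseteq> A" "X \<subseteq> A" "a c \<in> A" "\<tau> z = h (\<tau> (a c))"
    "\<tau> ` X' = h ` \<tau> ` X" "Q (f ` X) (f (a c)) X' z" "oriented r (f (a c)) z"
    using d unfolding displaced_in_def by (elim bexE exE conjE) (rule that, assumption+)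
  have "k z = h (k (a c))" using agree a(2,5,6) by simp
  then have kz: "iv k (h (k (a c))) = z" using fhk by (simp add: G_iv_eq)
  have "k ` X' = \<tau> ` X'" "k ` X = \<tau> ` X" using agree a(3,4) by (auto intro!: image_cong)
  then have "k ` X' = h ` k ` X" using a(7) by simp
  then have kX: "iv k ` h ` k ` X = X'" using fhk by (metis G_iv_img1)
  have g: "g (a c) = iv f z" "g ` X = iv f ` X'"
    unfolding kX[symmetric] kz[symmetric] by (simp_all add: g_def image_image)
  have "Q (iv f ` f ` X) (iv f (f (a c))) (iv f ` X') (iv f z)"
    by (rule displacement_G[OF Q, OF _ a(8)]) (simp add: G_iv fhk)
  moreover have "oriented r (iv f (f (a c))) (iv f z)"
    using a(9) by (simp only: oriented_G[OF G_iv[OF fhk(1)]])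
  ultimately have "Q X (a c) (iv f ` X') (iv f z) \<and> oriented r (a c) (iv f z)"
    by (simp only: G_iv_img1[OF fhk(1)] G_iv1[OF fhk(1)] simp_thms)
  then show ?thesis using a(1) by (intro bexI[of _ a]) (simp only: g)
qed

text \<open>Composing \<open>f\<inverse>\<close> with a generic conjugate of \<open>h\<close> adds up their displacements. In the tournament case
  the arrow between a point and its image can moreover be prescribed for each type.\<close>

lemma displacement_step:
  assumes fh: "f \<in> G" "h \<in> G" and P: "displacement P" "displaces P f" "displaces P h"
    and Q: "displacement Q" "composes P Q" and R: "\<And>r. r \<in> R \<Longrightarrow> orientable P r"
  obtains k where "k \<in> G"
    "\<And>r. r \<in> R \<Longrightarrow> displaces (\<lambda>X x Y y. Q X x Y y \<and> oriented r x y) (iv f \<circ> iv k \<circ> h \<circ> k)"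
proof -
  obtain e :: "nat \<Rightarrow> 'a set \<times> 'a \<times> bool option" where e: "\<And>X c r. finite X \<Longrightarrow> \<exists>n. e n = (X, c, r)"
    by (rule enumerate_types, rule that, assumption)
  define D where "D n \<tau> A \<longleftrightarrow> (case e n of (X, c, r) \<Rightarrow>
      finite X \<longrightarrow> c \<notin> X \<longrightarrow> r \<in> R \<longrightarrow> displaced_in Q f h X c r \<tau> A)" for n \<tau> A
  note [simp] = fh G_iv
  obtain k where k: "k \<in> G"
    "\<And>n. \<exists>\<tau> A. \<tau> \<in> G \<and> finite A \<and> True \<and> (\<forall>a\<in>A. k a = \<tau> a) \<and> D n \<tau> A"
  proof (rule generic_automorphism[of id "{}" "\<lambda>_ _. True" D])
    fix \<tau> A n assume t: "\<tau> \<in> G" "finite (A :: 'a set)"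
    obtain X c r where en: "e n = (X, c, r)" by (cases "e n")
    show "\<exists>\<tau>' A'. \<tau>' \<in> G \<and> finite A' \<and> A \<subseteq> A' \<and> (\<forall>a\<in>A. \<tau>' a = \<tau> a) \<and> True \<and> D n \<tau>' A'"
    proof (cases "finite X \<and> c \<notin> X \<and> r \<in> R")
      case False
      then have "D n \<tau> A" by (auto simp: D_def en)
      then show ?thesis using t by (intro exI[of _ \<tau>] exI[of _ A]) simp
    next
      case True
      define X' where "X' = (iv \<tau> \<circ> h \<circ> \<tau>) ` X"
      define B where "B = A \<union> X \<union> f ` X \<union> X'"
      have B: "finite B" "X \<subseteq> B" "f ` X \<subseteq> B" "(iv \<tau> \<circ> h \<circ> \<tau>) ` X \<subseteq> B"
        using t True by (auto simp: B_def X'_def)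
      obtain \<tau>' a where a: "\<tau>' \<in> G" "\<And>u. u \<in> B \<Longrightarrow> \<tau>' u = \<tau> u" "a \<in> GF X"
        "Q (f ` X) (f (a c)) ((iv \<tau> \<circ> h \<circ> \<tau>) ` X) (iv \<tau>' (h (\<tau>' (a c))))"
        "oriented r (f (a c)) (iv \<tau>' (h (\<tau>' (a c))))"
        by (rule displace_extend[OF fh t(1) B _ P Q(2), of c "{}" "{}" "\<lambda>_. {}" r]) (use True R in auto)
      define z where "z = iv \<tau>' (h (\<tau>' (a c)))"
      have "\<tau>' ` X' = \<tau> ` X'" "\<tau>' ` X = \<tau> ` X" using a(2) by (auto intro!: image_cong simp: B_def)
      moreover have "\<tau> ` X' = h ` \<tau> ` X" using t by (simp add: X'_def image_image)
      ultimately have "\<tau>' ` X' = h ` \<tau>' ` X" by simp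
      moreover have "\<tau>' z = h (\<tau>' (a c))" using a(1) by (simp add: z_def)
      moreover have "X' \<subseteq> insert (a c) (insert z B)" "X \<subseteq> insert (a c) (insert z B)" by (auto simp: B_def)
      ultimately have "displaced_in Q f h X c r \<tau>' (insert (a c) (insert z B))"
        unfolding displaced_in_def using a(3,4,5)
        by (intro bexI[of _ a] bexI[of _ z] exI[of _ X'] conjI) (simp_all add: z_def X'_def)
      then have "D n \<tau>' (insert (a c) (insert z B))" by (simp add: D_def en)
      moreover have "A \<subseteq> B" by (auto simp: B_def)
      ultimately show ?thesis
        using a(1,2) B(1) by (intro exI[of _ \<tau>'] exI[of _ "insert (a c) (insert z B)"]) auto
    qed
  next
    fix \<tau> A x assume "\<tau> \<in> G" "finite (A :: 'a set)"
    then show "\<exists>\<tau>' A'. \<tau>' \<in> G \<and> finite A' \<and> A \<subseteq> A' \<and> (\<forall>a\<in>A. \<tau>' a = \<tau> a) \<and> True \<and> x \<in> A'"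
      by (intro exI[of _ \<tau>] exI[of _ "insert x A"]) auto
  next
    fix \<tau> A y assume "\<tau> \<in> G" "finite (A :: 'a set)"
    then show "\<exists>\<tau>' A'. \<tau>' \<in> G \<and> finite A' \<and> A \<subseteq> A' \<and> (\<forall>a\<in>A. \<tau>' a = \<tau> a) \<and> True \<and> y \<in> \<tau>' ` A'"
      by (intro exI[of _ \<tau>] exI[of _ "insert (iv \<tau> y) A"]) auto
  qed (use that in auto)
  show ?thesis
  proof (rule that[OF k(1)])
    fix r assume r: "r \<in> R"
    show "displaces (\<lambda>X x Y y. Q X x Y y \<and> oriented r x y) (iv f \<circ> iv k \<circ> h \<circ> k)"
      unfolding displaces_def
    proof (intro allI impI)
      fix X c assume X: "finite X" "c \<notin> (X :: 'a set)"
      obtain n where n: "e n = (X, c, r)" using e X by blast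
      obtain \<tau> A where "\<forall>a\<in>A. k a = \<tau> a" "D n \<tau> A" using k(2)[of n] by blast
      then have "\<And>u. u \<in> A \<Longrightarrow> k u = \<tau> u" "displaced_in Q f h X c r \<tau> A"
        using X r by (simp_all add: D_def n)
      then show "\<exists>a\<in>GF X. Q X (a c) ((iv f \<circ> iv k \<circ> h \<circ> k) ` X) ((iv f \<circ> iv k \<circ> h \<circ> k) (a c)) \<and>
          oriented r (a c) ((iv f \<circ> iv k \<circ> h \<circ> k) (a c))"
        using displaced_in_limit[OF fh k(1) Q(1)] by metis
    qed
  qed
qed

section \<open>Making a tournament automorphism follow the arrows\<close>

text \<open>Conditions on a finite part \<open>\<tau> | A\<close> of \<open>k\<close> that keep \<open>h x \<rightarrow> h\<^sup>k x\<close> possible for all \<open>x\<close>. The first two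
  are this requirement where both sides are decided, once read in the domain and once in the range of \<open>k\<close>;
  the last excludes that a new point gets contradictory demands from its two neighbours.\<close>

definition follows :: "('a \<Rightarrow> 'a) \<Rightarrow> ('a \<Rightarrow> 'a) \<Rightarrow> 'a set \<Rightarrow> bool" where
  "follows h \<tau> A \<longleftrightarrow>
     (\<forall>s\<in>A. h s \<in> A \<longrightarrow> E (\<tau> (h s)) (h (\<tau> s))) \<and>
     (\<forall>s\<in>A. \<forall>t\<in>A. \<tau> t = h (\<tau> s) \<longrightarrow> E (h s) t) \<and>
     (\<forall>s\<in>A. h (h s) \<in> A \<longrightarrow> \<tau> (h (h s)) \<noteq> h (h (\<tau> s)))"

text \<open>The points at orbit distance one or two, which are those that the conditions of \<open>follows\<close> relate.\<close>

definition near :: "('a \<Rightarrow> 'a) \<Rightarrow> 'a set \<Rightarrow> 'a set" where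
  "near h S = h ` S \<union> iv h ` S \<union> h ` h ` S \<union> iv h ` iv h ` S"

lemma near_iff:
  assumes "h \<in> G"
  shows "u \<notin> near h S \<longleftrightarrow> (\<forall>s\<in>S. u \<noteq> h s \<and> h u \<noteq> s \<and> u \<noteq> h (h s) \<and> h (h u) \<noteq> s)"
proof -
  have "u \<in> iv h ` T \<longleftrightarrow> h u \<in> T" for u T
    using G_in_img'[OF G_iv[OF assms], of u T] assms by simp
  then show ?thesis unfolding near_def by auto
qed

lemma finite_near: "finite S \<Longrightarrow> finite (near h S)" by (simp add: near_def)

lemma follows_cong: "(\<And>a. a \<in> A \<Longrightarrow> \<tau>' a = \<tau> a) \<Longrightarrow> follows h \<tau>' A = follows h \<tau> A"
  unfolding follows_def by simp

text \<open>The image of \<open>x\<close> must have an arrow from \<open>h\<inverse> (\<tau> (h x))\<close> and an arrow to \<open>h (\<tau> (h\<inverse> x))\<close>, as far as these are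
decided. The three conditions on \<open>\<tau>\<close> make these demands compatible with each other and with the arrows between the
image and the other decided points. Finally the image \<open>y\<close> is chosen with \<open>y \<rightarrow> h y\<close>, so that it differs from \<open>h y\<close> and
\<open>h (h y)\<close>.\<close>

lemma follows_insert:
  assumes no: "\<not> ord" and h: "h \<in> G" "displaces (\<lambda>X x Y y. E x y) h"
    and t: "\<tau> \<in> G" "finite A" "follows h \<tau> A"
  shows "\<exists>\<tau>'\<in>G. (\<forall>a\<in>A. \<tau>' a = \<tau> a) \<and> follows h \<tau>' (insert x A)"
proof (cases "x \<in> A")
  case True
  then show ?thesis using t by (intro bexI[of _ \<tau>]) (auto simp: insert_absorb)
next
  case x: False
  let ?B = "\<tau> ` A"
  note f1 = t(3)[unfolded follows_def, THEN conjunct1, rule_format]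
  note f2 = t(3)[unfolded follows_def, THEN conjunct2, THEN conjunct1, rule_format]
  note f3 = t(3)[unfolded follows_def, THEN conjunct2, THEN conjunct2, rule_format]
  \<comment> \<open>the demands on the image of \<open>x\<close> that come from \<open>h x\<close> and from \<open>h\<inverse> x\<close>\<close>
  define L where "L = {iv h (\<tau> (h x)) |_ :: unit. h x \<in> A}"
  define U where "U = {h (\<tau> s) |s. s \<in> A \<and> x = h s}"
  have LU: "finite L" "finite U" using t(2) by (auto simp: L_def U_def)
  have xB: "\<tau> x \<notin> ?B" using x t(1) by (simp add: G_in_img)
  have cut: "cut E ord (L \<union> {u \<in> ?B. E u (\<tau> x)}) (U \<union> {u \<in> ?B. E (\<tau> x) u})"
    unfolding cut_def
  proof (intro ballI conjI)
    fix l u assume l: "l \<in> L \<union> {u \<in> ?B. E u (\<tau> x)}" and u: "u \<in> U \<union> {u \<in> ?B. E (\<tau> x) u}"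
    have l': "h l = \<tau> (h x) \<and> h x \<in> A" if "l \<in> L" using that h(1) by (auto simp: L_def)
    have u': "\<exists>s\<in>A. u = h (\<tau> s) \<and> x = h s" if "u \<in> U" using that by (auto simp: U_def)
    show "l \<noteq> u"
    proof
      assume lu: "l = u"
      show False
      proof (cases "l \<in> L")
        case True
        note l'' = l'[OF True]
        show False
        proof (cases "u \<in> U")
          case True
          then obtain s where s: "s \<in> A" "u = h (\<tau> s)" "x = h s" using u' by blast
          then show False using f3[of s] l'' lu by simp
        next
          case False
          then obtain q where q: "q \<in> A" "u = \<tau> q" "E (\<tau> x) (\<tau> q)" using u by auto
          then have "E x q" using G_E t(1) by blast
          moreover have "E (h q) (h x)" using f2[of q "h x"] q l'' lu by simp
          then have "E q x" using G_E h(1) by blast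
          ultimately show False using E_asym by blast
        qed
      next
        case False
        then obtain q where q: "q \<in> A" "l = \<tau> q" "E (\<tau> q) (\<tau> x)" using l by auto
        then have qx: "E q x" using G_E t(1) by blast
        show False
        proof (cases "u \<in> U")
          case True
          then obtain s where s: "s \<in> A" "u = h (\<tau> s)" "x = h s" using u' by blast
          then have "E x q" using f2[of s q] q lu by simp
          then show False using qx E_asym by blast
        next
          case False
          then show False using u q lu E_asym by auto
        qed
      qed
    qed
    show "ord \<longrightarrow> E l u" using no by simp
  qed
  define N where "N = near h ?B \<union> L \<union> U"
  have N: "finite N" using t(2) LU by (simp add: N_def finite_near)
  obtain a where a: "a \<in> GF ?B" "ind {a (\<tau> x)} ?B N" "\<And>l. l \<in> L \<Longrightarrow> E l (a (\<tau> x))" "\<And>u. u \<in> U \<Longrightarrow> E (a (\<tau> x)) u"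
    by (rule move_point[OF _ N xB LU cut]) (use t(2) in auto)
  have y1: "a (\<tau> x) \<notin> ?B \<union> N" using GF_notin[OF a(1) xB] ind_disjoint[OF a(2)] by auto
  obtain b where b: "b \<in> GF (?B \<union> N)" "E (b (a (\<tau> x))) (h (b (a (\<tau> x))))"
    using displacesD[OF h(2) _ y1] t(2) N by auto
  define y where "y = b (a (\<tau> x))"
  have y: "y \<notin> ?B" "y \<notin> near h ?B" using GF_notin[OF b(1) y1] by (auto simp: y_def N_def)
  have yh: "E y (h y)" using b(2) by (simp add: y_def)
  have yne: "y \<noteq> h y" "y \<noteq> h (h y)"
    using yh E_irrefl E_asym G_E[OF h(1), of y "h y"] by metis+
  have yL: "E l y" if "l \<in> L" for l
    using a(3)[OF that] GF_fix[OF b(1), of l] that G_E[OF GF_G[OF b(1)], of l "a (\<tau> x)"]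
    by (simp add: y_def N_def)
  have yU: "E y u" if "u \<in> U" for u
    using a(4)[OF that] GF_fix[OF b(1), of u] that G_E[OF GF_G[OF b(1)], of "a (\<tau> x)" u]
    by (simp add: y_def N_def)
  define \<tau>' where "\<tau>' = b \<circ> a \<circ> \<tau>"
  have t': "\<tau>' \<in> G" using GF_G[OF a(1)] GF_G[OF b(1)] t(1) by (simp add: \<tau>'_def G_comp)
  have t'x: "\<tau>' x = y" by (simp add: \<tau>'_def y_def)
  have t'A: "\<tau>' s = \<tau> s" if "s \<in> A" for s
    using GF_fix[OF a(1), of "\<tau> s"] GF_fix[OF b(1), of "\<tau> s"] that by (simp add: \<tau>'_def)
  have nb: "y \<noteq> h (\<tau> s)" "h y \<noteq> \<tau> s" "y \<noteq> h (h (\<tau> s))" "h (h y) \<noteq> \<tau> s" if "s \<in> A" for s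
    using y(2)[unfolded near_iff[OF h(1)]] that by auto
  have "follows h \<tau>' (insert x A)"
    unfolding follows_def
  proof (intro conjI ballI impI)
    fix s assume s: "s \<in> insert x A" "h s \<in> insert x A"
    have 1: "E (\<tau> (h x)) (h y)" if "h x \<in> A"
    proof -
      have "E (iv h (\<tau> (h x))) y" using yL that by (auto simp: L_def)
      then show ?thesis using G_E[OF h(1), of "iv h (\<tau> (h x))" y] h(1) by simp
    qed
    have 2: "E y (h (\<tau> s))" if "s \<in> A" "h s = x" using yU that by (auto simp: U_def)
    show "E (\<tau>' (h s)) (h (\<tau>' s))"
    proof (cases "s = x")
      case True
      then show ?thesis using s(2) 1 yh t'x t'A by (cases "h x = x") auto
    next
      case False
      then show ?thesis using s 2 f1 t'x t'A by (cases "h s = x") auto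
    qed
  next
    fix s t assume s: "s \<in> insert x A" "t \<in> insert x A" "\<tau>' t = h (\<tau>' s)"
    show "E (h s) t"
    proof (cases "s = x")
      case True
      then have ht: "\<tau>' t = h y" using s(3) t'x by simp
      then have "t \<noteq> x" using yne(1) t'x by auto
      then show ?thesis using s(2) ht nb(2)[of t] t'A[of t] by simp
    next
      case False
      then have sA: "s \<in> A" "\<tau>' t = h (\<tau> s)" using s t'A by auto
      then have "t \<noteq> x" using nb(1)[of s] t'x by auto
      then show ?thesis using s(2) sA f2[of s t] t'A[of t] by simp
    qed
  next
    fix s assume s: "s \<in> insert x A" "h (h s) \<in> insert x A"
    show "\<tau>' (h (h s)) \<noteq> h (h (\<tau>' s))"
    proof (cases "s = x")
      case True
      then show ?thesis using s(2) nb(4)[of "h (h x)"] yne(2) t'x t'A[of "h (h x)"]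
        by (cases "h (h x) = x") auto
    next
      case False
      then have sA: "s \<in> A" using s(1) by simp
      then show ?thesis using s(2) nb(3)[of s] f3[of s] t'x t'A[of s] t'A[of "h (h s)"]
        by (cases "h (h s) = x") auto
    qed
  qed
  then show ?thesis using t' t'A by blast
qed

lemma follows_converse:
  assumes "\<tau> \<in> G" "h \<in> G"
  shows "expansion.follows (\<lambda>a b. E b a) h (iv \<tau>) (\<tau> ` A) \<longleftrightarrow> follows h \<tau> A"
proof -
  interpret conv: expansion M ind "\<lambda>a b. E b a" ord by (rule expansion_converse)
  have [simp]: "iv \<tau> (\<tau> s) = s" for s using assms by simp
  have eq: "h (\<tau> s) \<in> \<tau> ` A \<longleftrightarrow> iv \<tau> (h (\<tau> s)) \<in> A" "h (h (\<tau> s)) \<in> \<tau> ` A \<longleftrightarrow> iv \<tau> (h (h (\<tau> s))) \<in> A" for s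
    using G_in_img'[OF assms(1)] by auto
  have "conv.follows h (iv \<tau>) (\<tau> ` A) \<longleftrightarrow>
     (\<forall>s\<in>A. h (\<tau> s) \<in> \<tau> ` A \<longrightarrow> E (h s) (iv \<tau> (h (\<tau> s)))) \<and>
     (\<forall>s\<in>A. \<forall>t\<in>A. t = h s \<longrightarrow> E (\<tau> t) (h (\<tau> s))) \<and>
     (\<forall>s\<in>A. h (h (\<tau> s)) \<in> \<tau> ` A \<longrightarrow> iv \<tau> (h (h (\<tau> s))) \<noteq> h (h s))"
    unfolding conv.follows_def by simp
  also have "(\<forall>s\<in>A. h (\<tau> s) \<in> \<tau> ` A \<longrightarrow> E (h s) (iv \<tau> (h (\<tau> s)))) \<longleftrightarrow>
      (\<forall>s\<in>A. \<forall>t\<in>A. \<tau> t = h (\<tau> s) \<longrightarrow> E (h s) t)"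
    using assms by (auto simp: eq) (metis G_iv1 G_iv2 eq(1))+
  also have "(\<forall>s\<in>A. h (h (\<tau> s)) \<in> \<tau> ` A \<longrightarrow> iv \<tau> (h (h (\<tau> s))) \<noteq> h (h s)) \<longleftrightarrow>
      (\<forall>s\<in>A. h (h s) \<in> A \<longrightarrow> \<tau> (h (h s)) \<noteq> h (h (\<tau> s)))"
    using assms by (metis G_iv1 G_iv2 eq(2))
  finally show ?thesis unfolding follows_def by auto
qed

end

context expansion
begin

text \<open>The previous lemma for \<open>\<tau>\<inverse>\<close> and the reversed arrows.\<close>

lemma follows_insert_range:
  assumes no: "\<not> ord" and h: "h \<in> G" "displaces (\<lambda>X x Y y. E y x) h"
    and t: "\<tau> \<in> G" "finite A" "follows h \<tau> A"
  shows "\<exists>\<tau>'\<in>G. (\<forall>a\<in>A. \<tau>' a = \<tau> a) \<and> follows h \<tau>' (insert (iv \<tau>' y) A)"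
proof -
  interpret conv: expansion M ind "\<lambda>a b. E b a" ord by (rule expansion_converse)
  have G: "conv.G = G" unfolding conv.G_def G_def by blast
  then have GF: "conv.GF = GF" unfolding conv.GF_def GF_def by simp
  have "conv.displaces (\<lambda>X x Y y. E y x) h"
    using h(2) unfolding conv.displaces_def displaces_def GF .
  moreover have "conv.follows h (iv \<tau>) (\<tau> ` A)" using t by (simp add: follows_converse h)
  ultimately obtain \<sigma> where s: "\<sigma> \<in> G" "\<forall>b\<in>\<tau> ` A. \<sigma> b = iv \<tau> b" "conv.follows h \<sigma> (insert y (\<tau> ` A))"
    using conv.follows_insert[of h "iv \<tau>" "\<tau> ` A" y] no h(1) t(1,2) by (auto simp: G G_iv)
  have eq: "iv \<sigma> a = \<tau> a" if "a \<in> A" for a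
    using s(1,2) that t(1) by (simp add: G_iv_eq)
  have im: "\<sigma> ` \<tau> ` A = A" using s(2) t(1) by (simp add: image_image)
  have "insert y (\<tau> ` A) = iv \<sigma> ` insert (\<sigma> y) A"
  proof -
    have "iv \<sigma> ` A = \<tau> ` A" using eq by (intro image_cong) auto
    then show ?thesis using s(1) by simp
  qed
  then have "conv.follows h (iv (iv \<sigma>)) (iv \<sigma> ` insert (\<sigma> y) A)" using s(1,3) by simp
  then have "follows h (iv \<sigma>) (insert (\<sigma> y) A)"
    using follows_converse[OF G_iv[OF s(1)] h(1)] by blast
  then show ?thesis using s(1) eq by (intro bexI[of _ "iv \<sigma>"]) (simp_all add: G_iv)
qed

lemma follows_extend_dom:
  assumes no: "\<not> ord" and h: "h \<in> G" "displaces (\<lambda>X x Y y. E x y) h"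
    and t: "\<tau> \<in> G" "finite A" "follows h \<tau> A" and F: "finite F"
  shows "\<exists>\<tau>'\<in>G. (\<forall>a\<in>A. \<tau>' a = \<tau> a) \<and> follows h \<tau>' (A \<union> F)"
  using F
proof induction
  case empty
  show ?case using t by (intro bexI[of _ \<tau>]) auto
next
  case (insert x F)
  then obtain \<tau>1 where 1: "\<tau>1 \<in> G" "\<forall>a\<in>A. \<tau>1 a = \<tau> a" "follows h \<tau>1 (A \<union> F)" by blast
  have "finite (A \<union> F)" using insert t by simp
  from follows_insert[OF no h 1(1) this 1(3), of x] obtain \<tau>2 where
    2: "\<tau>2 \<in> G" "\<forall>a\<in>A \<union> F. \<tau>2 a = \<tau>1 a" "follows h \<tau>2 (insert x (A \<union> F))" by blast
  show ?case using 1(2) 2 by (intro bexI[of _ \<tau>2]) auto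
qed

lemma follows_extend_ran:
  assumes no: "\<not> ord" and h: "h \<in> G" "displaces (\<lambda>X x Y y. E y x) h"
    and t: "\<tau> \<in> G" "finite A" "follows h \<tau> A" and F: "finite F"
  shows "\<exists>\<tau>'\<in>G. \<exists>A'. finite A' \<and> A \<subseteq> A' \<and> (\<forall>a\<in>A. \<tau>' a = \<tau> a) \<and> follows h \<tau>' A' \<and> F \<subseteq> \<tau>' ` A'"
  using F
proof induction
  case empty
  show ?case using t by (intro bexI[of _ \<tau>] exI[of _ A]) auto
next
  case (insert y F)
  then obtain \<tau>1 A1 where 1: "\<tau>1 \<in> G" "finite A1" "A \<subseteq> A1" "\<forall>a\<in>A. \<tau>1 a = \<tau> a"
    "follows h \<tau>1 A1" "F \<subseteq> \<tau>1 ` A1" by (elim bexE exE conjE) (rule that, assumption+)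
  from follows_insert_range[OF no h 1(1,2,5), of y] obtain \<tau>2 where
    2: "\<tau>2 \<in> G" "\<forall>a\<in>A1. \<tau>2 a = \<tau>1 a" "follows h \<tau>2 (insert (iv \<tau>2 y) A1)" by blast
  have "\<tau>2 ` A1 = \<tau>1 ` A1" using 2(2) by (intro image_cong) auto
  then have "insert y F \<subseteq> \<tau>2 ` insert (iv \<tau>2 y) A1" using 1(6) 2(1) by auto
  moreover have "\<forall>a\<in>A. \<tau>2 a = \<tau> a" using 1(3,4) 2(2) by (simp add: subset_iff)
  ultimately show ?case using 1(2,3) 2
    by (intro bexI[of _ \<tau>2] exI[of _ "insert (iv \<tau>2 y) A1"]) auto
qed

text \<open>Adding a far moved realization \<open>x\<close> and the preimage \<open>z\<close> of \<open>h (\<tau> x)\<close> as in the displacement step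
  creates no new demands except \<open>h x \<rightarrow> z\<close>, because all new points avoid the neighbourhoods of the old ones.\<close>

lemma follows_insert_displaced:
  assumes h: "h \<in> G" and t: "\<tau> \<in> G" "follows h \<tau> A"
    and x: "x \<notin> A" "x \<notin> near h A" and y: "\<tau> x \<notin> near h (\<tau> ` A)" "h (\<tau> x) \<notin> \<tau> ` A"
    and Ex: "E x (h x)" and Ey: "E (\<tau> x) (h (\<tau> x))"
    and z: "\<tau> z = h (\<tau> x)" "z \<notin> near h (insert x A)" "z \<noteq> x" "z \<notin> A" "E (h x) z"
  shows "follows h \<tau> (insert z (insert x A))"
proof -
  have fx: "h x \<noteq> x" "h (h x) \<noteq> x" "h (\<tau> x) \<noteq> \<tau> x" "h (h (\<tau> x)) \<noteq> \<tau> x"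
    using Ex Ey E_irrefl E_asym G_E[OF h] by metis+
  have nx: "x \<noteq> h s" "h x \<noteq> s" "x \<noteq> h (h s)" "h (h x) \<noteq> s" if "s \<in> A" for s
    using x(2)[unfolded near_iff[OF h]] that by auto
  have nz: "z \<noteq> h s" "h z \<noteq> s" "z \<noteq> h (h s)" "h (h z) \<noteq> s" if "s \<in> insert x A" for s
    using z(2)[unfolded near_iff[OF h]] that by auto
  have ny: "\<tau> x \<noteq> h (\<tau> s)" "h (\<tau> x) \<noteq> \<tau> s" "\<tau> x \<noteq> h (h (\<tau> s))" "h (h (\<tau> x)) \<noteq> \<tau> s" if "s \<in> A" for s
    using y(1)[unfolded near_iff[OF h]] that by auto
  have inj: "\<tau> s = \<tau> u \<longleftrightarrow> s = u" "h s = h u \<longleftrightarrow> s = u" for s u using G_inj t(1) h by auto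
  note f1 = t(2)[unfolded follows_def, THEN conjunct1, rule_format]
  note f2 = t(2)[unfolded follows_def, THEN conjunct2, THEN conjunct1, rule_format]
  note f3 = t(2)[unfolded follows_def, THEN conjunct2, THEN conjunct2, rule_format]
  show ?thesis
    unfolding follows_def
  proof (intro conjI ballI impI)
    fix s assume s: "s \<in> insert z (insert x A)" "h s \<in> insert z (insert x A)"
    consider "s = z" | "s = x" | "s \<in> A" using s(1) by blast
    then show "E (\<tau> (h s)) (h (\<tau> s))"
    proof cases
      case 1
      then have "h z = z" using s(2) nz(2)[of "h z"] by auto
      then show ?thesis using 1 z(1) Ey G_E[OF h, of "\<tau> x" "h (\<tau> x)"] by simp
    next
      case 2
      then show ?thesis using s(2) nx(2)[of "h x"] nz(1)[of x] fx(1) by auto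
    next
      case 3
      then have "h s \<in> A" using s(2) nx(1)[OF 3] nz(1)[of s] by auto
      then show ?thesis using f1 3 by simp
    qed
  next
    fix s u assume s: "s \<in> insert z (insert x A)" "u \<in> insert z (insert x A)" "\<tau> u = h (\<tau> s)"
    consider "s = z" | "s = x" | "s \<in> A" using s(1) by blast
    then show "E (h s) u"
    proof cases
      case 1
      then have "\<tau> u = h (h (\<tau> x))" using s(3) z(1) by simp
      then have "u \<notin> A" "u \<noteq> x" "u \<noteq> z" using ny(4)[of u] fx(3,4) z(1) inj(2) by auto
      then show ?thesis using s(2) by simp
    next
      case 2
      then have "\<tau> u = \<tau> z" using s(3) z(1) by simp
      then show ?thesis using 2 z(5) inj(1) by simp
    next
      case 3
      have "u \<noteq> x" using s(3) ny(1)[OF 3] by auto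
      moreover have "u \<noteq> z"
      proof
        assume "u = z"
        then have "s = x" using s(3) z(1) inj by simp
        then show False using 3 x(1) by simp
      qed
      ultimately show ?thesis using s f2 3 by simp
    qed
  next
    fix s assume s: "s \<in> insert z (insert x A)" "h (h s) \<in> insert z (insert x A)"
    consider "s = z" | "s = x" | "s \<in> A" using s(1) by blast
    then show "\<tau> (h (h s)) \<noteq> h (h (\<tau> s))"
    proof cases
      case 1
      then have "h (h z) = z" using s(2) nz(4)[of "h (h z)"] by auto
      then show ?thesis using 1 z(1) fx(4) inj(2) by auto
    next
      case 2
      then show ?thesis using s(2) nx(4)[of "h (h x)"] nz(3)[of x] fx(2) by auto
    next
      case 3
      then have "h (h s) \<in> A" using s(2) nx(3)[OF 3] nz(3)[of s] by auto
      then show ?thesis using f3 3 by simp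
    qed
  qed
qed

text \<open>For each type \<open>k\<close> is first extended to the parameters and their images, and then to a far moved realization; in
between all points are added in such a way that \<open>h x \<rightarrow> h\<^sup>k x\<close> remains possible. Both directions of arrows are
needed in the displacements of \<open>h\<close>, one for adding points to the domain and the other for the range.\<close>

lemma tournament_step:
  assumes no: "\<not> ord" and h: "h \<in> G" and P: "displacement P" "composes P P"
    and d: "displaces (\<lambda>X x Y y. P X x Y y \<and> E x y) h" "displaces (\<lambda>X x Y y. P X x Y y \<and> E y x) h"
  obtains k where "k \<in> G" "displaces P (iv h \<circ> iv k \<circ> h \<circ> k)" "\<And>x. E x ((iv h \<circ> iv k \<circ> h \<circ> k) x)"
proof -
  have d1: "displaces (\<lambda>X x Y y. E x y) h" by (rule displaces_mono[OF d(1) h]) simp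
  have d2: "displaces (\<lambda>X x Y y. E y x) h" by (rule displaces_mono[OF d(2) h]) simp
  let ?P = "\<lambda>X x Y y. P X x Y y \<and> E x y"
  have P': "displacement ?P" using P(1) unfolding displacement_def by (auto simp: G_E)
  have PP: "composes ?P P" using P(2) unfolding composes_def by meson
  have ori: "orientable ?P (Some True)"
    unfolding orientable_def using no E_irrefl by blast
  obtain e :: "nat \<Rightarrow> 'a set \<times> 'a \<times> bool option" where e: "\<And>X c r. finite X \<Longrightarrow> \<exists>n. e n = (X, c, r)"
    by (rule enumerate_types, rule that, assumption)
  define D where "D n \<tau> A \<longleftrightarrow> (case e n of (X, c, r) \<Rightarrow>
      finite X \<longrightarrow> c \<notin> X \<longrightarrow> displaced_in P h h X c None \<tau> A)" for n \<tau> A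
  obtain k where k: "k \<in> G"
    "\<And>F. finite F \<Longrightarrow> \<exists>\<tau> A. \<tau> \<in> G \<and> finite A \<and> follows h \<tau> A \<and> (\<forall>a\<in>A. k a = \<tau> a) \<and> F \<subseteq> A"
    "\<And>n. \<exists>\<tau> A. \<tau> \<in> G \<and> finite A \<and> follows h \<tau> A \<and> (\<forall>a\<in>A. k a = \<tau> a) \<and> D n \<tau> A"
  proof (rule generic_automorphism[of id "{}" "follows h" D])
    show "follows h id {}" by (simp add: follows_def)
    fix \<tau> A n assume t: "\<tau> \<in> G" "finite (A :: 'a set)" "follows h \<tau> A"
    obtain X c r where en: "e n = (X, c, r)" by (cases "e n")
    show "\<exists>\<tau>' A'. \<tau>' \<in> G \<and> finite A' \<and> A \<subseteq> A' \<and> (\<forall>a\<in>A. \<tau>' a = \<tau> a) \<and> follows h \<tau>' A' \<and> D n \<tau>' A'"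
    proof (cases "finite X \<and> c \<notin> X")
      case False
      then have "D n \<tau> A" by (auto simp: D_def en)
      then show ?thesis using t by (intro exI[of _ \<tau>] exI[of _ A]) simp
    next
      case True
      then have "finite (X \<union> h ` X)" by simp
      from follows_extend_dom[OF no h d1 t this] obtain \<tau>1 where
        1: "\<tau>1 \<in> G" "\<forall>a\<in>A. \<tau>1 a = \<tau> a" "follows h \<tau>1 (A \<union> (X \<union> h ` X))" by blast
      have fin1: "finite (A \<union> (X \<union> h ` X))" "finite (h ` \<tau>1 ` X)" using t(2) True by auto
      from follows_extend_ran[OF no h d2 1(1) fin1(1) 1(3) fin1(2)] obtain \<tau>2 B where
        2: "\<tau>2 \<in> G" "finite B" "A \<union> (X \<union> h ` X) \<subseteq> B" "\<forall>a\<in>A \<union> (X \<union> h ` X). \<tau>2 a = \<tau>1 a"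
        "follows h \<tau>2 B" "h ` \<tau>1 ` X \<subseteq> \<tau>2 ` B" by (elim bexE exE conjE) (rule that, assumption+)
      define X' where "X' = (iv \<tau>2 \<circ> h \<circ> \<tau>2) ` X"
      have eq21: "\<tau>2 ` X = \<tau>1 ` X" using 2(4) by (intro image_cong) auto
      have t2X': "\<tau>2 ` X' = h ` \<tau>2 ` X" using 2(1) by (simp add: X'_def image_image)
      have "\<tau>2 ` X' \<subseteq> \<tau>2 ` B" using t2X' eq21 2(6) by simp
      then have "iv \<tau>2 ` \<tau>2 ` X' \<subseteq> iv \<tau>2 ` \<tau>2 ` B" by (rule image_mono)
      then have X'B: "X' \<subseteq> B" using 2(1) by simp
      have XB: "X \<subseteq> B" "h ` X \<subseteq> B" using 2(3) by auto
      have cX: "c \<notin> X" using True by simp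
      have finN: "finite (near h B)" "finite (near h (\<tau>2 ` B))" "\<And>x. finite (near h (insert x B))"
        using 2(2) by (auto intro: finite_near)
      obtain \<tau>' a where a: "\<tau>' \<in> G" "\<And>u. u \<in> B \<Longrightarrow> \<tau>' u = \<tau>2 u" "a \<in> GF X"
        "a c \<notin> B \<union> near h B" "h (a c) \<notin> B" "\<tau>' (a c) \<notin> near h (\<tau>2 ` B)"
        "?P X (a c) (h ` X) (h (a c))" "?P (\<tau>2 ` X) (\<tau>' (a c)) (h ` \<tau>2 ` X) (h (\<tau>' (a c)))"
        "h (\<tau>' (a c)) \<notin> \<tau>2 ` B"
        "iv \<tau>' (h (\<tau>' (a c))) \<noteq> a c \<Longrightarrow>
          iv \<tau>' (h (\<tau>' (a c))) \<notin> B \<union> insert (a c) (near h (insert (a c) B))"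
        "P (h ` X) (h (a c)) ((iv \<tau>2 \<circ> h \<circ> \<tau>2) ` X) (iv \<tau>' (h (\<tau>' (a c))))"
        "oriented (Some True) (h (a c)) (iv \<tau>' (h (\<tau>' (a c))))"
        by (rule displace_extend[OF h h 2(1,2) XB X'B[unfolded X'_def] cX P' d(1) d(1) PP finN(1,2),
              of "\<lambda>x. near h (insert x B)" "Some True"]) (use finN(3) ori in auto)
      define x where "x = a c"
      define z where "z = iv \<tau>' (h (\<tau>' x))"
      have t'z: "\<tau>' z = h (\<tau>' x)" using a(1) by (simp add: z_def)
      have t'B: "\<tau>' ` B = \<tau>2 ` B" using a(2) by (intro image_cong) auto
      have zx: "z \<noteq> x"
      proof
        assume "z = x"
        then have "h (\<tau>' x) = \<tau>' x" using t'z by simp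
        then show False using a(8) E_irrefl by (simp add: x_def)
      qed
      have zB: "z \<notin> B \<union> insert x (near h (insert x B))" using a(10) zx by (simp add: z_def x_def)
      have fB: "follows h \<tau>' B" using 2(5) follows_cong[of B \<tau>' \<tau>2 h] a(2) by simp
      have fol: "follows h \<tau>' (insert z (insert x B))"
        by (rule follows_insert_displaced[OF h a(1) fB])
          (use a(4-9,12) t'B t'z zB zx in \<open>simp_all add: x_def[symmetric] z_def[symmetric]\<close>)
      have "\<tau>' ` X' = \<tau>2 ` X'" "\<tau>' ` X = \<tau>2 ` X" using a(2) X'B XB by (auto intro!: image_cong)
      then have "\<tau>' ` X' = h ` \<tau>' ` X" using t2X' by simp
      then have "displaced_in P h h X c None \<tau>' (insert z (insert x B))"
        unfolding displaced_in_def using a(3,11) t'z X'B XB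
        by (intro bexI[of _ a] bexI[of _ z] exI[of _ X'] conjI) (auto simp: z_def[symmetric] x_def[symmetric] X'_def)
      then have "D n \<tau>' (insert z (insert x B))" by (cases r) (simp_all add: D_def en)
      moreover have "\<forall>u\<in>A. \<tau>' u = \<tau> u"
      proof
        fix u assume u: "u \<in> A"
        then have "u \<in> B" using 2(3) by auto
        then show "\<tau>' u = \<tau> u" using a(2) 2(4) 1(2) u by simp
      qed
      moreover have "A \<subseteq> insert z (insert x B)" using 2(3) by auto
      ultimately show ?thesis using a(1) 2(2) fol
        by (intro exI[of _ \<tau>'] exI[of _ "insert z (insert x B)"] conjI) simp_all
    qed
  next
    fix \<tau> A x assume t: "\<tau> \<in> G" "finite (A :: 'a set)" "follows h \<tau> A"
    from follows_insert[OF no h d1 t, of x] obtain \<tau>' where "\<tau>' \<in> G" "\<forall>a\<in>A. \<tau>' a = \<tau> a"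
      "follows h \<tau>' (insert x A)" by blast
    then show "\<exists>\<tau>' A'. \<tau>' \<in> G \<and> finite A' \<and> A \<subseteq> A' \<and> (\<forall>a\<in>A. \<tau>' a = \<tau> a) \<and> follows h \<tau>' A' \<and> x \<in> A'"
      using t(2) by (intro exI[of _ \<tau>'] exI[of _ "insert x A"]) auto
  next
    fix \<tau> A y assume t: "\<tau> \<in> G" "finite (A :: 'a set)" "follows h \<tau> A"
    from follows_insert_range[OF no h d2 t, of y] obtain \<tau>' where "\<tau>' \<in> G" "\<forall>a\<in>A. \<tau>' a = \<tau> a"
      "follows h \<tau>' (insert (iv \<tau>' y) A)" by blast
    then show "\<exists>\<tau>' A'. \<tau>' \<in> G \<and> finite A' \<and> A \<subseteq> A' \<and> (\<forall>a\<in>A. \<tau>' a = \<tau> a) \<and> follows h \<tau>' A' \<and> y \<in> \<tau>' ` A'"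
      using t(2) by (intro exI[of _ \<tau>'] exI[of _ "insert (iv \<tau>' y) A"]) auto
  qed (use that in auto)
  show ?thesis
  proof (rule that[OF k(1)])
    show "displaces P (iv h \<circ> iv k \<circ> h \<circ> k)"
      unfolding displaces_def
    proof (intro allI impI)
      fix X c assume X: "finite X" "c \<notin> (X :: 'a set)"
      obtain n where n: "e n = (X, c, None)" using e X by blast
      obtain \<tau> A where "\<forall>a\<in>A. k a = \<tau> a" "D n \<tau> A" using k(3)[of n] by (elim exE conjE) (rule that, assumption+)
      then have "\<And>u. u \<in> A \<Longrightarrow> k u = \<tau> u" "displaced_in P h h X c None \<tau> A"
        using X by (simp_all add: D_def n)
      then show "\<exists>a\<in>GF X. P X (a c) ((iv h \<circ> iv k \<circ> h \<circ> k) ` X) ((iv h \<circ> iv k \<circ> h \<circ> k) (a c))"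
        using displaced_in_limit[OF h h k(1) P(1)] by metis
    qed
    fix x
    define z where "z = iv k (h (k x))"
    have kz: "k z = h (k x)" using k(1) by (simp add: z_def)
    obtain \<tau> A where A: "follows h \<tau> A" "\<forall>a\<in>A. k a = \<tau> a" "{x, z} \<subseteq> A"
      using k(2)[of "{x, z}"] by auto
    then have "E (h x) z" using kz unfolding follows_def by simp
    then have "E (iv h (h x)) (iv h z)" using G_E[OF G_iv[OF h]] by simp
    then show "E x ((iv h \<circ> iv k \<circ> h \<circ> k) x)" using h by (simp add: z_def)
  qed
qed

end

section \<open>Full sets\<close>

context independence
begin

lemma ind2_remove:
  assumes "ind2 ind (A \<union> S) X Y (A' \<union> S')"
  shows "ind2 ind S (X \<union> A) (Y \<union> A') S'"
proof -
  have 1: "ind (A \<union> S \<union> X) Y (A' \<union> S')" and 2: "ind (A \<union> S) X (A' \<union> S' \<union> Y)"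
    using assms by (auto simp: ind2_def)
  have "ind (A \<union> S \<union> X) (Y \<union> A') S'" using 1 ind_trans by blast
  moreover have "ind S (X \<union> A) (A' \<union> S' \<union> Y)" using 2 by (rule ind_shrink_left)
  ultimately show ?thesis by (simp add: ind2_def Un_ac)
qed

lemma ind2_mono: "ind2 ind A X Y A' \<Longrightarrow> B \<subseteq> A \<Longrightarrow> B' \<subseteq> A' \<Longrightarrow> ind2 ind B X Y B'"
  by (auto simp: ind2_def elim!: ind_mono)

end

context expansion
begin

text \<open>The cut that a point must realize in order to look like \<open>s\<close> over \<open>X \<union> g X\<close> and to be mapped by \<open>g\<close>
  to a point that looks like \<open>\<psi> s\<close>.\<close>

definition graph_cut :: "('a \<Rightarrow> 'a) \<Rightarrow> ('a \<Rightarrow> 'a) \<Rightarrow> 'a set \<Rightarrow> 'a \<Rightarrow> bool" where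
  "graph_cut g \<psi> X s \<longleftrightarrow>
     cut E ord ({u \<in> X \<union> g ` X. E u s} \<union> iv g ` {u \<in> X \<union> g ` X. E u (\<psi> s)})
       ({u \<in> X \<union> g ` X. E s u} \<union> iv g ` {u \<in> X \<union> g ` X. E (\<psi> s) u})"

text \<open>If the cut is consistent, maximal displacement provides a point of the graph of \<open>g\<close> with the type of
  \<open>(s, \<psi> s)\<close> over \<open>X \<union> g X\<close>: in the structure this type is determined by stationarity.\<close>

lemma full_point:
  assumes g: "g \<in> G" "\<And>x. E x (g x)" "displaces (\<lambda>X x Y y. ind2 ind {x} X Y {y}) g"
    and X: "finite X" and psi: "\<psi> \<in> G" "\<And>u. u \<in> X \<Longrightarrow> \<psi> u = g u"
    and s: "s \<notin> X" "E s (\<psi> s)" "ind2 ind {s} X (g ` X) {\<psi> s}" and cut: "graph_cut g \<psi> X s"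
  obtains a where "a \<in> GF (X \<union> g ` X)" "g (a s) = a (\<psi> s)" "a s \<notin> X \<union> near g X"
proof -
  define K where "K = X \<union> g ` X"
  define N where "N = K \<union> iv g ` K \<union> near g X"
  \<comment> \<open>the cut puts both \<open>x\<close> and \<open>g x\<close> into position: the bounds on \<open>g x\<close> are pulled back along \<open>g\<close>\<close>
  define L where "L = {u \<in> K. E u s} \<union> iv g ` {u \<in> K. E u (\<psi> s)}"
  define U where "U = {u \<in> K. E s u} \<union> iv g ` {u \<in> K. E (\<psi> s) u}"
  have fin: "finite K" "finite N" "finite L" "finite U"
    using X by (auto simp: K_def N_def L_def U_def finite_near)
  have LU: "cut E ord L U" using cut by (simp add: graph_cut_def L_def U_def K_def)
  have s1: "ind ({s} \<union> X) (g ` X) {\<psi> s}" and s2: "ind {s} X ({\<psi> s} \<union> g ` X)"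
    using s(3) by (auto simp: ind2_def)
  have sK: "s \<notin> K" using ind_disjoint[OF s2] s(1) by (auto simp: K_def)
  have psX: "\<psi> ` X = g ` X" using psi(2) by (intro image_cong) auto
  have psK: "\<psi> s \<notin> K"
  proof
    assume "\<psi> s \<in> K"
    then have "\<psi> s \<in> g ` X" using ind_disjoint[OF s1] by (auto simp: K_def)
    then have "\<psi> s \<in> \<psi> ` X" by (simp add: psX)
    then show False using s(1) G_in_img[OF psi(1)] by blast
  qed
  obtain \<sigma> where sg: "\<sigma> \<in> Fix M X" "ind {\<sigma> s} X N" "\<forall>l\<in>L. E l (\<sigma> s)" "\<forall>u\<in>U. E (\<sigma> s) u"
    using extend[OF fin(3,4) LU X fin(2) s(1)] by blast
  have isK: "ind {s} X K"
  proof -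
    have "ind {s} X (g ` X)" by (rule ind_mono_right[OF s2]) auto
    then show ?thesis by (simp add: K_def ind_absorb_right)
  qed
  have "ind {\<sigma> s} X K" by (rule ind_mono_right[OF sg(2)]) (auto simp: N_def)
  then obtain \<tau> where tau: "\<tau> \<in> Fix M (X \<union> K)" "\<tau> s = \<sigma> s"
    using stationary[OF X fin(1) sg(1) isK] by blast
  have "\<tau> \<in> Fix M K" using tau(1) Fix_mono[of K "X \<union> K" M] by blast
  moreover have "E u (\<tau> s) \<longleftrightarrow> E u s" if u: "u \<in> K" for u
  proof (cases "E u s")
    case True
    then have "u \<in> L" using u by (simp add: L_def)
    then show ?thesis using True sg(3) tau(2) by simp
  next
    case False
    then have "E s u" using E_total[of u s] sK u by auto
    then have "u \<in> U" using u by (simp add: U_def)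
    then show ?thesis using False sg(4) tau(2) E_asym by auto
  qed
  ultimately obtain k where k: "k \<in> GF K" "k s = \<sigma> s"
    using type_over[OF fin(1), of \<tau> s] tau(2) by metis
  define x0 where "x0 = \<sigma> s"
  have x0K: "x0 \<notin> K" using GF_notin[OF k(1) sK] k(2) by (simp add: x0_def)
  have x0N: "x0 \<notin> N" using ind_disjoint[OF sg(2)] x0K by (auto simp: x0_def K_def)
  obtain b where b: "b \<in> GF N" "ind2 ind {b x0} N (g ` N) {g (b x0)}"
    using displacesD[OF g(3) fin(2) x0N] .
  define x where "x = b x0"
  have bG: "b \<in> G" using GF_G[OF b(1)] .
  have KN: "K \<subseteq> N" "X \<subseteq> K" "g ` X \<subseteq> K" by (auto simp: N_def K_def)
  have xN: "x \<notin> N" using GF_notin[OF b(1) x0N] by (simp add: x_def)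
  have ixN: "ind {x} X N"
  proof -
    have "ind (b ` {x0}) (b ` X) (b ` N)" using sg(2) by (simp only: ind_G[OF bG] x0_def)
    then show ?thesis using GF_img[OF b(1), of X] GF_img[OF b(1), of N] KN by (simp add: x_def)
  qed
  have XN: "X \<union> N = N" using KN by auto
  have i2: "ind2 ind {x} X (g ` X) {g x}"
    using ind2_base[OF ixN, of g] b(2) G_Aut[OF g(1)] by (simp add: XN x_def)
  define a where "a = b \<circ> k"
  have a: "a \<in> GF K" using GF_comp[OF GF_mono[OF b(1) KN(1)] k(1)] by (simp add: a_def)
  have aG: "a \<in> G" using GF_G[OF a] .
  have as: "a s = x" using k(2) by (simp add: a_def x_def x0_def)
  have aX: "a ` X = X" "a ` g ` X = g ` X" using GF_img[OF a] KN by auto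
  define y where "y = a (\<psi> s)"
  \<comment> \<open>\<open>y\<close> and \<open>g x\<close> have the same type over \<open>X\<close>, \<open>g X\<close> and \<open>x\<close>\<close>
  define t where "t = g \<circ> a \<circ> iv \<psi> \<circ> iv a"
  have tG: "t \<in> G" using g(1) aG psi(1) by (simp add: t_def G_comp G_iv)
  have ty: "t y = g x" using aG psi(1) as by (simp add: t_def y_def)
  have "t u = u" if u: "u \<in> g ` X" for u
  proof -
    obtain v where v: "v \<in> X" "u = g v" using u by blast
    have "iv a u = u" using GF_fix[OF GF_iv[OF a]] KN u by blast
    moreover have "iv \<psi> u = v" using psi v by (simp add: G_iv_eq)
    moreover have "a v = v" using GF_fix[OF a] KN v by blast
    ultimately show ?thesis using v by (simp add: t_def)
  qed
  then have tF: "t \<in> Fix M (g ` X)" using G_Aut[OF tG] by (simp add: Fix_def)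
  have i1: "ind {y} (g ` X) (insert x X)"
  proof -
    have "ind (a ` ({s} \<union> X)) (a ` g ` X) (a ` {\<psi> s})" using s1 by (simp only: ind_G[OF aG])
    then have "ind (insert x X) (g ` X) {y}" using aX as by (simp add: y_def)
    then show ?thesis by (rule ind_sym)
  qed
  have "ind {t y} (g ` X) (insert x X)" using i2 ty by (auto simp: ind2_def intro: ind_sym)
  then obtain \<rho> where rho: "\<rho> \<in> Fix M (g ` X \<union> insert x X)" "\<rho> y = g x"
    using stationary[OF _ _ tF i1] X ty by auto
  have eqW: "g ` X \<union> insert x X = insert x K" by (auto simp: K_def)
  have "E u (\<rho> y) \<longleftrightarrow> E u y" if u: "u \<in> insert x K" for u
  proof (cases "u = x")
    case True
    have "E x y" using s(2) G_E[OF aG, of s "\<psi> s"] as by (simp add: y_def)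
    then show ?thesis using True g(2) rho(2) by simp
  next
    case False
    then have u: "u \<in> K" using u by simp
    have uy: "E u y \<longleftrightarrow> E u (\<psi> s)"
      using G_E[OF aG, of u "\<psi> s"] GF_fix[OF a u] by (simp add: y_def)
    have iu: "b (iv g u) = iv g u" using GF_fix[OF b(1)] u by (auto simp: N_def)
    show ?thesis
    proof (cases "E u (\<psi> s)")
      case True
      then have "iv g u \<in> L" using u by (auto simp: L_def)
      then have "E (iv g u) x0" using sg(3) by (simp add: x0_def)
      then have "E (b (iv g u)) (b x0)" using G_E[OF bG] by simp
      then have "E (iv g u) x" using iu by (simp add: x_def)
      then have "E (g (iv g u)) (g x)" using G_E[OF g(1)] by simp
      then show ?thesis using True uy rho(2) g(1) by simp
    next
      case False
      then have "E (\<psi> s) u" using E_total[of u "\<psi> s"] psK u by auto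
      then have "iv g u \<in> U" using u by (auto simp: U_def)
      then have "E x0 (iv g u)" using sg(4) by (simp add: x0_def)
      then have "E (b x0) (b (iv g u))" using G_E[OF bG] by simp
      then have "E x (iv g u)" using iu by (simp add: x_def)
      then have "E (g x) (g (iv g u))" using G_E[OF g(1)] by simp
      then show ?thesis using False uy rho(2) g(1) E_asym by auto
    qed
  qed
  then obtain c where c: "c \<in> GF (insert x K)" "c y = g x"
    using type_over[of "insert x K" \<rho> y] rho fin(1) unfolding eqW by auto
  show ?thesis
  proof (rule that[of "c \<circ> a"])
    show "c \<circ> a \<in> GF (X \<union> g ` X)"
      using GF_comp[OF GF_mono[OF c(1)] a] by (auto simp: K_def[symmetric])
    have cx: "c x = x" using GF_fix[OF c(1)] by simp
    then show "g ((c \<circ> a) s) = (c \<circ> a) (\<psi> s)" using c(2) as by (simp add: y_def)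
    show "(c \<circ> a) s \<notin> X \<union> near g X" using cx as xN by (auto simp: N_def K_def)
  qed
qed

text \<open>One more point \<open>s\<close> is placed after the points of \<open>S\<close>, with \<open>X \<union> a S\<close> in place of \<open>X\<close>. Over this larger set the target
map is \<open>\<psi>\<close> conjugated by \<open>a\<close>, and maximal displacement of the whole tuple provides that of \<open>s\<close>. The new point
stays away from the orbits of the old ones, so that no gaps arise.\<close>

lemma full_insert:
  assumes g: "g \<in> G" "\<And>x. E x (g x)" "displaces (\<lambda>X x Y y. ind2 ind {x} X Y {y}) g"
    and X: "finite X" "finite S" and psi: "\<psi> \<in> G" "\<And>u. u \<in> X \<Longrightarrow> \<psi> u = g u"
    and s: "E s (\<psi> s)" "ind2 ind (insert s S) X (g ` X) (\<psi> ` insert s S)"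
    and a: "a \<in> GF (X \<union> g ` X)" "\<And>t. t \<in> S \<Longrightarrow> g (a t) = a (\<psi> t)"
    and cut: "s \<notin> X \<union> S \<Longrightarrow> graph_cut g (a \<circ> \<psi> \<circ> iv a) (X \<union> a ` S) (a s)"
  shows "\<exists>b\<in>GF (X \<union> g ` X). (\<forall>t\<in>insert s S. g (b t) = b (\<psi> t)) \<and> b ` S = a ` S \<and>
    (b s \<in> X \<union> b ` S \<or> b s \<notin> near g (X \<union> b ` S))"
proof (cases "s \<in> X \<union> S")
  case True
  have "g (a s) = a (\<psi> s)" if "s \<in> X"
    using GF_fix[OF a(1), of s] GF_fix[OF a(1), of "g s"] psi(2) that by simp
  moreover have "a s \<in> X \<union> a ` S" using True GF_fix[OF a(1), of s] by auto
  ultimately show ?thesis using True a by (intro bexI[of _ a]) auto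
next
  case False
  define X1 where "X1 = X \<union> a ` S"
  define \<phi> where "\<phi> = a \<circ> \<psi> \<circ> iv a"
  have aG: "a \<in> G" using GF_G[OF a(1)] .
  have aX: "a ` X = X" "a ` g ` X = g ` X" using GF_img[OF a(1)] by auto
  have phi: "\<phi> \<in> G" using aG psi(1) by (simp add: \<phi>_def G_comp G_iv)
  have phia: "\<phi> (a t) = a (\<psi> t)" for t using aG by (simp add: \<phi>_def)
  have phi_eq: "\<phi> u = g u" if u: "u \<in> X1" for u
  proof (cases "u \<in> X")
    case True
    then have "iv a u = u" using GF_fix[OF GF_iv[OF a(1)], of u] by simp
    then show ?thesis using GF_fix[OF a(1), of "g u"] psi(2) True by (simp add: \<phi>_def)
  next
    case False
    then obtain t where "t \<in> S" "u = a t" using u by (auto simp: X1_def)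
    then show ?thesis using phia a(2) by simp
  qed
  have X1: "finite X1" using X by (simp add: X1_def)
  have aS: "a ` \<psi> ` S = g ` a ` S" using a(2) by (force simp: image_image)
  have sX1: "a s \<notin> X1"
  proof
    assume "a s \<in> X1"
    then have "a s \<in> a ` (X \<union> S)" using aX by (simp add: X1_def image_Un)
    then show False using False G_in_img[OF aG] by blast
  qed
  have "ind2 ind (S \<union> {s}) X (g ` X) (\<psi> ` S \<union> {\<psi> s})" using s(2) by simp
  then have "ind2 ind {s} (X \<union> S) (g ` X \<union> \<psi> ` S) {\<psi> s}" by (rule ind2_remove)
  then have "ind2 ind (a ` {s}) (a ` (X \<union> S)) (a ` (g ` X \<union> \<psi> ` S)) (a ` {\<psi> s})"
    by (simp only: ind2_G[OF aG])
  moreover have "a ` (X \<union> S) = X1" using aX by (simp add: X1_def image_Un)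
  moreover have "a ` (g ` X \<union> \<psi> ` S) = g ` X1" using aX aS by (simp add: X1_def image_Un)
  ultimately have i: "ind2 ind {a s} X1 (g ` X1) {\<phi> (a s)}" by (simp add: phia)
  have Es: "E (a s) (\<phi> (a s))" using s(1) G_E[OF aG] phia by simp
  have gc: "graph_cut g \<phi> X1 (a s)" using cut[OF False] by (simp add: \<phi>_def X1_def)
  obtain c where c: "c \<in> GF (X1 \<union> g ` X1)" "g (c (a s)) = c (\<phi> (a s))" "c (a s) \<notin> X1 \<union> near g X1"
    by (rule full_point[OF g X1 phi phi_eq sX1 Es i gc])
  have caS: "c (a t) = a t" "c (g (a t)) = g (a t)" if "t \<in> S" for t
    using GF_fix[OF c(1)] that by (auto simp: X1_def)
  have "(c \<circ> a) ` S = a ` S" using caS(1) by (force simp: image_iff)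
  moreover have "c \<circ> a \<in> GF (X \<union> g ` X)"
    by (rule GF_comp[OF GF_mono[OF c(1)] a(1)]) (auto simp: X1_def)
  moreover have "c (a (\<psi> t)) = a (\<psi> t)" if "t \<in> S" for t using caS(2)[OF that] a(2)[OF that] by simp
  then have "g ((c \<circ> a) t) = (c \<circ> a) (\<psi> t)" if "t \<in> insert s S" for t
    using that c(2) caS(1)[of t] a(2)[of t] phia[of s] by (cases "t = s") auto
  ultimately show ?thesis using c(3) by (intro bexI[of _ "c \<circ> a"]) (simp_all add: X1_def)
qed

text \<open>In a tournament the cut fails only if \<open>g u \<in> X\<close> for some \<open>u\<close> in \<open>g X - X\<close>: then the arrow between \<open>u\<close> and
  the new point is prescribed together with the one between their images.\<close>

definition gap_free :: "('a \<Rightarrow> 'a) \<Rightarrow> 'a set \<Rightarrow> bool" where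
  "gap_free g X \<longleftrightarrow> (\<forall>e\<in>X. g (g e) \<in> X \<longrightarrow> g e \<in> X)"

lemma graph_cut_tournament:
  assumes no: "\<not> ord" and g: "g \<in> G" and psi: "\<psi> \<in> G" "\<And>u. u \<in> X \<Longrightarrow> \<psi> u = g u" and X: "gap_free g X"
  shows "graph_cut g \<psi> X s"
proof -
  have key: False if u: "u \<in> X \<union> g ` X" and gu: "g u \<in> X \<union> g ` X"
    and or: "E u s \<and> E (\<psi> s) (g u) \<or> E s u \<and> E (g u) (\<psi> s)" for u
  proof (cases "u \<in> X")
    case True
    then have "g u = \<psi> u" using psi(2) by simp
    then show ?thesis using or G_E[OF psi(1)] E_asym by metis
  next
    case False
    then obtain e where e: "e \<in> X" "u = g e" using u by blast
    have "g u \<notin> g ` X" using False G_in_img[OF g] by blast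
    then have "g (g e) \<in> X" using gu e by simp
    then have "g e \<in> X" using X e(1) by (simp add: gap_free_def)
    then show ?thesis using False e by simp
  qed
  have gi: "g (iv g w) = w" for w using g by simp
  show ?thesis
    unfolding graph_cut_def cut_def
  proof (intro ballI conjI)
    fix l u assume l: "l \<in> {u \<in> X \<union> g ` X. E u s} \<union> iv g ` {u \<in> X \<union> g ` X. E u (\<psi> s)}"
      and u: "u \<in> {u \<in> X \<union> g ` X. E s u} \<union> iv g ` {u \<in> X \<union> g ` X. E (\<psi> s) u}"
    have l': "(l \<in> X \<union> g ` X \<and> E l s) \<or> (g l \<in> X \<union> g ` X \<and> E (g l) (\<psi> s))"
      using l gi by (elim UnE imageE) simp_all
    have u': "(u \<in> X \<union> g ` X \<and> E s u) \<or> (g u \<in> X \<union> g ` X \<and> E (\<psi> s) (g u))"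
      using u gi by (elim UnE imageE) simp_all
    show "l \<noteq> u"
    proof
      assume "l = u"
      then show False using l' u' key[of u] E_asym by metis
    qed
    show "ord \<longrightarrow> E l u" using no by simp
  qed
qed

lemma gap_free_insert:
  assumes g: "g \<in> G" "\<And>x. E x (g x)" and X: "gap_free g X" and x: "x \<notin> near g X"
  shows "gap_free g (insert x X)"
proof -
  have n: "x \<noteq> g s" "g x \<noteq> s" "x \<noteq> g (g s)" "g (g x) \<noteq> s" if "s \<in> X" for s
    using x[unfolded near_iff[OF g(1)]] that by auto
  have "g (g x) \<noteq> x" using g(2)[of x] g(2)[of "g x"] E_asym by metis
  then show ?thesis using X n unfolding gap_free_def by (metis insert_iff)
qed

lemma full_tournament:
  assumes no: "\<not> ord"
    and g: "g \<in> G" "\<And>x. E x (g x)" "displaces (\<lambda>X x Y y. ind2 ind {x} X Y {y}) g"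
    and X: "finite X" "gap_free g X" and psi: "\<psi> \<in> G" "\<And>u. u \<in> X \<Longrightarrow> \<psi> u = g u"
    and S: "finite S" "\<And>s. s \<in> S \<Longrightarrow> E s (\<psi> s)" "ind2 ind S X (g ` X) (\<psi> ` S)"
  shows "\<exists>a\<in>GF (X \<union> g ` X). (\<forall>s\<in>S. g (a s) = a (\<psi> s)) \<and> gap_free g (X \<union> a ` S)"
  using S
proof (induction S)
  case empty
  show ?case using X by (intro bexI[of _ id]) auto
next
  case (insert s S)
  have "ind2 ind S X (g ` X) (\<psi> ` S)" by (rule ind2_mono[OF insert.prems(2)]) auto
  then obtain a where a: "a \<in> GF (X \<union> g ` X)" "\<forall>s\<in>S. g (a s) = a (\<psi> s)" "gap_free g (X \<union> a ` S)"
    using insert by auto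
  have aG: "a \<in> G" using GF_G[OF a(1)] .
  have eq: "(a \<circ> \<psi> \<circ> iv a) u = g u" if u: "u \<in> X \<union> a ` S" for u
  proof (cases "u \<in> X")
    case True
    then have "iv a u = u" using GF_fix[OF GF_iv[OF a(1)], of u] by simp
    then show ?thesis using GF_fix[OF a(1), of "g u"] psi(2) True by simp
  next
    case False
    then show ?thesis using u a(2) aG by auto
  qed
  have "a \<circ> \<psi> \<circ> iv a \<in> G" by (intro G_comp aG psi(1) G_iv)
  then have gc: "graph_cut g (a \<circ> \<psi> \<circ> iv a) (X \<union> a ` S) (a s)"
    by (rule graph_cut_tournament[OF no g(1) _ eq a(3)])
  have Es: "E s (\<psi> s)" and ga: "\<And>t. t \<in> S \<Longrightarrow> g (a t) = a (\<psi> t)" using insert.prems(1) a(2) by auto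
  have "\<exists>b\<in>GF (X \<union> g ` X). (\<forall>t\<in>insert s S. g (b t) = b (\<psi> t)) \<and> b ` S = a ` S \<and>
      (b s \<in> X \<union> b ` S \<or> b s \<notin> near g (X \<union> b ` S))"
    by (rule full_insert[OF g X(1) insert.hyps(1) psi Es insert.prems(2) a(1) ga gc])
  then obtain b where b: "b \<in> GF (X \<union> g ` X)" "\<forall>t\<in>insert s S. g (b t) = b (\<psi> t)" "b ` S = a ` S"
    "b s \<in> X \<union> b ` S \<or> b s \<notin> near g (X \<union> b ` S)"
    by (elim bexE conjE) (rule that, assumption+)
  have "gap_free g (insert (b s) (X \<union> b ` S))"
    using b(4)
  proof
    assume "b s \<in> X \<union> b ` S"
    then show ?thesis using a(3) b(3) by (simp add: insert_absorb)
  next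
    assume "b s \<notin> near g (X \<union> b ` S)"
    then show ?thesis using gap_free_insert[OF g(1,2)] a(3) b(3) by simp
  qed
  then show ?case using b(1,2) by (intro bexI[of _ b]) (simp_all add: Un_insert_right)
qed

text \<open>In an order the only pairs of parameters whose comparison is not forced consist of a point of \<open>g X\<close> and
  a point of \<open>X\<close>.\<close>

lemma graph_cut_order:
  assumes o: ord and g: "g \<in> G" and psi: "\<psi> \<in> G" "\<And>u. u \<in> X \<Longrightarrow> \<psi> u = g u"
    and c1: "\<And>v u. v \<in> X \<Longrightarrow> u \<in> X \<Longrightarrow> E (g v) s \<Longrightarrow> E (\<psi> s) u \<Longrightarrow> E (g (g v)) u"
    and c2: "\<And>v u. v \<in> X \<Longrightarrow> u \<in> X \<Longrightarrow> E s (g v) \<Longrightarrow> E u (\<psi> s) \<Longrightarrow> E u (g (g v))"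
  shows "graph_cut g \<psi> X s"
proof -
  note tr = E_trans[OF o]
  have k1: "E (g l) w" if lw: "l \<in> X \<union> g ` X" "E l s" "w \<in> X \<union> g ` X" "E (\<psi> s) w" for l w
  proof (cases "l \<in> X")
    case True
    then have "E (g l) (\<psi> s)" using psi lw(2) G_E[OF psi(1), of l s] by simp
    then show ?thesis using lw(4) by (rule tr)
  next
    case False
    then obtain v where v: "v \<in> X" "l = g v" using lw(1) by blast
    show ?thesis
    proof (cases "w \<in> X")
      case True
      then show ?thesis using c1 v lw by blast
    next
      case False
      then obtain u where u: "u \<in> X" "w = g u" using lw(3) by blast
      then have "E s u" using lw(4) psi G_E[OF psi(1), of s u] by simp
      with lw(2) have "E l u" by (rule tr)
      then show ?thesis using u G_E[OF g] by simp
    qed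
  qed
  have k2: "E w (g u)" if uw: "u \<in> X \<union> g ` X" "E s u" "w \<in> X \<union> g ` X" "E w (\<psi> s)" for u w
  proof (cases "u \<in> X")
    case True
    then have "E (\<psi> s) (g u)" using psi uw(2) G_E[OF psi(1), of s u] by simp
    show ?thesis by (rule tr[OF uw(4)]) fact
  next
    case False
    then obtain v where v: "v \<in> X" "u = g v" using uw(1) by blast
    show ?thesis
    proof (cases "w \<in> X")
      case True
      then show ?thesis using c2 v uw by blast
    next
      case False
      then obtain l where l: "l \<in> X" "w = g l" using uw(3) by blast
      then have "E l s" using uw(4) psi G_E[OF psi(1), of l s] by simp
      then have "E l u" using uw(2) by (rule tr)
      then show ?thesis using l G_E[OF g] by simp
    qed
  qed
  have gi: "g (iv g w) = w" for w using g by simp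
  show ?thesis
    unfolding graph_cut_def cut_def
  proof (intro ballI)
    fix l u assume l: "l \<in> {u \<in> X \<union> g ` X. E u s} \<union> iv g ` {u \<in> X \<union> g ` X. E u (\<psi> s)}"
      and u: "u \<in> {u \<in> X \<union> g ` X. E s u} \<union> iv g ` {u \<in> X \<union> g ` X. E (\<psi> s) u}"
    have l': "(l \<in> X \<union> g ` X \<and> E l s) \<or> (g l \<in> X \<union> g ` X \<and> E (g l) (\<psi> s))"
      using l gi by (elim UnE imageE) simp_all
    have u': "(u \<in> X \<union> g ` X \<and> E s u) \<or> (g u \<in> X \<union> g ` X \<and> E (\<psi> s) (g u))"
      using u gi by (elim UnE imageE) simp_all
    have "E l u"
      using l' u'
    proof (elim disjE conjE)
      assume "E l s" "E s u"
      then show ?thesis by (rule tr)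
    next
      assume "l \<in> X \<union> g ` X" "E l s" "g u \<in> X \<union> g ` X" "E (\<psi> s) (g u)"
      then have "E (g l) (g u)" by (rule k1)
      then show ?thesis by (simp only: G_E[OF g])
    next
      assume "g l \<in> X \<union> g ` X" "E (g l) (\<psi> s)" "u \<in> X \<union> g ` X" "E s u"
      then have "E (g l) (g u)" by (intro k2)
      then show ?thesis by (simp only: G_E[OF g])
    next
      assume "E (g l) (\<psi> s)" "E (\<psi> s) (g u)"
      then have "E (g l) (g u)" by (rule tr)
      then show ?thesis by (simp only: G_E[OF g])
    qed
    then show "l \<noteq> u \<and> (ord \<longrightarrow> E l u)" using E_irrefl by blast
  qed
qed

lemma finite_E_max:
  assumes o: ord and S: "finite S" "S \<noteq> {}"
  obtains s where "s \<in> S" "\<And>t. t \<in> S \<Longrightarrow> t = s \<or> E t s"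
proof -
  from S have "\<exists>s\<in>S. \<forall>t\<in>S. t = s \<or> E t s"
  proof (induction rule: finite_ne_induct)
    case (insert x F)
    then obtain s where s: "s \<in> F" "\<forall>t\<in>F. t = s \<or> E t s" by auto
    show ?case
    proof (cases "E s x")
      case True
      have "t = x \<or> E t x" if "t \<in> insert x F" for t
        using that s(2) True E_trans[OF o, of t s x] by auto
      then show ?thesis by (intro bexI[of _ x]) auto
    next
      case False
      then have "x = s \<or> E x s" using E_total[of x s] by auto
      then show ?thesis using s by (intro bexI[of _ s]) auto
    qed
  qed simp
  then show ?thesis using that by (elim bexE) simp
qed

lemma finite_E_min:
  assumes o: ord and S: "finite S" "S \<noteq> {}"
  obtains s where "s \<in> S" "\<And>t. t \<in> S \<Longrightarrow> t = s \<or> E s t"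
proof -
  interpret conv: expansion M ind "\<lambda>a b. E b a" ord by (rule expansion_converse)
  show ?thesis by (rule conv.finite_E_max[OF o S]) (use that in blast)
qed

text \<open>Closed under \<open>g\<close> and its inverse as far as one stays between points of the set. Without this \<open>s\<close> and \<open>\<psi> s\<close> could be
prescribed with \<open>g v < s\<close> and \<open>\<psi> s < u\<close> for \<open>v\<close>, \<open>u\<close> in \<open>X\<close> although \<open>u\<close> is smaller than \<open>g (g v)\<close>.\<close>

definition orbit_closed :: "('a \<Rightarrow> 'a) \<Rightarrow> 'a set \<Rightarrow> bool" where
  "orbit_closed g X \<longleftrightarrow> (\<forall>u\<in>X. (\<exists>x\<in>X. g x = u \<or> E (g x) u) \<longrightarrow> u \<in> g ` X) \<and>
     (\<forall>v\<in>X. (\<exists>x\<in>X. g v = x \<or> E (g v) x) \<longrightarrow> g v \<in> X)"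

lemma orbit_closed_pred: "orbit_closed g X \<Longrightarrow> u \<in> X \<Longrightarrow> x \<in> X \<Longrightarrow> E (g x) u \<Longrightarrow> u \<in> g ` X"
  by (auto simp: orbit_closed_def)

lemma orbit_closed_succ: "orbit_closed g X \<Longrightarrow> v \<in> X \<Longrightarrow> x \<in> X \<Longrightarrow> g v = x \<or> E (g v) x \<Longrightarrow> g v \<in> X"
  by (auto simp: orbit_closed_def)

text \<open>In an order the points above the minimum of \<open>X\<close> are treated in increasing order, then those below it in
  decreasing order; the new point is then always extremal, and closure under orbits makes its cut consistent.\<close>

lemma full_order:
  assumes o: ord
    and g: "g \<in> G" "\<And>x. E x (g x)" "displaces (\<lambda>X x Y y. ind2 ind {x} X Y {y}) g"
    and X: "finite X" "orbit_closed g X" and psi: "\<psi> \<in> G" "\<And>u. u \<in> X \<Longrightarrow> \<psi> u = g u"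
    and S: "finite S" "\<And>s. s \<in> S \<Longrightarrow> E s (\<psi> s)" "ind2 ind S X (g ` X) (\<psi> ` S)"
  shows "\<exists>a\<in>GF (X \<union> g ` X). \<forall>s\<in>S. g (a s) = a (\<psi> s)"
  using S
proof (induction "card S" arbitrary: S)
  case 0
  then show ?case by (intro bexI[of _ id]) auto
next
  case (Suc n)
  note tr = E_trans[OF o]
  have ne: "S \<noteq> {}" using Suc(2) by auto
  define low where "low s \<longleftrightarrow> X \<noteq> {} \<and> (\<forall>x\<in>X. E s x)" for s
  obtain s where s: "s \<in> S" and ext: "(\<forall>t\<in>S. t = s \<or> E s t) \<and> low s \<or> (\<forall>t\<in>S. (t = s \<or> E t s) \<and> \<not> low t)"
  proof (cases "\<exists>t\<in>S. low t")
    case True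
    obtain s where s: "s \<in> S" "\<And>t. t \<in> S \<Longrightarrow> t = s \<or> E s t" by (rule finite_E_min[OF o Suc(3) ne], rule that) simp_all
    obtain t where t: "t \<in> S" "low t" using True by blast
    have "E s x" if "x \<in> X" for x
      using s(2)[OF t(1)] t(2) that tr[of s t x] by (auto simp: low_def)
    then have "low s" using t(2) by (simp add: low_def)
    then show ?thesis using that[OF s(1)] s(2) by simp
  next
    case False
    obtain s where "s \<in> S" "\<And>t. t \<in> S \<Longrightarrow> t = s \<or> E t s" by (rule finite_E_max[OF o Suc(3) ne], rule that) simp_all
    then show ?thesis using that False by simp
  qed
  define T where "T = S - {s}"
  have ST: "S = insert s T" "s \<notin> T" using s by (auto simp: T_def)
  have T: "finite T" "n = card T" using Suc(2,3) s by (simp_all add: T_def)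
  have iT: "ind2 ind T X (g ` X) (\<psi> ` T)" by (rule ind2_mono[OF Suc(5)]) (auto simp: T_def)
  have ET: "\<And>t. t \<in> T \<Longrightarrow> E t (\<psi> t)" using Suc(4) by (simp add: T_def)
  obtain a where a: "a \<in> GF (X \<union> g ` X)" "\<forall>t\<in>T. g (a t) = a (\<psi> t)"
    using Suc(1)[OF T(2,1) ET iT] by blast
  have aG: "a \<in> G" using GF_G[OF a(1)] .
  define \<phi> where "\<phi> = a \<circ> \<psi> \<circ> iv a"
  have phi: "\<phi> \<in> G" unfolding \<phi>_def by (intro G_comp aG psi(1) G_iv)
  define X1 where "X1 = X \<union> a ` T"
  have eq: "\<phi> u = g u" if u: "u \<in> X1" for u
  proof (cases "u \<in> X")
    case True
    then have "iv a u = u" using GF_fix[OF GF_iv[OF a(1)], of u] by simp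
    then show ?thesis using GF_fix[OF a(1), of "g u"] psi(2) True by (simp add: \<phi>_def)
  next
    case False
    then show ?thesis using u a(2) aG by (auto simp: X1_def \<phi>_def)
  qed
  have Es: "E s (\<psi> s)" using Suc(4) s by blast
  define s' where "s' = a s"
  have Es': "E s' (\<phi> s')" using Es G_E[OF aG] aG by (simp add: \<phi>_def s'_def)
  have gc: "graph_cut g \<phi> X1 s'" if new: "s \<notin> X \<union> T"
  proof (rule graph_cut_order[OF o g(1) phi eq])
    have xs: "E x s' \<longleftrightarrow> E x s" "E s' x \<longleftrightarrow> E s x" if "x \<in> X" for x
      using G_E[OF aG, of x s] G_E[OF aG, of s x] GF_fix[OF a(1), of x] that by (simp_all add: s'_def)
    have ts: "E (a t) s' \<longleftrightarrow> E t s" "E s' (a t) \<longleftrightarrow> E s t" for t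
      using G_E[OF aG] by (simp_all add: s'_def)
    have tx: "E (a t) x \<longleftrightarrow> E t x" "E x (a t) \<longleftrightarrow> E x t" if "x \<in> X" for t x
      using G_E[OF aG, of x t] G_E[OF aG, of t x] GF_fix[OF a(1), of x] that by simp_all
    note gmono = G_E[OF g(1)]
    \<comment> \<open>if \<open>s\<close> is low, it lies below everything\<close>
    have below: "E s' v" if "\<forall>t\<in>S. t = s \<or> E s t" "low s" "v \<in> X1" for v
      using that xs(2) ts(2) ST unfolding low_def X1_def by auto
    have above: "E u s'" if "\<forall>t\<in>S. (t = s \<or> E t s) \<and> \<not> low t" "u \<in> X1" "u \<notin> X" for u
      using that ts(1) ST unfolding X1_def by auto
    have not_above: "u \<in> X" if "\<forall>t\<in>S. (t = s \<or> E t s) \<and> \<not> low t" "u \<in> X1" "E s' u" for u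
      using above[OF that(1,2)] that(3) E_asym by blast
    have preX: "\<exists>w\<in>X. u = g w \<and> \<phi> w = g w" if "u \<in> X" "x \<in> X" "E (g x) u" for u x
      using orbit_closed_pred[OF X(2) that] eq by (auto simp: X1_def)
    have mX: "\<exists>m\<in>X. E m s' \<and> (\<forall>v\<in>X1. m = v \<or> E m v)"
      if hi: "\<forall>t\<in>S. (t = s \<or> E t s) \<and> \<not> low t" and Xne: "X \<noteq> {}"
    proof -
      obtain m where m: "m \<in> X" "\<And>x. x \<in> X \<Longrightarrow> x = m \<or> E m x" by (rule finite_E_min[OF o X(1) Xne], rule that) simp_all
      have mt: "m = t \<or> E m t" if "t \<in> S" for t
      proof -
        have "\<not> low t" using hi that by blast
        then obtain x where x: "x \<in> X" "\<not> E t x" using Xne by (auto simp: low_def)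
        then have "t = x \<or> E x t" using E_total by blast
        then show ?thesis using m(2)[OF x(1)] tr[of m x t] by auto
      qed
      have "E m s'" using mt[OF s] xs(1)[OF m(1)] new m(1) by auto
      moreover have "m = v \<or> E m v" if v: "v \<in> X1" for v
      proof (cases "v \<in> X")
        case True
        then show ?thesis using m(2)[of v] by auto
      next
        case False
        then obtain t where t: "t \<in> T" "v = a t" using v by (auto simp: X1_def)
        have am: "a m = m" using GF_fix[OF a(1), of m] m(1) by simp
        have "m = t \<or> E m t" using mt[of t] ST t(1) by simp
        then show ?thesis
        proof
          assume "m = t"
          then show ?thesis using am t(2) by simp
        next
          assume "E m t"
          then show ?thesis using tx(2)[OF m(1), of t] t(2) by simp
        qed
      qed
      ultimately show ?thesis using m(1) by (intro bexI[of _ m]) auto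
    qed
    fix v u assume v: "v \<in> X1" and u: "u \<in> X1"
    show "E (g (g v)) u" if vs: "E (g v) s'" and su: "E (\<phi> s') u"
      using ext
    proof
      assume "(\<forall>t\<in>S. t = s \<or> E s t) \<and> low s"
      then have "E s' v" using below v by simp
      then have "E s' (g v)" using g(2) by (rule tr)
      then show ?thesis using vs E_asym by blast
    next
      assume hi: "\<forall>t\<in>S. (t = s \<or> E t s) \<and> \<not> low t"
      have "E s' u" using Es' su by (rule tr)
      then have uX: "u \<in> X" by (rule not_above[OF hi u])
      then have "X \<noteq> {}" by auto
      from mX[OF hi this] obtain m where m: "m \<in> X" "E m s'" by auto
      have "E (g m) (\<phi> s')" using G_E[OF phi, of m s'] m eq[of m] by (simp add: X1_def)
      then have "E (g m) u" using su by (rule tr)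
      then obtain w where w: "w \<in> X" "u = g w" "\<phi> w = g w" using preX[OF uX m(1)] by auto
      then have "E s' w" using su G_E[OF phi, of s' w] by simp
      with vs have "E (g v) w" by (rule tr)
      then show ?thesis using w gmono by simp
    qed
    show "E u (g (g v))" if sv: "E s' (g v)" and us: "E u (\<phi> s')"
      using ext
    proof
      assume "(\<forall>t\<in>S. t = s \<or> E s t) \<and> low s"
      then have "E s' v" using below v by simp
      then have "E (\<phi> s') (g v)" using G_E[OF phi, of s' v] eq[OF v] by simp
      with us have "E u (g v)" by (rule tr)
      then show ?thesis using g(2) by (rule tr)
    next
      assume hi: "\<forall>t\<in>S. (t = s \<or> E t s) \<and> \<not> low t"
      have gg: "E (g v) (g (g v))" by (rule g(2))
      show ?thesis
      proof (cases "E s' u")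
        case False
        then have "u = s' \<or> E u s'" using E_total[of u s'] by auto
        then have "E u (g v)" using sv tr[of u s' "g v"] by auto
        then show ?thesis using gg by (rule tr)
      next
        case True
        then have uX: "u \<in> X" by (rule not_above[OF hi u])
        then have "X \<noteq> {}" by auto
        from mX[OF hi this] obtain m where m: "m \<in> X" "E m s'" "\<forall>v\<in>X1. m = v \<or> E m v" by (elim bexE conjE) (rule that, assumption+)
        show ?thesis
        proof (cases "E (g m) u")
          case True
          then obtain w where w: "w \<in> X" "u = g w" "\<phi> w = g w" using preX[OF uX m(1)] by auto
          then have "E w s'" using us G_E[OF phi, of w s'] by simp
          then have "E w (g v)" using sv by (rule tr)
          then show ?thesis using w gmono by simp
        next
          case False
          then have "u = g m \<or> E u (g m)" using E_total[of u "g m"] by auto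
          moreover have "g m = g v \<or> E (g m) (g v)" using m(3) v gmono[of m v] by auto
          ultimately have "u = g v \<or> E u (g v)" using tr[of u "g m" "g v"] by auto
          then show ?thesis using gg tr[of u "g v" "g (g v)"] by auto
        qed
      qed
    qed
  qed
  have i: "ind2 ind (insert s T) X (g ` X) (\<psi> ` insert s T)" using Suc(5) ST by simp
  have ga: "\<And>t. t \<in> T \<Longrightarrow> g (a t) = a (\<psi> t)" using a(2) by blast
  have "\<exists>b\<in>GF (X \<union> g ` X). (\<forall>t\<in>insert s T. g (b t) = b (\<psi> t)) \<and> b ` T = a ` T \<and>
      (b s \<in> X \<union> b ` T \<or> b s \<notin> near g (X \<union> b ` T))"
    by (rule full_insert[OF g X(1) T(1) psi Es i a(1) ga]) (use gc in \<open>simp_all add: \<phi>_def X1_def s'_def\<close>)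
  then show ?case unfolding ST(1) by (elim bexE conjE) (rule bexI)
qed

end

section \<open>Hulls\<close>

context expansion
begin

definition archimedean :: "('a \<Rightarrow> 'a) \<Rightarrow> bool" where
  "archimedean g \<longleftrightarrow> (\<forall>x y. \<exists>n. E y ((g ^^ n) x))"

text \<open>The elements that turn out to move maximally and to be compatible. In an order the orbits have to be cofinal in
order that the part of an orbit between two points is finite; the construction of finite full sets rests on this.\<close>

definition maximal_mover :: "('a \<Rightarrow> 'a) \<Rightarrow> bool" where
  "maximal_mover g \<longleftrightarrow> g \<in> G \<and> (\<forall>x. E x (g x)) \<and> displaces (\<lambda>X x Y y. ind2 ind {x} X Y {y}) g \<and>
     (ord \<longrightarrow> archimedean g)"

lemma maximal_moverD:
  assumes "maximal_mover g"
  shows "g \<in> G" "\<And>x. E x (g x)" "displaces (\<lambda>X x Y y. ind2 ind {x} X Y {y}) g" "ord \<Longrightarrow> archimedean g"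
  using assms unfolding maximal_mover_def by blast+

lemma maximal_mover_conj:
  assumes g: "maximal_mover g" and b: "b \<in> G"
  shows "maximal_mover (iv b \<circ> g \<circ> b)"
proof -
  note gD = maximal_moverD[OF g]
  let ?f = "iv b \<circ> g \<circ> b"
  have f: "?f \<in> G" by (intro G_comp G_iv gD(1) b)
  moreover have "E x (?f x)" for x
    using G_E[OF G_iv[OF b], of "b x" "g (b x)"] gD(2)[of "b x"] b by simp
  moreover have "displaces (\<lambda>X x Y y. ind2 ind {x} X Y {y}) ?f"
    unfolding displaces_def
  proof (intro allI impI)
    fix X c assume X: "finite X" "c \<notin> (X :: 'a set)"
    have "finite (b ` X)" "b c \<notin> b ` X" using X G_in_img[OF b] by auto
    then obtain a where a: "a \<in> GF (b ` X)" "ind2 ind {a (b c)} (b ` X) (g ` b ` X) {g (a (b c))}"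
      by (rule displacesD[OF gD(3)])
    define d where "d = iv b \<circ> a \<circ> b"
    have "d \<in> G" unfolding d_def by (intro G_comp G_iv GF_G[OF a(1)] b)
    moreover have "d u = u" if "u \<in> X" for u using GF_fix[OF a(1), of "b u"] that b by (simp add: d_def)
    ultimately have d: "d \<in> GF X" by (simp add: GF_def)
    have "ind2 ind (iv b ` {a (b c)}) (iv b ` b ` X) (iv b ` g ` b ` X) (iv b ` {g (a (b c))})"
      using a(2) by (simp only: ind2_G[OF G_iv[OF b]])
    then have "ind2 ind {d c} X (?f ` X) {?f (d c)}" using b by (simp add: d_def image_comp comp_assoc)
    with d show "\<exists>a\<in>GF X. ind2 ind {a c} X (?f ` X) {?f (a c)}" by (intro bexI[of _ d])
  qed
  moreover have "archimedean ?f" if o: ord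
  proof -
    have it: "(?f ^^ n) x = iv b ((g ^^ n) (b x))" for n x
      by (induction n) (use b in simp_all)
    show ?thesis
      unfolding archimedean_def
    proof (intro allI)
      fix x y
      obtain n where "E (b y) ((g ^^ n) (b x))" using gD(4)[OF o] by (auto simp: archimedean_def)
      then have "E (iv b (b y)) (iv b ((g ^^ n) (b x)))" using G_E[OF G_iv[OF b]] by simp
      then show "\<exists>n. E y ((?f ^^ n) x)" using b by (intro exI[of _ n]) (simp only: it G_iv1)
    qed
  qed
  ultimately show ?thesis by (simp add: maximal_mover_def)
qed

text \<open>All segments of orbits between two points of the given set are added. For each pair one segment is enough,
also if the orbit is finite.\<close>

lemma gap_free_hull:
  assumes g: "g \<in> G" and X0: "finite X0"
  shows "\<exists>X. finite X \<and> X0 \<subseteq> X \<and> gap_free g X"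
proof -
  define conn where "conn d e \<longleftrightarrow> (\<exists>j. 1 \<le> j \<and> (g ^^ j) d = e)" for d e
  define J where "J d e = (SOME j. 1 \<le> j \<and> (g ^^ j) d = e)" for d e
  have J: "1 \<le> J d e \<and> (g ^^ J d e) d = e" if "conn d e" for d e
    unfolding J_def by (rule someI_ex) (use that in \<open>simp add: conn_def\<close>)
  define seg where "seg p = (case p of (d, e) \<Rightarrow> (\<lambda>i. (g ^^ i) d) ` {..J d e})" for p
  define X where "X = X0 \<union> (\<Union>p\<in>{p \<in> X0 \<times> X0. conn (fst p) (snd p)}. seg p)"
  have segX: "(g ^^ i) d \<in> X" if "d \<in> X0" "e \<in> X0" "conn d e" "i \<le> J d e" for d e i
    using that by (auto simp: X_def seg_def intro!: bexI[of _ "(d, e)"])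
  have XE: "x \<in> X0 \<or> (\<exists>d e i. d \<in> X0 \<and> e \<in> X0 \<and> conn d e \<and> i \<le> J d e \<and> x = (g ^^ i) d)" if "x \<in> X" for x
    using that by (force simp: X_def seg_def)
  have "gap_free g X"
    unfolding gap_free_def
  proof (intro ballI impI)
    fix x assume x: "x \<in> X" "g (g x) \<in> X"
    have "\<exists>k e. e \<in> X0 \<and> (g ^^ k) (g (g x)) = e"
      using XE[OF x(2)]
    proof (elim disjE exE conjE)
      assume "g (g x) \<in> X0"
      then show ?thesis by (intro exI[of _ 0]) simp
    next
      fix d e i assume de: "d \<in> X0" "e \<in> X0" "conn d e" "i \<le> J d e" "g (g x) = (g ^^ i) d"
      have "(g ^^ (J d e - i)) (g (g x)) = (g ^^ (J d e - i + i)) d" using de(5) by (simp add: funpow_add)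
      also have "\<dots> = e" using de(4) J[OF de(3)] by simp
      finally show ?thesis using de(2) by blast
    qed
    then obtain k e where k: "e \<in> X0" "(g ^^ k) (g (g x)) = e" by blast
    have c: "conn x e"
      unfolding conn_def by (rule exI[of _ "k + 2"]) (use k in \<open>simp add: funpow_add funpow_swap1 numeral_2_eq_2\<close>)
    have x0: "g x \<in> X" if "x \<in> X0"
      using segX[OF that k(1) c, of 1] J[OF c] by simp
    from XE[OF x(1)] show "g x \<in> X"
    proof (elim disjE exE conjE)
      fix d e' i assume de: "d \<in> X0" "e' \<in> X0" "conn d e'" "i \<le> J d e'" "x = (g ^^ i) d"
      show ?thesis
      proof (cases "i = J d e'")
        case True
        then show ?thesis using x0 J[OF de(3)] de(2,5) by simp
      next
        case False
        then show ?thesis using segX[OF de(1-3), of "Suc i"] de(4,5) by simp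
      qed
    qed (rule x0)
  qed
  moreover have "finite X" using X0 by (auto simp: X_def seg_def)
  ultimately show ?thesis by (intro exI[of _ X]) (auto simp: X_def)
qed

text \<open>All points are added that lie between points of the given set and in the orbit of one of them. These are finitely
many, since every orbit leaves every interval.\<close>

lemma orbit_closed_hull:
  assumes o: ord and g: "g \<in> G" "\<And>x. E x (g x)" "archimedean g" and X0: "finite X0"
  shows "\<exists>X. finite X \<and> X0 \<subseteq> X \<and> orbit_closed g X \<and>
    (\<forall>v\<in>X. \<exists>z1\<in>X0. \<exists>z2\<in>X0. (z1 = v \<or> E z1 v) \<and> (v = z2 \<or> E v z2))"
proof -
  define le where "le a b \<longleftrightarrow> a = b \<or> E a b" for a b
  have le_tr: "le a c" if "le a b" "le b c" for a b c
    using that E_trans[OF o, of a b c] by (auto simp: le_def)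
  have le_g: "le (g a) (g b) \<longleftrightarrow> le a b" for a b using G_inj[OF g(1)] G_E[OF g(1)] by (simp add: le_def)
  have g_le: "le a (g a)" for a using g(2) by (simp add: le_def)
  have pow_le: "le ((g ^^ n) a) ((g ^^ n) b) \<longleftrightarrow> le a b" for n a b
    by (induction n) (simp_all add: le_g)
  have pow_mono: "le ((g ^^ i) a) ((g ^^ j) a)" if "i \<le> j" for i j a
    using that
  proof (induction rule: dec_induct)
    case base
    show ?case by (simp add: le_def)
  next
    case (step n)
    then show ?case using le_tr[OF step.IH g_le] by simp
  qed
  have not_le: "\<not> le b a" if "E a b" for a b using that E_asym E_irrefl by (auto simp: le_def)
  define X where "X = {v. (\<exists>z\<in>X0. le z v) \<and> (\<exists>z\<in>X0. le v z) \<and> (\<exists>d\<in>X0. \<exists>j. (g ^^ j) v = d \<or> (g ^^ j) d = v)}"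
  define up where "up d z = {v. le v z \<and> (\<exists>j. (g ^^ j) d = v)}" for d z
  define down where "down d z = {v. le z v \<and> (\<exists>j. (g ^^ j) v = d)}" for d z
  have "finite (up d z)" for d z
  proof -
    obtain N where N: "E z ((g ^^ N) d)" using g(3) by (auto simp: archimedean_def)
    have "j < N" if "le ((g ^^ j) d) z" for j
    proof (rule ccontr)
      assume "\<not> j < N"
      then have "le ((g ^^ N) d) ((g ^^ j) d)" by (intro pow_mono) simp
      then have "le ((g ^^ N) d) z" using that by (rule le_tr)
      then show False using not_le[OF N] by simp
    qed
    then have "up d z \<subseteq> (\<lambda>j. (g ^^ j) d) ` {..<N}" by (auto simp: up_def)
    then show ?thesis by (rule finite_subset) simp
  qed
  moreover have "finite (down d z)" for d z
  proof -
    obtain N where N: "E d ((g ^^ N) z)" using g(3) by (auto simp: archimedean_def)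
    have j: "j < N" if "le z v" "(g ^^ j) v = d" for j v
    proof (rule ccontr)
      assume "\<not> j < N"
      then have "le ((g ^^ N) z) ((g ^^ j) z)" by (intro pow_mono) simp
      moreover have "le ((g ^^ j) z) ((g ^^ j) v)" using that(1) by (simp add: pow_le)
      ultimately have "le ((g ^^ N) z) d" using that(2) le_tr by simp
      then show False using not_le[OF N] by simp
    qed
    have inj: "inj (g ^^ j)" for j using G_bij[OF g(1)] by (simp add: bij_is_inj)
    have "v = inv_into UNIV (g ^^ j) d" if "(g ^^ j) v = d" for j v
      using that inj[of j] by (simp add: inv_f_eq)
    then have "down d z \<subseteq> (\<lambda>j. inv_into UNIV (g ^^ j) d) ` {..<N}"
      using j unfolding down_def by blast
    then show ?thesis by (rule finite_subset) simp
  qed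
  moreover have "X \<subseteq> (\<Union>d\<in>X0. \<Union>z\<in>X0. up d z \<union> down d z)"
    by (auto simp: X_def up_def down_def)
  ultimately have "finite X" using X0 by (elim finite_subset) auto
  moreover have "X0 \<subseteq> X"
  proof
    fix v assume "v \<in> X0"
    moreover have "le v v" "(g ^^ 0) v = v" by (simp_all add: le_def)
    ultimately show "v \<in> X" unfolding X_def by blast
  qed
  moreover have "orbit_closed g X"
    unfolding orbit_closed_def
  proof (intro conjI ballI impI)
    fix u assume u: "u \<in> X" "\<exists>x\<in>X. g x = u \<or> E (g x) u"
    then obtain x where x: "x \<in> X" "le (g x) u" by (auto simp: le_def)
    define v where "v = iv g u"
    have gv: "g v = u" using g(1) by (simp add: v_def)
    have "le x v" using x(2) le_g[of x v] gv by simp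
    then have 1: "\<exists>z\<in>X0. le z v" using x(1) le_tr unfolding X_def by blast
    have "le v u" using g_le[of v] gv by simp
    then have 2: "\<exists>z\<in>X0. le v z" using u(1) le_tr unfolding X_def by blast
    obtain d j where d: "d \<in> X0" "(g ^^ j) u = d \<or> (g ^^ j) d = u" using u(1) unfolding X_def by blast
    have "\<exists>j. (g ^^ j) v = d \<or> (g ^^ j) d = v"
      using d(2)
    proof
      assume "(g ^^ j) u = d"
      then have "(g ^^ Suc j) v = d" using gv by (simp add: funpow_swap1)
      then show ?thesis by blast
    next
      assume dj: "(g ^^ j) d = u"
      show ?thesis
      proof (cases j)
        case 0
        then have "(g ^^ 1) v = d" using dj gv by simp
        then show ?thesis by blast
      next
        case (Suc i)
        then have "g ((g ^^ i) d) = g v" using dj gv by simp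
        then have "(g ^^ i) d = v" using G_inj[OF g(1)] by blast
        then show ?thesis by blast
      qed
    qed
    then have "v \<in> X" using 1 2 d(1) unfolding X_def by blast
    then show "u \<in> g ` X" using gv by blast
  next
    fix v assume v: "v \<in> X" "\<exists>x\<in>X. g v = x \<or> E (g v) x"
    then obtain x where x: "x \<in> X" "le (g v) x" by (auto simp: le_def)
    have 1: "\<exists>z\<in>X0. le z (g v)" using v(1) le_tr[OF _ g_le] unfolding X_def by blast
    have 2: "\<exists>z\<in>X0. le (g v) z" using x le_tr unfolding X_def by blast
    obtain d j where d: "d \<in> X0" "(g ^^ j) v = d \<or> (g ^^ j) d = v" using v(1) unfolding X_def by blast
    have "\<exists>j. (g ^^ j) (g v) = d \<or> (g ^^ j) d = g v"
      using d(2)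
    proof
      assume dj: "(g ^^ j) v = d"
      show ?thesis
      proof (cases j)
        case 0
        then have "(g ^^ 1) d = g v" using dj by simp
        then show ?thesis by blast
      next
        case (Suc i)
        then have "(g ^^ i) (g v) = d" using dj by (simp add: funpow_swap1)
        then show ?thesis by blast
      qed
    next
      assume "(g ^^ j) d = v"
      then have "(g ^^ Suc j) d = g v" by simp
      then show ?thesis by blast
    qed
    then show "g v \<in> X" using 1 2 d(1) unfolding X_def by blast
  qed
  moreover have "\<forall>v\<in>X. \<exists>z1\<in>X0. \<exists>z2\<in>X0. (z1 = v \<or> E z1 v) \<and> (v = z2 \<or> E v z2)"
    unfolding X_def le_def by blast
  ultimately show ?thesis by (intro exI[of _ X]) simp
qed

text \<open>In an order the hull of a set stays within its convex hull. This is used when a hull of \<open>Z\<close> is compared with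
the points of \<open>Z\<close> alone.\<close>

definition hull_of :: "('a \<Rightarrow> 'a) \<Rightarrow> 'a set \<Rightarrow> 'a set \<Rightarrow> bool" where
  "hull_of g X0 X \<longleftrightarrow> finite X \<and> X0 \<subseteq> X \<and> (if ord then orbit_closed g X \<and>
     (\<forall>v\<in>X. \<exists>z1\<in>X0. \<exists>z2\<in>X0. (z1 = v \<or> E z1 v) \<and> (v = z2 \<or> E v z2)) else gap_free g X)"

lemma hull_exists: "maximal_mover g \<Longrightarrow> finite X0 \<Longrightarrow> \<exists>X. hull_of g X0 X"
  unfolding hull_of_def maximal_mover_def
  using gap_free_hull[of g X0] orbit_closed_hull[of g X0] by (cases ord) auto

lemma full_hull:
  assumes g: "maximal_mover g" and X: "hull_of g X0 X" and psi: "\<psi> \<in> G" "\<And>u. u \<in> X \<Longrightarrow> \<psi> u = g u"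
    and S: "finite S" "\<And>s. s \<in> S \<Longrightarrow> E s (\<psi> s)" "ind2 ind S X (g ` X) (\<psi> ` S)"
  shows "\<exists>a\<in>GF (X \<union> g ` X). \<forall>s\<in>S. g (a s) = a (\<psi> s)"
proof (cases ord)
  case True
  show ?thesis
    by (rule full_order[OF True maximal_moverD(1-3)[OF g] _ _ psi S]) (use X[unfolded hull_of_def] True in simp_all)
next
  case False
  have "\<exists>a\<in>GF (X \<union> g ` X). (\<forall>s\<in>S. g (a s) = a (\<psi> s)) \<and> gap_free g (X \<union> a ` S)"
    by (rule full_tournament[OF False maximal_moverD(1-3)[OF g] _ _ psi S]) (use X[unfolded hull_of_def] False in simp_all)
  then show ?thesis by (elim bexE conjE) (rule bexI)
qed

section \<open>Maximal movers move maximally and are compatible\<close>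

lemma Aut_expand: "Aut (expand M E) = G"
proof -
  have "rel (expand M E) r xs \<longleftrightarrow> (case r of Inl r' \<Rightarrow> rel M r' xs | Inr _ \<Rightarrow> \<exists>a b. xs = [a, b] \<and> E a b)" for r xs
    by (simp add: expand_def bin_struct_def split: sum.splits)
  note rels = this
  have u: "univ (expand M E) = UNIV" by (simp add: expand_def univ_M)
  have "f \<in> Aut (expand M E) \<longleftrightarrow> f \<in> G" for f
  proof
    assume f: "f \<in> Aut (expand M E)"
    then have b: "bij f" "\<And>r xs. rel (expand M E) r (map f xs) \<longleftrightarrow> rel (expand M E) r xs"
      by (simp_all add: Aut_iff[OF u])
    have "rel M r (map f xs) \<longleftrightarrow> rel M r xs" for r xs using b(2)[of "Inl r" xs] by (simp add: rels)
    moreover have "E (f x) (f y) \<longleftrightarrow> E x y" for x y using b(2)[of "Inr ()" "[x, y]"] by (simp add: rels)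
    ultimately show "f \<in> G" using b(1) by (simp add: G_def Aut_iff[OF univ_M])
  next
    assume f: "f \<in> G"
    have "rel (expand M E) r (map f xs) \<longleftrightarrow> rel (expand M E) r xs" for r xs
    proof (cases r)
      case (Inl r')
      then show ?thesis using G_Aut[OF f] by (simp add: rels Aut_iff[OF univ_M])
    next
      case (Inr r')
      have "(\<exists>a b. map f xs = [a, b] \<and> E a b) \<longleftrightarrow> (\<exists>a b. xs = [a, b] \<and> E a b)"
        using G_E[OF f] by (auto simp: map_eq_Cons_conv)
      then show ?thesis using Inr by (simp add: rels)
    qed
    then show "f \<in> Aut (expand M E)" using G_bij[OF f] by (simp add: Aut_iff[OF u])
  qed
  then show ?thesis by blast
qed

lemma Fix_expand: "Fix (expand M E) X = GF X"
  by (simp add: Fix_def GF_def Aut_expand)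

lemma tp_expand_iff: "tp (expand M E) X x = tp (expand M E) X y \<longleftrightarrow> (\<exists>f\<in>GF X. map f x = y)"
  using tp_eq_iff[of "expand M E" X x y] by (simp add: Fix_expand) (simp add: expand_def univ_M)

lemma univ_bin: "univ (bin_struct E) = UNIV"
  by (simp add: bin_struct_def)

lemma Aut_bin: "f \<in> Aut (bin_struct E) \<longleftrightarrow> bij f \<and> (\<forall>a b. E (f a) (f b) \<longleftrightarrow> E a b)"
proof
  assume f: "f \<in> Aut (bin_struct E)"
  then have b: "bij f" "\<And>r xs. rel (bin_struct E) r (map f xs) \<longleftrightarrow> rel (bin_struct E) r xs"
    by (simp_all add: Aut_iff[OF univ_bin])
  have "E (f x) (f y) \<longleftrightarrow> E x y" for x y using b(2)[of "()" "[x, y]"] by (simp add: bin_struct_def)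
  then show "bij f \<and> (\<forall>a b. E (f a) (f b) \<longleftrightarrow> E a b)" using b(1) by simp
next
  assume f: "bij f \<and> (\<forall>a b. E (f a) (f b) \<longleftrightarrow> E a b)"
  have "(\<exists>a b. map f xs = [a, b] \<and> E a b) \<longleftrightarrow> (\<exists>a b. xs = [a, b] \<and> E a b)" for xs
    using f by (auto simp: map_eq_Cons_conv)
  moreover have "rel (bin_struct E) r xs \<longleftrightarrow> (\<exists>a b. xs = [a, b] \<and> E a b)" for r xs
    by (simp add: bin_struct_def)
  ultimately show "f \<in> Aut (bin_struct E)" using f by (simp add: Aut_iff[OF univ_bin])
qed

lemma tp_bin_E:
  assumes "E x y" "tp (bin_struct E) {x} [z] = tp (bin_struct E) {x} [y]"
  shows "E x z"
proof -
  obtain f where "f \<in> Fix (bin_struct E) {x}" "f y = z"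
    using assms(2) tp_eq_iff[of "bin_struct E" "{x}" "[y]" "[z]"] by (auto simp: bin_struct_def)
  then have f: "f x = x" "f \<in> Aut (bin_struct E)" "f y = z" by (simp_all add: Fix_def)
  then have "\<forall>a b. E (f a) (f b) \<longleftrightarrow> E a b" using Aut_bin by blast
  then have "E (f x) (f y)" using assms(1) by blast
  then show ?thesis using f by simp
qed

lemma tp_bin_realized:
  assumes "E x y" "E x z" shows "[z] \<in> tp (bin_struct E) {x} [y]"
proof -
  have "x \<noteq> y" "x \<noteq> z" using assms E_irrefl by auto
  then have "partial_E_iso {(x, x), (y, z)}"
    using assms E_irrefl E_asym by (auto simp: partial_E_iso_def)
  then obtain k where "bij k" "\<And>a b. (a, b) \<in> {(x, x), (y, z)} \<Longrightarrow> k a = b" "\<And>a b. E (k a) (k b) \<longleftrightarrow> E a b"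
    using E_homogeneous[of "{(x, x), (y, z)}"] by auto
  then show ?thesis by (auto simp: tp_def Fix_def Aut_bin)
qed

text \<open>A tuple is moved maximally entry by entry, each over the parameters and the preceding entries.\<close>

lemma maximal_mover_moves_maximally:
  assumes g: "maximal_mover g" shows "moves_maximally M E ind g"
  unfolding moves_maximally_def
proof (intro conjI allI impI)
  note gD = maximal_moverD[OF g]
  show "L2_homogeneous E g"
    unfolding L2_homogeneous_def
  proof (intro allI)
    fix x y
    have E: "E x (g x)" "E y (g y)" using gD(2) by auto
    then have ne: "x \<noteq> g x" "y \<noteq> g y" using E_irrefl by metis+
    have "partial_E_iso {(x, y), (g x, g y)}"
      using E ne E_irrefl E_asym by (auto simp: partial_E_iso_def)
    then obtain k where "bij k" "\<And>a b. (a, b) \<in> {(x, y), (g x, g y)} \<Longrightarrow> k a = b"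
      "\<And>a b. E (k a) (k b) \<longleftrightarrow> E a b"
      using E_homogeneous[of "{(x, y), (g x, g y)}"] by auto
    then have "k \<in> Fix (bin_struct E) {}" "map k [x, g x] = [y, g y]" by (auto simp: Fix_def Aut_bin)
    then show "tp (bin_struct E) {} [x, g x] = tp (bin_struct E) {} [y, g y]"
      using tp_eq_iff[of "bin_struct E" "{}"] by (auto simp: bin_struct_def)
  qed
  fix X c assume X: "finite X \<and> infinite (tp (expand M E) X c)"
  have main: "\<exists>a\<in>GF X. ind2 ind (a ` S) X (g ` X) (g ` a ` S)" if "finite S" for S
    using that
  proof induction
    case empty
    show ?case by (intro bexI[of _ id]) (auto simp: ind2_def intro: ind_base ind_base_right)
  next
    case (insert s S)
    then obtain a where a: "a \<in> GF X" "ind2 ind (a ` S) X (g ` X) (g ` a ` S)" by blast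
    show ?case
    proof (cases "a s \<in> X \<union> a ` S")
      case True
      then have "ind2 ind (a ` S \<union> {a s}) X (g ` X) (g ` a ` S \<union> {g (a s)})"
        by (intro ind2_absorb a(2)) auto
      then show ?thesis using a(1) by (intro bexI[of _ a]) auto
    next
      case False
      have "finite (X \<union> a ` S)" using X insert by simp
      then obtain b where b: "b \<in> GF (X \<union> a ` S)"
        "ind2 ind {b (a s)} (X \<union> a ` S) (g ` (X \<union> a ` S)) {g (b (a s))}"
        using displacesD[OF gD(3) _ False] by blast
      have "ind2 ind (a ` S \<union> {b (a s)}) X (g ` X) (g ` a ` S \<union> {g (b (a s))})"
        by (rule ind2_insert[OF a(2)]) (use b(2) in \<open>simp add: image_Un\<close>)
      moreover have "(b \<circ> a) ` insert s S = a ` S \<union> {b (a s)}"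
      proof -
        have "b ` a ` S = a ` S" by (rule GF_img[OF b(1)]) auto
        then show ?thesis by (simp add: image_comp)
      qed
      moreover have "b \<circ> a \<in> GF X" using GF_comp[OF GF_mono[OF b(1)] a(1)] by auto
      ultimately show ?thesis by (intro bexI[of _ "b \<circ> a"]) simp_all
    qed
  qed
  obtain a where a: "a \<in> GF X" "ind2 ind (a ` set c) X (g ` X) (g ` a ` set c)" using main[of "set c"] by auto
  then have "map a c \<in> tp (expand M E) X c" by (auto simp: tp_def Fix_expand)
  then show "\<exists>x\<in>tp (expand M E) X c. ind2 ind (set x) X (g ` X) (g ` set x)"
    using a(2) by (intro bexI[of _ "map a c"]) simp_all
qed

lemma conjug_eq: "conjug g b = iv b \<circ> g \<circ> b"
  by (simp add: conjug_def)

text \<open>Conjugating \<open>g\<close> by \<open>a\<close> to send \<open>x\<close> to \<open>y\<close> means that \<open>g\<close> sends \<open>a x\<close> to \<open>a y\<close>, so the points have to be moved onto the graph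
of \<open>g\<close>.\<close>

lemma maximal_mover_full_for:
  assumes g: "maximal_mover g" and X: "hull_of g X0 X" shows "full_for M E ind g X"
  unfolding full_for_def
proof (intro allI impI, elim conjE)
  note gD = maximal_moverD[OF g]
  fix x y
  assume t: "tp (expand M E) (g ` X) (map g x) = tp (expand M E) (g ` X) y"
    and L2: "\<forall>i<length x. tp (bin_struct E) {x ! i} [y ! i] = tp (bin_struct E) {x ! i} [g (x ! i)]"
    and i: "ind2 ind (set x) X (g ` X) (set y)"
  obtain p where p: "p \<in> GF (g ` X)" "map p (map g x) = y" using t tp_expand_iff by blast
  define \<psi> where "\<psi> = p \<circ> g"
  have y: "y = map \<psi> x" using p(2) by (simp add: \<psi>_def)
  have psi: "\<psi> \<in> G" using G_comp[OF GF_G[OF p(1)] gD(1)] by (simp add: \<psi>_def)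
  have psiX: "\<psi> u = g u" if "u \<in> X" for u using GF_fix[OF p(1), of "g u"] that by (simp add: \<psi>_def)
  have E: "E s (\<psi> s)" if s: "s \<in> set x" for s
  proof -
    obtain i where i: "i < length x" "s = x ! i" using s by (auto simp: in_set_conv_nth)
    then have "tp (bin_struct E) {s} [\<psi> s] = tp (bin_struct E) {s} [g s]" using L2 y by simp
    then show ?thesis using tp_bin_E[OF gD(2)] by blast
  qed
  have "ind2 ind (set x) X (g ` X) (\<psi> ` set x)" using i y by simp
  then obtain a where a: "a \<in> GF (X \<union> g ` X)" "\<forall>s\<in>set x. g (a s) = a (\<psi> s)"
    using full_hull[OF g X psi psiX _ E] by auto
  have "map (conjug g a) x = y" using a(2) GF_G[OF a(1)] y by (simp add: conjug_def)
  then show "\<exists>a\<in>Fix (expand M E) (X \<union> g ` X). map (conjug g a) x = y"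
    using a(1) by (auto simp: Fix_expand)
qed

text \<open>The points of \<open>T\<close> can be moved over \<open>Y\<close>, without changing the \<open>E\<close>-type of \<open>T\<close> over \<open>Y\<close>, above prescribed
  bounds: in an order this is done in increasing order, so that the upper bounds come from \<open>Y\<close> only.\<close>

lemma push_up:
  assumes Y: "finite Y" and T: "finite T" "T \<inter> Y = {}" and N: "finite N"
    and B: "\<And>q. q \<in> T \<Longrightarrow> B q \<subseteq> N" "\<And>q. q \<in> T \<Longrightarrow> cut E ord (B q) {u \<in> Y. E q u}"
  shows "\<exists>\<theta>. bij \<theta> \<and> (\<forall>a b. E (\<theta> a) (\<theta> b) \<longleftrightarrow> E a b) \<and> (\<forall>u\<in>Y. \<theta> u = u) \<and>
    (\<forall>q\<in>T. \<theta> q \<notin> N \<and> (\<forall>p\<in>B q. E p (\<theta> q)))"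
  using T B
proof (induction "card T" arbitrary: T)
  case 0
  then show ?case by (intro exI[of _ id]) (auto simp: bij_def)
next
  case (Suc n)
  have ne: "T \<noteq> {}" using Suc(2) by auto
  obtain q where q: "q \<in> T" "\<And>t. ord \<Longrightarrow> t \<in> T \<Longrightarrow> t = q \<or> E t q"
  proof (cases ord)
    case True
    show ?thesis by (rule finite_E_max[OF True Suc(3) ne]) (use that in blast)
  next
    case False
    then show ?thesis using that ne by blast
  qed
  define S where "S = T - {q}"
  have S: "finite S" "n = card S" "S \<inter> Y = {}" "q \<notin> Y" "q \<notin> S" using Suc(2-4) q(1) by (auto simp: S_def)
  have "\<exists>\<theta>. bij \<theta> \<and> (\<forall>a b. E (\<theta> a) (\<theta> b) \<longleftrightarrow> E a b) \<and> (\<forall>u\<in>Y. \<theta> u = u) \<and>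
    (\<forall>q\<in>S. \<theta> q \<notin> N \<and> (\<forall>p\<in>B q. E p (\<theta> q)))"
    by (rule Suc(1)[OF S(2,1,3)]) (use Suc(5,6) in \<open>simp_all add: S_def\<close>)
  then obtain \<theta> where th: "bij \<theta>" "\<And>a b. E (\<theta> a) (\<theta> b) \<longleftrightarrow> E a b" "\<And>u. u \<in> Y \<Longrightarrow> \<theta> u = u"
    "\<And>q. q \<in> S \<Longrightarrow> \<theta> q \<notin> N" "\<And>q p. q \<in> S \<Longrightarrow> p \<in> B q \<Longrightarrow> E p (\<theta> q)" by (elim exE conjE) simp
  have inj: "\<theta> a = \<theta> b \<longleftrightarrow> a = b" for a b using th(1) by (auto simp: bij_def dest: injD)
  define L where "L = \<theta> ` {l \<in> Y \<union> S. E l q} \<union> B q"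
  define U where "U = \<theta> ` {u \<in> Y \<union> S. E q u}"
  have fin: "finite L" "finite U" using Y S(1) finite_subset[OF Suc(5)[OF q(1)] N] by (auto simp: L_def U_def)
  have "cut E ord L U"
    unfolding cut_def
  proof (intro ballI)
    fix l u assume l: "l \<in> L" and "u \<in> U"
    then obtain u0 where u: "u0 \<in> Y \<union> S" "E q u0" "u = \<theta> u0" by (auto simp: U_def)
    from l show "l \<noteq> u \<and> (ord \<longrightarrow> E l u)"
      unfolding L_def
    proof
      assume "l \<in> \<theta> ` {l \<in> Y \<union> S. E l q}"
      then obtain l0 where l: "E l0 q" "l = \<theta> l0" by blast
      have "l0 \<noteq> u0" using l u E_asym by blast
      moreover have "E l0 u0" if ord using E_trans[OF that l(1) u(2)] .
      ultimately show ?thesis using l u inj th(2) by simp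
    next
      assume l: "l \<in> B q"
      show ?thesis
      proof (cases "u0 \<in> Y")
        case True
        then show ?thesis using Suc(6)[OF q(1)] l u th(3) by (auto simp: cut_def)
      next
        case False
        then have u0: "u0 \<in> S" using u by blast
        have "\<not> ord" using q(2)[of u0] u0 u(2) E_asym E_irrefl by (auto simp: S_def)
        moreover have "l \<noteq> u" using th(4)[OF u0] Suc(5)[OF q(1)] l u(3) by auto
        ultimately show ?thesis by simp
      qed
    qed
  qed
  then obtain \<sigma> where sg: "ind {\<sigma> q} {} N" "\<forall>l\<in>L. E l (\<sigma> q)" "\<forall>u\<in>U. E (\<sigma> q) u"
    using extend[OF fin _ _ N, of "{}" q] by auto
  define w where "w = \<sigma> q"
  have w: "w \<notin> N" "\<And>l. l \<in> L \<Longrightarrow> E l w" "\<And>u. u \<in> U \<Longrightarrow> E w u"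
    using ind_disjoint[OF sg(1)] sg(2,3) by (auto simp: w_def)
  define r where "r = insert (q, w) ((\<lambda>a. (a, \<theta> a)) ` (Y \<union> S))"
  have qw: "(a = q \<longleftrightarrow> \<theta> a = w) \<and> (E a q \<longleftrightarrow> E (\<theta> a) w) \<and> (E q a \<longleftrightarrow> E w (\<theta> a))" if a: "a \<in> Y \<union> S" for a
  proof -
    have aq: "a \<noteq> q" using a S(4,5) by auto
    show ?thesis
    proof (cases "E a q")
      case True
      then have "\<theta> a \<in> L" using a by (simp add: L_def)
      then have "E (\<theta> a) w" by (rule w(2))
      then show ?thesis using True aq E_asym E_irrefl by metis
    next
      case False
      then have qa: "E q a" using aq E_total by blast
      then have "\<theta> a \<in> U" using a by (simp add: U_def)
      then have "E w (\<theta> a)" by (rule w(3))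
      then show ?thesis using qa aq E_asym E_irrefl by metis
    qed
  qed
  have "partial_E_iso r"
  proof (rule partial_E_isoI)
    fix a b c d assume ab: "(a, b) \<in> r" and cd: "(c, d) \<in> r"
    have 1: "a = q \<and> b = w \<or> a \<in> Y \<union> S \<and> b = \<theta> a" using ab by (auto simp: r_def)
    have 2: "c = q \<and> d = w \<or> c \<in> Y \<union> S \<and> d = \<theta> c" using cd by (auto simp: r_def)
    from 1 2 show "(a = c \<longleftrightarrow> b = d) \<and> (E a c \<longleftrightarrow> E b d)"
    proof (elim disjE conjE)
      assume "a = q" "b = w" "c = q" "d = w"
      then show ?thesis using E_irrefl by simp
    next
      assume "a = q" "b = w" "c \<in> Y \<union> S" "d = \<theta> c"
      then show ?thesis using qw[of c] by auto
    next
      assume "a \<in> Y \<union> S" "b = \<theta> a" "c = q" "d = w"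
      then show ?thesis using qw[of a] by auto
    next
      assume "b = \<theta> a" "d = \<theta> c"
      then show ?thesis using inj th(2) by simp
    qed
  qed
  moreover have "finite r" using Y S(1) by (simp add: r_def)
  ultimately obtain k where k: "bij k" "\<And>a b. (a, b) \<in> r \<Longrightarrow> k a = b" "\<And>a b. E (k a) (k b) \<longleftrightarrow> E a b"
    using E_homogeneous by metis
  have kq: "k q = w" and ka: "k a = \<theta> a" if "a \<in> Y \<union> S" for a using k(2) that by (auto simp: r_def)
  show ?case
  proof (intro exI[of _ k] conjI allI ballI)
    fix u assume "u \<in> Y"
    then show "k u = u" using ka[of u] th(3) by simp
  next
    fix t assume t: "t \<in> T"
    have kq: "k q = w" using k(2) by (simp add: r_def)
    show "k t \<notin> N"
    proof (cases "t = q")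
      case False
      then have "t \<in> S" using t by (simp add: S_def)
      then show ?thesis using ka[of t] th(4) by simp
    qed (use kq w(1) in simp)
    fix p assume p: "p \<in> B t"
    show "E p (k t)"
    proof (cases "t = q")
      case True
      then show ?thesis using kq w(2)[of p] p by (simp add: L_def)
    next
      case False
      then have "t \<in> S" using t by (simp add: S_def)
      then show ?thesis using ka[of t] th(5) p by simp
    qed
  qed (use k(1,3) in auto)
qed

text \<open>Let \<open>f = g\<^sup>b\<close> and let \<open>q\<close> take the entries of \<open>z\<close> to those of \<open>x\<close>. For \<open>Z'\<close> a hull of \<open>Z\<close> is taken, and for \<open>b'\<close> an
automorphism \<open>c\<close> that makes the entries of \<open>z\<close> and \<open>x\<close> generic over \<open>Y \<union> Z\<close>. What remains is a common realization of
the types in \<open>E\<close>: the points \<open>f (c s)\<close> with \<open>s\<close> in \<open>z\<close> have to be moved over \<open>Y'\<close> above \<open>c s\<close> and \<open>c (q s)\<close>. In a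
tournament this is possible as \<open>c s\<close> and \<open>c (q s)\<close> are outside \<open>Y'\<close>. In an order it has to be shown that every point of
\<open>Y'\<close> above \<open>f (c s)\<close> is above \<open>c s\<close>, as \<open>f\<close> is increasing, and above \<open>c (q s)\<close>.\<close>

lemma maximal_mover_compatible:
  assumes g: "maximal_mover g" shows "compatible M E ind g"
  unfolding compatible_def
proof (intro allI impI)
  note gD = maximal_moverD[OF g]
  fix X0 :: "'a set" assume "finite X0"
  then obtain X where X: "hull_of g X0 X" using hull_exists[OF g] by blast
  then have finX: "finite X" "X0 \<subseteq> X" by (simp_all add: hull_of_def)
  define Y where "Y = g ` X"
  show "\<exists>X Y. finite X \<and> X0 \<subseteq> X \<and> Y = g ` X \<and>
          full_for M E ind g X \<and>
          (\<forall>b Z x z. b \<in> Aut (expand M E) \<and> finite Z \<and> conjug g b ` Z = Y \<and>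
             tp (expand M E) Y (map (conjug g b) z) = tp (expand M E) Y (map g x) \<and>
             ind (set z) Z (Y \<union> X) \<and> ind (set x) X (Y \<union> Z) \<longrightarrow>
             (\<exists>b' \<in> Fix (expand M E) (Y \<union> Z). \<exists>Z' Y'.
                finite Z' \<and> Z \<subseteq> Z' \<and> Y' = conjug g b ` Z' \<and>
                full_for M E ind (conjug g b) Z' \<and>
                tp (expand M E) Y (map (conjug g (b \<circ> b')) z)
                  = tp (expand M E) Y (map (conjug g b) z) \<and>
                ind (conjug g (b \<circ> b') ` set z) Y (inv_into UNIV b' ` Y') \<and>
                ind (b' ` set z) Z' Y' \<and>
                (\<exists>w. w \<in> tp (bin_struct E) (inv_into UNIV b' ` Y') (map (conjug g (b \<circ> b')) z) \<and>
                   (\<forall>i<length x. [w ! i] \<in> tp (bin_struct E) {x ! i} [g (x ! i)]) \<and>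
                   (\<forall>i<length z. [w ! i] \<in>
                      tp (bin_struct E) {z ! i} [conjug g (b \<circ> b') (z ! i)]))))"
  proof (rule exI[of _ X], rule exI[of _ Y], intro conjI allI impI)
    fix b Z x z
    assume a: "b \<in> Aut (expand M E) \<and> finite Z \<and> conjug g b ` Z = Y \<and>
             tp (expand M E) Y (map (conjug g b) z) = tp (expand M E) Y (map g x) \<and>
             ind (set z) Z (Y \<union> X) \<and> ind (set x) X (Y \<union> Z)"
    define f where "f = conjug g b"
    have b: "b \<in> G" using a by (simp add: Aut_expand)
    have f: "maximal_mover f" unfolding f_def conjug_eq by (rule maximal_mover_conj[OF g b])
    note fD = maximal_moverD[OF f]
    have Z: "finite Z" "f ` Z = Y" and iz: "ind (set z) Z (Y \<union> X)" and ix: "ind (set x) X (Y \<union> Z)"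
      using a by (simp_all add: f_def)
    obtain p where p: "p \<in> GF Y" "map p (map f z) = map g x"
      using a tp_expand_iff[of Y "map f z" "map g x"] by (auto simp: f_def)
    have pG: "p \<in> G" using GF_G[OF p(1)] .
    \<comment> \<open>the entry of \<open>x\<close> that corresponds to an entry of \<open>z\<close>\<close>
    define q where "q = iv g \<circ> p \<circ> f"
    have qG: "q \<in> G" unfolding q_def by (intro G_comp G_iv gD(1) fD(1) pG)
    have gq: "g (q s) = p (f s)" for s using gD(1) by (simp add: q_def)
    have x: "x = map q z"
    proof -
      have "map (iv g) (map g x) = map q z" using p(2) by (simp add: q_def flip: p(2))
      then show ?thesis using gD(1) by (simp add: map_idI)
    qed
    obtain Z' where Z': "hull_of f Z Z'" using hull_exists[OF f Z(1)] by blast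
    then have Z'f: "finite Z'" "Z \<subseteq> Z'" by (simp_all add: hull_of_def)
    define Y' where "Y' = f ` Z'"
    have Y': "finite Y'" "Y \<subseteq> Y'" using Z'f Z(2) by (auto simp: Y'_def)
    have finYZ: "finite (Y \<union> Z)" using finX(1) Z(1) by (simp add: Y_def)
    obtain c where c: "c \<in> GF (Y \<union> Z)" "ind (c ` (set z \<union> set x)) (Y \<union> Z) (Z' \<union> Y')"
      by (rule move_generic[OF _ finYZ, of "set z \<union> set x" "Z' \<union> Y'"]) (use Z'f(1) Y'(1) in auto)
    have cG: "c \<in> G" using GF_G[OF c(1)] .
    have cY: "c u = u" if "u \<in> Y" for u using GF_fix[OF c(1)] that by blast
    have cZ: "c u = u" if "u \<in> Z" for u using GF_fix[OF c(1)] that by blast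
    have img: "c ` Z = Z" "c ` Y = Y" by (rule GF_img[OF c(1)]; blast)+
    have iZ: "ind (c ` set z) Z (Y \<union> (Z' \<union> Y'))"
    proof -
      have "ind (set z) Z Y" by (rule ind_mono_right[OF iz]) simp
      then have "ind (c ` set z) (c ` Z) (c ` Y)" by (simp only: ind_G[OF cG])
      then have 1: "ind (c ` set z) Z Y" by (simp only: img)
      have "ind (c ` set z) (Z \<union> Y) (Z' \<union> Y')"
        using ind_mono_left[OF c(2), of "c ` set z"] by (simp add: image_mono Un_commute)
      then show ?thesis by (rule ind_trans_right[OF 1])
    qed
    have iZ1: "ind (c ` set z) Z Z'" by (rule ind_mono_right[OF iZ]) blast
    have iZ2: "ind (c ` set z) Z' Y'"
    proof -
      have "ind (c ` set z) Z (Z' \<union> Y')" by (rule ind_mono_right[OF iZ]) blast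
      then have "ind (c ` set z) (Z \<union> Z') Y'" using ind_trans by blast
      then show ?thesis using Z'f(2) by (simp add: Un_absorb1)
    qed
    have cz: "c s \<notin> Z' \<union> Y'" if s: "s \<in> set z" "s \<notin> Z" for s
    proof
      assume "c s \<in> Z' \<union> Y'"
      then have "c s \<in> Z" using ind_disjoint[OF iZ] s(1) by blast
      then have "c s \<in> c ` Z" by (simp only: img)
      then show False using s(2) G_in_img[OF cG] by simp
    qed
    have qZ: "q s \<notin> X" if s: "s \<notin> Z" for s
    proof
      assume "q s \<in> X"
      then have "p (f s) \<in> Y" using gq[of s] by (simp add: Y_def flip: gq)
      then have "p (f s) \<in> p ` Y" using GF_img[OF p(1), of Y] by simp
      then have "f s \<in> f ` Z" using G_in_img[OF pG] Z(2) by simp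
      then show False using s G_in_img[OF fD(1)] by simp
    qed
    have cx: "c (q s) \<notin> Z' \<union> Y'" if s: "s \<in> set z" "s \<notin> Z" for s
    proof
      assume "c (q s) \<in> Z' \<union> Y'"
      moreover have qs: "q s \<in> set x" using s(1) x by simp
      ultimately have "c (q s) \<in> Y \<union> Z" using ind_disjoint[OF c(2)] by blast
      then have "c (q s) \<in> c ` (Y \<union> Z)" using img by (simp add: image_Un)
      then have "q s \<in> Y \<union> Z" using G_in_img[OF cG] by blast
      then have "q s \<in> X" using ind_disjoint[OF ix] qs by blast
      then show False using qZ[OF s(2)] by simp
    qed
    \<comment> \<open>\<open>Z'\<close> lies between points of \<open>Z\<close>, so \<open>q s\<close> is below some point of \<open>X\<close>; if the largest \<open>m\<close> in \<open>X\<close> below \<open>q s\<close> exists,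
      then \<open>q s < g m\<close>, since \<open>X\<close> is closed, while \<open>g m < f (c s)\<close>\<close>
    have below: "E (c (q s)) u" if o: ord and s: "s \<in> set z" "s \<notin> Z" and u: "u \<in> Y'" "E (f (c s)) u" for s u
    proof -
      note tr = E_trans[OF o]
      have oc: "orbit_closed g X" using X[unfolded hull_of_def] o by simp
      obtain v where v: "v \<in> Z'" "u = f v" using u(1) by (auto simp: Y'_def)
      obtain z1 z2 where zz: "z1 \<in> Z" "z2 \<in> Z" "z1 = v \<or> E z1 v" "v = z2 \<or> E v z2"
        using Z' o v(1) unfolding hull_of_def by (auto split: if_splits)
      have csv: "E (c s) v" using u(2) v(2) G_E[OF fD(1)] by simp
      have "E (c s) z2" using csv zz(4) tr[of "c s" v z2] by auto
      then have "E s z2" using G_E[OF cG, of s z2] cZ[OF zz(2)] by simp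
      then have fz2: "E (f s) (f z2)" using G_E[OF fD(1)] by simp
      have fY: "f z2 \<in> Y" "f z1 \<in> Y" using zz(1,2) Z(2) by auto
      obtain x2 where x2: "x2 \<in> X" "f z2 = g x2" using fY by (auto simp: Y_def)
      obtain x1 where x1: "x1 \<in> X" "f z1 = g x1" using fY by (auto simp: Y_def)
      have "E (p (f s)) (p (f z2))" using fz2 G_E[OF pG] by simp
      then have "E (g (q s)) (g x2)" using GF_fix[OF p(1) fY(1)] x2 by (simp add: gq)
      then have qx2: "E (q s) x2" using G_E[OF gD(1)] by simp
      have cg: "c (g x) = g x" if "x \<in> X" for x using cY that by (simp add: Y_def)
      show ?thesis
      proof (cases "\<exists>x\<in>X. E x (q s)")
        case True
        define L where "L = {x \<in> X. E x (q s)}"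
        have Lne: "finite L" "L \<noteq> {}" using finX(1) True by (auto simp: L_def)
        obtain m where m: "m \<in> L" "\<And>t. t \<in> L \<Longrightarrow> t = m \<or> E t m"
          by (rule finite_E_max[OF o Lne], rule that) simp_all
        have mX: "m \<in> X" "E m (q s)" using m(1) by (simp_all add: L_def)
        have qm: "E (q s) (g m)"
        proof (rule ccontr)
          assume "\<not> E (q s) (g m)"
          then have le: "g m = q s \<or> E (g m) (q s)" using E_total by metis
          then have "E (g m) x2" using qx2 tr[of "g m" "q s" x2] by auto
          then have gmX: "g m \<in> X" using orbit_closed_succ[OF oc mX(1) x2(1)] by simp
          then have "E (g m) (q s)" using le qZ[OF s(2)] by auto
          then have "g m \<in> L" using gmX by (simp add: L_def)
          then show False using m(2) gD(2)[of m] E_asym E_irrefl by metis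
        qed
        have gmY: "g m \<in> Y" using mX(1) by (simp add: Y_def)
        then obtain d where d: "d \<in> Z" "g m = f d" using Z(2) by auto
        have "E (g m) (g (q s))" using mX(2) G_E[OF gD(1)] by simp
        then have "E (p (f d)) (p (f s))" using GF_fix[OF p(1) gmY] d(2) by (simp add: gq)
        then have "E d s" using G_E[OF pG] G_E[OF fD(1)] by simp
        then have "E (c d) (c s)" using G_E[OF cG] by simp
        then have "E (f d) (f (c s))" using cZ[OF d(1)] G_E[OF fD(1)] by simp
        moreover have "E (c (q s)) (f d)" using qm G_E[OF cG, of "q s" "g m"] cg[OF mX(1)] d(2) by simp
        ultimately have "E (c (q s)) (f (c s))" using tr by blast
        then show ?thesis using u(2) by (rule tr)
      next
        case False
        then have "E (q s) x1" using E_total[of "q s" x1] x1(1) qZ[OF s(2)] by auto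
        then have "E (q s) (g x1)" using gD(2) by (rule tr)
        then have "E (c (q s)) (f z1)" using G_E[OF cG, of "q s" "g x1"] cg[OF x1(1)] x1(2) by simp
        then show ?thesis using zz(3) v(2) G_E[OF fD(1), of z1 v] tr[of "c (q s)" "f z1" "f v"] by auto
      qed
    qed
    define T where "T = (\<lambda>s. f (c s)) ` (set z - Z)"
    define src where "src t = iv c (iv f t)" for t
    have bk: "src (f (c s)) = s" for s using cG fD(1) by (simp add: src_def)
    define B where "B t = {c (src t), c (q (src t))}" for t
    define N where "N = (\<Union>t\<in>T. B t)"
    have finT: "finite T" "finite N" by (simp_all add: T_def N_def B_def)
    have TY: "T \<inter> Y' = {}"
    proof -
      have "f (c s) \<notin> f ` Z'" if "s \<in> set z" "s \<notin> Z" for s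
        using cz[OF that] G_in_img[OF fD(1)] by simp
      then show ?thesis by (auto simp: T_def Y'_def)
    qed
    have cutB: "cut E ord (B t) {u \<in> Y'. E t u}" if t: "t \<in> T" for t
    proof -
      obtain s where s: "s \<in> set z" "s \<notin> Z" "t = f (c s)" using t by (auto simp: T_def)
      have "c s \<noteq> u" "c (q s) \<noteq> u" if "u \<in> Y'" for u using cz[OF s(1,2)] cx[OF s(1,2)] that by auto
      moreover have "E (c s) u" if "ord" "u \<in> Y'" "E (f (c s)) u" for u
        using E_trans[OF that(1) fD(2) that(3)] .
      ultimately show ?thesis using below[OF _ s(1,2)] by (auto simp: cut_def B_def s(3) bk)
    qed
    obtain \<theta> where th: "bij \<theta>" "\<And>a b. E (\<theta> a) (\<theta> b) \<longleftrightarrow> E a b" "\<And>u. u \<in> Y' \<Longrightarrow> \<theta> u = u"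
      "\<And>t p. t \<in> T \<Longrightarrow> p \<in> B t \<Longrightarrow> E p (\<theta> t)"
    proof -
      have "\<exists>\<theta>. bij \<theta> \<and> (\<forall>a b. E (\<theta> a) (\<theta> b) \<longleftrightarrow> E a b) \<and> (\<forall>u\<in>Y'. \<theta> u = u) \<and>
          (\<forall>q\<in>T. \<theta> q \<notin> N \<and> (\<forall>p\<in>B q. E p (\<theta> q)))"
        by (rule push_up[OF Y'(1) finT(1) TY finT(2) _ cutB]) (auto simp: N_def)
      then obtain \<theta> where "bij \<theta>" "\<forall>a b. E (\<theta> a) (\<theta> b) \<longleftrightarrow> E a b" "\<forall>u\<in>Y'. \<theta> u = u"
        "\<forall>q\<in>T. \<theta> q \<notin> N \<and> (\<forall>p\<in>B q. E p (\<theta> q))" by (elim exE conjE) (rule that, assumption+)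
      then show ?thesis using that[of \<theta>] by simp
    qed
    have up: "E (c s) (\<theta> (f (c s))) \<and> E (c (q s)) (\<theta> (f (c s)))" if s: "s \<in> set z" for s
    proof (cases "s \<in> Z")
      case False
      then have "f (c s) \<in> T" using s by (auto simp: T_def)
      then show ?thesis using th(4)[of "f (c s)"] by (simp add: B_def bk)
    next
      case True
      have fs: "f s \<in> Y" using True Z(2) by blast
      have t: "\<theta> (f (c s)) = f s" using cZ[OF True] th(3) fs Y'(2) by auto
      have "E (q s) (f s)" using gD(2)[of "q s"] GF_fix[OF p(1) fs] by (simp add: gq)
      then have "E (c (q s)) (f s)" using G_E[OF cG, of "q s" "f s"] cY[OF fs] by simp
      then show ?thesis using t cZ[OF True] fD(2)[of s] by simp
    qed
    define F where "F = conjug g (b \<circ> c)"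
    have F: "F = iv c \<circ> f \<circ> c"
      by (simp add: F_def f_def conjug_eq iv_comp[OF b cG] comp_assoc)
    \<comment> \<open>the permutation that pushes the images up, transported back by \<open>c\<close>\<close>
    define \<eta> where "\<eta> = iv c \<circ> \<theta> \<circ> c"
    have etaF: "\<eta> (F s) = iv c (\<theta> (f (c s)))" for s using cG by (simp add: \<eta>_def F)
    have eta: "bij \<eta>" "E (\<eta> a) (\<eta> b) \<longleftrightarrow> E a b" for a b
    proof -
      show "bij \<eta>" unfolding \<eta>_def by (intro bij_comp G_bij[OF cG] th(1) G_bij[OF G_iv[OF cG]])
      show "E (\<eta> a) (\<eta> b) \<longleftrightarrow> E a b"
        by (simp add: \<eta>_def G_E[OF G_iv[OF cG]] th(2) G_E[OF cG])
    qed
    have etaF_up: "E s (\<eta> (F s))" "E (q s) (\<eta> (F s))" if s: "s \<in> set z" for s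
    proof -
      have e: "c (\<eta> (F s)) = \<theta> (f (c s))" using cG by (simp add: etaF)
      show "E s (\<eta> (F s))" using up[OF s] G_E[OF cG, of s "\<eta> (F s)"] e by simp
      show "E (q s) (\<eta> (F s))" using up[OF s] G_E[OF cG, of "q s" "\<eta> (F s)"] e by simp
    qed
    have FE: "E s (F s)" for s
      using fD(2)[of "c s"] G_E[OF cG, of s "F s"] cG by (simp add: F)
    show "\<exists>b' \<in> Fix (expand M E) (Y \<union> Z). \<exists>Z' Y'.
                finite Z' \<and> Z \<subseteq> Z' \<and> Y' = conjug g b ` Z' \<and>
                full_for M E ind (conjug g b) Z' \<and>
                tp (expand M E) Y (map (conjug g (b \<circ> b')) z)
                  = tp (expand M E) Y (map (conjug g b) z) \<and>
                ind (conjug g (b \<circ> b') ` set z) Y (inv_into UNIV b' ` Y') \<and>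
                ind (b' ` set z) Z' Y' \<and>
                (\<exists>w. w \<in> tp (bin_struct E) (inv_into UNIV b' ` Y') (map (conjug g (b \<circ> b')) z) \<and>
                   (\<forall>i<length x. [w ! i] \<in> tp (bin_struct E) {x ! i} [g (x ! i)]) \<and>
                   (\<forall>i<length z. [w ! i] \<in>
                      tp (bin_struct E) {z ! i} [conjug g (b \<circ> b') (z ! i)]))"
      unfolding Fix_expand
    proof (rule bexI[of _ c], rule exI[of _ Z'], rule exI[of _ Y'], unfold F_def[symmetric] f_def[symmetric],
        intro conjI)
      show "full_for M E ind f Z'" by (rule maximal_mover_full_for[OF f Z'])
      show "tp (expand M E) Y (map F z) = tp (expand M E) Y (map f z)"
      proof -
        define d where "d = f \<circ> iv c \<circ> iv f \<circ> c"
        have "d \<in> G" unfolding d_def by (intro G_comp G_iv fD(1) cG)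
        moreover have "d u = u" if u: "u \<in> Y" for u
        proof -
          obtain t where t: "t \<in> Z" "u = f t" using u Z(2) by blast
          have "iv c t = t" using cZ[OF t(1)] cG by (simp add: G_iv_eq)
          then show ?thesis using cY[OF u] t(2) fD(1) by (simp add: d_def)
        qed
        ultimately have "d \<in> GF Y" by (simp add: GF_def)
        moreover have "map d (map F z) = map f z" using cG fD(1) by (simp add: d_def F)
        ultimately show ?thesis using tp_expand_iff by blast
      qed
      show "ind (F ` set z) Y (iv c ` Y')"
      proof -
        have "ind (f ` c ` set z) (f ` Z) (f ` Z')" using iZ1 by (simp only: ind_G[OF fD(1)])
        then have "ind (iv c ` f ` c ` set z) (iv c ` Y) (iv c ` Y')"
          by (simp only: ind_G[OF G_iv[OF cG]] Z(2) Y'_def)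
        moreover have "iv c ` Y = Y" by (rule GF_img[OF GF_iv[OF c(1)]]) blast
        moreover have "F ` set z = iv c ` f ` c ` set z" by (simp add: F image_image)
        ultimately show ?thesis by simp
      qed
      show "\<exists>w. w \<in> tp (bin_struct E) (iv c ` Y') (map F z) \<and>
          (\<forall>i<length x. [w ! i] \<in> tp (bin_struct E) {x ! i} [g (x ! i)]) \<and>
          (\<forall>i<length z. [w ! i] \<in> tp (bin_struct E) {z ! i} [F (z ! i)])"
      proof (rule exI[of _ "map \<eta> (map F z)"], intro conjI allI impI)
        have "\<eta> \<in> Fix (bin_struct E) (iv c ` Y')"
          using eta th(3) cG by (auto simp: Fix_def Aut_bin \<eta>_def)
        then show "map \<eta> (map F z) \<in> tp (bin_struct E) (iv c ` Y') (map F z)"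
          unfolding tp_def by blast
      next
        fix i assume i: "i < length x"
        then have "x ! i = q (z ! i)" "z ! i \<in> set z" "i < length z" by (simp_all add: x)
        then show "[map \<eta> (map F z) ! i] \<in> tp (bin_struct E) {x ! i} [g (x ! i)]"
          using tp_bin_realized[OF gD(2)[of "x ! i"] ] etaF_up(2)[of "z ! i"] by simp
      next
        fix i assume i: "i < length z"
        then have "z ! i \<in> set z" by simp
        then show "[map \<eta> (map F z) ! i] \<in> tp (bin_struct E) {z ! i} [F (z ! i)]"
          using tp_bin_realized[OF FE[of "z ! i"]] etaF_up(1)[of "z ! i"] i by simp
      qed
    qed (use Z'f iZ2 Y'_def c(1) in auto)
  qed (use finX Y_def maximal_mover_full_for[OF g X] in auto)
qed

end

section \<open>Increasing automorphisms with cofinal orbits in the order case\<close>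

context expansion
begin

text \<open>The weakest kind of displacement: only a point that is independent from the parameters over the empty set has to
be moved at all. It suffices for the constructions in an order.\<close>

definition moves_generic :: "'a set \<Rightarrow> 'a \<Rightarrow> 'a set \<Rightarrow> 'a \<Rightarrow> bool" where
  "moves_generic X x Y y \<longleftrightarrow> (ind {x} {} X \<longrightarrow> x \<noteq> y)"

text \<open>Both ends of the order are treated at once.\<close>

definition beyond :: "bool \<Rightarrow> 'a set \<Rightarrow> 'a \<Rightarrow> bool" where
  "beyond up S x \<longleftrightarrow> (\<forall>s\<in>S. if up then E s x else E x s)"

lemma beyond_Un: "beyond up (S \<union> T) x \<longleftrightarrow> beyond up S x \<and> beyond up T x"
  by (auto simp: beyond_def)

lemma beyond_G: "f \<in> G \<Longrightarrow> beyond up (f ` S) (f x) \<longleftrightarrow> beyond up S x"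
  by (simp add: beyond_def G_E)

lemma beyond_iv: "f \<in> G \<Longrightarrow> beyond up (iv f ` S) x \<longleftrightarrow> beyond up S (f x)"
  using beyond_G[of f up "iv f ` S" x] by simp

lemma beyond_notin: "beyond up S x \<Longrightarrow> x \<notin> S"
  using E_irrefl by (auto simp: beyond_def split: if_splits)

lemma move_beyond:
  assumes X: "finite X" "finite A" "c \<notin> X" and S: "finite S" and c: "beyond up X c"
  obtains a where "a \<in> GF X" "ind {a c} X A" "beyond up S (a c)"
proof (cases up)
  case True
  have e: "{u \<in> X. E c u} = {}" using c True E_asym by (auto simp: beyond_def)
  have cut: "cut E ord (S \<union> {u \<in> X. E u c}) ({} \<union> {u \<in> X. E c u})" unfolding e by (simp add: cut_def)
  show ?thesis
    by (rule move_point[OF X S _ cut]) (use that True in \<open>auto simp: beyond_def\<close>)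
next
  case False
  have e: "{u \<in> X. E u c} = {}" using c False E_asym by (auto simp: beyond_def)
  have cut: "cut E ord ({} \<union> {u \<in> X. E u c}) (S \<union> {u \<in> X. E c u})" unfolding e by (simp add: cut_def)
  show ?thesis
    by (rule move_point[OF X _ S cut]) (use that False in \<open>auto simp: beyond_def\<close>)
qed

text \<open>The commutator \<open>h\<inverse> h\<^sup>k\<close> moves a point \<open>x\<close> up if \<open>k h x\<close> lies below \<open>h k x\<close>. Far out this can be arranged: either
  \<open>h\<close> moves down some points \<open>x\<close> arbitrarily far out, and then \<open>k h x\<close> may be sent to any place below \<open>k x\<close>, or \<open>h\<close>
  eventually moves nothing down, and then \<open>k x\<close> can be chosen to be moved up.\<close>

lemma move_up_extend:
  assumes o: ord and h: "h \<in> G" "displaces moves_generic h" and t: "\<tau> \<in> G" "finite A"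
  shows "\<exists>\<tau>'\<in>G. (\<forall>a\<in>A. \<tau>' a = \<tau> a) \<and> (\<exists>x. beyond up {n} x \<and> E (\<tau>' (h x)) (h (\<tau>' x)))"
proof -
  let ?B = "\<tau> ` A"
  have "\<exists>\<tau>1 x. \<tau>1 \<in> G \<and> (\<forall>a\<in>A. \<tau>1 a = \<tau> a) \<and> beyond up {n} x \<and> beyond up A (h x) \<and> h x \<noteq> x \<and>
      beyond up ?B (\<tau>1 x) \<and> beyond up ?B (h (\<tau>1 x)) \<and> (E x (h x) \<longrightarrow> E (\<tau>1 x) (h (\<tau>1 x)))"
  proof (cases "\<forall>S. finite S \<longrightarrow> (\<exists>y. beyond up S y \<and> E (h y) y)")
    case True
    have "finite (insert n A \<union> iv h ` A)" using t(2) by simp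
    then obtain x where x: "beyond up (insert n A \<union> iv h ` A) x" "E (h x) x" using True by blast
    then have xA: "beyond up {n} x" "beyond up A x" "beyond up A (h x)"
      using h(1) by (simp_all only: beyond_Un beyond_iv insert_is_Un[of n A])
    have tx: "beyond up ?B (\<tau> x)" using xA(2) by (simp add: beyond_G t(1))
    obtain a where a: "a \<in> GF ?B" "beyond up (iv h ` ?B) (a (\<tau> x))"
      by (rule move_beyond[OF _ _ beyond_notin[OF tx] _ tx, of "{}" "iv h ` ?B"]) (use t(2) in auto)
    have "beyond up (a ` ?B) (a (\<tau> x))" using tx by (simp only: beyond_G[OF GF_G[OF a(1)]])
    then have aB: "beyond up ?B (a (\<tau> x))" by (simp only: GF_img[OF a(1) order_refl])
    have "\<not> E x (h x)" "h x \<noteq> x" using x(2) E_asym E_irrefl by metis+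
    moreover have "a \<circ> \<tau> \<in> G" using GF_G[OF a(1)] t(1) by (rule G_comp)
    moreover have "\<forall>u\<in>A. (a \<circ> \<tau>) u = \<tau> u" using GF_fix[OF a(1)] by simp
    ultimately show ?thesis
      using xA aB a(2) by (intro exI[of _ "a \<circ> \<tau>"] exI[of _ x]) (simp add: beyond_iv[OF h(1)])
  next
    case False
    then obtain S0 where S0: "finite S0" "\<And>y. beyond up S0 y \<Longrightarrow> \<not> E (h y) y" by auto
    define S where "S = insert n A \<union> iv h ` A \<union> S0"
    have finS: "finite S" using t(2) S0(1) by (simp add: S_def)
    obtain a0 where a0: "ind {a0 n} {} S" "beyond up S (a0 n)"
      by (rule move_beyond[of "{}" S n S up]) (use finS in \<open>auto simp: beyond_def\<close>)
    define x0 where "x0 = a0 n"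
    have x0S: "x0 \<notin> S" using a0(2) beyond_notin by (simp add: x0_def)
    obtain a where a: "a \<in> GF S" "moves_generic S (a x0) (h ` S) (h (a x0))"
      using displacesD[OF h(2) finS x0S] .
    define x where "x = a x0"
    have aS: "a ` S = S" "a ` {} = {}" using GF_img[OF a(1)] by auto
    have "beyond up (a ` S) (a x0)" using a0(2) by (simp only: beyond_G[OF GF_G[OF a(1)]] x0_def)
    then have xS: "beyond up S x" by (simp add: aS x_def)
    have "ind (a ` {x0}) (a ` {}) (a ` S)" using a0(1) by (simp only: ind_G[OF GF_G[OF a(1)]] x0_def)
    then have ix: "ind {x} {} S" by (simp add: aS x_def)
    then have hx: "h x \<noteq> x" using a(2) by (auto simp: moves_generic_def x_def)
    have xA: "beyond up {n} x" "beyond up A x" "beyond up A (h x)" "beyond up S0 x"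
      using xS h(1) unfolding S_def by (simp_all only: beyond_Un beyond_iv insert_is_Un[of n A])
    have tx: "beyond up ?B (\<tau> x)" using xA(2) by (simp add: beyond_G t(1))
    have ixA: "ind {x} {} A" by (rule ind_mono_right[OF ix]) (auto simp: S_def)
    define C where "C = S0 \<union> iv h ` ?B"
    have finC: "finite C" "finite ?B" using S0(1) t(2) by (simp_all add: C_def)
    obtain b where b: "b \<in> GF ?B" "ind {b (\<tau> x)} ?B C" "beyond up C (b (\<tau> x))"
      by (rule move_beyond[OF finC(2,1) beyond_notin[OF tx] finC(1) tx])
    define u0 where "u0 = b (\<tau> x)"
    have bB: "b ` ?B = ?B" by (rule GF_img[OF b(1)]) simp
    have "beyond up (b ` ?B) (b (\<tau> x))" using tx by (simp only: beyond_G[OF GF_G[OF b(1)]])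
    then have u0B: "beyond up (?B \<union> C) u0" using b(3) by (simp only: bB beyond_Un u0_def simp_thms)
    have "ind (b ` \<tau> ` {x}) (b ` \<tau> ` {}) (b ` \<tau> ` A)"
      using ixA by (simp only: ind_G[OF GF_G[OF b(1)]] ind_G[OF t(1)])
    then have "ind {u0} {} ?B" by (simp add: bB u0_def)
    then have iu0: "ind {u0} {} (?B \<union> C)" by (rule ind_trans_right) (use b(2) in \<open>simp add: u0_def\<close>)
    have "u0 \<notin> ?B \<union> C" using u0B by (rule beyond_notin)
    then obtain d where d: "d \<in> GF (?B \<union> C)" "moves_generic (?B \<union> C) (d u0) (h ` (?B \<union> C)) (h (d u0))"
      using displacesD[OF h(2), of "?B \<union> C" u0] finC by auto
    define u where "u = d u0"
    have dB: "d ` (?B \<union> C) = ?B \<union> C" by (rule GF_img[OF d(1)]) simp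
    have "ind (d ` {u0}) (d ` {}) (d ` (?B \<union> C))" using iu0 by (simp only: ind_G[OF GF_G[OF d(1)]])
    then have "ind {u} {} (?B \<union> C)" unfolding dB by (simp add: u_def)
    then have hu: "h u \<noteq> u" using d(2) by (auto simp: moves_generic_def u_def)
    have "beyond up (d ` (?B \<union> C)) (d u0)" using u0B by (simp only: beyond_G[OF GF_G[OF d(1)]])
    then have "beyond up (?B \<union> C) u" by (simp only: dB u_def)
    then have uB: "beyond up ?B u" "beyond up S0 u" "beyond up ?B (h u)"
      using h(1) by (simp_all only: beyond_Un C_def beyond_iv)
    have up: "E u (h u)" using S0(2)[OF uB(2)] hu E_total by metis
    define \<tau>1 where "\<tau>1 = d \<circ> b \<circ> \<tau>"
    have "\<tau>1 \<in> G" unfolding \<tau>1_def by (intro G_comp GF_G[OF d(1)] GF_G[OF b(1)] t(1))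
    moreover have "\<tau>1 s = \<tau> s" if "s \<in> A" for s
      using GF_fix[OF b(1), of "\<tau> s"] GF_fix[OF d(1), of "\<tau> s"] that by (simp add: \<tau>1_def)
    moreover have "\<tau>1 x = u" by (simp add: \<tau>1_def u_def u0_def)
    ultimately show ?thesis
      using xA uB up hx by (intro exI[of _ \<tau>1] exI[of _ x]) simp
  qed
  then obtain \<tau>1 x where x: "\<tau>1 \<in> G" "\<And>a. a \<in> A \<Longrightarrow> \<tau>1 a = \<tau> a" "beyond up {n} x" "beyond up A (h x)"
    "h x \<noteq> x" "beyond up ?B (\<tau>1 x)" "beyond up ?B (h (\<tau>1 x))" "E x (h x) \<Longrightarrow> E (\<tau>1 x) (h (\<tau>1 x))"
    by (elim exE conjE) simp
  define u where "u = \<tau>1 x"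
  define v where "v = \<tau>1 (h x)"
  have img: "\<tau>1 ` A = ?B" using x(2) by (intro image_cong) auto
  have vB: "beyond up ?B v" using x(4) beyond_G[OF x(1), of up A "h x"] by (simp add: img v_def)
  have vu: "v \<noteq> u" using x(5) G_inj[OF x(1)] by (simp add: u_def v_def)
  have uv: "E u (h u)" if "E u v" using that x(8) G_E[OF x(1)] by (simp add: u_def v_def)
  have cut: "cut E ord ({} \<union> {l \<in> insert u ?B. E l v}) ({h u} \<union> {w \<in> insert u ?B. E v w})"
  proof -
    have "E l w" if l: "l \<in> insert u ?B" "E l v" and w: "w = h u \<or> E v w" for l w
    proof (cases "E v w")
      case True
      then show ?thesis by (rule E_trans[OF o l(2)])
    next
      case False
      then have w: "w = h u" using w by simp
      show ?thesis
      proof (cases "l = u")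
        case True
        then show ?thesis using uv l(2) w by simp
      next
        case False
        then have lB: "l \<in> ?B" using l by simp
        then have "up" using vB l(2) E_asym by (auto simp: beyond_def split: if_splits)
        then show ?thesis using x(7) lB w by (auto simp: beyond_def u_def)
      qed
    qed
    then show ?thesis using E_irrefl unfolding cut_def by blast
  qed
  have fin: "finite (insert u ?B)" using t(2) by simp
  have vn: "v \<notin> insert u ?B" using vu beyond_notin[OF vB] by simp
  obtain d where d: "d \<in> GF (insert u ?B)" "\<And>w. w \<in> {h u} \<Longrightarrow> E (d v) w"
    by (rule move_point[OF fin _ vn _ _ cut, of "{}"]) auto
  define \<tau>' where "\<tau>' = d \<circ> \<tau>1"
  have "\<tau>' \<in> G" unfolding \<tau>'_def by (intro G_comp GF_G[OF d(1)] x(1))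
  moreover have "\<tau>' s = \<tau> s" if "s \<in> A" for s using GF_fix[OF d(1), of "\<tau> s"] x(2) that by (simp add: \<tau>'_def)
  moreover have "\<tau>' x = u" "\<tau>' (h x) = d v" using GF_fix[OF d(1), of u] by (simp_all add: \<tau>'_def u_def v_def)
  ultimately show ?thesis using d(2) x(3) by (intro bexI[of _ \<tau>'] conjI exI[of _ x]) auto
qed

definition cofinally_up :: "('a \<Rightarrow> 'a) \<Rightarrow> bool" where
  "cofinally_up h \<longleftrightarrow> (\<forall>up n. \<exists>x. beyond up {n} x \<and> E x (h x))"

text \<open>The previous lemma is one extension step; a generic \<open>k\<close> meets the requirements for all \<open>n\<close> and both ends.\<close>

lemma cofinally_up_exists:
  assumes o: ord and h: "h \<in> G" "displaces moves_generic h"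
  obtains k where "k \<in> G" "cofinally_up (iv h \<circ> iv k \<circ> h \<circ> k)"
proof -
  define D where "D m \<tau> A \<longleftrightarrow> (\<forall>up. \<exists>x. x \<in> A \<and> h x \<in> A \<and> beyond up {from_M m} x \<and> E (\<tau> (h x)) (h (\<tau> x)))" for m \<tau> A
  obtain k where k: "k \<in> G"
    "\<And>m. \<exists>\<tau> A. \<tau> \<in> G \<and> finite A \<and> True \<and> (\<forall>a\<in>A. k a = \<tau> a) \<and> D m \<tau> A"
  proof (rule generic_automorphism[of id "{}" "\<lambda>_ _. True" D])
    fix \<tau> A m assume t: "\<tau> \<in> G" "finite (A :: 'a set)"
    obtain \<tau>1 x where 1: "\<tau>1 \<in> G" "\<forall>a\<in>A. \<tau>1 a = \<tau> a" "beyond True {from_M m} x" "E (\<tau>1 (h x)) (h (\<tau>1 x))"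
      using move_up_extend[OF o h t, of True "from_M m"] by (elim bexE conjE exE) (rule that, assumption+)
    have finA: "finite (insert x (insert (h x) A))" using t(2) by simp
    obtain \<tau>2 y where 2: "\<tau>2 \<in> G" "\<forall>a\<in>insert x (insert (h x) A). \<tau>2 a = \<tau>1 a" "beyond False {from_M m} y"
        "E (\<tau>2 (h y)) (h (\<tau>2 y))"
      using move_up_extend[OF o h 1(1) finA, of False "from_M m"] by (elim bexE conjE exE) (rule that, assumption+)
    have "D m \<tau>2 (insert y (insert (h y) (insert x (insert (h x) A))))"
      unfolding D_def
    proof
      fix up
      show "\<exists>x'. x' \<in> insert y (insert (h y) (insert x (insert (h x) A))) \<and>
          h x' \<in> insert y (insert (h y) (insert x (insert (h x) A))) \<and> beyond up {from_M m} x' \<and>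
          E (\<tau>2 (h x')) (h (\<tau>2 x'))"
        using 1(3,4) 2(2,3,4) by (cases up) (auto intro: exI[of _ x] exI[of _ y])
    qed
    then show "\<exists>\<tau>' A'. \<tau>' \<in> G \<and> finite A' \<and> A \<subseteq> A' \<and> (\<forall>a\<in>A. \<tau>' a = \<tau> a) \<and> True \<and> D m \<tau>' A'"
      using 1(1,2) 2(1,2) finA
      by (intro exI[of _ \<tau>2] exI[of _ "insert y (insert (h y) (insert x (insert (h x) A)))"]) auto
  next
    fix \<tau> A x assume "\<tau> \<in> G" "finite (A :: 'a set)"
    then show "\<exists>\<tau>' A'. \<tau>' \<in> G \<and> finite A' \<and> A \<subseteq> A' \<and> (\<forall>a\<in>A. \<tau>' a = \<tau> a) \<and> True \<and> x \<in> A'"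
      by (intro exI[of _ \<tau>] exI[of _ "insert x A"]) auto
  next
    fix \<tau> A y assume "\<tau> \<in> G" "finite (A :: 'a set)"
    then show "\<exists>\<tau>' A'. \<tau>' \<in> G \<and> finite A' \<and> A \<subseteq> A' \<and> (\<forall>a\<in>A. \<tau>' a = \<tau> a) \<and> True \<and> y \<in> \<tau>' ` A'"
      by (intro exI[of _ \<tau>] exI[of _ "insert (iv \<tau> y) A"]) auto
  qed (use that in auto)
  show ?thesis
  proof (rule that[OF k(1)])
    show "cofinally_up (iv h \<circ> iv k \<circ> h \<circ> k)"
      unfolding cofinally_up_def
    proof (intro allI)
      fix up n
      obtain m where m: "from_M m = n" using from_M_surj by blast
      obtain \<tau> A where A: "\<forall>a\<in>A. k a = \<tau> a" "D m \<tau> A" using k(2)[of m] by (elim exE conjE) (rule that, assumption+)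
      then obtain x where x: "x \<in> A" "h x \<in> A" "beyond up {n} x" "E (\<tau> (h x)) (h (\<tau> x))"
        unfolding D_def m by blast
      then have "E (k (h x)) (h (k x))" using A(1) by simp
      then have "E (iv k (k (h x))) (iv k (h (k x)))" by (simp only: G_E[OF G_iv[OF k(1)]])
      then have "E (h x) (iv k (h (k x)))" by (simp only: G_iv1[OF k(1)])
      then have "E (iv h (h x)) (iv h (iv k (h (k x))))" by (simp only: G_E[OF G_iv[OF h(1)]])
      then have "E x ((iv h \<circ> iv k \<circ> h \<circ> k) x)" by (simp only: G_iv1[OF h(1)] o_apply)
      then show "\<exists>x. beyond up {n} x \<and> E x ((iv h \<circ> iv k \<circ> h \<circ> k) x)" using x(3) by blast
    qed
  qed
qed

lemma cofinally_up_finite: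
  assumes o: ord and h: "cofinally_up h" and S: "finite S"
  obtains x where "beyond up S x" "E x (h x)"
proof (cases "S = {}")
  case True
  obtain x where "E x (h x)" using h unfolding cofinally_up_def by blast
  then show ?thesis using that True by (simp add: beyond_def)
next
  case False
  show ?thesis
  proof (cases up)
    case True
    obtain m where m: "m \<in> S" "\<And>t. t \<in> S \<Longrightarrow> t = m \<or> E t m" by (rule finite_E_max[OF o S False], rule that) simp_all
    obtain x where x: "beyond True {m} x" "E x (h x)" using h unfolding cofinally_up_def by blast
    have "E t x" if "t \<in> S" for t using m(2)[OF that] x(1) E_trans[OF o, of t m x] by (auto simp: beyond_def)
    then show ?thesis using that[of x] x(2) True by (simp add: beyond_def)
  next
    case f: False
    obtain m where m: "m \<in> S" "\<And>t. t \<in> S \<Longrightarrow> t = m \<or> E m t" by (rule finite_E_min[OF o S False], rule that) simp_all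
    obtain x where x: "beyond False {m} x" "E x (h x)" using h unfolding cofinally_up_def by blast
    have "E x t" if "t \<in> S" for t using m(2)[OF that] x(1) E_trans[OF o, of x m t] by (auto simp: beyond_def)
    then show ?thesis using that[of x] x(2) f by (simp add: beyond_def)
  qed
qed

text \<open>Now \<open>k\<close> is built such that \<open>h\<^sup>k h\<close> has a chain of points \<open>e\<^sub>i\<close>, cofinal in both directions, with
  \<open>h\<^sup>k h e\<^sub>i > e\<^sub>i\<^sub>+\<^sub>1\<close>. The state keeps the points \<open>t\<^sub>i = h e\<^sub>i\<close> with \<open>r\<^sub>i = h\<^sup>k t\<^sub>i > h\<inverse> t\<^sub>i\<^sub>+\<^sub>1\<close>. At the upper end
  \<open>\<tau> t\<close> is moved up by \<open>h\<close>, at the lower end \<open>h\<close> moves \<open>h\<inverse> t\<close> up to \<open>t\<close>; this leaves room for the next point.\<close>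

definition link :: "('a \<Rightarrow> 'a) \<Rightarrow> ('a \<Rightarrow> 'a) \<Rightarrow> 'a set \<Rightarrow> 'a \<Rightarrow> 'a \<Rightarrow> bool" where
  "link h \<tau> A s s' \<longleftrightarrow> s \<in> A \<and> s' \<in> A \<and> (\<exists>r\<in>A. \<tau> r = h (\<tau> s) \<and> E (iv h s') r)"

definition chained :: "('a \<Rightarrow> 'a) \<Rightarrow> ('a \<Rightarrow> 'a) \<Rightarrow> 'a set \<Rightarrow> 'a \<Rightarrow> 'a \<Rightarrow> bool" where
  "chained h \<tau> A t0 t \<longleftrightarrow> t0 \<in> A \<and> t \<in> A \<and> (\<forall>a\<in>A. (a = t0 \<or> E t0 a) \<and> (a = t \<or> E a t)) \<and>
     E (\<tau> t) (h (\<tau> t)) \<and> E (iv h t0) t0 \<and> (link h \<tau> A)\<^sup>*\<^sup>* t0 t"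

lemma link_mono:
  assumes "A \<subseteq> A'" "\<forall>a\<in>A. \<tau>' a = \<tau> a" shows "(link h \<tau> A)\<^sup>*\<^sup>* s s' \<Longrightarrow> (link h \<tau>' A')\<^sup>*\<^sup>* s s'"
proof (rule rtranclp_mono[THEN predicate2D, rotated], assumption)
  show "link h \<tau> A \<le> link h \<tau>' A'"
  proof (rule predicate2I)
    fix s s' assume "link h \<tau> A s s'"
    then obtain r where r: "s \<in> A" "s' \<in> A" "r \<in> A" "\<tau> r = h (\<tau> s)" "E (iv h s') r" by (auto simp: link_def)
    then have "\<tau>' r = h (\<tau>' s)" using assms(2) by simp
    then show "link h \<tau>' A' s s'" using r assms(1) unfolding link_def by blast
  qed
qed

text \<open>The chain gets a new last point \<open>t'\<close> beyond \<open>n\<close>. It is placed below \<open>h x\<close> for a point \<open>x\<close> that is moved up, after \<open>h\<^sup>k t\<close> has been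
decided to lie above \<open>x\<close>; and its image is a point that is moved up, as the next step will require.\<close>

lemma chained_up:
  assumes o: ord and h: "h \<in> G" "cofinally_up h" and t: "\<tau> \<in> G" "finite A" "chained h \<tau> A t0 t"
  shows "\<exists>\<tau>'\<in>G. \<exists>A' t'. finite A' \<and> A \<subseteq> A' \<and> (\<forall>a\<in>A. \<tau>' a = \<tau> a) \<and> chained h \<tau>' A' t0 t' \<and>
    E n t' \<and> E n (\<tau>' t')"
proof -
  note tr = E_trans[OF o]
  have c: "t0 \<in> A" "t \<in> A" "\<And>a. a \<in> A \<Longrightarrow> a = t0 \<or> E t0 a" "\<And>a. a \<in> A \<Longrightarrow> a = t \<or> E a t"
    "E (\<tau> t) (h (\<tau> t))" "E (iv h t0) t0" "(link h \<tau> A)\<^sup>*\<^sup>* t0 t" using t(3) by (auto simp: chained_def)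
  define u where "u = \<tau> t"
  obtain x where x: "beyond True (insert n A) x" "E x (h x)"
    by (rule cofinally_up_finite[OF o h(2), of "insert n A" True], use t(2) in simp, rule that) simp_all
  have xA: "E a x" if "a \<in> A" for a using x(1) that by (simp add: beyond_def)
  have nx: "E n x" using x(1) by (simp add: beyond_def)
  have xhA: "E a (h x)" if "a \<in> A" for a by (rule tr[OF xA[OF that] x(2)])
  \<comment> \<open>the point \<open>r\<close>, to be mapped to \<open>h u\<close>, between \<open>x\<close> and \<open>h x\<close>\<close>
  define r0 where "r0 = iv \<tau> (h u)"
  have tr0: "\<tau> r0 = h u" using t(1) by (simp add: r0_def)
  have Ar0: "E a r0" if a: "a \<in> A" for a
  proof -
    have "\<tau> a = u \<or> E (\<tau> a) u" using c(4)[OF a] G_E[OF t(1)] by (auto simp: u_def)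
    then have "E (\<tau> a) (\<tau> r0)" using c(5) tr[of "\<tau> a" u "h u"] by (auto simp: tr0 u_def)
    then show ?thesis by (simp only: G_E[OF t(1)])
  qed
  have r0A: "r0 \<notin> A" using Ar0 E_irrefl by blast
  have cut1: "cut E ord ({x} \<union> {a \<in> A. E a r0}) ({h x} \<union> {a \<in> A. E r0 a})"
    using x(2) xhA Ar0 E_asym E_irrefl by (auto simp: cut_def)
  obtain a1 where a1: "a1 \<in> GF A" "E x (a1 r0)" "E (a1 r0) (h x)"
    by (rule move_point[OF t(2) _ r0A _ _ cut1, of "{}"]) auto
  define r where "r = a1 r0"
  define \<tau>1 where "\<tau>1 = \<tau> \<circ> iv a1"
  have a1G: "a1 \<in> G" using GF_G[OF a1(1)] .
  have t1: "\<tau>1 \<in> G" unfolding \<tau>1_def by (intro G_comp t(1) G_iv a1G)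
  have t1r: "\<tau>1 r = h u" using a1G by (simp add: \<tau>1_def r_def tr0)
  have t1A: "\<tau>1 a = \<tau> a" if "a \<in> A" for a using GF_fix[OF GF_iv[OF a1(1)] that] by (simp add: \<tau>1_def)
  have Ar: "E a r" if "a \<in> A" for a by (rule tr[OF xA[OF that]]) (simp add: r_def a1(2))
  \<comment> \<open>the new end point \<open>t'\<close>\<close>
  obtain u' where u': "beyond True {h u, n} u'" "E u' (h u')"
    by (rule cofinally_up_finite[OF o h(2), of "{h u, n}" True], simp, rule that) simp_all
  define s where "s = iv \<tau>1 u'"
  have ts: "\<tau>1 s = u'" using t1 by (simp add: s_def)
  have "E (\<tau>1 r) (\<tau>1 s)" using u'(1) by (simp add: t1r ts beyond_def)
  then have rs: "E r s" by (simp only: G_E[OF t1])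
  have As: "E a s" if "a \<in> insert r A" for a using that rs Ar tr[of a r s] by auto
  have sA: "s \<notin> insert r A" using As E_irrefl by blast
  have cut2: "cut E ord ({} \<union> {a \<in> insert r A. E a s}) ({h x} \<union> {a \<in> insert r A. E s a})"
    using xhA a1(3) As E_asym E_irrefl by (auto simp: cut_def r_def)
  obtain a2 where a2: "a2 \<in> GF (insert r A)" "\<And>u. u \<in> {h x} \<Longrightarrow> E (a2 s) u"
    by (rule move_point[OF _ _ sA _ _ cut2, of "{}"]) (use t(2) in auto)
  define t' where "t' = a2 s"
  define \<tau>' where "\<tau>' = \<tau>1 \<circ> iv a2"
  have a2G: "a2 \<in> G" using GF_G[OF a2(1)] .
  have t': "\<tau>' \<in> G" unfolding \<tau>'_def by (intro G_comp t1 G_iv a2G)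
  have t't: "\<tau>' t' = u'" using a2G by (simp add: \<tau>'_def t'_def ts)
  have t'A: "\<tau>' a = \<tau>1 a" if "a \<in> insert r A" for a using GF_fix[OF GF_iv[OF a2(1)] that] by (simp add: \<tau>'_def)
  have At': "E a t'" if "a \<in> insert r A" for a
    using As[OF that] GF_fix[OF a2(1) that] G_E[OF a2G, of a s] by (simp add: t'_def)
  have t'hx: "E t' (h x)" using a2(2) by (simp add: t'_def)
  define A' where "A' = insert t' (insert r A)"
  have "E (iv h t') (iv h (h x))" using t'hx by (simp only: G_E[OF G_iv[OF h(1)]])
  then have "E (iv h t') x" using h(1) by simp
  then have "E (iv h t') r" by (rule tr) (simp add: r_def a1(2))
  moreover have "\<tau>' r = h (\<tau>' t)" using t'A[of r] t'A[of t] t1A[of t] c(2) by (simp add: t1r u_def)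
  ultimately have link: "link h \<tau>' A' t t'" unfolding link_def A'_def using c(2) by blast
  have "\<forall>a\<in>A. \<tau>' a = \<tau> a" using t'A t1A by simp
  moreover have "chained h \<tau>' A' t0 t'"
    unfolding chained_def
  proof (intro conjI ballI)
    have "(link h \<tau>' A')\<^sup>*\<^sup>* t0 t" by (rule link_mono[OF _ calculation c(7)]) (auto simp: A'_def)
    then show "(link h \<tau>' A')\<^sup>*\<^sup>* t0 t'" using link by (rule rtranclp.rtrancl_into_rtrancl)
    show "E (\<tau>' t') (h (\<tau>' t'))" using u'(2) by (simp add: t't)
    fix a assume a: "a \<in> A'"
    show "a = t0 \<or> E t0 a" using a c(1,3) Ar[OF c(1)] At'[of t0] by (auto simp: A'_def)
    show "a = t' \<or> E a t'" using a At' by (auto simp: A'_def)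
  qed (use c(1,6) in \<open>auto simp: A'_def\<close>)
  moreover have "E n t'"
  proof -
    have "E n r" by (rule tr[OF nx]) (simp add: r_def a1(2))
    then show ?thesis by (rule tr) (rule At', simp)
  qed
  moreover have "E n (\<tau>' t')" using u'(1) by (simp add: t't beyond_def)
  moreover have "finite A'" "A \<subseteq> A'" using t(2) by (auto simp: A'_def)
  ultimately show ?thesis using t' by (intro bexI[of _ \<tau>'] exI[of _ A'] exI[of _ t'] conjI)
qed

lemma chained_down:
  assumes o: ord and h: "h \<in> G" "cofinally_up h" and t: "\<tau> \<in> G" "finite A" "chained h \<tau> A t0 t"
  shows "\<exists>\<tau>'\<in>G. \<exists>A' t'. finite A' \<and> A \<subseteq> A' \<and> (\<forall>a\<in>A. \<tau>' a = \<tau> a) \<and> chained h \<tau>' A' t' t \<and>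
    E t' n \<and> E (\<tau>' t') n"
proof -
  note tr = E_trans[OF o]
  have c: "t0 \<in> A" "t \<in> A" "\<And>a. a \<in> A \<Longrightarrow> a = t0 \<or> E t0 a" "\<And>a. a \<in> A \<Longrightarrow> a = t \<or> E a t"
    "E (\<tau> t) (h (\<tau> t))" "E (iv h t0) t0" "(link h \<tau> A)\<^sup>*\<^sup>* t0 t" using t(3) by (auto simp: chained_def)
  obtain u where u: "beyond False {iv h (\<tau> t0), n} u" "E u (h u)"
    by (rule cofinally_up_finite[OF o h(2), of "{iv h (\<tau> t0), n}" False], simp, rule that) simp_all
  have "E (h u) (h (iv h (\<tau> t0)))" using u(1) by (simp add: G_E[OF h(1)] beyond_def)
  then have hut: "E (h u) (\<tau> t0)" using h(1) by simp
  \<comment> \<open>the point \<open>r\<close>, to be mapped to \<open>h u\<close>, between \<open>h\<inverse> t0\<close> and \<open>t0\<close>\<close>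
  define r0 where "r0 = iv \<tau> (h u)"
  have tr0: "\<tau> r0 = h u" using t(1) by (simp add: r0_def)
  have "E (\<tau> r0) (\<tau> t0)" using hut by (simp add: tr0)
  then have r0t: "E r0 t0" by (simp only: G_E[OF t(1)])
  have Ar0: "E r0 a" if a: "a \<in> A" for a using c(3)[OF a] r0t tr[of r0 t0 a] by auto
  have r0A: "r0 \<notin> A" using Ar0 E_irrefl by blast
  have iA: "E (iv h t0) a" if "a \<in> A" for a using c(3)[OF that] c(6) tr[of "iv h t0" t0 a] by auto
  have cut1: "cut E ord ({iv h t0} \<union> {a \<in> A. E a r0}) ({} \<union> {a \<in> A. E r0 a})"
    using iA Ar0 E_asym E_irrefl by (auto simp: cut_def)
  obtain a1 where a1: "a1 \<in> GF A" "E (iv h t0) (a1 r0)"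
    by (rule move_point[OF t(2) _ r0A _ _ cut1, of "{}"]) auto
  define r where "r = a1 r0"
  define \<tau>1 where "\<tau>1 = \<tau> \<circ> iv a1"
  have a1G: "a1 \<in> G" using GF_G[OF a1(1)] .
  have t1: "\<tau>1 \<in> G" unfolding \<tau>1_def by (intro G_comp t(1) G_iv a1G)
  have t1r: "\<tau>1 r = h u" using a1G by (simp add: \<tau>1_def r_def tr0)
  have t1A: "\<tau>1 a = \<tau> a" if "a \<in> A" for a using GF_fix[OF GF_iv[OF a1(1)] that] by (simp add: \<tau>1_def)
  have Ar: "E r a" if "a \<in> A" for a
    using Ar0[OF that] GF_fix[OF a1(1) that] G_E[OF a1G, of r0 a] by (simp add: r_def)
  \<comment> \<open>the new end point \<open>t'\<close>\<close>
  obtain x where x: "beyond False {iv h r, iv h n} x" "E x (h x)"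
    by (rule cofinally_up_finite[OF o h(2), of "{iv h r, iv h n}" False], simp, rule that) simp_all
  have "E (h x) (h (iv h r))" "E (h x) (h (iv h n))" using x(1) by (simp_all add: G_E[OF h(1)] beyond_def)
  then have hx: "E (h x) r" "E (h x) n" using h(1) by simp_all
  define s where "s = iv \<tau>1 u"
  have ts: "\<tau>1 s = u" using t1 by (simp add: s_def)
  have "E (\<tau>1 s) (\<tau>1 r)" using u(2) by (simp add: t1r ts)
  then have sr: "E s r" by (simp only: G_E[OF t1])
  have As: "E s a" if "a \<in> insert r A" for a using that sr Ar tr[of s r a] by auto
  have sA: "s \<notin> insert r A" using As E_irrefl by blast
  have xr: "E x a" if "a \<in> insert r A" for a using that tr[OF x(2) hx(1)] Ar tr[of x r a] by auto
  have cut2: "cut E ord ({x} \<union> {a \<in> insert r A. E a s}) ({h x} \<union> {a \<in> insert r A. E s a})"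
  proof -
    have "{a \<in> insert r A. E a s} = {}" using As E_asym by blast
    moreover have "x \<notin> insert r A" "x \<noteq> h x" using xr x(2) E_irrefl by metis+
    ultimately show ?thesis using x(2) xr by (auto simp: cut_def)
  qed
  obtain a2 where a2: "a2 \<in> GF (insert r A)" "\<And>l. l \<in> {x} \<Longrightarrow> E l (a2 s)" "\<And>u. u \<in> {h x} \<Longrightarrow> E (a2 s) u"
    by (rule move_point[OF _ _ sA _ _ cut2, of "{}"]) (use t(2) in auto)
  define t' where "t' = a2 s"
  define \<tau>' where "\<tau>' = \<tau>1 \<circ> iv a2"
  have a2G: "a2 \<in> G" using GF_G[OF a2(1)] .
  have t': "\<tau>' \<in> G" unfolding \<tau>'_def by (intro G_comp t1 G_iv a2G)
  have t't: "\<tau>' t' = u" using a2G by (simp add: \<tau>'_def t'_def ts)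
  have t'A: "\<tau>' a = \<tau>1 a" if "a \<in> insert r A" for a using GF_fix[OF GF_iv[OF a2(1)] that] by (simp add: \<tau>'_def)
  have At': "E t' a" if "a \<in> insert r A" for a
    using As[OF that] GF_fix[OF a2(1) that] G_E[OF a2G, of s a] by (simp add: t'_def)
  have xt': "E x t'" "E t' (h x)" using a2(2,3) by (simp_all add: t'_def)
  define A' where "A' = insert t' (insert r A)"
  have "E (iv h t') (iv h (h x))" using xt'(2) by (simp only: G_E[OF G_iv[OF h(1)]])
  then have "E (iv h t') x" using h(1) by simp
  then have it': "E (iv h t') t'" using xt'(1) by (rule tr)
  have "E (iv h t0) r" using a1(2) by (simp add: r_def)
  moreover have "\<tau>' r = h (\<tau>' t')" using t'A[of r] by (simp add: t1r t't)
  ultimately have link: "link h \<tau>' A' t' t0" unfolding link_def A'_def using c(1) by blast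
  have "\<forall>a\<in>A. \<tau>' a = \<tau> a" using t'A t1A by simp
  moreover have "chained h \<tau>' A' t' t"
    unfolding chained_def
  proof (intro conjI ballI)
    have "(link h \<tau>' A')\<^sup>*\<^sup>* t0 t" by (rule link_mono[OF _ calculation c(7)]) (auto simp: A'_def)
    with link show "(link h \<tau>' A')\<^sup>*\<^sup>* t' t" by (rule converse_rtranclp_into_rtranclp)
    show "E (\<tau>' t) (h (\<tau>' t))" using c(2,5) t'A t1A by simp
    fix a assume a: "a \<in> A'"
    show "a = t' \<or> E t' a" using a At' by (auto simp: A'_def)
    show "a = t \<or> E a t" using a c(2,4) Ar[OF c(2)] At'[of t] by (auto simp: A'_def)
  qed (use c(2) it' in \<open>auto simp: A'_def\<close>)
  moreover have "E t' n" by (rule tr[OF xt'(2) hx(2)])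
  moreover have "E (\<tau>' t') n" using u(1) by (simp add: t't beyond_def)
  moreover have "finite A'" "A \<subseteq> A'" using t(2) by (auto simp: A'_def)
  ultimately show ?thesis using t' by (intro bexI[of _ \<tau>'] exI[of _ A'] exI[of _ t'] conjI)
qed

lemma chained_around:
  assumes o: ord and h: "h \<in> G" "cofinally_up h" and t: "\<tau> \<in> G" "finite A" "chained h \<tau> A t0 t"
  shows "\<exists>\<tau>' A' s0 s. \<tau>' \<in> G \<and> finite A' \<and> A \<subseteq> A' \<and> (\<forall>a\<in>A. \<tau>' a = \<tau> a) \<and> chained h \<tau>' A' s0 s \<and>
    n \<in> A' \<and> n \<in> \<tau>' ` A'"
proof -
  obtain \<tau>1 A1 t1 where 1: "\<tau>1 \<in> G" "finite A1" "A \<subseteq> A1" "\<forall>a\<in>A. \<tau>1 a = \<tau> a" "chained h \<tau>1 A1 t0 t1"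
    "E n t1" "E n (\<tau>1 t1)"
    using chained_up[OF o h t, of n] by (elim bexE exE conjE) (rule that, assumption+)
  obtain \<tau>2 A2 t2 where 2: "\<tau>2 \<in> G" "finite A2" "A1 \<subseteq> A2" "\<forall>a\<in>A1. \<tau>2 a = \<tau>1 a" "chained h \<tau>2 A2 t2 t1"
    "E t2 n" "E (\<tau>2 t2) n"
    using chained_down[OF o h 1(1,2,5), of n] by (elim bexE exE conjE) (rule that, assumption+)
  define m where "m = iv \<tau>2 n"
  have tm: "\<tau>2 m = n" using 2(1) by (simp add: m_def)
  have t1A: "t1 \<in> A1" using 1(5) by (simp add: chained_def)
  have "E (\<tau>2 m) (\<tau>2 t1)" "E (\<tau>2 t2) (\<tau>2 m)" using 1(7) 2(4,7) t1A by (simp_all add: tm)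
  then have m: "E m t1" "E t2 m" by (simp_all only: G_E[OF 2(1)])
  define A' where "A' = insert m (insert n A2)"
  have "chained h \<tau>2 A' t2 t1"
  proof -
    have "(link h \<tau>2 A')\<^sup>*\<^sup>* t2 t1"
      by (rule link_mono[of A2 A' \<tau>2 \<tau>2]) (use 2(5) in \<open>auto simp: A'_def chained_def\<close>)
    then show ?thesis using 2(5,6) 1(6) m by (auto simp: chained_def A'_def)
  qed
  moreover have "\<forall>a\<in>A. \<tau>2 a = \<tau> a"
  proof
    fix a assume a: "a \<in> A"
    then have "a \<in> A1" using 1(3) by blast
    then show "\<tau>2 a = \<tau> a" using 1(4) 2(4) a by simp
  qed
  moreover have "n \<in> \<tau>2 ` A'" using tm by (auto simp: A'_def)
  moreover have "finite A'" "A \<subseteq> A'" "n \<in> A'" using 2(2,3) 1(3) by (auto simp: A'_def)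
  ultimately show ?thesis using 2(1) by (intro exI[of _ \<tau>2] exI[of _ A'] exI[of _ t2] exI[of _ t1]) simp
qed

text \<open>By induction along the chain the iterates of \<open>h\<^sup>k h\<close> overtake all its points, and the chain is cofinal at both
ends. For the same reason \<open>h\<^sup>k h\<close> is increasing: if \<open>a\<close> is the last point of the chain that is not above \<open>x\<close>, then the
image of \<open>a\<close> is above the next point of the chain, which is above \<open>x\<close>.\<close>

lemma archimedean_exists:
  assumes o: ord and h: "h \<in> G" "cofinally_up h"
  obtains k where "k \<in> G" "\<And>x. E x ((iv k \<circ> h \<circ> k \<circ> h) x)" "archimedean (iv k \<circ> h \<circ> k \<circ> h)"
proof -
  note tr = E_trans[OF o]
  define I where "I \<tau> A \<longleftrightarrow> (\<exists>t0 t. chained h \<tau> A t0 t)" for \<tau> A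
  obtain x0 where x0: "E x0 (h x0)" using h(2) unfolding cofinally_up_def by blast
  obtain k where k: "k \<in> G"
    "\<And>F. finite F \<Longrightarrow> \<exists>\<tau> A. \<tau> \<in> G \<and> finite A \<and> I \<tau> A \<and> (\<forall>a\<in>A. k a = \<tau> a) \<and> F \<subseteq> A"
  proof (rule generic_automorphism[of id "{h x0}" I "\<lambda>_ _ _. True"])
    have "E (h x0) (h (h x0))" using x0 G_E[OF h(1)] by simp
    then show "I id {h x0}" unfolding I_def chained_def using x0 h(1)
      by (intro exI[of _ "h x0"]) auto
    fix \<tau> A n assume t: "\<tau> \<in> G" "finite A" "I \<tau> A"
    then show "\<exists>\<tau>' A'. \<tau>' \<in> G \<and> finite A' \<and> A \<subseteq> A' \<and> (\<forall>a\<in>A. \<tau>' a = \<tau> a) \<and> I \<tau>' A' \<and> True"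
      by (intro exI[of _ \<tau>] exI[of _ A]) simp
  next
    fix \<tau> A n assume t: "\<tau> \<in> G" "finite A" "I \<tau> A"
    then obtain t0 t where "chained h \<tau> A t0 t" unfolding I_def by blast
    from chained_around[OF o h t(1,2) this, of n]
    obtain \<tau>' A' s0 s where *: "\<tau>' \<in> G" "finite A'" "A \<subseteq> A'" "\<forall>a\<in>A. \<tau>' a = \<tau> a" "chained h \<tau>' A' s0 s"
      "n \<in> A'" "n \<in> \<tau>' ` A'" by (elim exE conjE) (rule that, assumption+)
    have I: "I \<tau>' A'" unfolding I_def using *(5) by blast
    show "\<exists>\<tau>' A'. \<tau>' \<in> G \<and> finite A' \<and> A \<subseteq> A' \<and> (\<forall>a\<in>A. \<tau>' a = \<tau> a) \<and> I \<tau>' A' \<and> n \<in> A'"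
      using * I by (intro exI[of _ \<tau>'] exI[of _ A']) simp
    show "\<exists>\<tau>' A'. \<tau>' \<in> G \<and> finite A' \<and> A \<subseteq> A' \<and> (\<forall>a\<in>A. \<tau>' a = \<tau> a) \<and> I \<tau>' A' \<and> n \<in> \<tau>' ` A'"
      using * I by (intro exI[of _ \<tau>'] exI[of _ A']) simp
  qed (use that in auto)
  define g where "g = iv k \<circ> h \<circ> k \<circ> h"
  have gG: "g \<in> G" unfolding g_def by (intro G_comp G_iv k(1) h(1))
  define C where "C e e' \<longleftrightarrow> E e' (g e)" for e e'
  have chain: "\<exists>e0 e. (e0 = x \<or> E e0 x) \<and> (y = e \<or> E y e) \<and> C\<^sup>*\<^sup>* e0 e" for x y
  proof -
    obtain \<tau> A where A: "I \<tau> A" "\<forall>a\<in>A. k a = \<tau> a" "{h x, h y} \<subseteq> A" using k(2)[of "{h x, h y}"] by auto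
    then obtain t0 t where c: "chained h \<tau> A t0 t" unfolding I_def by blast
    have st: "C (iv h s) (iv h s')" if lk: "link h \<tau> A s s'" for s s'
    proof -
      obtain r where r: "s \<in> A" "r \<in> A" "\<tau> r = h (\<tau> s)" "E (iv h s') r" using lk by (auto simp: link_def)
      then have "k r = h (k s)" using A(2) by simp
      then have "iv k (h (k s)) = r" using k(1) by (simp add: G_iv_eq)
      then have "g (iv h s) = r" using h(1) by (simp add: g_def)
      then show ?thesis using r(4) by (simp add: C_def)
    qed
    have "(link h \<tau> A)\<^sup>*\<^sup>* s s' \<Longrightarrow> C\<^sup>*\<^sup>* (iv h s) (iv h s')" for s s'
      by (induction rule: rtranclp_induct) (auto intro: st rtranclp.rtrancl_into_rtrancl)
    then have "C\<^sup>*\<^sup>* (iv h t0) (iv h t)" using c by (simp add: chained_def)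
    moreover have "t0 = h x \<or> E t0 (h x)" "h y = t \<or> E (h y) t"
      using c A(3) by (auto simp: chained_def)
    then have "iv h t0 = x \<or> E (iv h t0) x" "y = iv h t \<or> E y (iv h t)"
      using G_E[OF h(1), of "iv h t0" x] G_E[OF h(1), of y "iv h t"] h(1) by (auto simp: G_iv_eq)
    ultimately show ?thesis by blast
  qed
  have crossing: "C\<^sup>*\<^sup>* a b \<Longrightarrow> a = x \<or> E a x \<Longrightarrow> E x b \<Longrightarrow> E x (g x)" for a b x
  proof (induction rule: converse_rtranclp_induct)
    case base
    then show ?case using E_irrefl E_asym by blast
  next
    case (step a a')
    show ?case
    proof (cases "a' = x \<or> E a' x")
      case True
      then show ?thesis using step.IH step.prems by blast
    next
      case False
      then have "E x a'" using E_total by blast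
      then have "E x (g a)" by (rule tr) (use step(1) in \<open>simp add: C_def\<close>)
      then show ?thesis using step.prems(1) G_E[OF gG, of a x] tr[of x "g a" "g x"] by auto
    qed
  qed
  have inc: "E x (g x)" for x
  proof -
    obtain a where "beyond True {x} (a :: 'a)" using h(2) unfolding cofinally_up_def by blast
    then have xa: "E x a" by (simp add: beyond_def)
    obtain e0 e where e: "e0 = x \<or> E e0 x" "a = e \<or> E a e" "C\<^sup>*\<^sup>* e0 e" using chain[of x a] by blast
    have "E x e" using xa e(2) tr[of x a e] by auto
    then show ?thesis using crossing[OF e(3,1)] by simp
  qed
  have iter: "C\<^sup>*\<^sup>* a b \<Longrightarrow> \<exists>n. b = (g ^^ n) a \<or> E b ((g ^^ n) a)" for a b
  proof (induction rule: rtranclp_induct)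
    case base
    show ?case by (rule exI[of _ 0]) simp
  next
    case (step b b')
    then obtain n where n: "b = (g ^^ n) a \<or> E b ((g ^^ n) a)" by blast
    have "E b' (g b)" using step(2) by (simp add: C_def)
    then have "E b' ((g ^^ Suc n) a)" using n G_E[OF gG, of b "(g ^^ n) a"] tr[of b' "g b" "g ((g ^^ n) a)"] by auto
    then show ?case by blast
  qed
  have "archimedean g"
    unfolding archimedean_def
  proof (intro allI)
    fix x y
    obtain e0 e where e: "e0 = x \<or> E e0 x" "y = e \<or> E y e" "C\<^sup>*\<^sup>* e0 e" using chain[of x y] by blast
    obtain n where n: "e = (g ^^ n) e0 \<or> E e ((g ^^ n) e0)" using iter[OF e(3)] by blast
    have mono: "(g ^^ n) e0 = (g ^^ n) x \<or> E ((g ^^ n) e0) ((g ^^ n) x)"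
      using e(1) by (induction n) (auto simp: G_E[OF gG])
    have "y = (g ^^ n) e0 \<or> E y ((g ^^ n) e0)" using e(2) n tr[of y e "(g ^^ n) e0"] by auto
    then have "y = (g ^^ n) x \<or> E y ((g ^^ n) x)" using mono tr[of y "(g ^^ n) e0" "(g ^^ n) x"] by auto
    then have "E y ((g ^^ Suc n) x)" using inc[of "(g ^^ n) x"] tr[of y "(g ^^ n) x" "g ((g ^^ n) x)"] by auto
    then show "\<exists>n. E y ((g ^^ n) x)" by blast
  qed
  then show ?thesis using that[OF k(1)] inc by (simp add: g_def)
qed

section \<open>Finding a maximal mover in a normal subgroup\<close>

text \<open>The products that occur when displacements are added up. Increasing elements with cofinal orbits
form such a set, although they do not form a group.\<close>

definition closed_under_conjugates :: "('a \<Rightarrow> 'a) set \<Rightarrow> bool" where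
  "closed_under_conjugates N \<longleftrightarrow> N \<subseteq> G \<and> (\<forall>h\<in>N. \<forall>k\<in>G. h \<circ> (iv k \<circ> h \<circ> k) \<in> N)"

text \<open>The displacement step with \<open>h\<inverse>\<close> as its first factor, so that the product \<open>h h\<^sup>k\<close> has no inverse in it.\<close>

lemma displacement_upgrade:
  assumes N: "closed_under_conjugates N" and h: "h \<in> N" "displaces P h"
    and P: "displacement P" "symmetric_displacement P" and Q: "displacement Q" "composes P Q"
  shows "\<exists>g\<in>N. displaces Q g"
proof -
  have hG: "h \<in> G" using N h(1) by (auto simp: closed_under_conjugates_def)
  obtain k where k: "k \<in> G" "\<And>r. r \<in> {None} \<Longrightarrow>
      displaces (\<lambda>X x Y y. Q X x Y y \<and> oriented r x y) (iv (iv h) \<circ> iv k \<circ> h \<circ> k)"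
  proof (rule displacement_step[OF G_iv[OF hG] hG P(1) displaces_iv[OF P(2) hG h(2)] h(2) Q, of "{None}"])
    show "orientable P r" if "r \<in> {None}" for r using that by (simp add: orientable_def)
  qed (use that in blast)
  have "iv (iv h) \<circ> iv k \<circ> h \<circ> k = h \<circ> (iv k \<circ> h \<circ> k)" using hG by (simp add: comp_assoc)
  then have "displaces Q (h \<circ> (iv k \<circ> h \<circ> k))" using k(2)[of None] by simp
  then show ?thesis using N h(1) k(1) unfolding closed_under_conjugates_def by blast
qed

abbreviation normal_hull :: "('a \<Rightarrow> 'a) \<Rightarrow> ('a \<Rightarrow> 'a) set" where
  "normal_hull h \<equiv> normal_closure (aut_group (expand M E)) h"

lemma group_G: "group (aut_group (expand M E))"
  by (rule group_aut_group) (simp add: expand_def univ_M)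

lemma carrier_G: "carrier (aut_group (expand M E)) = G"
  by (simp add: aut_group_def Aut_expand)

lemma m_inv_G:
  assumes "f \<in> G" shows "m_inv (aut_group (expand M E)) f = iv f"
proof -
  interpret group "aut_group (expand M E)" by (rule group_G)
  show ?thesis
  proof (rule inv_equality)
    show "iv f \<otimes>\<^bsub>aut_group (expand M E)\<^esub> f = \<one>\<^bsub>aut_group (expand M E)\<^esub>"
      using assms by (auto simp: aut_group_def)
  qed (use assms G_iv in \<open>simp_all add: carrier_G\<close>)
qed

lemma normal_hull_self: "h \<in> normal_hull h"
  by (simp add: normal_closure_def)

lemma normal_hull_comp: "a \<in> normal_hull h \<Longrightarrow> b \<in> normal_hull h \<Longrightarrow> a \<circ> b \<in> normal_hull h"
  unfolding normal_closure_def
proof (intro InterI)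
  fix K assume ab: "a \<in> \<Inter> {N. N \<lhd> aut_group (expand M E) \<and> h \<in> N}"
    "b \<in> \<Inter> {N. N \<lhd> aut_group (expand M E) \<and> h \<in> N}" and K: "K \<in> {N. N \<lhd> aut_group (expand M E) \<and> h \<in> N}"
  then have "subgroup K (aut_group (expand M E))" by (simp add: normal_def)
  from subgroup.m_closed[OF this, of a b] show "a \<circ> b \<in> K" using ab K by (simp add: aut_group_def)
qed

lemma normal_hull_iv: "a \<in> normal_hull h \<Longrightarrow> a \<in> G \<Longrightarrow> iv a \<in> normal_hull h"
  unfolding normal_closure_def
proof (intro InterI)
  fix K assume a: "a \<in> \<Inter> {N. N \<lhd> aut_group (expand M E) \<and> h \<in> N}" "a \<in> G"
    and K: "K \<in> {N. N \<lhd> aut_group (expand M E) \<and> h \<in> N}"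
  then have "subgroup K (aut_group (expand M E))" by (simp add: normal_def)
  from subgroup.m_inv_closed[OF this, of a] show "iv a \<in> K" using a K by (simp add: m_inv_G)
qed

lemma normal_hull_conj: "a \<in> normal_hull h \<Longrightarrow> k \<in> G \<Longrightarrow> iv k \<circ> a \<circ> k \<in> normal_hull h"
  unfolding normal_closure_def
proof (intro InterI)
  fix K assume a: "a \<in> \<Inter> {N. N \<lhd> aut_group (expand M E) \<and> h \<in> N}" "k \<in> G"
    and K: "K \<in> {N. N \<lhd> aut_group (expand M E) \<and> h \<in> N}"
  then have "K \<lhd> aut_group (expand M E)" by simp
  from normal.inv_op_closed1[OF this, of k a] show "iv k \<circ> a \<circ> k \<in> K"
    using a K by (simp add: m_inv_G carrier_G) (simp add: aut_group_def)
qed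

lemma increasing_archimedean_comp:
  assumes o: ord and h: "h \<in> G" "\<And>x. E x (h x)" "archimedean h" and g: "g \<in> G" "\<And>x. E x (g x)"
  shows "E x ((h \<circ> g) x)" "archimedean (h \<circ> g)"
proof -
  note tr = E_trans[OF o]
  show inc: "E x ((h \<circ> g) x)" for x using tr[OF g(2)[of x] h(2)[of "g x"]] by simp
  define f where "f = h \<circ> g"
  have hf: "E (h x) (f x)" for x using g(2)[of x] G_E[OF h(1)] by (simp add: f_def)
  have le: "(h ^^ n) x = (f ^^ n) x \<or> E ((h ^^ n) x) ((f ^^ n) x)" for n x
  proof (induction n)
    case (Suc n)
    let ?a = "(h ^^ n) x" and ?b = "(f ^^ n) x"
    have "h ?a = h ?b \<or> E (h ?a) (h ?b)" using Suc G_E[OF h(1), of ?a ?b] by auto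
    then have "E (h ?a) (f ?b)" using hf[of ?b] tr[of "h ?a" "h ?b" "f ?b"] by auto
    then show ?case by simp
  qed simp
  have "archimedean f"
    unfolding archimedean_def
  proof (intro allI)
    fix x y
    obtain n where "E y ((h ^^ n) x)" using h(3) by (auto simp: archimedean_def)
    then have "E y ((f ^^ n) x)" using le[of n x] tr[of y "(h ^^ n) x" "(f ^^ n) x"] by auto
    then show "\<exists>n. E y ((f ^^ n) x)" by blast
  qed
  then show "archimedean (h \<circ> g)" by (simp add: f_def)
qed

text \<open>What remains to be supplied by the structure is that every nontrivial element of a set closed under
  products with conjugates can be improved to one that moves maximally, ignoring \<open>E\<close>. In an order this is applied
  to the increasing elements with cofinal orbits. In a tournament it is applied to the whole normal subgroup; a
  further step provides both directions of arrows, and the last one makes all of them point from \<open>x\<close> to \<open>g x\<close>.\<close>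

lemma maximal_mover_exists:
  assumes h: "h \<in> G" "displaces moves_generic h" "h \<noteq> id"
    and upgrade: "\<And>N g. closed_under_conjugates N \<Longrightarrow> g \<in> N \<Longrightarrow> g \<noteq> id \<Longrightarrow>
      \<exists>g'\<in>N. displaces (\<lambda>X x Y y. ind2 ind {x} X Y {y}) g'"
    and comp: "composes (\<lambda>X x Y y. ind2 ind {x} X Y {y}) (\<lambda>X x Y y. ind2 ind {x} X Y {y})"
  shows "\<exists>g\<in>normal_hull h. maximal_mover g"
proof (cases ord)
  case o: True
  obtain k where k: "k \<in> G" "cofinally_up (iv h \<circ> iv k \<circ> h \<circ> k)" by (rule cofinally_up_exists[OF o h(1,2)])
  define h1 where "h1 = iv h \<circ> (iv k \<circ> h \<circ> k)"
  have h1: "h1 \<in> G" "cofinally_up h1" "h1 \<in> normal_hull h"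
    using k(2) unfolding h1_def
    by (auto simp: comp_assoc intro!: G_comp G_iv h(1) k(1) normal_hull_comp normal_hull_iv normal_hull_self
        normal_hull_conj[unfolded comp_assoc])
  obtain k' where k': "k' \<in> G" "\<And>x. E x ((iv k' \<circ> h1 \<circ> k' \<circ> h1) x)" "archimedean (iv k' \<circ> h1 \<circ> k' \<circ> h1)"
    by (rule archimedean_exists[OF o h1(1,2)], rule that) simp_all
  define h2 where "h2 = iv k' \<circ> h1 \<circ> k' \<circ> h1"
  define N where "N = {g \<in> normal_hull h. g \<in> G \<and> (\<forall>x. E x (g x)) \<and> archimedean g}"
  have "h2 \<in> normal_hull h" unfolding h2_def by (intro normal_hull_comp normal_hull_conj h1(3) k'(1))
  moreover have "h2 \<in> G" unfolding h2_def by (intro G_comp G_iv k'(1) h1(1))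
  ultimately have h2: "h2 \<in> N" using k'(2,3) by (simp add: N_def h2_def)
  have "f \<circ> (iv l \<circ> f \<circ> l) \<in> N" if fN: "f \<in> N" and l: "l \<in> G" for f l
  proof -
    have f: "f \<in> normal_hull h" "f \<in> G" "\<And>x. E x (f x)" "archimedean f" using fN by (simp_all add: N_def)
    have c: "iv l \<circ> f \<circ> l \<in> G" by (intro G_comp G_iv l f(2))
    have "E x ((iv l \<circ> f \<circ> l) x)" for x
      using G_E[OF G_iv[OF l], of "l x" "f (l x)"] f(3)[of "l x"] l by simp
    note ia = increasing_archimedean_comp[OF o f(2-4) c this]
    have "f \<circ> (iv l \<circ> f \<circ> l) \<in> normal_hull h" by (intro normal_hull_comp normal_hull_conj f(1) l)
    moreover have "f \<circ> (iv l \<circ> f \<circ> l) \<in> G" by (rule G_comp[OF f(2) c])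
    ultimately show ?thesis using ia unfolding N_def by blast
  qed
  then have cl: "closed_under_conjugates N" unfolding closed_under_conjugates_def by (auto simp: N_def)
  have "h2 \<noteq> id" using h2 E_irrefl by (auto simp: N_def)
  then obtain g where "g \<in> N" "displaces (\<lambda>X x Y y. ind2 ind {x} X Y {y}) g"
    using upgrade[OF cl h2] by blast
  then show ?thesis unfolding maximal_mover_def N_def by blast
next
  case no: False
  let ?T = "\<lambda>X x Y y. ind2 ind {x} X Y {y}"
  define N where "N = normal_hull h \<inter> G"
  have cl: "closed_under_conjugates N"
    unfolding closed_under_conjugates_def N_def
    by (intro conjI ballI IntI normal_hull_comp normal_hull_conj G_comp G_iv) auto
  have "h \<in> N" using h(1) normal_hull_self by (simp add: N_def)
  then obtain g0 where "g0 \<in> N" and g0: "displaces ?T g0" using upgrade[OF cl _ h(3)] by blast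
  then have g0N: "g0 \<in> normal_hull h" "g0 \<in> G" by (simp_all add: N_def)
  have ne: "\<forall>X x Y y. x \<notin> X \<longrightarrow> ?T X x Y y \<longrightarrow> x \<noteq> y"
    using ind_disjoint by (fastforce simp: ind2_def)
  obtain k where k: "k \<in> G" "\<And>r. r \<in> {Some True, Some False} \<Longrightarrow>
      displaces (\<lambda>X x Y y. ?T X x Y y \<and> oriented r x y) (iv (iv g0) \<circ> iv k \<circ> g0 \<circ> k)"
  proof (rule displacement_step[OF G_iv[OF g0N(2)] g0N(2) displacement_ind2
        displaces_iv[OF symmetric_displacement_ind2 g0N(2) g0] g0 displacement_ind2 comp, of "{Some True, Some False}"])
    show "orientable ?T r" if "r \<in> {Some True, Some False}" for r using no ne unfolding orientable_def by blast
  qed (use that in blast)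
  define g1 where "g1 = g0 \<circ> (iv k \<circ> g0 \<circ> k)"
  have g1: "g1 \<in> normal_hull h" "g1 \<in> G"
    unfolding g1_def by (intro normal_hull_comp normal_hull_conj G_comp G_iv g0N k(1))+
  have e: "iv (iv g0) \<circ> iv k \<circ> g0 \<circ> k = g1" using g0N(2) by (simp add: g1_def comp_assoc)
  have d: "displaces (\<lambda>X x Y y. ?T X x Y y \<and> E x y) g1" "displaces (\<lambda>X x Y y. ?T X x Y y \<and> E y x) g1"
    using k(2)[of "Some True"] k(2)[of "Some False"] unfolding e by simp_all
  obtain k' where k': "k' \<in> G" "displaces ?T (iv g1 \<circ> iv k' \<circ> g1 \<circ> k')"
    "\<And>x. E x ((iv g1 \<circ> iv k' \<circ> g1 \<circ> k') x)"
    by (rule tournament_step[OF no g1(2) displacement_ind2 comp d], rule that) simp_all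
  define g where "g = iv g1 \<circ> iv k' \<circ> g1 \<circ> k'"
  have "g = iv g1 \<circ> (iv k' \<circ> g1 \<circ> k')" by (simp add: g_def comp_assoc)
  then have "g \<in> normal_hull h"
    using normal_hull_comp[OF normal_hull_iv[OF g1] normal_hull_conj[OF g1(1) k'(1)]] by simp
  moreover have "g \<in> G" unfolding g_def by (intro G_comp G_iv g1(2) k'(1))
  ultimately show ?thesis using k'(2,3) no unfolding maximal_mover_def g_def by blast
qed

end

section \<open>Fraisse limits\<close>

lemma homogeneous_extend:
  assumes M: "univ M = UNIV" "homogeneous M" and f: "finite A" "inj_on f A"
    "\<And>r xs. set xs \<subseteq> A \<Longrightarrow> rel M r (map f xs) \<longleftrightarrow> rel M r xs"
  shows "\<exists>g\<in>Aut M. \<forall>a\<in>A. g a = f a"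
proof -
  have "isom f (substr M A) (substr M (f ` A))"
    using f by (auto simp: isom_def substr_def bij_betw_def)
  then show ?thesis using M f(1) unfolding homogeneous_def by blast
qed

definition pullback :: "('r, 'a) struct \<Rightarrow> (nat \<Rightarrow> 'a) \<Rightarrow> nat set \<Rightarrow> ('r, nat) struct" where
  "pullback M f V = \<lparr>univ = V, rel = (\<lambda>r ns. set ns \<subseteq> V \<and> rel M r (map f ns))\<rparr>"

lemma pullback_age:
  assumes "wf_struct ar M" "univ M = UNIV" "finite V" "inj_on f V"
  shows "pullback M f V \<in> age ar M"
proof -
  have "embedding f (pullback M f V) M"
    using assms by (auto simp: embedding_def isom_def substr_def pullback_def bij_betw_def)
  moreover have "wf_struct ar (pullback M f V)"
    using assms(1) by (fastforce simp: wf_struct_def pullback_def)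
  ultimately show ?thesis using assms(3) by (auto simp: age_def pullback_def)
qed

text \<open>By homogeneity an embedding into the limit can be corrected so that it undoes \<open>i\<close> on \<open>W\<close>.\<close>

lemma realize_over:
  assumes M: "univ M = UNIV" "homogeneous M" and N: "N \<in> age ar M"
    and i: "finite W" "inj_on i W" "i ` W \<subseteq> univ N"
    "\<And>r xs. set xs \<subseteq> W \<Longrightarrow> rel N r (map i xs) \<longleftrightarrow> rel M r xs"
  obtains j where "inj_on j (univ N)" "\<And>r ns. set ns \<subseteq> univ N \<Longrightarrow> rel M r (map j ns) \<longleftrightarrow> rel N r ns"
    "\<And>w. w \<in> W \<Longrightarrow> j (i w) = w"
proof -
  obtain j0 where j0: "embedding j0 N M" using N by (auto simp: age_def)
  then have inj: "inj_on j0 (univ N)" by (simp add: embedding_def isom_def bij_betw_def)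
  have rel: "rel M r (map j0 ns) \<longleftrightarrow> rel N r ns" if "set ns \<subseteq> univ N" for r ns
    using j0 that by (fastforce simp: embedding_def isom_def substr_def)
  have "\<exists>g\<in>Aut M. \<forall>a\<in>W. g a = (j0 \<circ> i) a"
  proof (rule homogeneous_extend[OF M i(1)])
    show "inj_on (j0 \<circ> i) W" using i(2,3) inj by (auto intro: comp_inj_on inj_on_subset)
    show "rel M r (map (j0 \<circ> i) xs) \<longleftrightarrow> rel M r xs" if "set xs \<subseteq> W" for r xs
    proof -
      have "set (map i xs) \<subseteq> univ N" using i(3) that by auto
      then have "rel M r (map j0 (map i xs)) \<longleftrightarrow> rel N r (map i xs)" by (rule rel)
      then show ?thesis using i(4)[OF that] by simp
    qed
  qed
  then obtain s where s: "s \<in> Aut M" "\<forall>a\<in>W. s a = j0 (i a)" by auto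
  have bs: "bij s" using Aut_bij[OF M(1) s(1)] .
  have ivs: "iv s \<in> Aut M" using Aut_inv[OF s(1) M(1)] .
  show ?thesis
  proof (rule that[of "iv s \<circ> j0"])
    show "inj_on (iv s \<circ> j0) (univ N)"
      using inj bs by (intro comp_inj_on) (auto intro: inj_on_subset[OF bij_is_inj[OF bij_imp_bij_inv]])
    show "rel M r (map (iv s \<circ> j0) ns) \<longleftrightarrow> rel N r ns" if "set ns \<subseteq> univ N" for r ns
    proof -
      have "rel M r (map (iv s) (map j0 ns)) \<longleftrightarrow> rel M r (map j0 ns)"
        using ivs by (simp only: Aut_iff[OF M(1)])
      then show ?thesis using rel[OF that] by simp
    qed
    show "(iv s \<circ> j0) (i w) = w" if "w \<in> W" for w
    proof -
      have "iv s (j0 (i w)) = iv s (s w)" using s(2) that by simp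
      also have "\<dots> = w" using bs by (simp add: bij_is_inj)
      finally show ?thesis by simp
    qed
  qed
qed

section \<open>Order and tournament expansions\<close>

context independence
begin

lemma Fix_inj: "\<sigma> \<in> Fix M X \<Longrightarrow> \<sigma> a = \<sigma> b \<longleftrightarrow> a = b"
  using Aut_bij[OF univ_M Fix_subset_Aut] by (auto simp: bij_def dest: injD)

lemma Fix_notin: "\<sigma> \<in> Fix M X \<Longrightarrow> c \<notin> X \<Longrightarrow> \<sigma> c \<notin> X"
proof
  assume s: "\<sigma> \<in> Fix M X" "c \<notin> X" "\<sigma> c \<in> X"
  then have "\<sigma> (\<sigma> c) = \<sigma> c" by (simp add: Fix_def)
  then show False using s Fix_inj[OF s(1)] by simp
qed

lemma infinite_realizations:
  assumes "finite X" "c \<notin> X" shows "infinite ((\<lambda>\<sigma>. \<sigma> c) ` Fix M X)"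
proof
  assume fin: "finite ((\<lambda>\<sigma>. \<sigma> c) ` Fix M X)"
  obtain \<sigma> where s: "\<sigma> \<in> Fix M X" "ind {\<sigma> c} X ((\<lambda>\<sigma>. \<sigma> c) ` Fix M X)"
    using ind_exists[OF assms(1) fin assms(2)] by blast
  then have "\<sigma> c \<in> X" using ind_disjoint[OF s(2)] by blast
  then show False using Fix_notin[OF s(1) assms(2)] by simp
qed

lemma infinite_tp:
  assumes "finite X" "c \<notin> X" shows "infinite (tp M X [c])"
proof
  assume "finite (tp M X [c])"
  then have "finite (hd ` tp M X [c])" by simp
  moreover have "hd ` tp M X [c] = (\<lambda>\<sigma>. \<sigma> c) ` Fix M X" by (simp add: tp_def image_image)
  ultimately show False using infinite_realizations[OF assms] by simp
qed

text \<open>A finite cut is realized by the points of an interval: from the largest lower to the smallest upper bound, if there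
are any.\<close>

lemma order_expansion_expansion:
  assumes c: "countable (UNIV :: 'a set)" and E: "order_expansion M E"
  shows "expansion M ind E True"
proof -
  have irr: "\<not> E a a" and tr: "E a b \<Longrightarrow> E b d \<Longrightarrow> E a d" and tot: "a \<noteq> b \<Longrightarrow> E a b \<or> E b a" for a b d
    using E by (auto simp: order_expansion_def irreflp_def totalp_on_def dest: transpD)
  have asy: "E a b \<Longrightarrow> \<not> E b a" for a b using tr irr by blast
  have ends: "\<exists>b. E b a" "\<exists>b. E a b" for a using E by (auto simp: order_expansion_def)
  have dens: "\<exists>x. [x] \<in> tp M X [d] \<and> E a x \<and> E x b" if "finite X" "d \<notin> X" "E a b" for X d a b
    using E infinite_tp[OF that(1,2)] that(1,3) unfolding order_expansion_def by blast
  have max: "\<exists>m\<in>S. \<forall>t\<in>S. t = m \<or> E t m" if "finite S" "S \<noteq> {}" for S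
    using that
  proof (induction rule: finite_ne_induct)
    case (insert x F)
    then obtain s where s: "s \<in> F" "\<forall>t\<in>F. t = s \<or> E t s" by auto
    show ?case
    proof (cases "E s x")
      case True
      have "t = x \<or> E t x" if "t \<in> insert x F" for t using that s(2) True tr[of t s x] by auto
      then show ?thesis by (intro bexI[of _ x]) auto
    next
      case False
      then have "x = s \<or> E x s" using tot[of x s] by auto
      then show ?thesis using s by (intro bexI[of _ s]) auto
    qed
  qed simp
  have min: "\<exists>m\<in>S. \<forall>t\<in>S. t = m \<or> E m t" if "finite S" "S \<noteq> {}" for S
    using that
  proof (induction rule: finite_ne_induct)
    case (insert x F)
    then obtain s where s: "s \<in> F" "\<forall>t\<in>F. t = s \<or> E s t" by auto
    show ?case
    proof (cases "E x s")
      case True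
      have "t = x \<or> E x t" if "t \<in> insert x F" for t using that s(2) True tr[of x s t] by auto
      then show ?thesis by (intro bexI[of _ x]) auto
    next
      case False
      then have "x = s \<or> E s x" using tot[of x s] by auto
      then show ?thesis using s by (intro bexI[of _ s]) auto
    qed
  qed simp
  show ?thesis
  proof unfold_locales
    fix L U X :: "'a set" and d
    assume fin: "finite L" "finite U" and cut: "cut E True L U" and X: "finite X" "d \<notin> X"
    obtain a b where ab: "E a b" "\<forall>l\<in>L. l = a \<or> E l a" "\<forall>u\<in>U. u = b \<or> E b u"
    proof (cases "L = {}")
      case True
      obtain b where b: "\<forall>u\<in>U. u = b \<or> E b u" using min[OF fin(2)] by (cases "U = {}") auto
      obtain a where "E a b" using ends by blast
      then show ?thesis using that b True by simp
    next
      case False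
      obtain a where a: "a \<in> L" "\<forall>l\<in>L. l = a \<or> E l a" using max[OF fin(1) False] by blast
      show ?thesis
      proof (cases "U = {}")
        case True
        obtain b where "E a b" using ends by blast
        then show ?thesis using that a True by simp
      next
        case False
        obtain b where b: "b \<in> U" "\<forall>u\<in>U. u = b \<or> E b u" using min[OF fin(2) False] by blast
        have "E a b" using cut a(1) b(1) by (simp add: cut_def)
        then show ?thesis using that a b by simp
      qed
    qed
    obtain x where x: "[x] \<in> tp M X [d]" "E a x" "E x b" using dens[OF X ab(1)] by blast
    then obtain \<sigma> where s: "\<sigma> \<in> Fix M X" "x = \<sigma> d" by (auto simp: tp_def)
    have "E l x" if "l \<in> L" for l using ab(2) that x(2) tr[of l a x] by auto
    moreover have "E x u" if "u \<in> U" for u using ab(3) that x(3) tr[of x b u] by auto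
    ultimately show "\<exists>\<sigma>\<in>Fix M X. (\<forall>l\<in>L. E l (\<sigma> d)) \<and> (\<forall>u\<in>U. E (\<sigma> d) u)"
      using s by (intro bexI[of _ \<sigma>]) auto
  qed (use c irr tr tot asy in blast)+
qed

text \<open>That the arrows form a tournament is read off from the structures with one and two points in the age.\<close>

lemma tournament_expansion_expansion:
  assumes c: "countable (UNIV :: 'a set)" and E: "tournament_expansion M E"
  shows "expansion M ind E False"
proof -
  have lim: "wf_struct (\<lambda>_. 2) (bin_struct E)" "age (\<lambda>_. 2) (bin_struct E) = tournament_class"
    using E by (auto simp: tournament_expansion_def fraisse_limit_def)
  have u: "univ (bin_struct E) = UNIV" by (simp add: bin_struct_def)
  have irr: "\<not> E a a" for a
  proof -
    have "pullback (bin_struct E) (\<lambda>_. a) {0} \<in> tournament_class"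
      using pullback_age[OF lim(1) u, of "{0}" "\<lambda>_. a"] lim(2) by simp
    then show ?thesis by (simp add: tournament_class_def pullback_def bin_struct_def)
  qed
  have tour: "E a b \<longleftrightarrow> \<not> E b a" if "a \<noteq> b" for a b
  proof -
    let ?f = "\<lambda>n :: nat. if n = 0 then a else b"
    have "inj_on ?f {0, 1}" using that by (auto simp: inj_on_def)
    then have P: "pullback (bin_struct E) ?f {0, 1} \<in> tournament_class"
      using pullback_age[OF lim(1) u, of "{0, 1}" ?f] lim(2) by simp
    define P where "P = pullback (bin_struct E) ?f {0, 1}"
    have "\<forall>x\<in>univ P. \<forall>y\<in>univ P. x \<noteq> y \<longrightarrow> (rel P () [x, y] \<longleftrightarrow> \<not> rel P () [y, x])"
      using P unfolding P_def[symmetric] tournament_class_def by (elim CollectE conjE) assumption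
    moreover have "0 \<in> univ P" "1 \<in> univ P" by (simp_all add: P_def pullback_def)
    ultimately have "rel P () [0, 1] \<longleftrightarrow> \<not> rel P () [1, 0]" by (metis zero_neq_one)
    moreover have "rel P () [0, 1] \<longleftrightarrow> E a b" "rel P () [1, 0] \<longleftrightarrow> E b a"
      by (simp_all add: P_def pullback_def bin_struct_def)
    ultimately show ?thesis by blast
  qed
  show ?thesis
  proof unfold_locales
    fix L U X :: "'a set" and d
    assume fin: "finite L" "finite U" and cut: "cut E False L U" and X: "finite X" "d \<notin> X"
    have "U \<inter> L = {}" using cut by (auto simp: cut_def)
    then have "finite U \<and> finite L \<and> U \<inter> L = {}" using fin by simp
    moreover have "\<forall>A B. finite A \<and> finite B \<and> A \<inter> B = {} \<longrightarrow>
        (\<exists>x. [x] \<in> tp M X [d] \<and> (\<forall>a\<in>A. E x a) \<and> (\<forall>b\<in>B. E b x))"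
      using conjI[OF X(1) infinite_tp[OF X]]
      by (rule E[unfolded tournament_expansion_def, THEN conjunct2, THEN spec, THEN spec, THEN mp])
    ultimately have "\<exists>x. [x] \<in> tp M X [d] \<and> (\<forall>a\<in>U. E x a) \<and> (\<forall>b\<in>L. E b x)"
      by (elim allE impE) assumption
    then obtain x where x: "[x] \<in> tp M X [d]" "\<forall>a\<in>U. E x a" "\<forall>b\<in>L. E b x"
      by (elim exE conjE) (rule that, assumption+)
    then show "\<exists>\<sigma>\<in>Fix M X. (\<forall>l\<in>L. E l (\<sigma> d)) \<and> (\<forall>u\<in>U. E (\<sigma> d) u)"
      by (auto simp: tp_def)
  next
    show "E a b \<or> E b a" if "a \<noteq> b" for a b using tour[OF that] by blast
    show "\<not> E b a" if "E a b" for a b using that tour irr by metis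
  qed (use c irr in blast)+
qed

end

section \<open>Free amalgamation\<close>

text \<open>The new point is realized in the free amalgam of a copy of \<open>X \<union> A\<close> on even numbers with a copy of
  \<open>X \<union> {c}\<close> in which \<open>c\<close> has become the number 1.\<close>

lemma free_ind_exists:
  fixes M :: "('r, 'a) struct"
  assumes K: "free_amalgamation_class ar K" "fraisse_limit ar K M" and fin: "finite X" "finite A" and c: "c \<notin> X"
  shows "\<exists>\<sigma>\<in>Fix M X. free_ind M {\<sigma> c} X A"
proof -
  have M: "wf_struct ar M" "univ M = UNIV" "countable (UNIV :: 'a set)" "homogeneous M" "age ar M = K"
    using K(2) by (auto simp: fraisse_limit_def)
  obtain e :: "'a \<Rightarrow> nat" where e: "inj e" using M(3) by (auto simp: countable_def)
  define i where "i u = 2 * e u" for u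
  define d where "d n = (if n = 1 then c else inv_into UNIV e (n div 2))" for n :: nat
  have di: "d (i u) = u" for u using e by (simp add: d_def i_def)
  have d1: "d 1 = c" by (simp add: d_def)
  have i1: "i u \<noteq> 1" for u by (simp add: i_def)
  have inji: "i u = i v \<longleftrightarrow> u = v" for u v using e by (auto simp: i_def dest: injD)
  define VA where "VA = i ` X"
  define VB where "VB = i ` (X \<union> A)"
  define VC where "VC = insert 1 (i ` X)"
  have finV: "finite VA" "finite VB" "finite VC" using fin by (auto simp: VA_def VB_def VC_def)
  have inj: "inj_on d VA" "inj_on d VB" "inj_on d VC"
    using c by (auto simp: inj_on_def VA_def VB_def VC_def di d1[simplified])
  define B where "B = pullback M d VB"
  define C where "C = pullback M d VC"
  have "pullback M d VA \<in> K" "B \<in> K" "C \<in> K"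
    using pullback_age[OF M(1,2)] finV inj M(5) by (auto simp: B_def C_def)
  moreover have "univ B \<inter> univ C = univ (pullback M d VA)"
    using i1 by (auto simp: B_def C_def pullback_def VA_def VB_def VC_def dest: sym)
  moreover have "substr B (univ (pullback M d VA)) = pullback M d VA"
    "substr C (univ (pullback M d VA)) = pullback M d VA"
    by (auto simp: substr_def B_def C_def pullback_def VA_def VB_def VC_def intro!: ext)
  ultimately have D: "free_amalgam B C \<in> age ar M"
    using K(1) unfolding free_amalgamation_class_def M(5) by metis
  define D where "D = free_amalgam B C"
  have uD: "univ D = VB \<union> VC" by (simp add: D_def free_amalgam_def B_def C_def pullback_def)
  have rD: "rel D r ns \<longleftrightarrow> (set ns \<subseteq> VB \<or> set ns \<subseteq> VC) \<and> rel M r (map d ns)" for r ns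
    by (auto simp: D_def free_amalgam_def B_def C_def pullback_def)
  have mdi: "map d (map i xs) = xs" for xs by (simp add: di map_idI)
  have reli: "rel D r (map i xs) \<longleftrightarrow> rel M r xs" if "set xs \<subseteq> X \<union> A" for r xs
  proof -
    have "set (map i xs) \<subseteq> VB" using that by (auto simp: VB_def)
    then show ?thesis by (simp only: rD mdi) simp
  qed
  have "finite (X \<union> A)" "inj_on i (X \<union> A)" "i ` (X \<union> A) \<subseteq> univ D"
    using fin inji by (simp_all add: inj_on_def uD VB_def)
  then obtain j where j: "inj_on j (univ D)" "\<And>r ns. set ns \<subseteq> univ D \<Longrightarrow> rel M r (map j ns) \<longleftrightarrow> rel D r ns"
    "\<And>w. w \<in> X \<union> A \<Longrightarrow> j (i w) = w"
    using realize_over[OF M(2,4) D[folded D_def] _ _ _ reli] by metis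
  define c' where "c' = j 1"
  have c'n: "c' \<notin> X \<union> A"
  proof
    assume c': "c' \<in> X \<union> A"
    then have "j (i c') = j 1" using j(3) by (simp add: c'_def)
    moreover have "i c' \<in> univ D" "1 \<in> univ D" using c' by (auto simp: uD VB_def VC_def)
    ultimately have "i c' = 1" using j(1) by (auto dest: inj_onD)
    then show False using i1 by simp
  qed
  define k where "k u = (if u = c' then 1 else i u)" for u
  have jk: "j (k u) = u" if "u \<in> insert c' (X \<union> A)" for u
    using that j(3) c'n by (auto simp: k_def c'_def)
  have kD: "k u \<in> univ D" if "u \<in> insert c' (X \<union> A)" for u
    using that by (auto simp: k_def uD VB_def VC_def)
  have relk: "rel M r xs \<longleftrightarrow> rel D r (map k xs)" if "set xs \<subseteq> insert c' (X \<union> A)" for r xs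
  proof -
    have "map j (map k xs) = xs" using jk that by (auto intro!: map_idI)
    moreover have "set (map k xs) \<subseteq> univ D" using kD that by auto
    ultimately show ?thesis using j(2)[of "map k xs" r] by simp
  qed
  define f where "f u = (if u = c then c' else u)" for u
  have "\<exists>g\<in>Aut M. \<forall>a\<in>insert c X. g a = f a"
  proof (rule homogeneous_extend[OF M(2,4)])
    show "inj_on f (insert c X)" using c'n c by (auto simp: inj_on_def f_def)
    fix r xs assume xs: "set xs \<subseteq> insert c X"
    have kf: "k (f u) \<in> VC" "d (k (f u)) = u" if "u \<in> insert c X" for u
      using that c'n c di d1 by (auto simp: k_def f_def VC_def)
    have "set (map f xs) \<subseteq> insert c' (X \<union> A)" using xs by (auto simp: f_def)
    then have "rel M r (map f xs) \<longleftrightarrow> rel D r (map k (map f xs))" by (rule relk)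
    also have "\<dots> \<longleftrightarrow> rel M r (map d (map k (map f xs)))" using kf(1) xs by (auto simp: rD)
    also have "map d (map k (map f xs)) = xs" using kf(2) xs by (auto intro!: map_idI)
    finally show "rel M r (map f xs) \<longleftrightarrow> rel M r xs" .
  qed (use fin in simp)
  then obtain \<sigma> where s: "\<sigma> \<in> Aut M" "\<forall>a\<in>insert c X. \<sigma> a = f a" by blast
  then have "\<sigma> \<in> Fix M X" "\<sigma> c = c'" using c by (auto simp: Fix_def f_def)
  moreover have "free_ind M {c'} X A"
    unfolding free_ind_def
  proof (intro conjI notI)
    show "{c'} \<inter> A \<subseteq> X" using c'n by auto
    assume "\<exists>r xs. rel M r xs \<and> set xs \<subseteq> {c'} \<union> X \<union> A \<and> set xs \<inter> ({c'} - X) \<noteq> {} \<and> set xs \<inter> (A - X) \<noteq> {}"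
    then obtain r xs a where xs: "rel M r xs" "set xs \<subseteq> insert c' (X \<union> A)" "c' \<in> set xs" "a \<in> set xs" "a \<in> A" "a \<notin> X"
      by auto
    have "rel D r (map k xs)" using xs(1,2) relk by simp
    then have or: "set (map k xs) \<subseteq> VB \<or> set (map k xs) \<subseteq> VC" by (simp add: rD)
    have "k c' = 1" "k a = i a" using xs(5) c'n by (auto simp: k_def)
    then have in1: "1 \<in> set (map k xs)" "i a \<in> set (map k xs)" using xs(3,4) by force+
    have "1 \<notin> VB" using i1 by (auto simp: VB_def dest: sym)
    moreover have "i a \<notin> VC" using i1[of a] inji xs(6) by (auto simp: VC_def)
    ultimately show False using or in1 by blast
  qed
  ultimately show ?thesis by (intro bexI[of _ \<sigma>]) simp_all
qed

text \<open>Stationarity holds since a point independent from \<open>A\<close> over \<open>X\<close> has no relations with \<open>A\<close> other than those inside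
\<open>X\<close>, so that the map that moves the point and fixes \<open>X \<union> A\<close> is a partial isomorphism.\<close>

lemma free_independence:
  fixes M :: "('r, 'a) struct"
  assumes K: "free_amalgamation_class ar K" "fraisse_limit ar K M" and tr: "transitive M"
  shows "independence M (free_ind M)"
proof -
  have M: "univ M = UNIV" "homogeneous M" using K(2) by (auto simp: fraisse_limit_def)
  show ?thesis
  proof unfold_locales
    show "univ M = UNIV" by (rule M(1))
  next
    fix \<sigma> A B C assume s: "\<sigma> \<in> Aut M" and i: "free_ind M A B C"
    have b: "bij \<sigma>" using Aut_bij[OF M(1) s] .
    have inj: "\<sigma> a = \<sigma> b \<longleftrightarrow> a = b" for a b using b by (auto simp: bij_def dest: injD)
    show "free_ind M (\<sigma> ` A) (\<sigma> ` B) (\<sigma> ` C)"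
      unfolding free_ind_def
    proof (intro conjI notI)
      show "\<sigma> ` A \<inter> \<sigma> ` C \<subseteq> \<sigma> ` B" using i inj by (auto simp: free_ind_def)
      assume "\<exists>r xs. rel M r xs \<and> set xs \<subseteq> \<sigma> ` A \<union> \<sigma> ` B \<union> \<sigma> ` C \<and>
        set xs \<inter> (\<sigma> ` A - \<sigma> ` B) \<noteq> {} \<and> set xs \<inter> (\<sigma> ` C - \<sigma> ` B) \<noteq> {}"
      then obtain r xs where xs: "rel M r xs" "set xs \<subseteq> \<sigma> ` (A \<union> B \<union> C)"
        "set xs \<inter> (\<sigma> ` A - \<sigma> ` B) \<noteq> {}" "set xs \<inter> (\<sigma> ` C - \<sigma> ` B) \<noteq> {}" by (auto simp: image_Un)
      obtain ys where ys: "xs = map \<sigma> ys" "set ys \<subseteq> A \<union> B \<union> C"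
      proof
        have ii: "iv \<sigma> (\<sigma> a) = a" "\<sigma> (iv \<sigma> a) = a" for a
          using b by (simp_all add: bij_is_inj bij_is_surj surj_f_inv_f)
        show "xs = map \<sigma> (map (iv \<sigma>) xs)" by (simp add: ii map_idI)
        show "set (map (iv \<sigma>) xs) \<subseteq> A \<union> B \<union> C" using xs(2) ii(1) by auto
      qed
      have "rel M r ys" using xs(1) s ys(1) by (simp add: Aut_iff[OF M(1)])
      moreover have "set ys \<inter> (A - B) \<noteq> {}" "set ys \<inter> (C - B) \<noteq> {}" using xs(3,4) inj by (auto simp: ys(1))
      ultimately show False using i ys(2) unfolding free_ind_def by blast
    qed
  next
    fix A B C assume "free_ind M A B C"
    then show "free_ind M C B A" unfolding free_ind_def by blast
  next
    fix A B C :: "'a set" assume "A \<subseteq> B"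
    then show "free_ind M A B C" unfolding free_ind_def by blast
  next
    fix A B C assume "free_ind M A B C"
    then show "A \<inter> C \<subseteq> B" unfolding free_ind_def by blast
  next
    fix A B C D
    show "free_ind M A B (C \<union> D) \<longleftrightarrow> free_ind M A B C \<and> free_ind M A (B \<union> C) D"
    proof
      assume i: "free_ind M A B (C \<union> D)"
      have "free_ind M A B C" using i unfolding free_ind_def by blast
      moreover have "free_ind M A (B \<union> C) D"
        unfolding free_ind_def
      proof (intro conjI notI)
        show "A \<inter> D \<subseteq> B \<union> C" using i unfolding free_ind_def by blast
        assume "\<exists>r xs. rel M r xs \<and> set xs \<subseteq> A \<union> (B \<union> C) \<union> D \<and> set xs \<inter> (A - (B \<union> C)) \<noteq> {} \<and>
          set xs \<inter> (D - (B \<union> C)) \<noteq> {}"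
        then obtain r xs a b where "rel M r xs" "set xs \<subseteq> A \<union> B \<union> (C \<union> D)" "a \<in> set xs" "a \<in> A - B"
          "b \<in> set xs" "b \<in> (C \<union> D) - B" by blast
        then show False using i unfolding free_ind_def by blast
      qed
      ultimately show "free_ind M A B C \<and> free_ind M A (B \<union> C) D" ..
    next
      assume "free_ind M A B C \<and> free_ind M A (B \<union> C) D"
      then have i1: "A \<inter> C \<subseteq> B" "\<And>r xs. rel M r xs \<Longrightarrow> set xs \<subseteq> A \<union> B \<union> C \<Longrightarrow>
            set xs \<inter> (A - B) = {} \<or> set xs \<inter> (C - B) = {}"
        and i2: "A \<inter> D \<subseteq> B \<union> C" "\<And>r xs. rel M r xs \<Longrightarrow> set xs \<subseteq> A \<union> (B \<union> C) \<union> D \<Longrightarrow>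
            set xs \<inter> (A - (B \<union> C)) = {} \<or> set xs \<inter> (D - (B \<union> C)) = {}"
        unfolding free_ind_def by blast+
      show "free_ind M A B (C \<union> D)"
        unfolding free_ind_def
      proof (intro conjI notI)
        show "A \<inter> (C \<union> D) \<subseteq> B" using i1(1) i2(1) by blast
        assume "\<exists>r xs. rel M r xs \<and> set xs \<subseteq> A \<union> B \<union> (C \<union> D) \<and> set xs \<inter> (A - B) \<noteq> {} \<and>
          set xs \<inter> (C \<union> D - B) \<noteq> {}"
        then obtain r xs a b where xs: "rel M r xs" "set xs \<subseteq> A \<union> (B \<union> C) \<union> D" "a \<in> set xs" "a \<in> A" "a \<notin> B"
          "b \<in> set xs" "b \<in> C \<union> D" "b \<notin> B" by blast
        have "a \<notin> C" using xs(4,5) i1(1) by blast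
        then have D: "set xs \<inter> (D - (B \<union> C)) = {}" using i2(2)[OF xs(1,2)] xs(3-5) by blast
        then have "b \<in> C" using xs(6-8) by blast
        moreover have "set xs \<subseteq> A \<union> B \<union> C" using xs(2) D by blast
        ultimately show False using i1(2)[OF xs(1)] xs(3-8) by blast
      qed
    qed
  next
    fix X A :: "'a set" and \<sigma> x
    assume fin: "finite X" "finite A" and s: "\<sigma> \<in> Fix M X" and i: "free_ind M {x} X A" "free_ind M {\<sigma> x} X A"
    show "\<exists>\<tau>\<in>Fix M (X \<union> A). \<tau> x = \<sigma> x"
    proof (cases "x \<in> X")
      case True
      then have "\<sigma> x = x" using s by (simp add: Fix_def)
      then show ?thesis by (intro bexI[of _ id]) (simp_all add: Fix_def Aut_id)
    next
      case False
      have inj: "\<sigma> a = \<sigma> b \<longleftrightarrow> a = b" for a b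
        using Aut_bij[OF M(1) Fix_subset_Aut[OF s]] by (auto simp: bij_def dest: injD)
      have sX: "\<sigma> u = u" if "u \<in> X" for u using s that by (simp add: Fix_def)
      have sx: "\<sigma> x \<notin> X"
      proof
        assume "\<sigma> x \<in> X"
        then have "\<sigma> (\<sigma> x) = \<sigma> x" by (rule sX)
        then show False using False inj \<open>\<sigma> x \<in> X\<close> by simp
      qed
      have nA: "x \<notin> X \<union> A" "\<sigma> x \<notin> X \<union> A" using i False sx unfolding free_ind_def by blast+
      define f where "f u = (if u = x then \<sigma> x else u)" for u
      have "\<exists>g\<in>Aut M. \<forall>a\<in>insert x (X \<union> A). g a = f a"
      proof (rule homogeneous_extend[OF M])
        show "inj_on f (insert x (X \<union> A))" using nA by (auto simp: inj_on_def f_def)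
        fix r xs assume xs: "set xs \<subseteq> insert x (X \<union> A)"
        show "rel M r (map f xs) \<longleftrightarrow> rel M r xs"
        proof (cases "x \<in> set xs")
          case False
          then have "map f xs = xs" by (intro map_idI) (auto simp: f_def)
          then show ?thesis by simp
        next
          case x: True
          show ?thesis
          proof (cases "set xs \<subseteq> insert x X")
            case True
            then have e: "map f xs = map \<sigma> xs" using sX by (auto simp: f_def)
            have "rel M r (map \<sigma> xs) \<longleftrightarrow> rel M r xs" using Fix_subset_Aut[OF s] by (simp add: Aut_iff[OF M(1)])
            then show ?thesis by (simp only: e)
          next
            case False
            then obtain a where a: "a \<in> set xs" "a \<in> A" "a \<notin> X" "a \<noteq> x" using xs by blast
            have "\<not> rel M r xs" using i(1) x a xs nA unfolding free_ind_def by blast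
            moreover have "set (map f xs) \<subseteq> {\<sigma> x} \<union> X \<union> A" using xs by (auto simp: f_def)
            moreover have "\<sigma> x \<in> set (map f xs)" "a \<in> set (map f xs)" using x a by (auto simp: f_def image_iff)
            then have "\<not> rel M r (map f xs)" using i(2) calculation(2) a nA unfolding free_ind_def by blast
            ultimately show ?thesis by simp
          qed
        qed
      qed (use fin in simp)
      then obtain g where g: "g \<in> Aut M" "\<forall>a\<in>insert x (X \<union> A). g a = f a" by blast
      then have "g \<in> Fix M (X \<union> A)" "g x = \<sigma> x" using nA by (auto simp: Fix_def f_def)
      then show ?thesis by blast
    qed
  next
    fix X A :: "'a set" and c assume "finite X" "finite A" "c \<notin> X"
    then show "\<exists>\<sigma>\<in>Fix M X. free_ind M {\<sigma> c} X A" by (rule free_ind_exists[OF K])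
  next
    fix x y show "\<exists>\<sigma>\<in>Aut M. \<sigma> x = y" using tr by (simp add: transitive_def)
  qed
qed

context expansion
begin

text \<open>Unlike \<open>move_generic\<close> this moves all points of \<open>S\<close> into the same cut, whatever their mutual positions.\<close>

lemma move_into_cut:
  assumes "finite S" "finite W" "finite C" "S \<inter> W = {}" and L: "finite L" "finite U" "cut E ord L U"
  shows "\<exists>\<kappa>\<in>Fix M W. ind (\<kappa> ` S) W C \<and> (\<forall>s\<in>S. (\<forall>l\<in>L. E l (\<kappa> s)) \<and> (\<forall>u\<in>U. E (\<kappa> s) u))"
  using assms(1,4)
proof (induction rule: finite_induct)
  case empty
  show ?case by (intro bexI[of _ id]) (simp_all add: ind_base Fix_def Aut_id)
next
  case (insert x F)
  then obtain \<kappa> where k: "\<kappa> \<in> Fix M W" "ind (\<kappa> ` F) W C"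
    "\<forall>s\<in>F. (\<forall>l\<in>L. E l (\<kappa> s)) \<and> (\<forall>u\<in>U. E (\<kappa> s) u)" by auto
  have "\<kappa> x \<notin> W" using Fix_notin[OF k(1)] insert.prems by auto
  moreover have "\<kappa> x \<notin> \<kappa> ` F" using insert.hyps(2) Fix_inj[OF k(1)] by auto
  ultimately have "\<kappa> x \<notin> W \<union> \<kappa> ` F" by simp
  with extend[OF L] insert.hyps(1) assms(2,3) obtain \<sigma> where s: "\<sigma> \<in> Fix M (W \<union> \<kappa> ` F)"
    "ind {\<sigma> (\<kappa> x)} (W \<union> \<kappa> ` F) C" "\<forall>l\<in>L. E l (\<sigma> (\<kappa> x))" "\<forall>u\<in>U. E (\<sigma> (\<kappa> x)) u"
    by (metis finite_UnI finite_imageI)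
  have sF: "\<sigma> (\<kappa> t) = \<kappa> t" if "t \<in> F" for t using s(1) that by (auto simp: Fix_def)
  have "(\<sigma> \<circ> \<kappa>) ` insert x F = \<kappa> ` F \<union> {\<sigma> (\<kappa> x)}" using sF by (auto simp: image_iff)
  then have "ind ((\<sigma> \<circ> \<kappa>) ` insert x F) W C" using ind_trans_left[OF k(2) s(2)] by simp
  moreover have "\<sigma> \<circ> \<kappa> \<in> Fix M W" using Fix_comp[OF subsetD[OF Fix_mono s(1)] k(1)] by simp
  moreover have "(\<forall>l\<in>L. E l ((\<sigma> \<circ> \<kappa>) t)) \<and> (\<forall>u\<in>U. E ((\<sigma> \<circ> \<kappa>) t) u)" if "t \<in> insert x F" for t
    using that s(3,4) k(3) sF by auto
  ultimately show ?case by (intro bexI[of _ "\<sigma> \<circ> \<kappa>"]) blast+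
qed

lemma displacement_neq: "displacement (\<lambda>X x Y y. x \<noteq> y)"
  by (simp add: displacement_def G_inj)

lemma symmetric_displacement_neq: "symmetric_displacement (\<lambda>X x Y y. x \<noteq> y)"
  by (auto simp: symmetric_displacement_def)

lemma moves_maximally_neq: "x \<notin> X \<Longrightarrow> ind2 ind {x} X Y {y} \<Longrightarrow> x \<noteq> y"
  using ind_disjoint[of "{x}" X "{y} \<union> Y"] by (auto simp: ind2_def)

lemma composes_mono:
  assumes "composes P Q" and "\<And>X x Y y. x \<notin> X \<Longrightarrow> P' X x Y y \<Longrightarrow> P X x Y y"
  shows "composes P' Q"
  unfolding composes_def
proof (intro allI impI)
  fix A X x p q
  assume a: "finite A" "p \<in> G" "q \<in> G" "X \<subseteq> A" "p ` X \<subseteq> A" "q ` X \<subseteq> A" "x \<notin> A"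
    "ind {x} X A" "ind {p x} (p ` X) A" "ind {q x} (q ` X) A" "ind {q x} (insert x A) {p x}"
    and P: "P' X x (p ` X) (p x)" "P' X x (q ` X) (q x)"
  have "x \<notin> X" using a(4,7) by auto
  then show "Q (p ` X) (p x) (q ` X) (q x)"
    by (intro composesD[OF assms(1) a] assms(2) P)
qed

end

locale free_expansion = expansion M "free_ind M" E ord for M :: "('r, 'a) struct" and E ord +
  assumes homogeneous_M: "homogeneous M" and nontrivial_M: "nontrivial M"
begin

lemma free_indD: "free_ind M A B C \<Longrightarrow> rel M r xs \<Longrightarrow> set xs \<subseteq> A \<union> B \<union> C \<Longrightarrow> u \<in> set xs \<Longrightarrow> u \<in> A - B \<Longrightarrow>
    v \<in> set xs \<Longrightarrow> v \<in> C - B \<Longrightarrow> False"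
  unfolding free_ind_def by blast

lemma Aut_rel: "\<sigma> \<in> Aut M \<Longrightarrow> rel M r (map \<sigma> xs) \<longleftrightarrow> rel M r xs"
  using Aut_iff[OF univ_M] by simp

text \<open>Below the least size of a related set with at least two points only constant tuples are related, and those are
alike by transitivity.\<close>

lemma small_tuples:
  assumes n: "\<And>r xs. rel M r xs \<Longrightarrow> 2 \<le> card (set xs) \<Longrightarrow> n \<le> card (set xs)"
    and f: "inj_on f (set xs)" "card (set xs) < n"
  shows "rel M r (map f xs) \<longleftrightarrow> rel M r xs"
proof (cases "2 \<le> card (set xs)")
  case True
  have "card (set (map f xs)) = card (set xs)" using f(1) by (simp add: card_image)
  then show ?thesis using n[of r xs] n[of r "map f xs"] True f(2) by auto
next
  case False
  show ?thesis
  proof (cases "xs = []")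
    case False
    then have "card (set xs) \<noteq> 0" by simp
    then have "card (set xs) = 1" using \<open>\<not> 2 \<le> card (set xs)\<close> by linarith
    then obtain a where a: "set xs = {a}" by (rule card_1_singletonE)
    obtain \<sigma> where s: "\<sigma> \<in> Aut M" "\<sigma> a = f a" using point_transitive by blast
    have e: "map f xs = map \<sigma> xs" using a s(2) by simp
    show ?thesis unfolding e by (rule Aut_rel[OF s(1)])
  qed simp
qed

lemma small_extend:
  assumes n: "\<And>r xs. rel M r xs \<Longrightarrow> 2 \<le> card (set xs) \<Longrightarrow> n \<le> card (set xs)"
    and f: "finite S" "inj_on f S" "card S < n"
  shows "\<exists>g\<in>Aut M. \<forall>a\<in>S. g a = f a"
proof (rule homogeneous_extend[OF univ_M homogeneous_M f(1,2)])
  fix r xs assume xs: "set xs \<subseteq> S"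
  show "rel M r (map f xs) \<longleftrightarrow> rel M r xs"
  proof (rule small_tuples[OF n])
    show "inj_on f (set xs)" using f(2) xs by (rule inj_on_subset)
    show "card (set xs) < n" using card_mono[OF f(1) xs] f(3) by simp
  qed
qed

text \<open>If only constant tuples were related, every permutation would be an automorphism.\<close>

lemma minimal_tuple:
  obtains r xs where "rel M r xs" "2 \<le> card (set xs)"
    "\<And>s ys. rel M s ys \<Longrightarrow> 2 \<le> card (set ys) \<Longrightarrow> card (set xs) \<le> card (set ys)"
proof -
  have ex: "\<exists>k r xs. rel M r xs \<and> 2 \<le> card (set xs) \<and> k = card (set xs)"
  proof (rule ccontr)
    assume none: "\<not> ?thesis"
    have "Aut M = {f. bij f}"
    proof (intro equalityI subsetI)
      show "f \<in> {f. bij f}" if "f \<in> Aut M" for f using Aut_bij[OF univ_M that] by simp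
      fix f :: "'a \<Rightarrow> 'a" assume "f \<in> {f. bij f}"
      then have f: "bij f" by simp
      have "rel M r (map f xs) \<longleftrightarrow> rel M r xs" for r xs
      proof (rule small_tuples[of "Suc (card (set xs))"])
        show "inj_on f (set xs)" using f by (auto simp: bij_def intro: inj_on_subset)
      qed (use none in auto)
      then show "f \<in> Aut M" using f by (simp add: Aut_iff[OF univ_M])
    qed
    then show False using nontrivial_M by (simp add: nontrivial_def)
  qed
  define n where "n = (LEAST k. \<exists>r xs. rel M r xs \<and> 2 \<le> card (set xs) \<and> k = card (set xs))"
  have "\<exists>r xs. rel M r xs \<and> 2 \<le> card (set xs) \<and> n = card (set xs)" unfolding n_def by (rule LeastI_ex[OF ex])
  then obtain r xs where xs: "rel M r xs" "2 \<le> card (set xs)" "n = card (set xs)" by blast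
  have "n \<le> card (set ys)" if "rel M s ys" "2 \<le> card (set ys)" for s ys
    unfolding n_def by (rule Least_le) (use that in blast)
  then show ?thesis using xs that by simp
qed

text \<open>Place a minimal related set with one point at \<open>a\<close> and the others generic over \<open>a\<close>. If \<open>h\<close> fixed all the others, they would
be related to \<open>h a\<close>, from which they are independent over \<open>a\<close>.\<close>

lemma moved_neighbour:
  assumes h: "h \<in> G" "h a \<noteq> a" and C: "finite C"
  obtains b where "h b \<noteq> b" "b \<noteq> a" "b \<notin> C" "free_ind M {b} {a} C"
proof -
  obtain r xs where xs: "rel M r xs" "2 \<le> card (set xs)"
    "\<And>s ys. rel M s ys \<Longrightarrow> 2 \<le> card (set ys) \<Longrightarrow> card (set xs) \<le> card (set ys)" by (rule minimal_tuple) blast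
  obtain q1 q2 where q: "q1 \<in> set xs" "q2 \<in> set xs" "q1 \<noteq> q2"
    using xs(2) by (metis List.finite_set One_nat_def Suc_1 card_le_Suc0_iff_eq not_less_eq_eq)
  obtain \<sigma> where s: "\<sigma> \<in> Aut M" "\<sigma> q1 = a" using point_transitive by blast
  have sinj: "\<sigma> u = \<sigma> v \<longleftrightarrow> u = v" for u v using Aut_bij[OF univ_M s(1)] by (auto simp: bij_def dest: injD)
  obtain k where k: "k \<in> GF {a}" "free_ind M (k ` \<sigma> ` (set xs - {q1})) {a} (C \<union> {h a})"
    using move_generic[of "\<sigma> ` (set xs - {q1})" "{a}" "C \<union> {h a}"] C by auto
  have ka: "k a = a" using GF_fix[OF k(1)] by simp
  define f where "f = k \<circ> \<sigma>"
  have fA: "f \<in> Aut M" using s(1) k(1) by (simp add: f_def Aut_comp G_Aut GF_G)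
  have finj: "f u = f v \<longleftrightarrow> u = v" for u v using sinj G_inj[OF GF_G[OF k(1)]] by (simp add: f_def)
  have fq: "f q1 = a" using s(2) ka by (simp add: f_def)
  have k2: "free_ind M (f ` (set xs - {q1})) {a} (C \<union> {h a})" using k(2) by (simp add: f_def image_comp)
  have "\<exists>u\<in>set xs - {q1}. h (f u) \<noteq> f u"
  proof (rule ccontr)
    assume "\<not> ?thesis"
    then have hf: "h (f u) = f u" if "u \<in> set xs" "u \<noteq> q1" for u using that by auto
    have hfA: "h \<circ> f \<in> Aut M" using h(1) fA by (simp add: Aut_comp G_Aut)
    have r: "rel M r (map (h \<circ> f) xs)" using Aut_rel[OF hfA] xs(1) by blast
    show False
    proof (rule free_indD[OF k2 r, of "f q2" "h a"])
      show "set (map (h \<circ> f) xs) \<subseteq> f ` (set xs - {q1}) \<union> {a} \<union> (C \<union> {h a})"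
        using hf fq by auto
      show "f q2 \<in> set (map (h \<circ> f) xs)" using q hf[of q2] by (auto simp: image_iff intro!: bexI[of _ q2])
      show "f q2 \<in> f ` (set xs - {q1}) - {a}" using q finj[of q2 q1] fq by auto
      show "h a \<in> set (map (h \<circ> f) xs)" using q(1) fq by (auto simp: image_iff intro!: bexI[of _ q1])
      show "h a \<in> C \<union> {h a} - {a}" using h(2) by simp
    qed
  qed
  then obtain u where u: "u \<in> set xs - {q1}" "h (f u) \<noteq> f u" by blast
  have i: "free_ind M {f u} {a} C" by (rule ind_mono[OF k2]) (use u in auto)
  have ne: "f u \<noteq> a" using u finj[of u q1] fq by auto
  moreover have "f u \<notin> C" using ind_disjoint[OF i] ne by auto
  ultimately show ?thesis using that u(2) i by blast
qed

text \<open>The neighbour \<open>a\<close> of a moved point is moved and outside \<open>C\<close>; a neighbour of \<open>a\<close> is then independent from \<open>C\<close>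
even without \<open>a\<close>.\<close>

lemma moved_independent:
  assumes h: "h \<in> G" "h \<noteq> id" and C: "finite C"
  obtains b where "h b \<noteq> b" "b \<notin> C" "free_ind M {b} {} C"
proof -
  obtain a0 where "h a0 \<noteq> a0" using h(2) by (auto simp: fun_eq_iff)
  then obtain a where a: "h a \<noteq> a" "a \<notin> C" using moved_neighbour[OF h(1) _ C] by blast
  obtain b where b: "h b \<noteq> b" "b \<noteq> a" "b \<notin> C" "free_ind M {b} {a} C" using moved_neighbour[OF h(1) a(1) C] by blast
  have "free_ind M {b} {} C"
    unfolding free_ind_def
  proof (intro conjI notI)
    show "{b} \<inter> C \<subseteq> {}" using b(3) by simp
    assume "\<exists>r xs. rel M r xs \<and> set xs \<subseteq> {b} \<union> {} \<union> C \<and> set xs \<inter> ({b} - {}) \<noteq> {} \<and> set xs \<inter> (C - {}) \<noteq> {}"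
    then obtain r xs v where xs: "rel M r xs" "set xs \<subseteq> {b} \<union> C" "b \<in> set xs" "v \<in> set xs" "v \<in> C" by auto
    show False by (rule free_indD[OF b(4) xs(1), of b v]) (use xs a(2) b(2) in auto)
  qed
  with b that show ?thesis by blast
qed

text \<open>Suppose that \<open>h\<close> fixes all realizations of the type of \<open>c\<close> over \<open>X\<close>. A moved point \<open>b\<close> independent from \<open>X\<close> can be
completed by realizations of the type in the structure to a minimal related set, because all subsets of fewer
points look alike and \<open>b\<close> looks over \<open>X\<close> like any other point independent from \<open>X\<close>. The realizations are then moved
over \<open>X\<close> and \<open>b\<close> to the right place with respect to \<open>E\<close>, independent from \<open>h b\<close>. Now \<open>h\<close> fixes them, so they are
related to \<open>h b\<close>, a contradiction.\<close>

lemma displaces_neq: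
  assumes h: "h \<in> G" "h \<noteq> id" shows "displaces (\<lambda>X x Y y. x \<noteq> y) h"
  unfolding displaces_def
proof (intro allI impI, rule ccontr)
  fix X c assume X: "finite X" "c \<notin> X" and "\<not> (\<exists>a\<in>GF X. a c \<noteq> h (a c))"
  then have fixed: "h (a c) = a c" if "a \<in> GF X" for a using that by auto
  obtain b where b: "h b \<noteq> b" "b \<notin> X \<union> iv h ` X" "free_ind M {b} {} (X \<union> iv h ` X)"
    using moved_independent[OF h, of "X \<union> iv h ` X"] X(1) by auto
  have bX: "free_ind M {b} {} X" using b(3) by (rule ind_mono) auto
  have hb: "h b \<notin> X" using b(2) h(1) by (auto simp: image_iff)
  obtain r xs where xs: "rel M r xs" "2 \<le> card (set xs)"
    "\<And>s ys. rel M s ys \<Longrightarrow> 2 \<le> card (set ys) \<Longrightarrow> card (set xs) \<le> card (set ys)" by (rule minimal_tuple) blast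
  obtain q1 q2 where q: "q1 \<in> set xs" "q2 \<in> set xs" "q1 \<noteq> q2"
    using xs(2) by (metis List.finite_set One_nat_def Suc_1 card_le_Suc0_iff_eq not_less_eq_eq)
  define Q where "Q = set xs - {q1}"
  have Q: "finite Q" "card Q < card (set xs)" "q2 \<in> Q" "q1 \<notin> Q" "set xs = insert q1 Q"
    using q card_Diff1_less[OF List.finite_set q(1)] by (auto simp: Q_def)
  define R where "R = (\<lambda>\<sigma>. \<sigma> c) ` Fix M X"
  obtain S where S: "S \<subseteq> R" "finite S" "card S = card Q"
    using infinite_arbitrarily_large[of R "card Q"] infinite_realizations[OF X] unfolding R_def by blast
  obtain f where f: "bij_betw f Q S" using finite_same_card_bij[OF Q(1) S(2)] S(3) by auto
  obtain \<sigma>1 where s1: "\<sigma>1 \<in> Aut M" "\<forall>u\<in>Q. \<sigma>1 u = f u"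
    using small_extend[of "card (set xs)" Q f] xs(3) Q(1,2) bij_betw_imp_inj_on[OF f] by blast
  have s1Q: "\<sigma>1 ` Q = S" using s1(2) f by (auto simp: bij_betw_def image_iff)
  have s1inj: "\<sigma>1 u = \<sigma>1 v \<longleftrightarrow> u = v" for u v using Aut_bij[OF univ_M s1(1)] by (auto simp: bij_def dest: injD)
  have q1S: "\<sigma>1 q1 \<notin> S" using s1Q Q(4) s1inj by auto
  have RX: "s \<notin> X" if "s \<in> R" for s using that Fix_notin[OF _ X(2)] by (auto simp: R_def)
  \<comment> \<open>move the remaining point over \<open>S\<close> away from \<open>X\<close>, and then over \<open>X\<close> to \<open>b\<close>\<close>
  obtain \<sigma>2 where s2: "\<sigma>2 \<in> Fix M S" "free_ind M {\<sigma>2 (\<sigma>1 q1)} S X" using ind_exists[OF S(2) X(1) q1S] by blast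
  define b' where "b' = \<sigma>2 (\<sigma>1 q1)"
  have b'S: "b' \<notin> S" using Fix_notin[OF s2(1) q1S] by (simp add: b'_def)
  have SX: "S \<inter> X = {}" using RX S(1) by auto
  have b'X: "free_ind M {b'} {} X"
    unfolding free_ind_def
  proof (intro conjI notI)
    show "{b'} \<inter> X \<subseteq> {}" using ind_disjoint[OF s2(2)] b'S by (auto simp: b'_def)
    assume "\<exists>r xs. rel M r xs \<and> set xs \<subseteq> {b'} \<union> {} \<union> X \<and> set xs \<inter> ({b'} - {}) \<noteq> {} \<and> set xs \<inter> (X - {}) \<noteq> {}"
    then obtain r xs v where xs: "rel M r xs" "set xs \<subseteq> {b'} \<union> X" "b' \<in> set xs" "v \<in> set xs" "v \<in> X" by auto
    show False by (rule free_indD[OF s2(2) xs(1), of b' v]) (use xs b'S SX in \<open>auto simp: b'_def\<close>)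
  qed
  obtain \<tau>0 where t0: "\<tau>0 \<in> Aut M" "\<tau>0 b' = b" using point_transitive by blast
  then have "\<tau>0 \<in> Fix M {}" by (simp add: Fix_def)
  then obtain \<tau> where t: "\<tau> \<in> Fix M X" "\<tau> b' = b"
    using stationary[of "{}" X \<tau>0 b'] X(1) b'X bX t0(2) by auto
  define \<sigma> where "\<sigma> = \<tau> \<circ> \<sigma>2 \<circ> \<sigma>1"
  have sA: "\<sigma> \<in> Aut M" unfolding \<sigma>_def by (intro Aut_comp Fix_subset_Aut[OF t(1)] Fix_subset_Aut[OF s2(1)] s1(1))
  have sinj: "\<sigma> u = \<sigma> v \<longleftrightarrow> u = v" for u v using Aut_bij[OF univ_M sA] by (auto simp: bij_def dest: injD)
  have sq: "\<sigma> q1 = b" using t(2) by (simp add: \<sigma>_def b'_def)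
  have sR: "\<sigma> u \<in> R" if "u \<in> Q" for u
  proof -
    have "\<sigma>1 u \<in> S" using s1Q that by auto
    then have "\<sigma> u = \<tau> (\<sigma>1 u)" "\<sigma>1 u \<in> R" using s2(1) S(1) by (auto simp: \<sigma>_def Fix_def)
    then obtain \<rho> where "\<rho> \<in> Fix M X" "\<sigma> u = \<tau> (\<rho> c)" by (auto simp: R_def)
    then have "\<tau> \<circ> \<rho> \<in> Fix M X" "\<sigma> u = (\<tau> \<circ> \<rho>) c" using Fix_comp[OF t(1)] by auto
    then show ?thesis unfolding R_def by blast
  qed
  define L where "L = {u \<in> X. E u c}"
  define U where "U = {u \<in> X. E c u}"
  have LU: "finite L" "finite U" "cut E ord L U"
    using X(1) by (auto simp: L_def U_def intro: cut_realized[of _ c])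
  \<comment> \<open>give the realizations the position of \<open>c\<close> over \<open>X\<close>\<close>
  have "\<sigma> u \<noteq> b" if "u \<in> Q" for u using that Q(4) sinj[of u q1] sq by auto
  then have disj: "\<sigma> ` Q \<inter> (X \<union> {b}) = {}" using sR RX by blast
  then obtain \<kappa> where k: "\<kappa> \<in> Fix M (X \<union> {b})" "free_ind M (\<kappa> ` \<sigma> ` Q) (X \<union> {b}) {h b}"
    "\<forall>s\<in>\<sigma> ` Q. (\<forall>l\<in>L. E l (\<kappa> s)) \<and> (\<forall>u\<in>U. E (\<kappa> s) u)"
    using move_into_cut[of "\<sigma> ` Q" "X \<union> {b}" "{h b}", OF _ _ _ _ LU] Q(1) X(1) by auto
  have kX: "\<kappa> \<in> Fix M X" by (rule subsetD[OF Fix_mono k(1)]) blast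
  have hk: "h (\<kappa> (\<sigma> u)) = \<kappa> (\<sigma> u)" if u: "u \<in> Q" for u
  proof -
    obtain \<rho> where r: "\<rho> \<in> Fix M X" "\<sigma> u = \<rho> c" using sR[OF u] by (auto simp: R_def)
    have kr: "\<kappa> \<circ> \<rho> \<in> Fix M X" by (rule Fix_comp[OF kX r(1)])
    have k3: "E l (\<kappa> (\<sigma> u))" "E (\<kappa> (\<sigma> u)) v" if "l \<in> L" "v \<in> U" for l v using k(3) u that by auto
    have "E v ((\<kappa> \<circ> \<rho>) c) \<longleftrightarrow> E v c" if v: "v \<in> X" for v
    proof (cases "E v c")
      case True
      then have "E v (\<kappa> (\<sigma> u))" using k(3) u v by (simp add: L_def)
      then show ?thesis using True r(2) by simp
    next
      case False
      then have "E c v" using E_total[of v c] v X(2) by auto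
      then have "E (\<kappa> (\<sigma> u)) v" using k(3) u v by (simp add: U_def)
      then show ?thesis using False E_asym r(2) by auto
    qed
    then obtain g where "g \<in> GF X" "g c = (\<kappa> \<circ> \<rho>) c" using type_over[OF X(1) kr] by blast
    then show ?thesis using fixed[of g] r(2) by simp
  qed
  have kinj: "\<kappa> u = \<kappa> v \<longleftrightarrow> u = v" for u v by (rule Fix_inj[OF k(1)])
  have kb: "\<kappa> b = b" using k(1) by (simp add: Fix_def)
  have "h \<circ> \<kappa> \<circ> \<sigma> \<in> Aut M" by (intro Aut_comp G_Aut[OF h(1)] Fix_subset_Aut[OF k(1)] sA)
  then have rl: "rel M r (map (h \<circ> \<kappa> \<circ> \<sigma>) xs)" using Aut_rel xs(1) by blast
  have st: "set (map (h \<circ> \<kappa> \<circ> \<sigma>) xs) = insert (h b) (\<kappa> ` \<sigma> ` Q)"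
    using hk sq kb by (force simp: Q(5))
  have "\<sigma> q2 \<notin> X \<union> {b}" using Q(3) disj by blast
  then have n: "\<kappa> (\<sigma> q2) \<notin> X \<union> {b}" by (rule Fix_notin[OF k(1)])
  show False
  proof (rule free_indD[OF k(2) rl, of "\<kappa> (\<sigma> q2)" "h b"])
    show "\<kappa> (\<sigma> q2) \<in> \<kappa> ` \<sigma> ` Q - (X \<union> {b})" using Q(3) n by blast
  qed (use st hb b(1) Q(3) in auto)
qed

text \<open>A relation between \<open>p x\<close> and \<open>q x\<close> is excluded as these points are outside \<open>x\<close> and \<open>A\<close>, over which they
are independent; it is here that both are different from \<open>x\<close>. Relations of only one of them with \<open>X\<close> and its images are
excluded by its independence from \<open>A\<close>.\<close>

lemma composes_neq: "composes (\<lambda>X x Y y. x \<noteq> y) (\<lambda>X x Y y. ind2 (free_ind M) {x} X Y {y})"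
  unfolding composes_def
proof (intro allI impI)
  fix A X x p q
  assume a: "finite A" "p \<in> G" "q \<in> G" "X \<subseteq> A" "p ` X \<subseteq> A" "q ` X \<subseteq> A" "x \<notin> A"
    "free_ind M {x} X A" "free_ind M {p x} (p ` X) A" "free_ind M {q x} (q ` X) A"
    "free_ind M {q x} (insert x A) {p x}" and P: "x \<noteq> p x" "x \<noteq> q x"
  have "p x \<notin> p ` X" "q x \<notin> q ` X" using a(2,3,4,7) by (auto simp: G_inj)
  then have n: "p x \<notin> A" "q x \<notin> A" using ind_disjoint[OF a(9)] ind_disjoint[OF a(10)] by auto
  then have ne: "p x \<noteq> q x" using ind_disjoint[OF a(11)] P by auto
  have both: False if "rel M r xs" "set xs \<subseteq> {p x, q x} \<union> A" "p x \<in> set xs" "q x \<in> set xs" for r xs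
    by (rule free_indD[OF a(11) that(1), of "q x" "p x"]) (use that n P in auto)
  have 1: "free_ind M ({p x} \<union> p ` X) (q ` X) {q x}"
    unfolding free_ind_def
  proof (intro conjI notI)
    show "({p x} \<union> p ` X) \<inter> {q x} \<subseteq> q ` X" using ne n a(5) by auto
    assume "\<exists>r xs. rel M r xs \<and> set xs \<subseteq> {p x} \<union> p ` X \<union> q ` X \<union> {q x} \<and>
      set xs \<inter> ({p x} \<union> p ` X - q ` X) \<noteq> {} \<and> set xs \<inter> ({q x} - q ` X) \<noteq> {}"
    then obtain r xs v where xs: "rel M r xs" "set xs \<subseteq> {p x, q x} \<union> (p ` X \<union> q ` X)" "q x \<in> set xs"
      "v \<in> set xs" "v \<in> {p x} \<union> p ` X - q ` X" by blast
    show False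
    proof (cases "p x \<in> set xs")
      case True then show False using both[OF xs(1)] xs(2,3) a(5,6) by blast
    next
      case False
      have "set xs \<subseteq> {q x} \<union> q ` X \<union> A" using xs(2) False a(5,6) by blast
      moreover have "v \<in> A - q ` X" using xs(4,5) False a(5,6) by blast
      moreover have "q x \<in> {q x} - q ` X" using n a(5,6) by blast
      ultimately show False using free_indD[OF a(10) xs(1)] xs(3,4) by blast
    qed
  qed
  have 2: "free_ind M {p x} (p ` X) ({q x} \<union> q ` X)"
    unfolding free_ind_def
  proof (intro conjI notI)
    show "{p x} \<inter> ({q x} \<union> q ` X) \<subseteq> p ` X" using ne n a(6) by auto
    assume "\<exists>r xs. rel M r xs \<and> set xs \<subseteq> {p x} \<union> p ` X \<union> ({q x} \<union> q ` X) \<and>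
      set xs \<inter> ({p x} - p ` X) \<noteq> {} \<and> set xs \<inter> ({q x} \<union> q ` X - p ` X) \<noteq> {}"
    then obtain r xs v where xs: "rel M r xs" "set xs \<subseteq> {p x, q x} \<union> (p ` X \<union> q ` X)" "p x \<in> set xs"
      "v \<in> set xs" "v \<in> {q x} \<union> q ` X - p ` X" by blast
    show False
    proof (cases "q x \<in> set xs")
      case True then show False using both[OF xs(1)] xs(2,3) a(5,6) by blast
    next
      case False
      have "set xs \<subseteq> {p x} \<union> p ` X \<union> A" using xs(2) False a(5,6) by blast
      moreover have "v \<in> A - p ` X" using xs(4,5) False a(5,6) by blast
      moreover have "p x \<in> {p x} - p ` X" using n a(5,6) by blast
      ultimately show False using free_indD[OF a(9) xs(1)] xs(3,4) by blast
    qed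
  qed
  show "ind2 (free_ind M) {p x} (p ` X) (q ` X) {q x}" using 1 2 by (simp add: ind2_def)
qed

lemma maximal_mover_in_hull:
  assumes h: "h \<in> G" "h \<noteq> id" shows "\<exists>g\<in>normal_hull h. maximal_mover g"
proof (rule maximal_mover_exists[OF h(1) _ h(2)])
  show "displaces moves_generic h"
    by (rule displaces_mono[OF displaces_neq[OF h] h(1)]) (simp add: moves_generic_def)
  show "\<exists>g'\<in>N. displaces (\<lambda>X x Y y. ind2 (free_ind M) {x} X Y {y}) g'"
    if "closed_under_conjugates N" "g \<in> N" "g \<noteq> id" for N g
  proof (rule displacement_upgrade[OF that(1,2) displaces_neq displacement_neq symmetric_displacement_neq
      displacement_ind2 composes_neq])
    show "g \<in> G" using that by (auto simp: closed_under_conjugates_def)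
    show "g \<noteq> id" by (rule that)
  qed
  show "composes (\<lambda>X x Y y. ind2 (free_ind M) {x} X Y {y}) (\<lambda>X x Y y. ind2 (free_ind M) {x} X Y {y})"
    by (rule composes_mono[OF composes_neq moves_maximally_neq])
qed

end

section \<open>The bounded rational Urysohn space\<close>

locale urysohn =
  fixes ar :: "'r \<Rightarrow> nat" and \<rho> :: "'r \<Rightarrow> real" and M :: "('r, 'a) struct"
  assumes urysohn: "bounded_rational_urysohn ar \<rho> M"
begin

abbreviation d :: "'a \<Rightarrow> 'a \<Rightarrow> real" where "d \<equiv> urysohn_dist \<rho> M"

lemma wf: "wf_struct ar M" and univ: "univ M = UNIV" and countable: "countable (UNIV :: 'a set)"
  and homogeneous: "homogeneous M" and age: "age ar M = metric_class ar \<rho>"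
  and binary: "ar r = 2" and rho: "bij_betw \<rho> UNIV (\<rat> \<inter> {0..1})"
  using urysohn by (auto simp: bounded_rational_urysohn_def fraisse_limit_def)

lemma rho_surj: "t \<in> \<rat> \<Longrightarrow> 0 \<le> t \<Longrightarrow> t \<le> 1 \<Longrightarrow> \<exists>r. \<rho> r = t"
  using rho by (auto simp: bij_betw_def) (metis Int_iff atLeastAtMost_iff imageE)

lemma rho_inj: "\<rho> r = \<rho> s \<longleftrightarrow> r = s"
  using rho by (auto simp: bij_betw_def dest: injD)

text \<open>The age only contains structures on natural numbers, so a finite subspace is copied there by \<open>e\<close>.\<close>

lemma finite_metric:
  assumes W: "finite W" and e: "inj (e :: 'a \<Rightarrow> nat)"
  obtains D where "Metric_space (e ` W) D"
    "\<And>u v. u \<in> W \<Longrightarrow> v \<in> W \<Longrightarrow> d u v = D (e u) (e v) \<and> d u v \<in> \<rat> \<inter> {0..1} \<and> (\<forall>r. rel M r [u, v] \<longleftrightarrow> d u v = \<rho> r)"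
proof -
  have ie: "inv_into UNIV e (e u) = u" for u using e by simp
  have "inj_on (inv_into UNIV e) (e ` W)" by (rule inj_on_inv_into) auto
  then have "pullback M (inv_into UNIV e) (e ` W) \<in> metric_class ar \<rho>"
    using pullback_age[OF wf univ] W age by auto
  then obtain D where D: "Metric_space (e ` W) D"
    "\<forall>a\<in>e ` W. \<forall>b\<in>e ` W. D a b \<in> \<rat> \<inter> {0..1} \<and> (\<forall>r. rel (pullback M (inv_into UNIV e) (e ` W)) r [a, b] \<longleftrightarrow> D a b = \<rho> r)"
    by (auto simp: metric_class_def pullback_def)
  show ?thesis
  proof (rule that[OF D(1)])
    fix u v assume uv: "u \<in> W" "v \<in> W"
    have R: "D (e u) (e v) \<in> \<rat> \<inter> {0..1}" using D(2) uv by blast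
    have rl: "rel M r [u, v] \<longleftrightarrow> D (e u) (e v) = \<rho> r" for r
    proof -
      have "rel (pullback M (inv_into UNIV e) (e ` W)) r [e u, e v] \<longleftrightarrow> D (e u) (e v) = \<rho> r" using D(2) uv by blast
      then show ?thesis using uv by (simp add: pullback_def ie)
    qed
    obtain s where s: "\<rho> s = D (e u) (e v)" using rho_surj R by auto
    have "(THE r. rel M r [u, v]) = s" by (rule the_equality) (use s rl rho_inj in auto)
    then have "d u v = D (e u) (e v)" using s by (simp add: urysohn_dist_def)
    then show "d u v = D (e u) (e v) \<and> d u v \<in> \<rat> \<inter> {0..1} \<and> (\<forall>r. rel M r [u, v] \<longleftrightarrow> d u v = \<rho> r)"
      using R rl by simp
  qed
qed

lemma dist: "d a b \<in> \<rat>" "0 \<le> d a b" "d a b \<le> 1" "d a b = 0 \<longleftrightarrow> a = b" "d a b = d b a"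
  "d a c \<le> d a b + d b c" "rel M r [a, b] \<longleftrightarrow> d a b = \<rho> r"
proof -
  obtain e :: "'a \<Rightarrow> nat" where e: "inj e" using countable by (auto simp: countable_def)
  obtain D where D: "Metric_space (e ` {a, b, c}) D"
    "\<And>u v. u \<in> {a, b, c} \<Longrightarrow> v \<in> {a, b, c} \<Longrightarrow> d u v = D (e u) (e v) \<and> d u v \<in> \<rat> \<inter> {0..1} \<and> (\<forall>r. rel M r [u, v] \<longleftrightarrow> d u v = \<rho> r)"
    by (rule finite_metric[OF _ e, of "{a, b, c}"]) (simp, rule that)
  have ab: "d a b = D (e a) (e b)" "d b a = D (e b) (e a)" "d a c = D (e a) (e c)" "d b c = D (e b) (e c)"
    using D(2) by blast+
  show "d a b \<in> \<rat>" "0 \<le> d a b" "d a b \<le> 1" "rel M r [a, b] \<longleftrightarrow> d a b = \<rho> r" using D(2)[of a b] by auto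
  show "d a b = 0 \<longleftrightarrow> a = b" using Metric_space.zero[OF D(1), of "e a" "e b"] ab e by (auto dest: injD)
  show "d a b = d b a" using Metric_space.commute[OF D(1)] ab by simp
  show "d a c \<le> d a b + d b c" using Metric_space.triangle[OF D(1), of "e a" "e b" "e c"] ab by simp
qed

lemma dist_self [simp]: "d a a = 0" using dist(4) by blast

lemma rel_pair_map:
  assumes "rel M r (map f xs)" shows "\<exists>a b. xs = [a, b]"
proof -
  have "length (map f xs) = ar r" using wf assms unfolding wf_struct_def by blast
  then have "length xs = Suc (Suc 0)" using binary[of r] by simp
  then show ?thesis by (auto simp: length_Suc_conv)
qed

lemma rel_pair: "rel M r xs \<Longrightarrow> \<exists>a b. xs = [a, b]"
  using rel_pair_map[of r id xs] by simp

lemma Aut_dist: "\<sigma> \<in> Aut M \<Longrightarrow> d (\<sigma> a) (\<sigma> b) = d a b"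
proof -
  assume s: "\<sigma> \<in> Aut M"
  obtain r where r: "\<rho> r = d a b" using rho_surj[OF dist(1-3)] by blast
  then have "rel M r [a, b]" by (simp add: dist(7))
  then have "rel M r (map \<sigma> [a, b])" using s by (simp only: Aut_iff[OF univ])
  then show ?thesis using r by (simp add: dist(7))
qed

lemma isometry_extend:
  assumes A: "finite A" and f: "\<And>a b. a \<in> A \<Longrightarrow> b \<in> A \<Longrightarrow> d (f a) (f b) = d a b"
  shows "\<exists>g\<in>Aut M. \<forall>a\<in>A. g a = f a"
proof (rule homogeneous_extend[OF univ homogeneous A])
  show "inj_on f A"
  proof (rule inj_onI)
    fix a b assume "a \<in> A" "b \<in> A" "f a = f b"
    then show "a = b" using f[of a b] dist(4)[of a b] by simp
  qed
  fix r xs assume xs: "set xs \<subseteq> A"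
  show "rel M r (map f xs) \<longleftrightarrow> rel M r xs"
  proof (cases "\<exists>a b. xs = [a, b]")
    case True
    then show ?thesis using f xs by (auto simp: dist(7))
  next
    case False
    then have "\<not> rel M r xs" "\<not> rel M r (map f xs)" using rel_pair rel_pair_map by blast+
    then show ?thesis by simp
  qed
qed

text \<open>A Katetov function with positive values: the distances of a possible new point to the points of \<open>W\<close>.\<close>

definition distance_function :: "'a set \<Rightarrow> ('a \<Rightarrow> real) \<Rightarrow> bool" where
  "distance_function W f \<longleftrightarrow> (\<forall>u\<in>W. f u \<in> \<rat> \<and> 0 < f u \<and> f u \<le> 1 \<and>
     (\<forall>v\<in>W. f u \<le> f v + d u v \<and> d u v \<le> f u + f v))"

text \<open>The one-point extension of \<open>W\<close>, with \<open>W\<close> copied to the positive numbers and the new point at 0, is in the age.\<close>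

lemma distance_function_realized:
  assumes W: "finite W" and f: "distance_function W f"
  shows "\<exists>x. \<forall>u\<in>W. d x u = f u"
proof -
  obtain e :: "'a \<Rightarrow> nat" where e: "inj e" using countable by (auto simp: countable_def)
  define i where "i u = Suc (e u)" for u
  define g where "g n = inv_into UNIV e (n - 1)" for n
  have gi: "g (i u) = u" for u using e by (simp add: g_def i_def)
  have i0: "i u \<noteq> 0" for u by (simp add: i_def)
  have inji: "i u = i v \<longleftrightarrow> u = v" for u v using e by (auto simp: i_def dest: injD)
  define V where "V = insert 0 (i ` W)"
  define D where "D m n = (if m \<notin> V \<or> n \<notin> V \<or> m = n then 0 else if m = 0 then f (g n)
    else if n = 0 then f (g m) else d (g m) (g n))" for m n
  have F: "f u \<in> \<rat>" "0 < f u" "f u \<le> 1" if "u \<in> W" for u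
    using f that unfolding distance_function_def by blast+
  have F2: "f u \<le> f v + d u v" "d u v \<le> f u + f v" if "u \<in> W" "v \<in> W" for u v
    using f that unfolding distance_function_def by blast+
  have V: "n = 0 \<or> (\<exists>u\<in>W. n = i u)" if "n \<in> V" for n using that by (auto simp: V_def)
  have iV: "i u \<in> V" if "u \<in> W" for u using that by (simp add: V_def)
  have zV: "0 \<in> V" by (simp add: V_def)
  have D0: "D 0 (i u) = f u" "D (i u) 0 = f u" if "u \<in> W" for u
    using iV[OF that] zV i0[of u] i0[of u, symmetric] by (simp_all add: D_def gi)
  have Di: "D (i u) (i v) = d u v" if "u \<in> W" "v \<in> W" for u v
    using iV that by (simp add: D_def gi inji i0)
  have Dn: "D n n = 0" for n by (simp add: D_def)
  have comm: "D m n = D n m" for m n using dist(5)[of "g m" "g n"] by (simp add: D_def)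
  have range: "D m n \<in> \<rat> \<inter> {0..1}" if "m \<in> V" "n \<in> V" for m n
    using V[OF that(1)] V[OF that(2)] by (auto simp: D0 Di Dn dist F less_imp_le)
  have nonneg: "0 \<le> D m n" for m n
  proof (cases "m \<in> V \<and> n \<in> V")
    case True then show ?thesis using range[of m n] by simp
  next
    case False then show ?thesis by (auto simp: D_def)
  qed
  have ms: "Metric_space V D"
  proof
    show "0 \<le> D m n" "D m n = D n m" for m n by (rule nonneg, rule comm)
    show "D m n = 0 \<longleftrightarrow> m = n" if "m \<in> V" "n \<in> V" for m n
    proof
      assume z: "D m n = 0"
      from V[OF that(1)] show "m = n"
      proof (elim disjE bexE)
        assume m: "m = 0"
        from V[OF that(2)] show ?thesis
        proof (elim disjE bexE)
          fix v assume "v \<in> W" "n = i v" then show ?thesis using m z D0(1)[of v] F(2)[of v] by simp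
        qed (use m in simp)
      next
        fix u assume m: "u \<in> W" "m = i u"
        from V[OF that(2)] show ?thesis
        proof (elim disjE bexE)
          assume "n = 0" then show ?thesis using m z D0(2)[of u] F(2)[of u] by simp
        next
          fix v assume n: "v \<in> W" "n = i v"
          then have "d u v = 0" using m z Di[of u v] by simp
          then show ?thesis using m n dist(4)[of u v] by simp
        qed
      qed
    qed (simp add: Dn)
    show "D x z \<le> D x y + D y z" if "x \<in> V" "y \<in> V" "z \<in> V" for x y z
    proof -
      consider "x = y" | "y = z" | "x = z" | "x \<noteq> y" "y \<noteq> z" "x \<noteq> z" by blast
      then show ?thesis
      proof cases
        case 3 then show ?thesis using nonneg[of x y] nonneg[of y x] by (simp add: Dn)
      next
        case 4
        have tri: "d u v \<le> d u w + d w v" for u v w by (rule dist(6))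
        have c1: "f w \<le> f v + d v w" if "v \<in> W" "w \<in> W" for v w using F2(1)[OF that(2,1)] dist(5)[of v w] by simp
        have c2: "f u \<le> d u v + f v" if "v \<in> W" "u \<in> W" for u v using F2(1)[OF that(2,1)] by simp
        show ?thesis using V[OF that(1)] V[OF that(2)] V[OF that(3)] 4
          by (elim disjE bexE) (simp_all add: D0 Di c1 c2 F2(2) tri)
      qed (simp_all add: Dn)
    qed
  qed
  define N :: "('r, nat) struct" where
    "N = \<lparr>univ = V, rel = (\<lambda>r ns. \<exists>m\<in>V. \<exists>n\<in>V. ns = [m, n] \<and> D m n = \<rho> r)\<rparr>"
  have uN: "univ N = V" by (simp add: N_def)
  have rN: "rel N r [m, n] \<longleftrightarrow> D m n = \<rho> r" if "m \<in> V" "n \<in> V" for r m n using that by (simp add: N_def)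
  have "N \<in> metric_class ar \<rho>"
    unfolding metric_class_def
  proof (intro CollectI conjI exI[of _ D] ballI allI)
    show "wf_struct ar N" using binary by (auto simp: wf_struct_def N_def)
    show "finite (univ N)" using W by (simp add: uN V_def)
    show "Metric_space (univ N) D" using ms by (simp add: uN)
    fix a b assume ab: "a \<in> univ N" "b \<in> univ N"
    show "D a b \<in> \<rat> \<inter> {0..1}" using range[of a b] ab by (simp add: uN)
    show "rel N r [a, b] \<longleftrightarrow> D a b = \<rho> r" for r using rN[of a b] ab by (simp add: uN)
  qed
  then have N: "N \<in> age ar M" by (simp add: age)
  have reli: "rel N r (map i xs) \<longleftrightarrow> rel M r xs" if xs: "set xs \<subseteq> W" for r xs
  proof (cases "\<exists>a b. xs = [a, b]")
    case True
    then show ?thesis using xs iV by (auto simp: rN Di dist(7))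
  next
    case False
    have "\<not> rel M r xs" using False rel_pair by blast
    moreover have "\<not> rel N r (map i xs)" using False by (auto simp: N_def map_eq_Cons_conv)
    ultimately show ?thesis by simp
  qed
  have "inj_on i W" "i ` W \<subseteq> univ N" by (auto simp: inj_on_def inji uN V_def)
  then obtain j where j: "\<And>r ns. set ns \<subseteq> univ N \<Longrightarrow> rel M r (map j ns) \<longleftrightarrow> rel N r ns"
    "\<And>w. w \<in> W \<Longrightarrow> j (i w) = w"
    using realize_over[OF univ homogeneous N W _ _ reli] by metis
  have "d (j 0) u = f u" if u: "u \<in> W" for u
  proof -
    obtain r where r: "\<rho> r = f u" using rho_surj[of "f u"] F[OF u] by auto
    then have "rel N r [0, i u]" using rN[OF zV iV[OF u]] D0(1)[OF u] by simp
    then have "rel M r (map j [0, i u])" using j(1)[of "[0, i u]" r] zV iV[OF u] by (simp add: uN)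
    then show ?thesis using j(2)[OF u] r by (simp add: dist(7))
  qed
  then show ?thesis by blast
qed

lemma urysohn_ind_iff:
  "urysohn_ind \<rho> M A C B \<longleftrightarrow> (\<forall>a\<in>A. \<forall>b\<in>B. d a b = 1 \<or> (\<exists>c\<in>C. d a b = d a c + d c b))"
  by (simp add: urysohn_ind_def)

lemma dist_eq_via: "d a c + d c b \<le> d a b \<Longrightarrow> d a b = d a c + d c b"
  using dist(6)[of a b c] by simp

lemma dist_eq_1: "1 \<le> d a b \<Longrightarrow> d a b = 1"
  using dist(3)[of a b] by simp

text \<open>The new point is as far from every \<open>u\<close> as its distances to \<open>X\<close> and the bound 1 permit.\<close>

lemma urysohn_ind_exists:
  assumes X: "finite X" "finite A" "c \<notin> X"
  shows "\<exists>\<sigma>\<in>Fix M X. urysohn_ind \<rho> M {\<sigma> c} X A"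
proof -
  have "\<exists>m. (m = 1 \<or> (\<exists>v\<in>X. m = d c v + d v u)) \<and> m \<le> 1 \<and> (\<forall>v\<in>X. m \<le> d c v + d v u)" for u
  proof -
    let ?T = "insert 1 ((\<lambda>v. d c v + d v u) ` X)"
    have "Min ?T \<in> ?T" by (rule Min_in) (use X in auto)
    moreover have "Min ?T \<le> t" if "t \<in> ?T" for t by (rule Min_le) (use X that in auto)
    ultimately show ?thesis by (intro exI[of _ "Min ?T"]) auto
  qed
  then obtain f where f: "\<And>u. f u = 1 \<or> (\<exists>v\<in>X. f u = d c v + d v u)" "\<And>u. f u \<le> 1"
    "\<And>u v. v \<in> X \<Longrightarrow> f u \<le> d c v + d v u" by metis
  have fX: "f u = d c u" if "u \<in> X" for u
  proof (rule antisym)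
    show "f u \<le> d c u" using f(3)[OF that, of u] by simp
    show "d c u \<le> f u" using f(1)[of u] dist(3)[of c u] dist(6)[of c u] by auto
  qed
  have "distance_function (X \<union> A) f"
    unfolding distance_function_def
  proof (intro ballI conjI)
    fix u v
    show "f u \<in> \<rat>" using f(1)[of u] dist(1) by auto
    show "f u \<le> 1" by (rule f(2))
    show "0 < f u"
    proof -
      have "0 < d c w + d w u" if "w \<in> X" for w
        using X(3) that dist(4)[of c w] dist(2)[of c w] dist(2)[of w u] by (cases "c = w") auto
      then show ?thesis using f(1)[of u] by auto
    qed
    show "f u \<le> f v + d u v"
    proof (cases "f v = 1")
      case True then show ?thesis using f(2)[of u] dist(2)[of u v] by simp
    next
      case False
      then obtain w where "w \<in> X" "f v = d c w + d w v" using f(1)[of v] by auto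
      then show ?thesis using f(3)[of w u] dist(6)[of w u v] dist(5)[of u v] by simp
    qed
    have nn: "0 \<le> f w" for w using f(1)[of w] dist(2) by (auto intro: add_nonneg_nonneg)
    show "d u v \<le> f u + f v"
    proof (cases "f u = 1 \<or> f v = 1")
      case True then show ?thesis using dist(3)[of u v] nn[of u] nn[of v] by auto
    next
      case False
      then obtain w w' where "f u = d c w + d w u" "f v = d c w' + d w' v" using f(1)[of u] f(1)[of v] by auto
      then show ?thesis
        using dist(6)[of u v w] dist(6)[of w v c] dist(6)[of c v w'] dist(5)[of u w] dist(5)[of w c] by simp
    qed
  qed
  then obtain x where x: "\<forall>u\<in>X \<union> A. d x u = f u" using distance_function_realized[of "X \<union> A" f] X by auto
  define g where "g u = (if u = c then x else u)" for u
  have "\<exists>\<sigma>\<in>Aut M. \<forall>a\<in>insert c X. \<sigma> a = g a"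
  proof (rule isometry_extend)
    fix a b assume "a \<in> insert c X" "b \<in> insert c X"
    then show "d (g a) (g b) = d a b"
      using x fX dist(5)[of _ x] dist(5)[of _ c] by (auto simp: g_def)
  qed (use X in simp)
  then obtain \<sigma> where s: "\<sigma> \<in> Aut M" "\<forall>a\<in>insert c X. \<sigma> a = g a" by blast
  have "\<sigma> \<in> Fix M X" "\<sigma> c = x" using s X(3) by (auto simp: Fix_def g_def)
  moreover have "urysohn_ind \<rho> M {x} X A"
    unfolding urysohn_ind_iff
  proof (intro ballI)
    fix a u assume "a \<in> {x}" "u \<in> A"
    then have "a = x" "d x u = f u" using x by auto
    moreover have "d x v = d c v" if "v \<in> X" for v using x fX that by simp
    ultimately show "d a u = 1 \<or> (\<exists>v\<in>X. d a u = d a v + d v u)" using f(1)[of u] by auto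
  qed
  ultimately show ?thesis by (intro bexI[of _ \<sigma>]) simp_all
qed

lemma urysohn_independence: "independence M (urysohn_ind \<rho> M)"
proof unfold_locales
  show "univ M = UNIV" by (rule univ)
next
  fix \<sigma> A B C assume s: "\<sigma> \<in> Aut M" and i: "urysohn_ind \<rho> M A B C"
  then show "urysohn_ind \<rho> M (\<sigma> ` A) (\<sigma> ` B) (\<sigma> ` C)" by (simp add: urysohn_ind_iff Aut_dist[OF s])
next
  fix A B C assume i: "urysohn_ind \<rho> M A B C"
  show "urysohn_ind \<rho> M C B A"
    unfolding urysohn_ind_iff
  proof (intro ballI)
    fix c a assume "c \<in> C" "a \<in> A"
    then have "d a c = 1 \<or> (\<exists>b\<in>B. d a c = d a b + d b c)" using i by (simp add: urysohn_ind_iff)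
    then show "d c a = 1 \<or> (\<exists>b\<in>B. d c a = d c b + d b a)" using dist(5) by (metis add.commute)
  qed
next
  fix A B C :: "'a set" assume "A \<subseteq> B"
  then show "urysohn_ind \<rho> M A B C" by (force simp: urysohn_ind_iff)
next
  fix A B C assume i: "urysohn_ind \<rho> M A B C"
  show "A \<inter> C \<subseteq> B"
  proof
    fix a assume "a \<in> A \<inter> C"
    then have "d a a = 1 \<or> (\<exists>b\<in>B. d a a = d a b + d b a)" using i unfolding urysohn_ind_iff by blast
    then obtain b where "b \<in> B" "0 = d a b + d b a" by auto
    then show "a \<in> B" using dist(2)[of a b] dist(2)[of b a] dist(4)[of a b] by auto
  qed
next
  fix A B C D
  show "urysohn_ind \<rho> M A B (C \<union> D) \<longleftrightarrow> urysohn_ind \<rho> M A B C \<and> urysohn_ind \<rho> M A (B \<union> C) D"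
  proof
    assume "urysohn_ind \<rho> M A B (C \<union> D)"
    then show "urysohn_ind \<rho> M A B C \<and> urysohn_ind \<rho> M A (B \<union> C) D"
      unfolding urysohn_ind_iff by blast
  next
    assume i: "urysohn_ind \<rho> M A B C \<and> urysohn_ind \<rho> M A (B \<union> C) D"
    show "urysohn_ind \<rho> M A B (C \<union> D)"
      unfolding urysohn_ind_iff
    proof (intro ballI)
      fix a e assume a: "a \<in> A" and e: "e \<in> C \<union> D"
      show "d a e = 1 \<or> (\<exists>b\<in>B. d a e = d a b + d b e)"
      proof (cases "e \<in> C")
        case True
        then show ?thesis using i a by (simp add: urysohn_ind_iff)
      next
        case False
        then have "d a e = 1 \<or> (\<exists>b\<in>B \<union> C. d a e = d a b + d b e)" using e i a by (simp add: urysohn_ind_iff)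
        then show ?thesis
        proof (elim disjE bexE)
          fix c assume c: "c \<in> B \<union> C" "d a e = d a c + d c e"
          show ?thesis
          proof (cases "c \<in> B")
            case False
            then have "d a c = 1 \<or> (\<exists>b\<in>B. d a c = d a b + d b c)" using c i a by (simp add: urysohn_ind_iff)
            then show ?thesis
            proof (elim disjE bexE)
              assume "d a c = 1"
              then show ?thesis using c(2) dist(2)[of c e] dist_eq_1[of a e] by simp
            next
              fix b assume b: "b \<in> B" "d a c = d a b + d b c"
              have "d a e = d a b + d b e" using c(2) b(2) dist(6)[of b e c] by (intro dist_eq_via) simp
              then show ?thesis using b(1) by blast
            qed
          qed (use c in blast)
        qed blast
      qed
    qed
  qed
next
  fix X A :: "'a set" and \<sigma> x
  assume fin: "finite X" "finite A" and s: "\<sigma> \<in> Fix M X"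
    and i: "urysohn_ind \<rho> M {x} X A" "urysohn_ind \<rho> M {\<sigma> x} X A"
  have X: "d (\<sigma> x) v = d x v" if "v \<in> X" for v
    using Aut_dist[OF Fix_subset_Aut[OF s], of x v] s that by (simp add: Fix_def)
  have le: "d y a \<le> d z a" if "urysohn_ind \<rho> M {z} X A" "\<And>v. v \<in> X \<Longrightarrow> d y v = d z v" "a \<in> A" for y z a
  proof -
    have "d z a = 1 \<or> (\<exists>v\<in>X. d z a = d z v + d v a)" using that by (simp add: urysohn_ind_iff)
    then show ?thesis using dist(3)[of y a] dist(6)[of y a] that(2) by auto metis
  qed
  have A: "d (\<sigma> x) a = d x a" if "a \<in> A" for a
    using le[OF i(1) X that] le[OF i(2) X[symmetric] that] by simp
  define f where "f u = (if u = x then \<sigma> x else u)" for u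
  have "\<exists>g\<in>Aut M. \<forall>a\<in>insert x (X \<union> A). g a = f a"
  proof (rule isometry_extend)
    fix a b assume "a \<in> insert x (X \<union> A)" "b \<in> insert x (X \<union> A)"
    then show "d (f a) (f b) = d a b"
      using X A dist(5)[of _ x] dist(5)[of _ "\<sigma> x"] by (auto simp: f_def)
  qed (use fin in simp)
  then obtain g where g: "g \<in> Aut M" "\<forall>a\<in>insert x (X \<union> A). g a = f a" by blast
  have "\<sigma> x = x" if "x \<in> X \<union> A"
    using that X[of x] A[of x] dist(4)[of "\<sigma> x" x] by auto
  then have "g \<in> Fix M (X \<union> A)" "g x = \<sigma> x" using g by (auto simp: Fix_def f_def)
  then show "\<exists>\<tau>\<in>Fix M (X \<union> A). \<tau> x = \<sigma> x" by blast
next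
  fix X A :: "'a set" and c assume "finite X" "finite A" "c \<notin> X"
  then show "\<exists>\<sigma>\<in>Fix M X. urysohn_ind \<rho> M {\<sigma> c} X A" by (rule urysohn_ind_exists)
next
  fix x y
  show "\<exists>\<sigma>\<in>Aut M. \<sigma> x = y" using isometry_extend[of "{x}" "\<lambda>_. y"] by simp
qed

end

section \<open>Displacement in the Urysohn space\<close>

locale urysohn_expansion = urysohn ar \<rho> M + expansion M "urysohn_ind \<rho> M" E ord
  for ar :: "'r \<Rightarrow> nat" and \<rho> and M :: "('r, 'a) struct" and E ord
begin

lemma dist_G: "f \<in> G \<Longrightarrow> d (f a) (f b) = d a b"
  by (rule Aut_dist[OF G_Aut])

text \<open>Distances compatible with the type of \<open>c\<close> over \<open>X\<close> are realized within that type in the expansion: the position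
with respect to \<open>E\<close> can be adjusted over all of \<open>W\<close>.\<close>

lemma distance_function_realized_type:
  assumes W: "finite W" "X \<subseteq> W" and c: "c \<notin> X" and f: "distance_function W f" "\<And>u. u \<in> X \<Longrightarrow> f u = d c u"
  obtains a where "a \<in> GF X" "\<And>u. u \<in> W \<Longrightarrow> d (a c) u = f u"
proof -
  have X: "finite X" using W by (rule rev_finite_subset)
  obtain x where x: "\<forall>u\<in>W. d x u = f u" using distance_function_realized[OF W(1) f(1)] by blast
  have "x \<notin> W"
  proof
    assume "x \<in> W"
    then have "f x = 0" "0 < f x" using x f(1) by (auto simp: distance_function_def)
    then show False by simp
  qed
  define L where "L = {u \<in> X. E u c}"
  define U where "U = {u \<in> X. E c u}"
  have LU: "finite L" "finite U" "cut E ord L U"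
    using X by (auto simp: L_def U_def intro: cut_realized[of _ c])
  obtain \<tau> where t: "\<tau> \<in> Fix M W" "\<forall>l\<in>L. E l (\<tau> x)" "\<forall>u\<in>U. E (\<tau> x) u"
    using realize[OF LU W(1) \<open>x \<notin> W\<close>] by blast
  define y where "y = \<tau> x"
  have y: "d y u = f u" if "u \<in> W" for u
    using Aut_dist[OF Fix_subset_Aut[OF t(1)], of x u] t(1) that x by (simp add: y_def Fix_def)
  define g where "g u = (if u = c then y else u)" for u
  have "\<exists>\<sigma>\<in>Aut M. \<forall>a\<in>insert c X. \<sigma> a = g a"
  proof (rule isometry_extend)
    fix a b assume "a \<in> insert c X" "b \<in> insert c X"
    moreover have "d y u = d c u" if "u \<in> X" for u using y f(2) that W(2) by auto
    ultimately show "d (g a) (g b) = d a b" using dist(5)[of _ y] dist(5)[of _ c] by (auto simp: g_def)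
  qed (use X in simp)
  then obtain \<sigma> where s: "\<sigma> \<in> Aut M" "\<forall>a\<in>insert c X. \<sigma> a = g a" by blast
  have sF: "\<sigma> \<in> Fix M X" "\<sigma> c = y" using s c by (auto simp: Fix_def g_def)
  have "E v (\<sigma> c) \<longleftrightarrow> E v c" if v: "v \<in> X" for v
  proof (cases "E v c")
    case True
    then have "E v y" using t(2) v by (simp add: L_def y_def)
    then show ?thesis using True sF(2) by simp
  next
    case False
    then have "E c v" using E_total[of v c] v c by auto
    then have "E y v" using t(3) v by (simp add: U_def y_def)
    then show ?thesis using False E_asym sF(2) by auto
  qed
  then obtain k where "k \<in> GF X" "k c = \<sigma> c" using type_over[OF X sF(1)] by blast
  then show ?thesis using that y sF(2) by simp
qed

text \<open>Being at distance one half from two points, and as far as possible from everything else.\<close>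

lemma distance_function_half:
  "distance_function W (\<lambda>u. min 1 (1 / 2 + min (d u s) (d u t)))"
  unfolding distance_function_def
proof (intro ballI conjI)
  fix u v
  show "min 1 (1 / 2 + min (d u s) (d u t)) \<in> \<rat>" by (auto simp: min_def dist(1))
  show "0 < min 1 (1 / 2 + min (d u s) (d u t))" using dist(2)[of u s] dist(2)[of u t] by (auto simp: min_def)
  show "min 1 (1 / 2 + min (d u s) (d u t)) \<le> 1" by simp
  show "min 1 (1 / 2 + min (d u s) (d u t)) \<le> min 1 (1 / 2 + min (d v s) (d v t)) + d u v"
    using dist(6)[of u s v] dist(6)[of u t v] dist(2)[of u v] by (auto simp: min_def)
  show "d u v \<le> min 1 (1 / 2 + min (d u s) (d u t)) + min 1 (1 / 2 + min (d v s) (d v t))"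
    using dist(3)[of u v] dist(2)[of u s] dist(2)[of u t] dist(2)[of v s] dist(2)[of v t] by (auto simp: min_def)
qed

lemma ind_empty: "urysohn_ind \<rho> M {x} {} X \<longleftrightarrow> (\<forall>u\<in>X. d x u = 1)"
  by (simp add: urysohn_ind_iff)

definition far :: "real \<Rightarrow> 'a set \<Rightarrow> 'a \<Rightarrow> 'a set \<Rightarrow> 'a \<Rightarrow> bool" where
  "far \<epsilon> X x Y y \<longleftrightarrow> (urysohn_ind \<rho> M {x} {} X \<longrightarrow> \<epsilon> \<le> d x y)"

lemma far_iff: "far \<epsilon> X x Y y \<longleftrightarrow> ((\<forall>u\<in>X. d x u = 1) \<longrightarrow> \<epsilon> \<le> d x y)"
  by (simp add: far_def ind_empty)

lemma displacement_far: "displacement (far \<epsilon>)"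
  unfolding displacement_def
proof (intro conjI ballI allI impI)
  fix f X x Y y assume "f \<in> G" "far \<epsilon> X x Y y"
  then show "far \<epsilon> (f ` X) (f x) (f ` Y) (f y)" by (simp add: far_iff dist_G)
next
  fix g X x C
  assume a: "g \<in> G" "finite X" "finite C" "urysohn_ind \<rho> M {x} X C" "far \<epsilon> (X \<union> C) x (g ` (X \<union> C)) (g x)"
  show "far \<epsilon> X x (g ` X) (g x)"
    unfolding far_def
  proof
    assume "urysohn_ind \<rho> M {x} {} X"
    then have "urysohn_ind \<rho> M {x} {} (X \<union> C)" using ind_trans_right[of "{x}" "{}" X C] a(4) by simp
    then show "\<epsilon> \<le> d x (g x)" using a(5) by (simp add: far_def)
  qed
qed

lemma symmetric_displacement_far: "symmetric_displacement (far \<epsilon>)"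
  by (simp add: symmetric_displacement_def far_iff dist_G dist(5))

text \<open>A point \<open>b\<close> at distance one half from a moved point \<open>a0\<close>, and as far as possible from everything else, is moved
as well, and it has distance at least one half from every parameter. A point at distance one half from \<open>b\<close> that is
chosen in the same way can therefore have distance 1 from the parameters, and again it is moved.\<close>

lemma displaces_far_exists:
  assumes h: "h \<in> G" "h \<noteq> id" obtains \<epsilon> where "0 < \<epsilon>" "displaces (far \<epsilon>) h"
proof -
  obtain a0 where a0: "h a0 \<noteq> a0" using h(2) by (auto simp: fun_eq_iff)
  define \<epsilon> where "\<epsilon> = min (1 / 2) (d a0 (h a0))"
  have e: "0 < \<epsilon>" "\<epsilon> \<le> 1 / 2" "\<epsilon> \<le> d a0 (h a0)"
    using a0 dist(2)[of a0 "h a0"] dist(4)[of a0 "h a0"] by (auto simp: \<epsilon>_def)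
  have "displaces (far \<epsilon>) h"
    unfolding displaces_def
  proof (intro allI impI)
    fix X :: "'a set" and c assume X: "finite X" "c \<notin> X"
    show "\<exists>a\<in>GF X. far \<epsilon> X (a c) (h ` X) (h (a c))"
    proof (cases "\<forall>u\<in>X. d c u = 1")
      case False
      then show ?thesis by (intro bexI[of _ id]) (auto simp: far_iff)
    next
      case c: True
      have "finite (X \<union> {a0, h a0})" using X by simp
      then obtain b where b: "\<forall>u\<in>X \<union> {a0, h a0}. d b u = min 1 (1 / 2 + min (d u a0) (d u a0))"
        using distance_function_realized[OF _ distance_function_half] by blast
      have b0: "d b a0 = 1 / 2" "d b (h a0) = min 1 (1 / 2 + d a0 (h a0))" using b dist(5)[of a0] by auto
      have bh: "\<epsilon> \<le> d b (h b)"
        using b0 e dist(6)[of b "h a0" "h b"] dist_G[OF h(1), of b a0] by (auto simp: min_def split: if_splits)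
      have bX: "1 / 2 \<le> d u b" if "u \<in> X" for u
        using b that dist(2)[of u a0] dist(5)[of u b] by simp
      have "finite (X \<union> {b, h b})" using X by simp
      then obtain a where a: "a \<in> GF X" "\<And>u. u \<in> X \<union> {b, h b} \<Longrightarrow> d (a c) u = min 1 (1 / 2 + min (d u b) (d u b))"
      proof (rule distance_function_realized_type[OF _ _ X(2) distance_function_half])
        show "min 1 (1 / 2 + min (d u b) (d u b)) = d c u" if "u \<in> X" for u
          using c bX[OF that] that by simp
      qed (auto intro: that)
      have "d (a c) b = 1 / 2" "d (a c) (h b) = min 1 (1 / 2 + d b (h b))" using a(2) dist(5)[of b "h b"] by auto
      then have "\<epsilon> \<le> d (a c) (h (a c))"
        using bh e dist(6)[of "a c" "h b" "h (a c)"] dist_G[OF h(1), of b "a c"] dist(5)[of b "a c"]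
          dist(5)[of "h b" "h (a c)"] by (auto simp: min_def split: if_splits)
      then show ?thesis using a(1) by (intro bexI[of _ a]) (auto simp: far_iff)
    qed
  qed
  with e(1) that show ?thesis by blast
qed

text \<open>Both images are at distance 1 from \<open>A\<close>, so the only short path between them passes through \<open>x\<close>.\<close>

lemma composes_far: "composes (far \<epsilon>) (far (min 1 (2 * \<epsilon>)))"
  unfolding composes_def
proof (intro allI impI)
  fix A X x p q
  assume a: "finite A" "p \<in> G" "q \<in> G" "X \<subseteq> A" "p ` X \<subseteq> A" "q ` X \<subseteq> A" "x \<notin> A"
    "urysohn_ind \<rho> M {x} X A" "urysohn_ind \<rho> M {p x} (p ` X) A" "urysohn_ind \<rho> M {q x} (q ` X) A"
    "urysohn_ind \<rho> M {q x} (insert x A) {p x}"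
    and P: "far \<epsilon> X x (p ` X) (p x)" "far \<epsilon> X x (q ` X) (q x)"
  show "far (min 1 (2 * \<epsilon>)) (p ` X) (p x) (q ` X) (q x)"
    unfolding far_iff
  proof
    assume "\<forall>u\<in>p ` X. d (p x) u = 1"
    then have X: "\<forall>u\<in>X. d x u = 1" by (simp add: dist_G[OF a(2)])
    have far_A: "d (g x) v = 1" if g: "g \<in> G" and i: "urysohn_ind \<rho> M {g x} (g ` X) A" and v: "v \<in> A" for g v
    proof -
      have "d (g x) v = 1 \<or> (\<exists>u\<in>X. d (g x) v = d x u + d (g u) v)"
        using i v unfolding urysohn_ind_iff by (auto simp: dist_G[OF g])
      then show ?thesis
      proof (elim disjE bexE)
        fix u assume "u \<in> X" "d (g x) v = d x u + d (g u) v"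
        then show ?thesis using X dist(2)[of "g u" v] by (intro dist_eq_1) simp
      qed
    qed
    have e: "\<epsilon> \<le> d x (p x)" "\<epsilon> \<le> d x (q x)" using P X by (simp_all add: far_iff)
    have "d (q x) (p x) = 1 \<or> d (q x) (p x) = d (q x) x + d x (p x) \<or>
        (\<exists>v\<in>A. d (q x) (p x) = d (q x) v + d v (p x))"
      using a(11) unfolding urysohn_ind_iff by auto
    then have "min 1 (2 * \<epsilon>) \<le> d (q x) (p x)"
    proof (elim disjE bexE)
      assume "d (q x) (p x) = d (q x) x + d x (p x)"
      then show ?thesis using e dist(5)[of x "q x"] by (auto simp: min_def)
    next
      fix v assume "v \<in> A" "d (q x) (p x) = d (q x) v + d v (p x)"
      then have "1 \<le> d (q x) (p x)" using far_A[OF a(3,10)] dist(2)[of v "p x"] by simp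
      then show ?thesis by simp
    qed simp
    then show "min 1 (2 * \<epsilon>) \<le> d (p x) (q x)" using dist(5)[of "p x" "q x"] by simp
  qed
qed

lemma displaces_far_1:
  assumes N: "closed_under_conjugates N" and g: "g \<in> N" "displaces (far \<epsilon>) g" and e: "0 < \<epsilon>"
  obtains g' where "g' \<in> N" "displaces (far 1) g'"
proof -
  have "\<exists>g'\<in>N. displaces (far (min 1 (2 ^ n * \<epsilon>))) g'" for n
  proof (induction n)
    case 0
    have "displaces (far (min 1 (2 ^ 0 * \<epsilon>))) g"
    proof (rule displaces_mono[OF g(2)])
      show "g \<in> G" using N g(1) by (auto simp: closed_under_conjugates_def)
    qed (auto simp: far_def)
    then show ?case using g(1) by blast
  next
    case (Suc n)
    then obtain g' where g': "g' \<in> N" "displaces (far (min 1 (2 ^ n * \<epsilon>))) g'" by blast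
    have eq: "min 1 (2 * min 1 (2 ^ n * \<epsilon>)) = min 1 (2 ^ Suc n * \<epsilon>)" by (simp add: min_def)
    show ?case
      by (rule displacement_upgrade[OF N g' displacement_far symmetric_displacement_far displacement_far
            composes_far[of "min 1 (2 ^ n * \<epsilon>)", unfolded eq]])
  qed
  moreover obtain n where "1 / \<epsilon> < 2 ^ n" using real_arch_pow[of 2 "1 / \<epsilon>"] by auto
  then have "min 1 (2 ^ n * \<epsilon>) = 1" using e by (simp add: field_simps min_def)
  ultimately show ?thesis using that by metis
qed

text \<open>Half of being displaced maximally: the distance from \<open>x\<close> to \<open>y\<close> is at least one half, or as large
  as the distance along a path through \<open>X\<close> and \<open>Y\<close>.\<close>

definition half_maximal :: "'a set \<Rightarrow> 'a \<Rightarrow> 'a set \<Rightarrow> 'a \<Rightarrow> bool" where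
  "half_maximal X x Y y \<longleftrightarrow> 1 / 2 \<le> d x y \<or> (\<exists>c\<in>X. \<exists>c'\<in>Y. d x c + d c c' + d c' y \<le> d x y)"

lemma displacement_half_maximal: "displacement half_maximal"
  unfolding displacement_def
proof (intro conjI ballI allI impI)
  fix f X x Y y assume "f \<in> G" "half_maximal X x Y y"
  then show "half_maximal (f ` X) (f x) (f ` Y) (f y)" by (simp add: half_maximal_def dist_G)
next
  fix g X x C
  assume a: "g \<in> G" "finite X" "finite C" "urysohn_ind \<rho> M {x} X C"
    "half_maximal (X \<union> C) x (g ` (X \<union> C)) (g x)"
  have X: "d x c = 1 \<or> (\<exists>u\<in>X. d x c = d x u + d u c)" if "c \<in> X \<union> C" for c
  proof (cases "c \<in> X")
    case True
    then show ?thesis by (intro disjI2 bexI[of _ c]) simp_all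
  next
    case False
    then show ?thesis using a(4) that by (simp add: urysohn_ind_iff)
  qed
  show "half_maximal X x (g ` X) (g x)"
    using a(5) unfolding half_maximal_def
  proof (elim disjE bexE)
    fix c c' assume c: "c \<in> X \<union> C" "c' \<in> g ` (X \<union> C)" "d x c + d c c' + d c' (g x) \<le> d x (g x)"
    then obtain b where b: "b \<in> X \<union> C" "c' = g b" by blast
    have gb: "d c' (g x) = d x b" using b(2) dist_G[OF a(1)] dist(5)[of b x] by simp
    show "1 / 2 \<le> d x (g x) \<or> (\<exists>c\<in>X. \<exists>c'\<in>g ` X. d x c + d c c' + d c' (g x) \<le> d x (g x))"
    proof (cases "d x c = 1 \<or> d x b = 1")
      case True
      then have "1 \<le> d x (g x)" using c(3) gb dist(2)[of x c] dist(2)[of c c'] dist(2)[of x b] by auto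
      then show ?thesis by simp
    next
      case False
      then obtain u v where u: "u \<in> X" "d x c = d x u + d u c" and v: "v \<in> X" "d x b = d x v + d v b"
        using X[OF c(1)] X[OF b(1)] by blast
      have "d (g v) (g x) = d x v" "d (g b) (g v) = d v b"
        using dist_G[OF a(1)] dist(5)[of v x] dist(5)[of b v] by simp_all
      then have "d x u + d u (g v) + d (g v) (g x) \<le> d x (g x)"
        using c(3) gb u(2) v(2) b(2) dist(6)[of u "g v" c] dist(6)[of c "g v" "g b"] by simp
      then show ?thesis using u(1) v(1) by blast
    qed
  qed simp
qed

lemma symmetric_displacement_half_maximal: "symmetric_displacement half_maximal"
  unfolding symmetric_displacement_def
proof (intro ballI allI impI)
  fix g X x assume "half_maximal X x (g ` X) (g x)"
  then show "half_maximal (g ` X) (g x) X x"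
    unfolding half_maximal_def
  proof (elim disjE bexE)
    fix c c' assume c: "c \<in> X" "c' \<in> g ` X" "d x c + d c c' + d c' (g x) \<le> d x (g x)"
    then have "d (g x) c' + d c' c + d c x \<le> d (g x) x"
      using dist(5)[of x c] dist(5)[of c c'] dist(5)[of c' "g x"] dist(5)[of x "g x"] by simp
    then show "1 / 2 \<le> d (g x) x \<or> (\<exists>c\<in>g ` X. \<exists>c'\<in>X. d (g x) c + d c c' + d c' x \<le> d (g x) x)"
      using c(1,2) by blast
  qed (use dist(5)[of x "g x"] in simp)
qed

text \<open>The realization \<open>x\<close> is tied to a point \<open>a\<close> at distance one half from it whose displacement is known. For this \<open>a\<close> is chosen at
distance one half from a generic realization \<open>x0\<close> and from a point \<open>a0\<close> that is moved by 1, so \<open>a\<close> is moved by at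
least one half; and \<open>x\<close> is a copy of \<open>x0\<close> over \<open>X\<close> and \<open>a\<close> that is independent from \<open>h a\<close>. If the distance from \<open>x\<close> to \<open>h a\<close>
is 1, then \<open>x\<close> is moved by at least one half. Otherwise it is attained through some \<open>c\<close> in \<open>X\<close>, and the distance from
\<open>c\<close> to \<open>h a\<close> is that from \<open>h\<inverse> c\<close> to \<open>a\<close>, which leads to \<open>x0\<close> and from there through a point of \<open>X\<close>.\<close>

lemma displaces_half_maximal:
  assumes h: "h \<in> G" "displaces (far 1) h" shows "displaces half_maximal h"
  unfolding displaces_def
proof (intro allI impI)
  fix X :: "'a set" and c assume X: "finite X" "c \<notin> X"
  obtain a1 where a1: "a1 \<in> GF X" "urysohn_ind \<rho> M {a1 c} X (iv h ` X)"
    using move_point_generic[OF X(1) _ X(2), of "iv h ` X"] X(1) by blast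
  define x0 where "x0 = a1 c"
  define W where "W = X \<union> iv h ` X \<union> {x0}"
  have W: "finite W" using X by (simp add: W_def)
  obtain \<sigma> where s: "\<sigma> \<in> Fix M {}" "urysohn_ind \<rho> M {\<sigma> c} {} (W \<union> iv h ` W)"
    using ind_exists[of "{}" "W \<union> iv h ` W" c] W by auto
  have s1: "d (\<sigma> c) u = 1" if "u \<in> W \<union> iv h ` W" for u using s(2) that unfolding ind_empty by blast
  have "\<sigma> c \<notin> W \<union> iv h ` W"
  proof
    assume "\<sigma> c \<in> W \<union> iv h ` W"
    then have "d (\<sigma> c) (\<sigma> c) = 1" by (rule s1)
    then show False by simp
  qed
  with displacesD[OF h(2)] W obtain k where k: "k \<in> GF (W \<union> iv h ` W)"
    "far 1 (W \<union> iv h ` W) (k (\<sigma> c)) (h ` (W \<union> iv h ` W)) (h (k (\<sigma> c)))"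
    by (metis finite_UnI finite_imageI)
  define a0 where "a0 = k (\<sigma> c)"
  have a0: "d a0 u = 1" if "u \<in> W \<union> iv h ` W" for u
    using s1[OF that] dist_G[OF GF_G[OF k(1)], of "\<sigma> c" u] GF_fix[OF k(1) that] by (simp add: a0_def)
  have ah: "d a0 (h a0) = 1" using k(2) a0 by (intro dist_eq_1) (simp add: far_iff a0_def)
  have ha0: "d (h a0) u = 1" if "u \<in> W" for u
    using a0[of "iv h u"] that dist_G[OF h(1), of a0 "iv h u"] h(1) by simp
  have "finite (W \<union> {a0, h a0})" using W by simp
  then obtain a where a: "\<forall>u\<in>W \<union> {a0, h a0}. d a u = min 1 (1 / 2 + min (d u x0) (d u a0))"
    using distance_function_realized[OF _ distance_function_half] by blast
  have x0W: "x0 \<in> W" by (simp add: W_def)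
  have ax: "d a x0 = 1 / 2" "d a a0 = 1 / 2" "d a (h a0) = 1"
    using a x0W a0[of x0] dist(5)[of x0 a0] ha0[of x0] ah dist(5)[of "h a0" a0] by auto
  have aW: "d a u = min 1 (1 / 2 + d u x0)" if "u \<in> W" for u
    using a that a0[of u] dist(5)[of u a0] dist(3)[of u x0] by simp
  have aha: "1 / 2 \<le> d a (h a)"
    using ax dist(6)[of a "h a0" "h a"] dist_G[OF h(1), of a a0] by simp
  obtain b where b: "b \<in> GF (X \<union> {a})" "urysohn_ind \<rho> M (b ` {x0}) (X \<union> {a}) {h a}"
    using move_generic[of "{x0}" "X \<union> {a}" "{h a}"] X(1) by auto
  define x where "x = b x0"
  have xu: "d x u = d x0 u" if "u \<in> X \<union> {a}" for u
    using dist_G[OF GF_G[OF b(1)], of x0 u] GF_fix[OF b(1) that] by (simp add: x_def)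
  have xa: "d x a = 1 / 2" using xu[of a] ax(1) dist(5)[of x0 a] by simp
  have hxa: "d (h a) (h x) = 1 / 2" using dist_G[OF h(1), of a x] xa dist(5)[of x a] by simp
  have "d x (h a) = 1 \<or> d x (h a) = d x a + d a (h a) \<or> (\<exists>c\<in>X. d x (h a) = d x c + d c (h a))"
    using b(2) unfolding urysohn_ind_iff x_def[symmetric] by (auto simp: x_def)
  then have "half_maximal X x (h ` X) (h x)"
  proof (elim disjE bexE)
    assume "d x (h a) = 1"
    then show ?thesis using hxa dist(6)[of x "h a" "h x"] dist(5)[of "h a" "h x"] by (simp add: half_maximal_def)
  next
    assume "d x (h a) = d x a + d a (h a)"
    then show ?thesis using xa aha hxa dist(6)[of x "h a" "h x"] dist(5)[of "h a" "h x"] by (simp add: half_maximal_def)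
  next
    fix c assume c: "c \<in> X" "d x (h a) = d x c + d c (h a)"
    let ?c = "iv h c"
    have cW: "?c \<in> W" using c(1) by (simp add: W_def)
    have "d c (h a) = d ?c a" using dist_G[OF h(1), of ?c a] h(1) by simp
    then have ca: "d c (h a) = min 1 (1 / 2 + d ?c x0)" using aW[OF cW] dist(5)[of ?c a] by simp
    have tri: "d x (h a) \<le> d x (h x) + 1 / 2" using hxa dist(6)[of x "h a" "h x"] dist(5)[of "h a" "h x"] by simp
    have "d x0 ?c = 1 \<or> (\<exists>e\<in>X. d x0 ?c = d x0 e + d e ?c)"
      using a1(2) c(1) unfolding urysohn_ind_iff by (auto simp: x0_def)
    then show ?thesis
    proof (elim disjE bexE)
      assume "d x0 ?c = 1"
      then show ?thesis using ca tri c(2) dist(2)[of x c] dist(5)[of x0 ?c] by (simp add: half_maximal_def)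
    next
      fix e assume e: "e \<in> X" "d x0 ?c = d x0 e + d e ?c"
      show ?thesis
      proof (cases "1 \<le> 1 / 2 + d ?c x0")
        case True
        then show ?thesis using ca tri c(2) dist(2)[of x c] by (simp add: half_maximal_def)
      next
        case False
        have "d (h e) c = d e ?c" using dist_G[OF h(1), of e ?c] h(1) by simp
        moreover have "d (h e) (h x) = d x0 e" using dist_G[OF h(1), of e x] xu[of e] e(1) dist(5)[of e x] by simp
        ultimately have "d x c + d c (h e) + d (h e) (h x) \<le> d x (h x)"
          using ca tri c(2) e(2) False dist(5)[of ?c x0] dist(5)[of c "h e"] by simp
        then show ?thesis using c(1) e(1) unfolding half_maximal_def by blast
      qed
    qed
  qed
  moreover have "b \<circ> a1 \<in> GF X" by (rule GF_comp[OF GF_mono[OF b(1)] a1(1)]) blast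
  ultimately show "\<exists>a\<in>GF X. half_maximal X (a c) (h ` X) (h (a c))"
    by (intro bexI[of _ "b \<circ> a1"]) (simp_all add: x_def x0_def)
qed

text \<open>If the distance between the two images is attained through a point of \<open>A\<close>, it is also attained through
both bases. If it is attained through \<open>x\<close>, then either both displacements are at least one half and the distance
is 1, or one of them follows a path through a base, hence through a point of \<open>A\<close>.\<close>

lemma composes_half_maximal: "composes half_maximal (\<lambda>X x Y y. ind2 (urysohn_ind \<rho> M) {x} X Y {y})"
  unfolding composes_def
proof (intro allI impI)
  fix A X x p q
  assume a: "finite A" "p \<in> G" "q \<in> G" "X \<subseteq> A" "p ` X \<subseteq> A" "q ` X \<subseteq> A" "x \<notin> A"
    "urysohn_ind \<rho> M {x} X A" "urysohn_ind \<rho> M {p x} (p ` X) A" "urysohn_ind \<rho> M {q x} (q ` X) A"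
    "urysohn_ind \<rho> M {q x} (insert x A) {p x}"
    and P: "half_maximal X x (p ` X) (p x)" "half_maximal X x (q ` X) (q x)"
  define y where "y = p x"
  define z where "z = q x"
  have pA: "d y v = 1 \<or> (\<exists>u\<in>p ` X. d y v = d y u + d u v)" if "v \<in> A" for v
    using a(9) that by (simp add: urysohn_ind_iff y_def)
  have qA: "d z v = 1 \<or> (\<exists>u\<in>q ` X. d z v = d z u + d u v)" if "v \<in> A" for v
    using a(10) that by (simp add: urysohn_ind_iff z_def)
  define good where "good \<longleftrightarrow> (d y z = 1 \<or> (\<exists>u\<in>p ` X. d y z = d y u + d u z)) \<and>
    (d z y = 1 \<or> (\<exists>u\<in>q ` X. d z y = d z u + d u y))"
  have via: good if v: "v \<in> A" "d z v + d v y \<le> d z y" for v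
    unfolding good_def
  proof
    from pA[OF v(1)] show "d y z = 1 \<or> (\<exists>u\<in>p ` X. d y z = d y u + d u z)"
    proof (elim disjE bexE)
      assume "d y v = 1"
      then have "1 \<le> d y z" using v(2) dist(2)[of z v] dist(5)[of y v] dist(5)[of y z] by simp
      then show ?thesis using dist_eq_1 by simp
    next
      fix u assume u: "u \<in> p ` X" "d y v = d y u + d u v"
      have "d y z = d y u + d u z"
        using u(2) v(2) dist(6)[of u z v] dist(5)[of y v] dist(5)[of y z] dist(5)[of v z] by (intro dist_eq_via) simp
      then show ?thesis using u(1) by blast
    qed
    from qA[OF v(1)] show "d z y = 1 \<or> (\<exists>u\<in>q ` X. d z y = d z u + d u y)"
    proof (elim disjE bexE)
      assume "d z v = 1"
      then have "1 \<le> d z y" using v(2) dist(2)[of v y] by simp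
      then show ?thesis using dist_eq_1 by simp
    next
      fix u assume u: "u \<in> q ` X" "d z v = d z u + d u v"
      have "d z y = d z u + d u y" using u(2) v(2) dist(6)[of u y v] by (intro dist_eq_via) simp
      then show ?thesis using u(1) by blast
    qed
  qed
  have "d z y = 1 \<or> d z y = d z x + d x y \<or> (\<exists>v\<in>A. d z y = d z v + d v y)"
    using a(11) unfolding urysohn_ind_iff y_def z_def by auto
  then have good
  proof (elim disjE bexE)
    assume "d z y = 1"
    then show ?thesis using dist(5)[of y z] by (simp add: good_def)
  next
    fix v assume "v \<in> A" "d z y = d z v + d v y"
    then show ?thesis using via[of v] by simp
  next
    assume x: "d z y = d z x + d x y"
    show ?thesis
      using P[unfolded half_maximal_def, folded y_def z_def]
    proof (elim disjE bexE)
      assume "1 / 2 \<le> d x y" "1 / 2 \<le> d x z"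
      then have "d z y = 1" using x dist(5)[of z x] by (intro dist_eq_1) simp
      then show ?thesis using dist(5)[of y z] by (simp add: good_def)
    next
      fix c c' assume c: "c \<in> X" "c' \<in> p ` X" "d x c + d c c' + d c' y \<le> d x y"
      show ?thesis
        by (rule via[of c']) (use c a(5) x dist(6)[of z c' x] dist(6)[of x c' c] in auto)
    next
      fix c c' assume c: "c \<in> X" "c' \<in> p ` X" "d x c + d c c' + d c' y \<le> d x y"
      show ?thesis
        by (rule via[of c']) (use c a(5) x dist(6)[of z c' x] dist(6)[of x c' c] in auto)
    next
      fix c c' assume c: "c \<in> X" "c' \<in> q ` X" "d x c + d c c' + d c' z \<le> d x z"
      show ?thesis
        by (rule via[of c']) (use c a(6) x dist(6)[of c' y x] dist(6)[of x c' c] dist(5)[of x z] dist(5)[of z c']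
            dist(5)[of x c'] in auto)
    qed
  qed
  then have yz: "d y z = 1 \<or> (\<exists>u\<in>p ` X. d y z = d y u + d u z)"
    and zy: "d z y = 1 \<or> (\<exists>u\<in>q ` X. d z y = d z u + d u y)" by (simp_all add: good_def)
  have "urysohn_ind \<rho> M {z} (q ` X) ({y} \<union> p ` X)"
    unfolding urysohn_ind_iff using zy qA a(5) by auto
  then have 1: "urysohn_ind \<rho> M ({y} \<union> p ` X) (q ` X) {z}" by (rule ind_sym)
  have 2: "urysohn_ind \<rho> M {y} (p ` X) ({z} \<union> q ` X)"
    unfolding urysohn_ind_iff using yz pA a(6) by auto
  show "ind2 (urysohn_ind \<rho> M) {p x} (p ` X) (q ` X) {q x}"
    using 1 2 by (simp add: ind2_def y_def z_def)
qed

lemma maximal_half_maximal: "ind2 (urysohn_ind \<rho> M) {x} X Y {y} \<Longrightarrow> half_maximal X x Y y"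
proof -
  assume i: "ind2 (urysohn_ind \<rho> M) {x} X Y {y}"
  have "d x y = 1 \<or> (\<exists>c\<in>X. d x y = d x c + d c y)" using i by (simp add: ind2_def urysohn_ind_iff)
  then show ?thesis
  proof (elim disjE bexE)
    fix c assume c: "c \<in> X" "d x y = d x c + d c y"
    have "d c y = 1 \<or> (\<exists>c'\<in>Y. d c y = d c c' + d c' y)" using i c(1) by (simp add: ind2_def urysohn_ind_iff)
    then show ?thesis
    proof (elim disjE bexE)
      assume "d c y = 1"
      then show ?thesis using c(2) dist(2)[of x c] by (simp add: half_maximal_def)
    next
      fix c' assume "c' \<in> Y" "d c y = d c c' + d c' y"
      then have "d x c + d c c' + d c' y \<le> d x y" using c(2) by simp
      then show ?thesis using c(1) \<open>c' \<in> Y\<close> unfolding half_maximal_def by blast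
    qed
  qed (simp add: half_maximal_def)
qed

lemma maximal_mover_in_hull:
  assumes h: "h \<in> G" "h \<noteq> id" shows "\<exists>g\<in>normal_hull h. maximal_mover g"
proof (rule maximal_mover_exists[OF h(1) _ h(2)])
  obtain \<epsilon> where e: "0 < \<epsilon>" "displaces (far \<epsilon>) h" by (rule displaces_far_exists[OF h])
  show "displaces moves_generic h"
    by (rule displaces_mono[OF e(2) h(1)]) (use e(1) in \<open>auto simp: moves_generic_def far_def\<close>)
  show "\<exists>g'\<in>N. displaces (\<lambda>X x Y y. ind2 (urysohn_ind \<rho> M) {x} X Y {y}) g'"
    if N: "closed_under_conjugates N" and g: "g \<in> N" "g \<noteq> id" for N g
  proof -
    have NG: "N \<subseteq> G" using N by (simp add: closed_under_conjugates_def)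
    obtain \<epsilon> where e: "0 < \<epsilon>" "displaces (far \<epsilon>) g" using displaces_far_exists[of g] g NG by blast
    obtain g1 where g1: "g1 \<in> N" "displaces (far 1) g1" by (rule displaces_far_1[OF N g(1) e(2,1)])
    have "displaces half_maximal g1" using displaces_half_maximal g1 NG by blast
    then show ?thesis
      by (rule displacement_upgrade[OF N g1(1) _ displacement_half_maximal symmetric_displacement_half_maximal
            displacement_ind2 composes_half_maximal])
  qed
  show "composes (\<lambda>X x Y y. ind2 (urysohn_ind \<rho> M) {x} X Y {y}) (\<lambda>X x Y y. ind2 (urysohn_ind \<rho> M) {x} X Y {y})"
    by (rule composes_mono[OF composes_half_maximal maximal_half_maximal])
qed

end

section \<open>Elements that move maximally and are compatible\<close>

context expansion
begin

lemma maximal_mover_suffices: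
  assumes "\<exists>g\<in>normal_hull h. maximal_mover g"
  shows "\<exists>g\<in>normal_hull h. moves_maximally M E ind g \<and> compatible M E ind g"
  using assms maximal_mover_moves_maximally maximal_mover_compatible by blast

end

theorem proposition1p6:
  fixes ar :: "'r \<Rightarrow> nat" and M :: "('r, 'a) struct" and E :: "'a \<Rightarrow> 'a \<Rightarrow> bool"
    and ind :: "'a set \<Rightarrow> 'a set \<Rightarrow> 'a set \<Rightarrow> bool" and h :: "'a \<Rightarrow> 'a"
  assumes "(\<exists>K. free_amalgamation_class ar K \<and> fraisse_limit ar K M \<and>
              transitive M \<and> nontrivial M \<and> ind = free_ind M)
         \<or> (\<exists>\<rho>. bounded_rational_urysohn ar \<rho> M \<and> ind = urysohn_ind \<rho> M)"
    and "order_expansion M E \<or> tournament_expansion M E"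
    and "h \<in> Aut (expand M E)" and "h \<noteq> id"
  shows "\<exists>g \<in> normal_closure (aut_group (expand M E)) h.
           moves_maximally M E ind g \<and> compatible M E ind g"
  using assms(1)
proof (elim disjE exE conjE)
  fix K assume K: "free_amalgamation_class ar K" "fraisse_limit ar K M" "transitive M" "nontrivial M"
    and ind: "ind = free_ind M"
  have M: "countable (UNIV :: 'a set)" "homogeneous M" using K(2) by (auto simp: fraisse_limit_def)
  have I: "independence M (free_ind M)" by (rule free_independence[OF K(1-3)])
  obtain ord where "expansion M (free_ind M) E ord"
    using assms(2) independence.order_expansion_expansion[OF I M(1)]
      independence.tournament_expansion_expansion[OF I M(1)] by blast
  then interpret free_expansion M E ord
    by (rule free_expansion.intro) (simp add: free_expansion_axioms_def M(2) K(4))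
  have "h \<in> G" using assms(3) by (simp add: Aut_expand)
  then show ?thesis
    unfolding ind by (intro maximal_mover_suffices maximal_mover_in_hull assms(4))
next
  fix \<rho> assume "bounded_rational_urysohn ar \<rho> M" and ind: "ind = urysohn_ind \<rho> M"
  then interpret U: urysohn ar \<rho> M by unfold_locales
  obtain ord where "expansion M (urysohn_ind \<rho> M) E ord"
    using assms(2) independence.order_expansion_expansion[OF U.urysohn_independence U.countable]
      independence.tournament_expansion_expansion[OF U.urysohn_independence U.countable] by blast
  then interpret urysohn_expansion ar \<rho> M E ord
    by (intro urysohn_expansion.intro U.urysohn_axioms)
  have "h \<in> G" using assms(3) by (simp add: Aut_expand)
  then show ?thesis
    unfolding ind by (intro maximal_mover_suffices maximal_mover_in_hull assms(4))
qed

end
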